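(* Let $(N_1,g_1,\mathcal{F}_1)$ and $(N_2,g_2,\mathcal{F}_2)$ be Morita equivalent singular Riemannian foliations (SRFs). Then their leaf spaces $(N_1/\mathcal{F}_1, d_{N_1/\mathcal{F}_1})$ and $(N_2/\mathcal{F}_2, d_{N_2/\mathcal{F}_2})$ are isometric as pseudo-metric spaces.
   Context: Manifolds are smooth. $\mathfrak{X}(M)$ and $\mathfrak{X}_c(M)$ denote the (compactly supported) vector fields on $M$. A singular foliation (SF) on $M$ is a $C^\infty(M)$-submodule $\mathcal{F}\subset\mathfrak{X}_c(M)$ that is closed under the Lie bracket and locally finitely generated: every $q\in M$ has an open neighborhood $U$ such that $\iota_U^{-1}\mathcal{F}:=\{X\in\mathcal{F}: \mathrm{supp}(X)\subset U\}$ equals $\langle X_1,\dots,X_N\rangle_{C^\infty_c(U)}$ for finitely many $X_1,\dots,X_N\in\mathfrak{X}(U)$. An SF partitions $M$ into connected injectively immersed submanifolds called leaves (two points lie in the same leaf iff they are joined by a finite concatenation of integral curves of vector fields in $\mathcal{F}$); $M/\mathcal{F}$ denotes the set of leaves. A singular Riemannian foliation (SRF; also called module SRF) is a triple $(M,g,\mathcal{F})$ with $(M,g)$ a Riemannian manifold and $\mathcal{F}$ an SF on $M$ such that $\mathcal{L}_Xg\in\Omega^1(M)\odot g_\flat(\mathcal{F})$ for every $X\in\mathcal{F}$, where $g_\flat(Y)=g(Y,\cdot)$, $\odot$ is the symmetric tensor product, and $\Omega^1(M)\odot g_\flat(\mathcal{F})$ consists of finite sums of elements $\omega\odot g_\flat(Y)$,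 $\omega\in\Omega^1(M)$, $Y\in\mathcal{F}$. For a submersion $\pi\colon N\to M$ and an SF $\mathcal{F}$ on $M$, a vector field $V$ on $N$ is projectable to $\mathcal{F}$ if there is $X\in\mathcal{F}$ with $\mathrm{d}_q\pi(V|_q)=X|_{\pi(q)}$ for all $q\in N$. The pullback foliation $\pi^{-1}\mathcal{F}$ is the SF on $N$ given by the $C^\infty_c(N)$-linear span of the vector fields projectable to $\mathcal{F}$. A smooth submersion $\pi\colon(N,h)\to(M,g)$ is a Riemannian submersion if for every $q\in N$ the restriction of $\mathrm{d}_q\pi$ to $\mathcal{H}_q=(\ker\mathrm{d}_q\pi)^{\perp_h}\subset T_qN$ is a linear isometry onto $T_{\pi(q)}M$. Two SRFs $(M_1,g_1,\mathcal{F}_1)$ and $(M_2,g_2,\mathcal{F}_2)$ are Morita equivalent if there exist a Riemannian manifold $(N,h)$ and surjective Riemannian submersions with connected fibers $\pi_i\colon(N,h)\to(M_i,g_i)$, $i=1,2$, with $\pi_1^{-1}\mathcal{F}_1=\pi_2^{-1}\mathcal{F}_2$. Pseudo-metric on the leaf space of an SRF $(M,g,\mathcal{F})$: for leaves $L_1,L_2$, $d_{M/\mathcal{F}}(L_1,L_2):=\inf\sum_{i=1}^k L_g(\gamma_i)$, where $L_g$ is Riemannian length and the infimum is over all discrete paths joining $L_1$ and $L_2$, i.e. finite families of piecewise smooth curves $\gamma_1,\dots,\gamma_k\colon[0,1]\to M$ ($k\ge1$ arbitrary) with $\gamma_1(0)\in L_1$, $\gamma_k(1)\in L_2$, and $\gamma_i(1)$,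 $\gamma_{i+1}(0)$ in the same leaf for $i=1,\dots,k-1$ (with value $+\infty$ if there is no such path). Isometric means that there is a bijection between the leaf spaces preserving these distances. *)

theory Defs
  imports "HOL-Analysis.Analysis"
begin

primrec Ck_on :: "nat \<Rightarrow> 'e::euclidean_space set \<Rightarrow> ('e \<Rightarrow> 'f::euclidean_space) \<Rightarrow> bool" where
  "Ck_on 0 U f \<longleftrightarrow> continuous_on U f"
| "Ck_on (Suc k) U f \<longleftrightarrow> (\<forall>x\<in>U. f differentiable (at x)) \<and>
     (\<forall>v. Ck_on k U (\<lambda>x. frechet_derivative f (at x) v))"

text \<open>Smoothness on an arbitrary set \<open>S\<close> means local smooth extendability to open sets of the
  ambient Euclidean space. It is used for open sets, for relatively open subsets of a linear
  subspace, and for compact intervals.\<close>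

definition smooth_on :: "'e::euclidean_space set \<Rightarrow> ('e \<Rightarrow> 'f::euclidean_space) \<Rightarrow> bool" where
  "smooth_on S f \<longleftrightarrow> (\<forall>x\<in>S. \<exists>U F. open U \<and> x \<in> U \<and> (\<forall>k. Ck_on k U F) \<and>
     (\<forall>y\<in>S \<inter> U. F y = f y))"

text \<open>The points of a manifold form a whole type, whose topology is Hausdorff and second countable
  by its sort. A chart is an open set together with a map that matters only on that set. Charts
  take values in relatively open subsets of one linear subspace \<open>E\<close> of the Euclidean type
  \<open>'e\<close>; the dimension of the manifold is that of \<open>E\<close>. The subspace is there because
  \<open>DIM('e)\<close> is never \<open>0\<close>, so that taking \<open>E = UNIV\<close> would exclude manifolds of dimension
  \<open>0\<close>.\<close>

type_synonym ('a, 'e) atlas = "('a set \<times> ('a \<Rightarrow> 'e)) set"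

definition smooth_manifold ::
  "('a::{second_countable_topology,t2_space}, 'e::euclidean_space) atlas \<Rightarrow> bool" where
  "smooth_manifold A \<longleftrightarrow>
     (\<exists>E. subspace E \<and>
       (\<forall>(U, \<phi>)\<in>A. open U \<and> openin (top_of_set E) (\<phi> ` U) \<and>
          homeomorphism U (\<phi> ` U) \<phi> (inv_into U \<phi>))) \<and>
     (\<Union>(U, \<phi>)\<in>A. U) = UNIV \<and>
     (\<forall>(U, \<phi>)\<in>A. \<forall>(V, \<psi>)\<in>A. smooth_on (\<phi> ` (U \<inter> V)) (\<psi> \<circ> inv_into U \<phi>))"

definition smooth_fun_on ::
  "('a::{second_countable_topology,t2_space}, 'e::euclidean_space) atlas \<Rightarrow> 'a set \<Rightarrow>
     ('a \<Rightarrow> real) \<Rightarrow> bool" where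
  "smooth_fun_on A W f \<longleftrightarrow> (\<forall>(U, \<phi>)\<in>A. smooth_on (\<phi> ` (U \<inter> W)) (f \<circ> inv_into U \<phi>))"

definition smooth_funs ::
  "('a::{second_countable_topology,t2_space}, 'e::euclidean_space) atlas \<Rightarrow> ('a \<Rightarrow> real) set" where
  "smooth_funs A = {f. smooth_fun_on A UNIV f}"

text \<open>\<open>smooth_funs_c A U\<close> is \<open>C\<^sub>c\<^sup>\<infinity>(U)\<close>, each function being extended by zero to the whole
  manifold.\<close>

definition smooth_funs_c ::
  "('a::{second_countable_topology,t2_space}, 'e::euclidean_space) atlas \<Rightarrow> 'a set \<Rightarrow>
     ('a \<Rightarrow> real) set" where
  "smooth_funs_c A U = {f \<in> smooth_funs A.
     compact (closure {p. f p \<noteq> 0}) \<and> closure {p. f p \<noteq> 0} \<subseteq> U}"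

definition smooth_map ::
  "('a::{second_countable_topology,t2_space}, 'e::euclidean_space) atlas \<Rightarrow>
   ('b::{second_countable_topology,t2_space}, 'f::euclidean_space) atlas \<Rightarrow> ('a \<Rightarrow> 'b) \<Rightarrow> bool" where
  "smooth_map A B \<pi> \<longleftrightarrow> continuous_on UNIV \<pi> \<and>
     (\<forall>(U, \<phi>)\<in>A. \<forall>(V, \<psi>)\<in>B. smooth_on (\<phi> ` (U \<inter> \<pi> -` V)) (\<psi> \<circ> \<pi> \<circ> inv_into U \<phi>))"

text \<open>Tangent vectors at \<open>p\<close> are the derivations at \<open>p\<close> of the algebra of smooth functions. They
  are set to zero on functions that are not smooth, so that equality of tangent vectors is
  equality in HOL.\<close>

type_synonym 'a tangent_vec = "('a \<Rightarrow> real) \<Rightarrow> real"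
type_synonym 'a vec_field = "'a \<Rightarrow> 'a tangent_vec"

definition tangent_space ::
  "('a::{second_countable_topology,t2_space}, 'e::euclidean_space) atlas \<Rightarrow> 'a \<Rightarrow>
     'a tangent_vec set" where
  "tangent_space A p = {v.
     (\<forall>f\<in>smooth_funs A. \<forall>g\<in>smooth_funs A. v (\<lambda>x. f x + g x) = v f + v g) \<and>
     (\<forall>f\<in>smooth_funs A. \<forall>c. v (\<lambda>x. c * f x) = c * v f) \<and>
     (\<forall>f\<in>smooth_funs A. \<forall>g\<in>smooth_funs A. v (\<lambda>x. f x * g x) = v f * g p + f p * v g) \<and>
     (\<forall>f. f \<notin> smooth_funs A \<longrightarrow> v f = 0)}"

text \<open>The differential of \<open>\<pi>\<close>; only the smooth structure \<open>B\<close> of the target enters. The base point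
  is implicit in the tangent vector.\<close>

definition pushforward ::
  "('b::{second_countable_topology,t2_space}, 'f::euclidean_space) atlas \<Rightarrow> ('a \<Rightarrow> 'b) \<Rightarrow>
     'a tangent_vec \<Rightarrow> 'b tangent_vec" where
  "pushforward B \<pi> v = (\<lambda>f. if f \<in> smooth_funs B then v (f \<circ> \<pi>) else 0)"

text \<open>Vector fields on an open set \<open>U\<close>, with the zero vector as a dummy value outside \<open>U\<close>.\<close>

definition vec_fields ::
  "('a::{second_countable_topology,t2_space}, 'e::euclidean_space) atlas \<Rightarrow> 'a set \<Rightarrow>
     'a vec_field set" where
  "vec_fields A U = {X. (\<forall>p\<in>U. X p \<in> tangent_space A p) \<and> (\<forall>p. p \<notin> U \<longrightarrow> X p = (\<lambda>f. 0)) \<and>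
     (\<forall>f\<in>smooth_funs A. smooth_fun_on A U (\<lambda>p. X p f))}"

definition vf_support :: "'a::topological_space vec_field \<Rightarrow> 'a set" where
  "vf_support X = closure {p. X p \<noteq> (\<lambda>f. 0)}"

definition vec_fields_c ::
  "('a::{second_countable_topology,t2_space}, 'e::euclidean_space) atlas \<Rightarrow> 'a vec_field set" where
  "vec_fields_c A = {X \<in> vec_fields A UNIV. compact (vf_support X)}"

text \<open>For \<open>X\<close> and \<open>Y\<close> smooth, both sides vanish on functions that are not smooth.\<close>

definition lie_bracket :: "'a vec_field \<Rightarrow> 'a vec_field \<Rightarrow> 'a vec_field" where
  "lie_bracket X Y = (\<lambda>p f. X p (\<lambda>q. Y q f) - Y p (\<lambda>q. X q f))"

definition vf_span :: "('a \<Rightarrow> real) set \<Rightarrow> 'a vec_field set \<Rightarrow> 'a vec_field set" where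
  "vf_span R G = {X. \<exists>(n::nat) c V. (\<forall>i<n. c i \<in> R \<and> V i \<in> G) \<and>
     X = (\<lambda>p f. \<Sum>i<n. c i p * V i p f)}"

definition restrict_foliation :: "'a::topological_space set \<Rightarrow> 'a vec_field set \<Rightarrow> 'a vec_field set" where
  "restrict_foliation U F = {X \<in> F. vf_support X \<subseteq> U}"

definition singular_foliation ::
  "('a::{second_countable_topology,t2_space}, 'e::euclidean_space) atlas \<Rightarrow>
     'a vec_field set \<Rightarrow> bool" where
  "singular_foliation A F \<longleftrightarrow>
     F \<subseteq> vec_fields_c A \<and>
     (\<lambda>p f. 0) \<in> F \<and>
     (\<forall>X\<in>F. \<forall>Y\<in>F. (\<lambda>p f. X p f + Y p f) \<in> F) \<and>
     (\<forall>c\<in>smooth_funs A. \<forall>X\<in>F. (\<lambda>p f. c p * X p f) \<in> F) \<and>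
     (\<forall>X\<in>F. \<forall>Y\<in>F. lie_bracket X Y \<in> F) \<and>
     (\<forall>q. \<exists>U G. open U \<and> q \<in> U \<and> finite G \<and> G \<subseteq> vec_fields A U \<and>
        restrict_foliation U F = vf_span (smooth_funs_c A U) G)"

definition integral_curve ::
  "('a::{second_countable_topology,t2_space}, 'e::euclidean_space) atlas \<Rightarrow> 'a vec_field \<Rightarrow>
     real \<Rightarrow> real \<Rightarrow> (real \<Rightarrow> 'a) \<Rightarrow> bool" where
  "integral_curve A X a b \<gamma> \<longleftrightarrow> (\<forall>t\<in>{a..b}. \<forall>f\<in>smooth_funs A.
     ((\<lambda>s. f (\<gamma> s)) has_real_derivative X (\<gamma> t) f) (at t within {a..b}))"

text \<open>Since a foliation is closed under negation, concatenations of forward integral curves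
  suffice.\<close>

definition same_leaf ::
  "('a::{second_countable_topology,t2_space}, 'e::euclidean_space) atlas \<Rightarrow> 'a vec_field set \<Rightarrow>
     ('a \<times> 'a) set" where
  "same_leaf A F = {(p, q). \<exists>X\<in>F. \<exists>a b \<gamma>. a \<le> b \<and> integral_curve A X a b \<gamma> \<and>
     \<gamma> a = p \<and> \<gamma> b = q}\<^sup>*"

definition leaf_space ::
  "('a::{second_countable_topology,t2_space}, 'e::euclidean_space) atlas \<Rightarrow> 'a vec_field set \<Rightarrow>
     'a set set" where
  "leaf_space A F = UNIV // same_leaf A F"

text \<open>The values of a metric (and of a one-form) matter only on tangent vectors at the point in
  question.\<close>

type_synonym 'a metric_tensor = "'a \<Rightarrow> 'a tangent_vec \<Rightarrow> 'a tangent_vec \<Rightarrow> real"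
type_synonym 'a one_form = "'a \<Rightarrow> 'a tangent_vec \<Rightarrow> real"

definition riemannian_metric ::
  "('a::{second_countable_topology,t2_space}, 'e::euclidean_space) atlas \<Rightarrow>
     'a metric_tensor \<Rightarrow> bool" where
  "riemannian_metric A g \<longleftrightarrow>
     (\<forall>p. \<forall>u\<in>tangent_space A p. \<forall>v\<in>tangent_space A p. g p u v = g p v u) \<and>
     (\<forall>p. \<forall>u\<in>tangent_space A p. \<forall>v\<in>tangent_space A p. \<forall>w\<in>tangent_space A p. \<forall>c d.
        g p (\<lambda>f. c * u f + d * v f) w = c * g p u w + d * g p v w) \<and>
     (\<forall>p. \<forall>v\<in>tangent_space A p. v \<noteq> (\<lambda>f. 0) \<longrightarrow> g p v v > 0) \<and>
     (\<forall>X\<in>vec_fields A UNIV. \<forall>Y\<in>vec_fields A UNIV. (\<lambda>p. g p (X p) (Y p)) \<in> smooth_funs A)"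

definition one_forms ::
  "('a::{second_countable_topology,t2_space}, 'e::euclidean_space) atlas \<Rightarrow> 'a one_form set" where
  "one_forms A = {\<omega>.
     (\<forall>p. \<forall>u\<in>tangent_space A p. \<forall>v\<in>tangent_space A p. \<forall>c d.
        \<omega> p (\<lambda>f. c * u f + d * v f) = c * \<omega> p u + d * \<omega> p v) \<and>
     (\<forall>X\<in>vec_fields A UNIV. (\<lambda>p. \<omega> p (X p)) \<in> smooth_funs A)}"

text \<open>\<open>lie_derivative_metric g X Y Z\<close> is the function
  \<open>(L\<^sub>X g)(Y, Z) = X(g(Y, Z)) - g([X, Y], Z) - g(Y, [X, Z])\<close>.\<close>

definition lie_derivative_metric ::
  "'a metric_tensor \<Rightarrow> 'a vec_field \<Rightarrow> 'a vec_field \<Rightarrow> 'a vec_field \<Rightarrow> 'a \<Rightarrow> real" where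
  "lie_derivative_metric g X Y Z = (\<lambda>p. X p (\<lambda>q. g q (Y q) (Z q))
     - g p (lie_bracket X Y p) (Z p) - g p (Y p) (lie_bracket X Z p))"

definition flat :: "'a metric_tensor \<Rightarrow> 'a vec_field \<Rightarrow> 'a one_form" where
  "flat g Y = (\<lambda>p v. g p (Y p) v)"

definition sym_prod :: "'a one_form \<Rightarrow> 'a one_form \<Rightarrow> 'a \<Rightarrow> 'a tangent_vec \<Rightarrow> 'a tangent_vec \<Rightarrow> real" where
  "sym_prod \<omega> \<eta> = (\<lambda>p u v. (\<omega> p u * \<eta> p v + \<eta> p u * \<omega> p v) / 2)"

definition singular_riemannian_foliation ::
  "('a::{second_countable_topology,t2_space}, 'e::euclidean_space) atlas \<Rightarrow> 'a metric_tensor \<Rightarrow>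
     'a vec_field set \<Rightarrow> bool" where
  "singular_riemannian_foliation A g F \<longleftrightarrow>
     smooth_manifold A \<and> riemannian_metric A g \<and> singular_foliation A F \<and>
     (\<forall>X\<in>F. \<exists>(n::nat) \<omega> V. (\<forall>i<n. \<omega> i \<in> one_forms A \<and> V i \<in> F) \<and>
        (\<forall>Y\<in>vec_fields A UNIV. \<forall>Z\<in>vec_fields A UNIV. \<forall>p.
           lie_derivative_metric g X Y Z p =
             (\<Sum>i<n. sym_prod (\<omega> i) (flat g (V i)) p (Y p) (Z p))))"

definition projectable ::
  "('n::{second_countable_topology,t2_space}, 'k::euclidean_space) atlas \<Rightarrow>
   ('a::{second_countable_topology,t2_space}, 'e::euclidean_space) atlas \<Rightarrow> ('n \<Rightarrow> 'a) \<Rightarrow>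
     'a vec_field set \<Rightarrow> 'n vec_field set" where
  "projectable B A \<pi> F = {V \<in> vec_fields B UNIV. \<exists>X\<in>F. \<forall>q. pushforward A \<pi> (V q) = X (\<pi> q)}"

definition pullback_foliation ::
  "('n::{second_countable_topology,t2_space}, 'k::euclidean_space) atlas \<Rightarrow>
   ('a::{second_countable_topology,t2_space}, 'e::euclidean_space) atlas \<Rightarrow> ('n \<Rightarrow> 'a) \<Rightarrow>
     'a vec_field set \<Rightarrow> 'n vec_field set" where
  "pullback_foliation B A \<pi> F = vf_span (smooth_funs_c B UNIV) (projectable B A \<pi> F)"

definition submersion ::
  "('n::{second_countable_topology,t2_space}, 'k::euclidean_space) atlas \<Rightarrow>
   ('a::{second_countable_topology,t2_space}, 'e::euclidean_space) atlas \<Rightarrow> ('n \<Rightarrow> 'a) \<Rightarrow> bool" where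
  "submersion B A \<pi> \<longleftrightarrow> smooth_map B A \<pi> \<and>
     (\<forall>q. pushforward A \<pi> ` tangent_space B q = tangent_space A (\<pi> q))"

definition horizontal_space ::
  "('n::{second_countable_topology,t2_space}, 'k::euclidean_space) atlas \<Rightarrow> 'n metric_tensor \<Rightarrow>
   ('a::{second_countable_topology,t2_space}, 'e::euclidean_space) atlas \<Rightarrow> ('n \<Rightarrow> 'a) \<Rightarrow> 'n \<Rightarrow>
     'n tangent_vec set" where
  "horizontal_space B h A \<pi> q = {v \<in> tangent_space B q.
     \<forall>w\<in>tangent_space B q. pushforward A \<pi> w = (\<lambda>f. 0) \<longrightarrow> h q v w = 0}"

definition riemannian_submersion ::
  "('n::{second_countable_topology,t2_space}, 'k::euclidean_space) atlas \<Rightarrow> 'n metric_tensor \<Rightarrow>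
   ('a::{second_countable_topology,t2_space}, 'e::euclidean_space) atlas \<Rightarrow> 'a metric_tensor \<Rightarrow>
     ('n \<Rightarrow> 'a) \<Rightarrow> bool" where
  "riemannian_submersion B h A g \<pi> \<longleftrightarrow> submersion B A \<pi> \<and>
     (\<forall>q. bij_betw (pushforward A \<pi>) (horizontal_space B h A \<pi> q) (tangent_space A (\<pi> q)) \<and>
        (\<forall>u\<in>horizontal_space B h A \<pi> q. \<forall>v\<in>horizontal_space B h A \<pi> q.
           g (\<pi> q) (pushforward A \<pi> u) (pushforward A \<pi> v) = h q u v))"

text \<open>HOL formulas cannot quantify over types, so the point type \<open>'n\<close> and the model type \<open>'k\<close> of
  the manifold in the middle are parameters. In a theorem that assumes Morita equivalence they are
  free type variables, so such a theorem covers every choice of that manifold.\<close>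

definition morita_equivalent ::
  "'n::{second_countable_topology,t2_space} itself \<Rightarrow> 'k::euclidean_space itself \<Rightarrow>
   ('a::{second_countable_topology,t2_space}, 'e::euclidean_space) atlas \<Rightarrow> 'a metric_tensor \<Rightarrow>
     'a vec_field set \<Rightarrow>
   ('b::{second_countable_topology,t2_space}, 'f::euclidean_space) atlas \<Rightarrow> 'b metric_tensor \<Rightarrow>
     'b vec_field set \<Rightarrow> bool" where
  "morita_equivalent TYPE('n) TYPE('k) A1 g1 F1 A2 g2 F2 \<longleftrightarrow>
     (\<exists>(B :: ('n, 'k) atlas) h \<pi>1 \<pi>2.
        smooth_manifold B \<and> riemannian_metric B h \<and>
        riemannian_submersion B h A1 g1 \<pi>1 \<and> surj \<pi>1 \<and> (\<forall>x. connected (\<pi>1 -` {x})) \<and>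
        riemannian_submersion B h A2 g2 \<pi>2 \<and> surj \<pi>2 \<and> (\<forall>y. connected (\<pi>2 -` {y})) \<and>
        pullback_foliation B A1 \<pi>1 F1 = pullback_foliation B A2 \<pi>2 F2)"

definition smooth_curve_on ::
  "('a::{second_countable_topology,t2_space}, 'e::euclidean_space) atlas \<Rightarrow> real set \<Rightarrow>
     (real \<Rightarrow> 'a) \<Rightarrow> bool" where
  "smooth_curve_on A S \<gamma> \<longleftrightarrow> continuous_on S \<gamma> \<and>
     (\<forall>(U, \<phi>)\<in>A. smooth_on (S \<inter> \<gamma> -` U) (\<phi> \<circ> \<gamma>))"

definition piecewise_smooth_curve ::
  "('a::{second_countable_topology,t2_space}, 'e::euclidean_space) atlas \<Rightarrow>
     (real \<Rightarrow> 'a) \<Rightarrow> bool" where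
  "piecewise_smooth_curve A \<gamma> \<longleftrightarrow> (\<exists>(n::nat) t. t 0 = 0 \<and> t n = 1 \<and>
     (\<forall>i<n. t i < t (Suc i) \<and> smooth_curve_on A {t i..t (Suc i)} \<gamma>))"

text \<open>At the finitely many break points and at the end points of a piecewise smooth curve on
  \<open>[0, 1]\<close> the following value may be meaningless; this does not affect the length.\<close>

definition velocity ::
  "('a::{second_countable_topology,t2_space}, 'e::euclidean_space) atlas \<Rightarrow> (real \<Rightarrow> 'a) \<Rightarrow> real \<Rightarrow>
     'a tangent_vec" where
  "velocity A \<gamma> t = (\<lambda>f. if f \<in> smooth_funs A then deriv (\<lambda>s. f (\<gamma> s)) t else 0)"

definition curve_length ::
  "('a::{second_countable_topology,t2_space}, 'e::euclidean_space) atlas \<Rightarrow> 'a metric_tensor \<Rightarrow>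
     (real \<Rightarrow> 'a) \<Rightarrow> real" where
  "curve_length A g \<gamma> =
     integral {0..1} (\<lambda>t. sqrt (g (\<gamma> t) (velocity A \<gamma> t) (velocity A \<gamma> t)))"

text \<open>A discrete path consists of the curves \<open>\<gamma> 0, \<dots>, \<gamma> (k - 1)\<close>.\<close>

definition discrete_path ::
  "('a::{second_countable_topology,t2_space}, 'e::euclidean_space) atlas \<Rightarrow> 'a vec_field set \<Rightarrow>
     'a set \<Rightarrow> 'a set \<Rightarrow> nat \<Rightarrow> (nat \<Rightarrow> real \<Rightarrow> 'a) \<Rightarrow> bool" where
  "discrete_path A F L1 L2 k \<gamma> \<longleftrightarrow> k \<ge> 1 \<and>
     (\<forall>i<k. piecewise_smooth_curve A (\<gamma> i)) \<and>
     \<gamma> 0 0 \<in> L1 \<and> \<gamma> (k - 1) 1 \<in> L2 \<and>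
     (\<forall>i. Suc i < k \<longrightarrow> (\<gamma> i 1, \<gamma> (Suc i) 0) \<in> same_leaf A F)"

definition leaf_dist ::
  "('a::{second_countable_topology,t2_space}, 'e::euclidean_space) atlas \<Rightarrow> 'a metric_tensor \<Rightarrow>
     'a vec_field set \<Rightarrow> 'a set \<Rightarrow> 'a set \<Rightarrow> ereal" where
  "leaf_dist A g F L1 L2 =
     Inf {ereal (\<Sum>i<k. curve_length A g (\<gamma> i)) | k \<gamma>. discrete_path A F L1 L2 k \<gamma>}"

definition isometric_spaces ::
  "'x set \<Rightarrow> ('x \<Rightarrow> 'x \<Rightarrow> ereal) \<Rightarrow> 'y set \<Rightarrow> ('y \<Rightarrow> 'y \<Rightarrow> ereal) \<Rightarrow> bool" where
  "isometric_spaces S d T e \<longleftrightarrow>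
     (\<exists>\<Phi>. bij_betw \<Phi> S T \<and> (\<forall>x\<in>S. \<forall>y\<in>S. e (\<Phi> x) (\<Phi> y) = d x y))"

end

theory Submission
  imports Defs
begin

text \<open>Let \<open>\<pi>1\<close> and \<open>\<pi>2\<close> be the two Riemannian submersions of a Morita equivalence, from \<open>N\<close> to \<open>M1\<close> and
  \<open>M2\<close>. The isometry sends the leaf through \<open>\<pi>1 x\<close> to the leaf through \<open>\<pi>2 x\<close>. Since the situation is
  symmetric, it is enough to show that this is well defined and does not increase distances.

  \<^bold>\<open>Leaves.\<close> Points of a leaf of \<open>F1\<close> are joined by integral curves of fields of \<open>F1\<close>. Near each of its
  points such a curve lifts along \<open>\<pi>1\<close> to an integral curve of a field of the pullback foliation
  (\<open>lift_curve\<close>). The lifts of consecutive pieces need not fit together, but they end in the same fibre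
  of \<open>\<pi>1\<close>. Nearby points of a fibre are joined by integral curves of fields that project to zero, which
  also belong to the pullback foliation (\<open>fibre_curve\<close>), and the fibres are connected. Because the
  pullback foliations of \<open>F1\<close> and \<open>F2\<close> agree, it remains to see that \<open>\<pi>2\<close> maps an integral curve
  of a field of the pullback foliation of \<open>F2\<close> into one leaf (\<open>image_same_leaf\<close>).

  The image curve is tangent to \<open>F2\<close>, but it need not be an integral curve of any field: its velocity
  is a combination of fields of \<open>F2\<close> with coefficients that depend on the position in \<open>N\<close>. That a
  curve of this kind stays in one leaf (\<open>tangent_curve_same_leaf\<close>) is the part of the integrability
  theorem of Stefan and Sussmann that is needed. Near a point \<open>y0\<close>, choose fields \<open>Xh v\<close> of the
  foliation, linear in \<open>v\<close>, whose values span the tangent space of the leaf at \<open>y0\<close> and whose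
  projections to this space are constant. Let \<open>\<eta> g\<close> be the local generators from which their part in
  the span of the \<open>Xh v\<close> has been subtracted. All brackets of these fields have projection zero, so by
  finite generation they are combinations of the \<open>\<eta> g\<close>. Hence the \<open>\<eta> g\<close> satisfy a linear
  differential inequality along every tangent curve through \<open>y0\<close>. As they vanish at \<open>y0\<close>, Gronwall's
  inequality shows that they vanish along the whole curve, and there the \<open>Xh v\<close> commute. The end point
  \<open>E v 1\<close> of the integral curve of \<open>Xh v\<close> that starts in \<open>y0\<close> therefore depends on \<open>v\<close> with derivative
  \<open>Xh (E v 1)\<close>. It follows that a tangent curve \<open>w\<close> and the curve of the points \<open>E v 1\<close>, where \<open>v\<close> is
  the projection of \<open>w t - y0\<close>, solve the same differential equation. So they agree, and every nearby
  point of \<open>w\<close> is reached from \<open>y0\<close> by a single integral curve.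

  \<^bold>\<open>Distances.\<close> A Riemannian submersion does not increase lengths (\<open>push_norm_le\<close>), and a local section
  of \<open>\<pi>1\<close> that is horizontal at one point stretches lengths near this point by at most a given factor
  \<open>K > 1\<close>. Following such a section by \<open>\<pi>2\<close> gives a local map from \<open>M1\<close> to \<open>M2\<close> (\<open>short_section\<close>). A
  curve in \<open>M1\<close> is cut into short pieces, and each piece is moved to \<open>M2\<close> by such a map. Consecutive
  images start and end in the same leaf, since they come from the same fibre of \<open>\<pi>1\<close>. Thus a discrete
  path of length \<open>l\<close> yields one between the corresponding leaves of length at most \<open>K * l\<close>
  (\<open>joined_transfer\<close>), and \<open>K\<close> tends to \<open>1\<close>. Horizontal lifts of whole curves, which may fail
  to exist when the metrics are incomplete, are replaced by the jumps that discrete paths allow.\<close>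

section \<open>Calculus of smooth maps between Euclidean spaces\<close>

definition Cinf :: "'e::euclidean_space set \<Rightarrow> ('e \<Rightarrow> 'f::euclidean_space) \<Rightarrow> bool" where
  "Cinf U f \<longleftrightarrow> (\<forall>k. Ck_on k U f)"

lemma Ck_on_cong:
  assumes "open U" "\<And>x. x \<in> U \<Longrightarrow> f x = g x" "Ck_on k U f"
  shows "Ck_on k U g"
  using assms(2,3)
proof (induction k arbitrary: f g)
  case 0
  then show ?case using continuous_on_cong[of U U f g] by simp
next
  case (Suc k)
  have d: "(g has_derivative frechet_derivative f (at x)) (at x)" if "x \<in> U" for x
    using that Suc.prems assms(1) frechet_derivative_works[of f "at x"]
      has_derivative_transform_within_open[of f _ x UNIV U g] by auto
  then have e: "frechet_derivative g (at x) = frechet_derivative f (at x)" if "x \<in> U" for x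
    using that by (metis frechet_derivative_at)
  have "Ck_on k U (\<lambda>x. frechet_derivative g (at x) v)" for v
    using Suc.IH[of "\<lambda>x. frechet_derivative f (at x) v" "\<lambda>x. frechet_derivative g (at x) v"]
      Suc.prems(2) e by simp
  then show ?case using d by (auto simp: differentiable_def)
qed

lemma Ck_on_subset: "Ck_on k U f \<Longrightarrow> V \<subseteq> U \<Longrightarrow> Ck_on k V f"
  by (induction k arbitrary: f) (auto intro: continuous_on_subset)

lemma Ck_on_SucD: "Ck_on (Suc k) U f \<Longrightarrow> Ck_on k U f"
proof (induction k arbitrary: f)
  case 0
  then show ?case
    by (auto intro!: continuous_at_imp_continuous_on differentiable_imp_continuous_within)
next
  case (Suc k)
  then show ?case by (metis Ck_on.simps(2))
qed

lemma Ck_on_local: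
  assumes "\<And>x. x \<in> U \<Longrightarrow> \<exists>V. open V \<and> x \<in> V \<and> Ck_on k V f"
  shows "Ck_on k U f"
  using assms
proof (induction k arbitrary: f)
  case 0
  show ?case
  proof (simp, rule continuous_at_imp_continuous_on, rule ballI)
    fix x assume "x \<in> U"
    then obtain V where "open V" "x \<in> V" "continuous_on V f" using 0[of x] by auto
    then show "isCont f x" by (simp add: continuous_on_eq_continuous_at)
  qed
next
  case (Suc k)
  have "f differentiable at x" if "x \<in> U" for x
    using Suc.prems[OF that] by auto
  moreover have "Ck_on k U (\<lambda>x. frechet_derivative f (at x) v)" for v
    by (rule Suc.IH) (use Suc.prems in \<open>fastforce\<close>)
  ultimately show ?case by simp
qed

lemma Ck_on_SucI:
  assumes "open U" "\<And>x. x \<in> U \<Longrightarrow> (f has_derivative f' x) (at x)"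
    and "\<And>v. Ck_on k U (\<lambda>x. f' x v)"
  shows "Ck_on (Suc k) U f"
proof -
  have e: "frechet_derivative f (at x) = f' x" if "x \<in> U" for x
    using that assms(2) by (metis frechet_derivative_at)
  have "Ck_on k U (\<lambda>x. frechet_derivative f (at x) v)" for v
    by (rule Ck_on_cong[OF assms(1) _ assms(3)[of v]]) (simp add: e)
  then show ?thesis using assms(2) by (auto simp: differentiable_def)
qed

lemma Ck_on_has_derivative:
  assumes "Ck_on (Suc k) U f" "x \<in> U"
  shows "(f has_derivative frechet_derivative f (at x)) (at x)"
  using assms frechet_derivative_works by auto

lemma Ck_on_const: "open U \<Longrightarrow> Ck_on k U (\<lambda>x. c)"
proof (induction k arbitrary: c)
  case (Suc k)
  then show ?case by (intro Ck_on_SucI[where f'="\<lambda>x v. 0"]) auto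
qed simp

lemma Ck_on_linear:
  fixes L :: "'e::euclidean_space \<Rightarrow> 'f::euclidean_space"
  assumes "linear L" "open U"
  shows "Ck_on k U L"
proof (cases k)
  case 0
  then show ?thesis using assms by (simp add: linear_continuous_on linear_conv_bounded_linear)
next
  case (Suc m)
  have "Ck_on (Suc m) U L"
    by (rule Ck_on_SucI[where f'="\<lambda>x. L"])
      (use assms in \<open>auto intro: Ck_on_const linear_imp_has_derivative\<close>)
  then show ?thesis using Suc by simp
qed

lemma Ck_on_add:
  assumes "open U" "Ck_on k U f" "Ck_on k U g"
  shows "Ck_on k U (\<lambda>x. f x + g x)"
  using assms(2,3)
proof (induction k arbitrary: f g)
  case 0 then show ?case by (auto intro: continuous_on_add)
next
  case (Suc k)
  show ?case
    by (rule Ck_on_SucI[OF assms(1),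
          where f'="\<lambda>x v. frechet_derivative f (at x) v + frechet_derivative g (at x) v"])
      (use Suc in \<open>auto intro!: has_derivative_add simp: frechet_derivative_works\<close>)
qed

lemma Ck_on_scaleR:
  fixes f :: "'e::euclidean_space \<Rightarrow> real"
  assumes "open U" "Ck_on k U f" "Ck_on k U g"
  shows "Ck_on k U (\<lambda>x. f x *\<^sub>R g x)"
  using assms(2,3)
proof (induction k arbitrary: f g)
  case 0 then show ?case by (auto intro: continuous_on_scaleR)
next
  case (Suc k)
  note D = Ck_on_has_derivative[OF Suc.prems(1)] Ck_on_has_derivative[OF Suc.prems(2)]
  show ?case
  proof (rule Ck_on_SucI[OF assms(1), where
        f'="\<lambda>x v. f x *\<^sub>R frechet_derivative g (at x) v + frechet_derivative f (at x) v *\<^sub>R g x"])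
    show "((\<lambda>x. f x *\<^sub>R g x) has_derivative
        (\<lambda>v. f x *\<^sub>R frechet_derivative g (at x) v + frechet_derivative f (at x) v *\<^sub>R g x)) (at x)"
      if "x \<in> U" for x
      using has_derivative_scaleR[OF D(1)[OF that] D(2)[OF that]] by simp
    show "Ck_on k U (\<lambda>x. f x *\<^sub>R frechet_derivative g (at x) v
        + frechet_derivative f (at x) v *\<^sub>R g x)" for v
      by (intro Ck_on_add[OF assms(1)] Suc.IH)
        (use Suc.prems Ck_on_SucD in auto)
  qed
qed

lemma Ck_on_compose_linear:
  assumes "open U" "linear L" "Ck_on k U f"
  shows "Ck_on k U (\<lambda>x. L (f x))"
  using assms(3)
proof (induction k arbitrary: f)
  case 0
  then show ?case
    using assms(2) by (auto intro: linear_continuous_on_compose)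
next
  case (Suc k)
  show ?case
  proof (rule Ck_on_SucI[OF assms(1), where f'="\<lambda>x v. L (frechet_derivative f (at x) v)"])
    show "((\<lambda>x. L (f x)) has_derivative (\<lambda>v. L (frechet_derivative f (at x) v))) (at x)"
      if "x \<in> U" for x
      using Ck_on_has_derivative[OF Suc.prems that] assms(2)
      by (simp add: bounded_linear.has_derivative linear_conv_bounded_linear)
  qed (use Suc in auto)
qed

lemma Ck_on_sum:
  assumes "open U" "\<And>i. i \<in> I \<Longrightarrow> Ck_on k U (f i)"
  shows "Ck_on k U (\<lambda>x. \<Sum>i\<in>I. f i x)"
  using assms(2)
  by (induction I rule: infinite_finite_induct) (auto intro: Ck_on_const Ck_on_add assms(1))

lemma linear_inner_const: "linear (\<lambda>y. y \<bullet> b)"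
  by (rule bounded_linear.linear[OF bounded_linear_inner_left])

lemma linear_basis_expansion:
  fixes L :: "'e::euclidean_space \<Rightarrow> 'f::real_vector"
  assumes "linear L"
  shows "L v = (\<Sum>b\<in>Basis. (v \<bullet> b) *\<^sub>R L b)"
proof -
  have "L (\<Sum>b\<in>Basis. (v \<bullet> b) *\<^sub>R b) = (\<Sum>b\<in>Basis. (v \<bullet> b) *\<^sub>R L b)"
    using assms by (simp only: linear_sum linear_cmul)
  then show ?thesis by (simp only: euclidean_representation)
qed

text \<open>Expanding the chain rule in the standard basis makes a directional derivative of the
  composition a sum of products, whose factors are of class \<open>k\<close> by the induction hypothesis.\<close>

lemma Ck_on_compose:
  fixes f :: "'e::euclidean_space \<Rightarrow> 'f::euclidean_space"
    and g :: "'d::euclidean_space \<Rightarrow> 'e"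
  assumes "open U" "open V" "g ` U \<subseteq> V" "Ck_on k U g" "Ck_on k V f"
  shows "Ck_on k U (\<lambda>x. f (g x))"
  using assms(4,5)
proof (induction k arbitrary: f)
  case 0
  then show ?case using assms(3) by (auto intro: continuous_on_compose2)
next
  case (Suc k)
  let ?f' = "\<lambda>x v. \<Sum>b\<in>Basis. (frechet_derivative g (at x) v \<bullet> b) *\<^sub>R frechet_derivative f (at (g x)) b"
  show ?case
  proof (rule Ck_on_SucI[OF assms(1), where f'="?f'"])
    fix x assume x: "x \<in> U"
    have gx: "g x \<in> V" using x assms(3) by auto
    have lin: "linear (frechet_derivative f (at (g x)))"
      using Ck_on_has_derivative[OF Suc.prems(2) gx] has_derivative_linear by blast
    have "((\<lambda>x. f (g x)) has_derivative
        (\<lambda>v. frechet_derivative f (at (g x)) (frechet_derivative g (at x) v))) (at x)"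
      using has_derivative_compose[OF Ck_on_has_derivative[OF Suc.prems(1) x]
          Ck_on_has_derivative[OF Suc.prems(2) gx]] .
    moreover have "frechet_derivative f (at (g x)) (frechet_derivative g (at x) v) = ?f' x v" for v
      by (rule linear_basis_expansion[OF lin])
    ultimately show "((\<lambda>x. f (g x)) has_derivative ?f' x) (at x)" by simp
  next
    fix v
    show "Ck_on k U (\<lambda>x. ?f' x v)"
    proof (intro Ck_on_sum[OF assms(1)] Ck_on_scaleR[OF assms(1)])
      fix b :: 'e assume "b \<in> Basis"
      show "Ck_on k U (\<lambda>x. frechet_derivative g (at x) v \<bullet> b)"
        using Suc.prems(1) by (intro Ck_on_compose_linear[OF assms(1) linear_inner_const]) auto
      show "Ck_on k U (\<lambda>x. frechet_derivative f (at (g x)) b)"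
        using Suc.IH[of "\<lambda>y. frechet_derivative f (at y) b"] Suc.prems Ck_on_SucD[OF Suc.prems(1)]
        by simp
    qed
  qed
qed

lemma Ck_on_inverse: "Ck_on k {x::real. x \<noteq> 0} inverse"
proof (induction k)
  case 0
  have "continuous_on {x::real. x \<noteq> 0} (\<lambda>x. inverse x)" by (rule continuous_on_inverse) auto
  then show ?case by simp
next
  case (Suc k)
  have o: "open {x::real. x \<noteq> 0}" by (simp add: open_Collect_neq)
  show ?case
  proof (rule Ck_on_SucI[OF o, where f'="\<lambda>x v. - (inverse x * v * inverse x)"])
    fix v :: real
    have l: "linear (\<lambda>z::real. (- v) *\<^sub>R z)" by (rule linear_scaleR)
    have "Ck_on k {x. x \<noteq> 0} (\<lambda>x. (- v) *\<^sub>R (inverse x *\<^sub>R inverse x))"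
      by (rule Ck_on_compose_linear[OF o l Ck_on_scaleR[OF o Suc Suc]])
    moreover have "(\<lambda>x. (- v) *\<^sub>R (inverse x *\<^sub>R inverse x)) = (\<lambda>x. - (inverse x * v * inverse x))"
      by (rule ext) simp
    ultimately show "Ck_on k {x. x \<noteq> 0} (\<lambda>x. - (inverse x * v * inverse x))" by simp
  qed (simp add: has_derivative_inverse')
qed

lemma Cinf_cong: "open U \<Longrightarrow> (\<And>x. x \<in> U \<Longrightarrow> f x = g x) \<Longrightarrow> Cinf U f \<Longrightarrow> Cinf U g"
  unfolding Cinf_def using Ck_on_cong by blast

lemma Cinf_subset: "Cinf U f \<Longrightarrow> V \<subseteq> U \<Longrightarrow> Cinf V f"
  unfolding Cinf_def using Ck_on_subset by blast

lemma Cinf_local: "(\<And>x. x \<in> U \<Longrightarrow> \<exists>V. open V \<and> x \<in> V \<and> Cinf V f) \<Longrightarrow> Cinf U f"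
  unfolding Cinf_def by (meson Ck_on_local)

lemma Cinf_const: "open U \<Longrightarrow> Cinf U (\<lambda>x. c)"
  by (simp add: Cinf_def Ck_on_const)

lemma Cinf_linear: "linear L \<Longrightarrow> open U \<Longrightarrow> Cinf U L"
  by (simp add: Cinf_def Ck_on_linear)

lemma Cinf_add: "open U \<Longrightarrow> Cinf U f \<Longrightarrow> Cinf U g \<Longrightarrow> Cinf U (\<lambda>x. f x + g x)"
  by (simp add: Cinf_def Ck_on_add)

lemma Cinf_scaleR:
  "open U \<Longrightarrow> Cinf U (f::_ \<Rightarrow> real) \<Longrightarrow> Cinf U g \<Longrightarrow> Cinf U (\<lambda>x. f x *\<^sub>R g x)"
  by (simp add: Cinf_def Ck_on_scaleR)

lemma Cinf_mult:
  "open U \<Longrightarrow> Cinf U (f::_ \<Rightarrow> real) \<Longrightarrow> Cinf U g \<Longrightarrow> Cinf U (\<lambda>x. f x * g x)"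
  using Cinf_scaleR[of U f g] by simp

lemma Cinf_compose_linear: "open U \<Longrightarrow> linear L \<Longrightarrow> Cinf U f \<Longrightarrow> Cinf U (\<lambda>x. L (f x))"
  by (simp add: Cinf_def Ck_on_compose_linear)

lemma Cinf_minus: "open U \<Longrightarrow> Cinf U f \<Longrightarrow> Cinf U (\<lambda>x. - f x)"
  by (rule Cinf_compose_linear[of U uminus f]) (auto simp: linear_iff)

lemma Cinf_diff: "open U \<Longrightarrow> Cinf U f \<Longrightarrow> Cinf U g \<Longrightarrow> Cinf U (\<lambda>x. f x - g x)"
  using Cinf_add[OF _ _ Cinf_minus, of U f g] by simp

lemma Cinf_sum: "open U \<Longrightarrow> (\<And>i. i \<in> I \<Longrightarrow> Cinf U (f i)) \<Longrightarrow> Cinf U (\<lambda>x. \<Sum>i\<in>I. f i x)"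
  by (simp add: Cinf_def Ck_on_sum)

lemma Cinf_compose:
  "open U \<Longrightarrow> open V \<Longrightarrow> g ` U \<subseteq> V \<Longrightarrow> Cinf U g \<Longrightarrow> Cinf V f \<Longrightarrow> Cinf U (\<lambda>x. f (g x))"
  unfolding Cinf_def using Ck_on_compose[of U V g _ f] by simp

lemma Cinf_inner_const: "open U \<Longrightarrow> Cinf U f \<Longrightarrow> Cinf U (\<lambda>x. f x \<bullet> b)"
  using Cinf_compose_linear[OF _ linear_inner_const] .

lemma Cinf_componentwise:
  assumes "open U" "\<And>b. b \<in> Basis \<Longrightarrow> Cinf U (\<lambda>x. f x \<bullet> b)"
  shows "Cinf U f"
proof -
  have "Cinf U (\<lambda>x. \<Sum>b\<in>Basis. (f x \<bullet> b) *\<^sub>R b)"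
    by (intro Cinf_sum Cinf_scaleR Cinf_const assms)
  then show ?thesis by (simp add: euclidean_representation)
qed

lemma Cinf_continuous_on: "Cinf U f \<Longrightarrow> continuous_on U f"
  unfolding Cinf_def by (metis Ck_on.simps(1))

lemma Cinf_has_derivative:
  "Cinf U f \<Longrightarrow> x \<in> U \<Longrightarrow> (f has_derivative frechet_derivative f (at x)) (at x)"
  unfolding Cinf_def using Ck_on_has_derivative by blast

lemma Cinf_frechet: "Cinf U f \<Longrightarrow> Cinf U (\<lambda>x. frechet_derivative f (at x) v)"
  unfolding Cinf_def by (metis Ck_on.simps(2))

lemma Cinf_linear_frechet: "Cinf U f \<Longrightarrow> x \<in> U \<Longrightarrow> linear (frechet_derivative f (at x))"
  using Cinf_has_derivative has_derivative_linear by blast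

lemma Cinf_frechet_apply:
  assumes "open U" "Cinf U f" "Cinf U v"
  shows "Cinf U (\<lambda>x. frechet_derivative f (at x) (v x))"
proof -
  have "Cinf U (\<lambda>x. \<Sum>b\<in>Basis. (v x \<bullet> b) *\<^sub>R frechet_derivative f (at x) b)"
    by (intro Cinf_sum Cinf_scaleR Cinf_inner_const Cinf_frechet assms)
  moreover have "(\<Sum>b\<in>Basis. (v x \<bullet> b) *\<^sub>R frechet_derivative f (at x) b)
      = frechet_derivative f (at x) (v x)" if "x \<in> U" for x
    using linear_basis_expansion[OF Cinf_linear_frechet[OF assms(2) that], of "v x"] by simp
  ultimately show ?thesis by (rule Cinf_cong[OF assms(1), rotated])
qed

lemma Cinf_inverse:
  assumes "open U" "Cinf U (f::_ \<Rightarrow> real)" "\<And>x. x \<in> U \<Longrightarrow> f x \<noteq> 0"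
  shows "Cinf U (\<lambda>x. inverse (f x))"
  by (rule Cinf_compose[where V="{x. x \<noteq> 0}"])
    (use assms Ck_on_inverse in \<open>auto simp: Cinf_def open_Collect_neq\<close>)

section \<open>Linear systems that depend on parameters\<close>

text \<open>Solutions of a linear system depend smoothly on the parameters. Differentiating
  \<open>B\<^sub>y s(y) = r(y)\<close> shows that a directional derivative of \<open>s\<close> solves a system with the same
  matrix, so the regularity of \<open>s\<close> can be improved one order at a time.\<close>

lemma linear_solve_continuous:
  fixes B :: "'p::euclidean_space \<Rightarrow> 'e::euclidean_space \<Rightarrow> 'e"
  assumes O: "open U" and lin: "\<And>y. y \<in> U \<Longrightarrow> linear (B y)" and inj: "\<And>y. y \<in> U \<Longrightarrow> inj (B y)"
    and B: "\<And>v. continuous_on U (\<lambda>y. B y v)" and r: "continuous_on U r"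
    and s: "\<And>y. y \<in> U \<Longrightarrow> B y (s y) = r y" and y0: "y0 \<in> U"
  shows "isCont s y0"
proof -
  obtain c where c: "c > 0" "\<And>v. c * norm v \<le> norm (B y0 v)"
    using linear_inj_bounded_below_pos[OF lin[OF y0] inj[OF y0]] by (metis mult.commute)
  define \<beta> where "\<beta> y = (\<Sum>b\<in>Basis. norm (B y b - B y0 b))" for y
  have cB: "isCont (\<lambda>y. B y v) y0" for v
    using B O y0 by (simp add: continuous_on_eq_continuous_at)
  have "isCont \<beta> y0" unfolding \<beta>_def by (intro continuous_intros cB)
  then have b0: "\<beta> \<midarrow>y0\<rightarrow> 0" by (simp add: isCont_def \<beta>_def)
  have bnd: "norm (B y v - B y0 v) \<le> \<beta> y * norm v" if "y \<in> U" for y v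
  proof -
    have "B y v - B y0 v = (\<Sum>b\<in>Basis. (v \<bullet> b) *\<^sub>R (B y b - B y0 b))"
      unfolding linear_basis_expansion[OF lin[OF that], of v]
        linear_basis_expansion[OF lin[OF y0], of v] sum_subtractf[symmetric]
      by (simp add: scaleR_diff_right)
    also have "norm \<dots> \<le> (\<Sum>b\<in>Basis. norm v * norm (B y b - B y0 b))"
      by (rule sum_norm_le) (simp add: Basis_le_norm mult_right_mono)
    finally show ?thesis by (simp add: \<beta>_def sum_distrib_left[symmetric] mult.commute)
  qed
  \<comment> \<open>The matrices near \<open>y0\<close> are bounded below by \<open>c / 2\<close>.\<close>
  have ev: "\<forall>\<^sub>F y in at y0. norm (s y - s y0) \<le> (2 / c) * (norm (r y - r y0) + \<beta> y * norm (s y0))"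
  proof -
    have "\<forall>\<^sub>F y in at y0. \<beta> y < c / 2" by (rule order_tendstoD(2)[OF b0]) (use c(1) in simp)
    moreover have "\<forall>\<^sub>F y in at y0. y \<in> U" using O y0 by (rule eventually_at_in_open')
    ultimately show ?thesis
    proof eventually_elim
      case (elim y)
      let ?d = "s y - s y0"
      have "B y ?d = (r y - r y0) - (B y (s y0) - B y0 (s y0))"
        using s[OF elim(2)] s[OF y0] lin[OF elim(2)] by (simp add: linear_diff)
      then have "norm (B y ?d) \<le> norm (r y - r y0) + \<beta> y * norm (s y0)"
        using norm_triangle_ineq4[of "r y - r y0" "B y (s y0) - B y0 (s y0)"] bnd[OF elim(2), of "s y0"]
        by simp
      moreover have "c * norm ?d \<le> norm (B y ?d) + \<beta> y * norm ?d"
        using c(2)[of ?d] bnd[OF elim(2), of ?d]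
          norm_triangle_ineq2[of "B y0 ?d" "B y ?d"]
        by (simp add: norm_minus_commute)
      moreover have "\<beta> y * norm ?d \<le> c / 2 * norm ?d"
        using elim(1) by (intro mult_right_mono) auto
      ultimately have "c / 2 * norm ?d \<le> norm (r y - r y0) + \<beta> y * norm (s y0)"
        by simp
      then show ?case using c(1) by (simp add: field_simps)
    qed
  qed
  have "isCont r y0" using r O y0 by (simp add: continuous_on_eq_continuous_at)
  then have "(\<lambda>y. (2 / c) * (norm (r y - r y0) + \<beta> y * norm (s y0))) \<midarrow>y0\<rightarrow>
      (2 / c) * (norm (r y0 - r y0) + 0 * norm (s y0))"
    by (intro tendsto_intros b0) (auto simp: isCont_def)
  then have lim: "(\<lambda>y. (2 / c) * (norm (r y - r y0) + \<beta> y * norm (s y0))) \<midarrow>y0\<rightarrow> 0"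
    by simp
  have "(\<lambda>y. norm (s y - s y0)) \<midarrow>y0\<rightarrow> 0"
    by (rule real_tendsto_sandwich[OF _ ev tendsto_const lim]) auto
  then show ?thesis by (simp add: isCont_def tendsto_norm_zero_iff LIM_zero_iff)
qed

text \<open>The remainder in the difference quotient of \<open>s\<close> is a sum of terms of the following shape.\<close>

lemma has_derivative_continuous_scaleR_zero:
  fixes f :: "'p::euclidean_space \<Rightarrow> real" and g :: "'p \<Rightarrow> 'e::euclidean_space"
  assumes f: "isCont f y0" "f y0 = 0" and g: "(g has_derivative g') (at y0)" "g y0 = 0"
  shows "((\<lambda>y. f y *\<^sub>R g y) has_derivative (\<lambda>h. 0)) (at y0)"
proof -
  have bl: "bounded_linear g'" using g(1) by (rule has_derivative_bounded_linear)
  obtain K where K: "\<And>h. norm (g' h) \<le> norm h * K" using bounded_linear.bounded[OF bl] by blast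
  have lim: "(\<lambda>y. norm (g y - g y0 - g' (y - y0)) / norm (y - y0)) \<midarrow>y0\<rightarrow> 0"
    using g(1) unfolding has_derivative_iff_norm by blast
  have fl: "(\<lambda>y. \<bar>f y\<bar>) \<midarrow>y0\<rightarrow> 0" using f by (metis isCont_def tendsto_rabs_zero)
  let ?b = "\<lambda>y. \<bar>f y\<bar> * (norm (g y - g y0 - g' (y - y0)) / norm (y - y0) + \<bar>K\<bar>)"
  have "?b \<midarrow>y0\<rightarrow> 0 * (0 + \<bar>K\<bar>)"
    by (intro tendsto_intros lim fl)
  then have b: "?b \<midarrow>y0\<rightarrow> 0" by simp
  have le: "norm (f y *\<^sub>R g y) / norm (y - y0) \<le> ?b y" if "y \<noteq> y0" for y
  proof -
    have "norm (g y) \<le> norm (g y - g y0 - g' (y - y0)) + norm (g' (y - y0))"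
      using norm_triangle_sub[of "g y" "g' (y - y0)"] g(2) by simp
    also have "norm (g' (y - y0)) \<le> norm (y - y0) * \<bar>K\<bar>"
      using K[of "y - y0"] by (meson abs_ge_self mult_left_mono norm_ge_zero order_trans)
    finally have "norm (g y) / norm (y - y0) \<le>
        norm (g y - g y0 - g' (y - y0)) / norm (y - y0) + \<bar>K\<bar>"
      using that by (simp add: field_simps)
    then have "\<bar>f y\<bar> * (norm (g y) / norm (y - y0)) \<le> ?b y"
      by (intro mult_left_mono) auto
    then show ?thesis by simp
  qed
  have "(\<lambda>y. norm (f y *\<^sub>R g y) / norm (y - y0)) \<midarrow>y0\<rightarrow> 0"
    by (rule real_tendsto_sandwich[OF _ _ tendsto_const b])
       (auto simp: eventually_at_filter le simp del: norm_scaleR)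
  then show ?thesis unfolding has_derivative_iff_norm using f(2) by simp
qed

lemma linear_solve_has_derivative:
  fixes B :: "'p::euclidean_space \<Rightarrow> 'e::euclidean_space \<Rightarrow> 'e"
  assumes O: "open U" and lin: "\<And>y. y \<in> U \<Longrightarrow> linear (B y)" and inj: "\<And>y. y \<in> U \<Longrightarrow> inj (B y)"
    and B: "\<And>v y. y \<in> U \<Longrightarrow> ((\<lambda>y. B y v) has_derivative B' v y) (at y)"
    and r: "\<And>y. y \<in> U \<Longrightarrow> (r has_derivative r' y) (at y)"
    and s: "\<And>y. y \<in> U \<Longrightarrow> B y (s y) = r y" and y0: "y0 \<in> U"
  shows "\<exists>s'. (s has_derivative s') (at y0) \<and> (\<forall>h. B y0 (s' h) = r' y0 h - B' (s y0) y0 h)"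
proof -
  have cB: "continuous_on U (\<lambda>y. B y v)" for v
    using B has_derivative_continuous by (metis continuous_at_imp_continuous_on)
  have cr: "continuous_on U r"
    using r has_derivative_continuous by (metis continuous_at_imp_continuous_on)
  have sc: "isCont s y0" by (rule linear_solve_continuous[OF O lin inj cB cr s y0])
  obtain L where L: "linear L" "\<And>v. L (B y0 v) = v" "\<And>v. B y0 (L v) = v"
    by (metis linear_injective_isomorphism[OF lin[OF y0] inj[OF y0]])
  define E where "E y = (\<Sum>b\<in>Basis. ((s y - s y0) \<bullet> b) *\<^sub>R (B y b - B y0 b))" for y
  have dE: "(E has_derivative (\<lambda>h. \<Sum>b\<in>(Basis::'e set). 0)) (at y0)"
    unfolding E_def
  proof (rule has_derivative_sum)
    fix b :: 'e
    have "((\<lambda>y. B y b - B y0 b) has_derivative (\<lambda>h. B' b y0 h - 0)) (at y0)"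
      by (intro has_derivative_diff B y0 has_derivative_const)
    then show "((\<lambda>y. ((s y - s y0) \<bullet> b) *\<^sub>R (B y b - B y0 b)) has_derivative (\<lambda>h. 0)) (at y0)"
      by (intro has_derivative_continuous_scaleR_zero) (auto intro!: continuous_intros sc)
  qed
  let ?s = "\<lambda>y. s y0 + L ((r y - r y0) - (B y (s y0) - B y0 (s y0)) - E y)"
  have eq: "?s y = s y" if "y \<in> U" for y
  proof -
    have "E y = B y (s y - s y0) - B y0 (s y - s y0)"
      unfolding linear_basis_expansion[OF lin[OF that], of "s y - s y0"]
        linear_basis_expansion[OF lin[OF y0], of "s y - s y0"] E_def sum_subtractf[symmetric]
      by (simp add: scaleR_diff_right)
    then have "(r y - r y0) - (B y (s y0) - B y0 (s y0)) - E y = B y0 (s y - s y0)"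
      using s[OF that] s[OF y0] lin[OF that] by (simp add: linear_diff)
    then show ?thesis using L(2) by simp
  qed
  have "(?s has_derivative (\<lambda>h. 0 + L ((r' y0 h - 0) - (B' (s y0) y0 h - 0) - (\<Sum>b\<in>(Basis::'e set). 0)))) (at y0)"
    by (intro has_derivative_add has_derivative_diff has_derivative_const dE r B y0
        bounded_linear.has_derivative[of L]) (use L(1) linear_conv_bounded_linear in blast)
  then have "(s has_derivative (\<lambda>h. L (r' y0 h - B' (s y0) y0 h))) (at y0)"
    using has_derivative_transform_within_open[OF _ O y0 eq] by simp
  then show ?thesis using L(3) by blast
qed

lemma Ck_on_linear_solve:
  fixes B :: "'p::euclidean_space \<Rightarrow> 'e::euclidean_space \<Rightarrow> 'e"
  assumes O: "open U" and lin: "\<And>y. y \<in> U \<Longrightarrow> linear (B y)" and inj: "\<And>y. y \<in> U \<Longrightarrow> inj (B y)"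
    and B: "\<And>v. Ck_on k U (\<lambda>y. B y v)" and r: "Ck_on k U r"
    and s: "\<And>y. y \<in> U \<Longrightarrow> B y (s y) = r y"
  shows "Ck_on k U s"
  using B r s
proof (induction k arbitrary: r s)
  case 0
  have "isCont s y" if "y \<in> U" for y
    by (rule linear_solve_continuous[OF O lin inj _ _ 0(3) that]) (use 0 in auto)
  then show ?case by (simp add: continuous_at_imp_continuous_on)
next
  case (Suc k)
  let ?B' = "\<lambda>v y. frechet_derivative (\<lambda>y. B y v) (at y)"
  have "\<exists>s'. (s has_derivative s') (at y) \<and>
      (\<forall>h. B y (s' h) = frechet_derivative r (at y) h - ?B' (s y) y h)" if "y \<in> U" for y
    by (rule linear_solve_has_derivative[OF O lin inj Ck_on_has_derivative[OF Suc.prems(1)] _ Suc.prems(3) that])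
      (use Ck_on_has_derivative[OF Suc.prems(2)] in auto)
  then obtain s' where s': "\<And>y. y \<in> U \<Longrightarrow> (s has_derivative s' y) (at y)"
    "\<And>y h. y \<in> U \<Longrightarrow> B y (s' y h) = frechet_derivative r (at y) h - ?B' (s y) y h"
    by metis
  have sk: "Ck_on k U s" by (rule Suc.IH[OF Ck_on_SucD[OF Suc.prems(1)] Ck_on_SucD[OF Suc.prems(2)] Suc.prems(3)])
  have dB: "?B' v y h = (\<Sum>b\<in>Basis. (v \<bullet> b) *\<^sub>R ?B' b y h)" if y: "y \<in> U" for v y h
  proof -
    have "((\<lambda>y. \<Sum>b\<in>Basis. (v \<bullet> b) *\<^sub>R B y b) has_derivative
        (\<lambda>h. \<Sum>b\<in>Basis. (v \<bullet> b) *\<^sub>R ?B' b y h)) (at y)"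
      by (intro has_derivative_sum has_derivative_scaleR_right Ck_on_has_derivative[OF Suc.prems(1) y])
    moreover have "(\<Sum>b\<in>Basis. (v \<bullet> b) *\<^sub>R B z b) = B z v" if "z \<in> U" for z
      using linear_basis_expansion[OF lin[OF that], of v] by simp
    ultimately have "((\<lambda>y. B y v) has_derivative (\<lambda>h. \<Sum>b\<in>Basis. (v \<bullet> b) *\<^sub>R ?B' b y h)) (at y)"
      by (rule has_derivative_transform_within_open[OF _ O y])
    from fun_cong[OF frechet_derivative_at[OF this], of h] show ?thesis by (rule sym)
  qed
  show ?case
  proof (rule Ck_on_SucI[OF O s'(1)])
    fix h
    have "Ck_on k U (\<lambda>y. frechet_derivative r (at y) h + - (\<Sum>b\<in>Basis. (s y \<bullet> b) *\<^sub>R ?B' b y h))"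
    proof (intro Ck_on_add[OF O] Ck_on_compose_linear[OF O, of uminus] Ck_on_sum[OF O] Ck_on_scaleR[OF O])
      show "Ck_on k U (\<lambda>y. frechet_derivative r (at y) h)" using Suc.prems(2) by simp
      show "linear uminus" by (auto simp: linear_iff)
      fix b :: 'e
      show "Ck_on k U (\<lambda>y. s y \<bullet> b)"
        by (rule Ck_on_compose_linear[OF O linear_inner_const sk])
      show "Ck_on k U (\<lambda>y. ?B' b y h)" using Suc.prems(1)[of b] by simp
    qed
    then show "Ck_on k U (\<lambda>y. s' y h)"
    proof (rule Suc.IH[OF Ck_on_SucD[OF Suc.prems(1)]])
      fix y assume y: "y \<in> U"
      show "B y (s' y h) = frechet_derivative r (at y) h + - (\<Sum>b\<in>Basis. (s y \<bullet> b) *\<^sub>R ?B' b y h)"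
        using s'(2)[OF y] dB[OF y, of "s y" h] by simp
    qed
  qed
qed

lemma Cinf_linear_solve:
  fixes B :: "'p::euclidean_space \<Rightarrow> 'e::euclidean_space \<Rightarrow> 'e"
  assumes "open U" "\<And>y. y \<in> U \<Longrightarrow> linear (B y)" "\<And>y. y \<in> U \<Longrightarrow> inj (B y)"
    and "\<And>v. Cinf U (\<lambda>y. B y v)" "Cinf U r" "\<And>y. y \<in> U \<Longrightarrow> B y (s y) = r y"
  shows "Cinf U s"
  unfolding Cinf_def
proof
  fix k
  show "Ck_on k U s"
    by (rule Ck_on_linear_solve[of U B k r s]) (use assms in \<open>auto simp: Cinf_def\<close>)
qed

section \<open>Bump functions, Hadamard's lemma and inverse functions\<close>

text \<open>The function \<open>x\<^sup>-\<^sup>n e\<^sup>-\<^sup>1\<^sup>/\<^sup>x\<close>, extended by \<open>0\<close> to \<open>x \<le> 0\<close>. The power is carried along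
  because the derivative is a combination of functions of the same form.\<close>

definition expflat :: "nat \<Rightarrow> real \<Rightarrow> real" where
  "expflat n x = (if x > 0 then inverse x ^ n * exp (- inverse x) else 0)"

lemma expflat_tendsto_0: "expflat n \<midarrow>0\<rightarrow> 0"
proof (rule filterlim_split_at_real)
  show "(expflat n \<longlongrightarrow> 0) (at_left 0)"
    by (rule tendsto_eventually) (auto simp: eventually_at_filter expflat_def)
  have "((\<lambda>x. inverse x ^ n / exp (inverse x)) \<longlongrightarrow> 0) (at_right (0::real))"
    by (rule filterlim_compose[OF tendsto_power_div_exp_0 filterlim_inverse_at_top_right])
  then show "(expflat n \<longlongrightarrow> 0) (at_right 0)"
    by (rule Lim_transform_eventually)
      (auto simp: eventually_at_filter expflat_def exp_minus divide_inverse)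
qed

lemma expflat_has_derivative:
  "(expflat n has_real_derivative (expflat (n + 2) x - real n * expflat (n + 1) x)) (at x)"
proof -
  consider "x > 0" | "x < 0" | "x = 0" by linarith
  then show ?thesis
  proof cases
    case 1
    have "((\<lambda>x. inverse x ^ n * exp (- inverse x)) has_real_derivative
        (expflat (n + 2) x - real n * expflat (n + 1) x)) (at x)"
      using 1 by (auto intro!: derivative_eq_intros simp: expflat_def power_Suc field_simps
          power2_eq_square split: nat.split) (cases n; simp add: field_simps)
    then show ?thesis
      by (rule has_field_derivative_transform_within_open[where S="{0<..}"])
        (use 1 in \<open>auto simp: expflat_def\<close>)
  next
    case 2
    have "((\<lambda>x. 0) has_real_derivative (expflat (n + 2) x - real n * expflat (n + 1) x)) (at x)"
      using 2 by (simp add: expflat_def)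
    then show ?thesis
      by (rule has_field_derivative_transform_within_open[where S="{..<0}"])
        (use 2 in \<open>auto simp: expflat_def\<close>)
  next
    case 3
    have "(\<lambda>h. (expflat n (0 + h) - expflat n 0) / h) = expflat (Suc n)"
      by (auto simp: expflat_def divide_inverse fun_eq_iff)
    then have "(expflat n has_real_derivative 0) (at 0)"
      using expflat_tendsto_0[of "Suc n"] unfolding DERIV_def by simp
    then show ?thesis using 3 by (simp add: expflat_def)
  qed
qed

lemma Ck_on_expflat: "Ck_on k UNIV (expflat n)"
proof (induction k arbitrary: n)
  case 0
  show ?case
    by (simp, intro continuous_at_imp_continuous_on ballI DERIV_isCont[OF expflat_has_derivative])
next
  case (Suc k)
  show ?case
  proof (rule Ck_on_SucI[OF open_UNIV])
    show "(expflat n has_derivative (\<lambda>v. (expflat (n + 2) x - real n * expflat (n + 1) x) * v)) (at x)" for x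
      using expflat_has_derivative has_field_derivative_def by blast
    fix v :: real
    have "Ck_on k UNIV (\<lambda>x. v *\<^sub>R (expflat (n + 2) x + (- real n) *\<^sub>R expflat (n + 1) x))"
      by (intro Ck_on_compose_linear[OF open_UNIV linear_scaleR] Ck_on_add[OF open_UNIV] Suc)
    then show "Ck_on k UNIV (\<lambda>x. (expflat (n + 2) x - real n * expflat (n + 1) x) * v)"
      by (simp add: mult.commute)
  qed
qed

lemma Cinf_norm_square: "Cinf UNIV (\<lambda>y::'e::euclidean_space. (norm (y - a))\<^sup>2)"
proof -
  have "Cinf UNIV (\<lambda>y. \<Sum>b\<in>Basis. ((y - a) \<bullet> b) * ((y - a) \<bullet> b))"
    by (intro Cinf_sum Cinf_mult Cinf_inner_const Cinf_diff Cinf_const Cinf_linear[OF linear_ident] open_UNIV)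
  moreover have "(\<Sum>b\<in>Basis. ((y - a) \<bullet> b) * ((y - a) \<bullet> b)) = (norm (y - a))\<^sup>2" for y
    unfolding power2_norm_eq_inner by (rule euclidean_inner[symmetric])
  ultimately show ?thesis by simp
qed

lemma smooth_bump_exists:
  fixes a :: "'e::euclidean_space"
  assumes "0 < r" "r < s"
  obtains \<beta> :: "'e \<Rightarrow> real" where "Cinf UNIV \<beta>" "\<And>y. norm (y - a) \<le> r \<Longrightarrow> \<beta> y = 1"
    "\<And>y. s \<le> norm (y - a) \<Longrightarrow> \<beta> y = 0"
proof -
  define q where "q y = (norm (y - a))\<^sup>2" for y
  define n where "n y = expflat 0 (s\<^sup>2 - q y)" for y
  define m where "m y = expflat 0 (q y - r\<^sup>2)" for y
  have rs: "r\<^sup>2 < s\<^sup>2" using assms by (simp add: power_strict_mono)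
  have pos: "n y + m y > 0" for y
  proof -
    have "s\<^sup>2 - q y > 0 \<or> q y - r\<^sup>2 > 0" using rs by linarith
    then show ?thesis unfolding n_def m_def expflat_def by (auto intro: add_pos_nonneg add_nonneg_pos)
  qed
  have ef: "Cinf UNIV (expflat 0)" by (simp add: Cinf_def Ck_on_expflat)
  have q: "Cinf UNIV q" unfolding q_def[abs_def] by (rule Cinf_norm_square)
  have n: "Cinf UNIV n" and m: "Cinf UNIV m"
    unfolding n_def m_def
    by (intro Cinf_compose[OF _ open_UNIV _ _ ef] Cinf_diff Cinf_const q; simp)+
  \<comment> \<open>\<open>n\<close> vanishes outside the larger ball and \<open>m\<close> inside the smaller one.\<close>
  have "Cinf UNIV (\<lambda>y. n y * inverse (n y + m y))"
    by (intro Cinf_mult Cinf_inverse Cinf_add n m open_UNIV) (use pos in \<open>auto simp: less_le\<close>)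
  moreover have "n y * inverse (n y + m y) = 1" if "norm (y - a) \<le> r" for y
  proof -
    have "q y \<le> r\<^sup>2" unfolding q_def using that by (simp add: power_mono)
    then have "m y = 0" by (simp add: m_def expflat_def)
    then show ?thesis using pos[of y] by simp
  qed
  moreover have "n y * inverse (n y + m y) = 0" if "s \<le> norm (y - a)" for y
  proof -
    have "s\<^sup>2 \<le> q y" unfolding q_def using that assms by (simp add: power_mono)
    then show ?thesis by (simp add: n_def expflat_def)
  qed
  ultimately show thesis by (rule that)
qed

lemma continuous_on_slice:
  assumes "continuous_on (S \<times> T) (\<lambda>(y, t). G y t)" "y \<in> S"
  shows "continuous_on T (G y)"
proof -
  have "continuous_on T (\<lambda>t. case (y, t) of (y, t) \<Rightarrow> G y t)"
    by (rule continuous_on_compose2[OF assms(1)]) (use assms(2) in \<open>auto intro!: continuous_intros\<close>)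
  then show ?thesis by simp
qed

text \<open>Hadamard's lemma. The powers of \<open>t\<close> are carried along because differentiation under the
  integral sign produces them.\<close>

lemma Ck_on_ray_integral:
  fixes u :: "'e::euclidean_space \<Rightarrow> real"
  assumes "Cinf (ball a r) u"
  shows "Ck_on k (ball a r) (\<lambda>y. integral (cbox 0 1) (\<lambda>t. t ^ m * u (a + t *\<^sub>R (y - a))))"
  using assms
proof (induction k arbitrary: m u)
  have in_ball: "a + t *\<^sub>R (y - a) \<in> ball a r" if "y \<in> ball a r" "t \<in> cbox 0 1" for y and t :: real
  proof -
    have "norm (t *\<^sub>R (y - a)) \<le> 1 * norm (y - a)"
      using that(2) by (simp add: mult_left_le_one_le)
    then show ?thesis using that(1) by (simp add: dist_norm norm_minus_commute)
  qed
  have cont: "continuous_on (ball a r \<times> cbox 0 1) (\<lambda>(y, t). t ^ m * u (a + t *\<^sub>R (y - a)))"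
    if "Cinf (ball a r) u" for m and u :: "'e \<Rightarrow> real"
  proof -
    have "continuous_on (ball a r \<times> cbox 0 1) (\<lambda>z. u (a + snd z *\<^sub>R (fst z - a)))"
      by (rule continuous_on_compose2[OF Cinf_continuous_on[OF that]])
        (use in_ball in \<open>auto intro!: continuous_intros\<close>)
    then show ?thesis by (auto intro!: continuous_intros simp: case_prod_unfold)
  qed
  {
    case 0
    show ?case
      using integral_continuous_on_param[OF cont[OF 0, of m]] by simp
  next
    case (Suc k)
    note u = Suc.prems
    let ?F = "\<lambda>y (t::real). t ^ m * u (a + t *\<^sub>R (y - a))"
    let ?D = "\<lambda>y (t::real) h. t ^ Suc m * frechet_derivative u (at (a + t *\<^sub>R (y - a))) h"
    have bl: "bounded_linear (?D y t)" if "y \<in> ball a r" "t \<in> cbox 0 1" for y t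
      using Cinf_linear_frechet[OF u in_ball[OF that]]
      by (simp add: bounded_linear_const_mult linear_conv_bounded_linear del: power_Suc)
    define fx where "fx y t = Blinfun (?D y t)" for y t
    have fx: "blinfun_apply (fx y t) = ?D y t" if "y \<in> ball a r" "t \<in> cbox 0 1" for y t
      unfolding fx_def using bl[OF that] by (rule bounded_linear_Blinfun_apply)
    have der: "((\<lambda>y. ?F y t) has_derivative blinfun_apply (fx y t)) (at y within ball a r)"
      if yt: "y \<in> ball a r" "t \<in> cbox 0 1" for y t
    proof -
      have "((\<lambda>y. a + t *\<^sub>R (y - a)) has_derivative (\<lambda>h. t *\<^sub>R h)) (at y)"
        by (auto intro!: derivative_eq_intros)
      from has_derivative_compose[OF this Cinf_has_derivative[OF u in_ball[OF yt]]]
      have "((\<lambda>y. ?F y t) has_derivative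
          (\<lambda>h. t ^ m * frechet_derivative u (at (a + t *\<^sub>R (y - a))) (t *\<^sub>R h))) (at y)"
        by (rule has_derivative_mult_right)
      moreover have "(\<lambda>h. t ^ m * frechet_derivative u (at (a + t *\<^sub>R (y - a))) (t *\<^sub>R h)) = ?D y t"
        using Cinf_linear_frechet[OF u in_ball[OF yt]] by (simp add: linear_cmul fun_eq_iff)
      ultimately show ?thesis using fx[OF yt] has_derivative_at_withinI by metis
    qed
    have contfx: "continuous_on (ball a r \<times> cbox 0 1) (\<lambda>(y, t). fx y t)"
    proof (rule continuous_on_blinfun_componentwise)
      fix b :: 'e assume "b \<in> Basis"
      show "continuous_on (ball a r \<times> cbox 0 1) (\<lambda>z. blinfun_apply (case z of (y, t) \<Rightarrow> fx y t) b)"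
        using cont[OF Cinf_frechet[OF u, of b], of "Suc m"]
        by (rule continuous_on_eq) (auto simp: fx)
    qed
    have intF: "?F y integrable_on cbox 0 1" if "y \<in> ball a r" for y
      by (rule integrable_continuous[OF continuous_on_slice[OF cont[OF u] that]])
    have intfx: "fx y integrable_on cbox 0 1" if "y \<in> ball a r" for y
      by (rule integrable_continuous[OF continuous_on_slice[OF contfx that]])
    show ?case
    proof (rule Ck_on_SucI[OF open_ball])
      fix y assume y: "y \<in> ball a r"
      have "((\<lambda>y. integral (cbox 0 1) (?F y)) has_derivative blinfun_apply (integral (cbox 0 1) (fx y)))
          (at y within ball a r)"
        by (rule leibniz_rule[OF der intF contfx y convex_ball])
      then show "((\<lambda>y. integral (cbox 0 1) (?F y)) has_derivative
          (\<lambda>h. integral (cbox 0 1) (\<lambda>t. ?D y t h))) (at y)"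
      proof -
        have "blinfun_apply (integral (cbox 0 1) (fx y)) h = integral (cbox 0 1) (\<lambda>t. ?D y t h)" for h
        proof -
          have "blinfun_apply (integral (cbox 0 1) (fx y)) h
              = integral (cbox 0 1) (\<lambda>t. blinfun_apply (fx y t) h)"
            by (rule blinfun_apply_integral[OF intfx[OF y]])
          also have "\<dots> = integral (cbox 0 1) (\<lambda>t. ?D y t h)"
            by (rule integral_cong) (simp add: fx[OF y])
          finally show ?thesis .
        qed
        then have "blinfun_apply (integral (cbox 0 1) (fx y)) = (\<lambda>h. integral (cbox 0 1) (\<lambda>t. ?D y t h))"
          by (rule ext)
        then show ?thesis
          using \<open>(_ has_derivative _) (at y within ball a r)\<close> at_within_open[OF y open_ball] by simp
      qed
    next
      fix h
      show "Ck_on k (ball a r) (\<lambda>y. integral (cbox 0 1) (\<lambda>t. ?D y t h))"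
        by (rule Suc.IH[OF Cinf_frechet[OF u]])
    qed
  }
qed

lemma Hadamard:
  fixes f :: "'e::euclidean_space \<Rightarrow> real"
  assumes "Cinf (ball a r) f"
  obtains g where "\<And>b. Cinf (ball a r) (g b)" "\<And>y. y \<in> ball a r \<Longrightarrow> f y = f a + (\<Sum>b\<in>Basis. ((y - a) \<bullet> b) * g b y)"
    "\<And>b. a \<in> ball a r \<Longrightarrow> g b a = frechet_derivative f (at a) b"
proof
  let ?g = "\<lambda>b y. integral (cbox 0 1) (\<lambda>t::real. t ^ 0 * frechet_derivative f (at (a + t *\<^sub>R (y - a))) b)"
  show "Cinf (ball a r) (?g b)" for b
    unfolding Cinf_def using Ck_on_ray_integral[OF Cinf_frechet[OF assms]] by blast
  show "?g b a = frechet_derivative f (at a) b" for b by simp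
  fix y assume y: "y \<in> ball a r"
  have in_ball: "a + t *\<^sub>R (y - a) \<in> ball a r" if "t \<in> {0..1}" for t :: real
  proof -
    have "norm (t *\<^sub>R (y - a)) \<le> 1 * norm (y - a)"
      using that by (simp add: mult_left_le_one_le)
    then show ?thesis using y by (simp add: dist_norm norm_minus_commute)
  qed
  have der: "((\<lambda>t. f (a + t *\<^sub>R (y - a))) has_vector_derivative
      frechet_derivative f (at (a + t *\<^sub>R (y - a))) (y - a)) (at t within {0..1})" if "t \<in> {0..1}" for t
  proof -
    have "((\<lambda>t. a + t *\<^sub>R (y - a)) has_derivative (\<lambda>h. h *\<^sub>R (y - a))) (at t within {0..1})"
      by (auto intro!: derivative_eq_intros)
    from has_derivative_compose[OF this Cinf_has_derivative[OF assms in_ball[OF that]]]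
    show ?thesis
      unfolding has_vector_derivative_def
      using Cinf_linear_frechet[OF assms in_ball[OF that]] by (simp add: linear_cmul)
  qed
  have I1: "((\<lambda>t. frechet_derivative f (at (a + t *\<^sub>R (y - a))) (y - a)) has_integral
      f (a + 1 *\<^sub>R (y - a)) - f (a + 0 *\<^sub>R (y - a))) {0..1}"
    by (rule fundamental_theorem_of_calculus[OF _ der]) auto
  have "((\<lambda>t. \<Sum>b\<in>Basis. ((y - a) \<bullet> b) *\<^sub>R (t ^ 0 * frechet_derivative f (at (a + t *\<^sub>R (y - a))) b))
      has_integral (\<Sum>b\<in>Basis. ((y - a) \<bullet> b) *\<^sub>R ?g b y)) (cbox 0 1)"
  proof (intro has_integral_sum finite_Basis has_integral_cmul integrable_integral integrable_continuous)
    fix b :: 'e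
    show "continuous_on (cbox 0 1) (\<lambda>t::real. t ^ 0 * frechet_derivative f (at (a + t *\<^sub>R (y - a))) b)"
      by (intro continuous_on_mult continuous_intros
          continuous_on_compose2[OF Cinf_continuous_on[OF Cinf_frechet[OF assms]]])
        (use in_ball in auto)
  qed
  then have I2: "((\<lambda>t. frechet_derivative f (at (a + t *\<^sub>R (y - a))) (y - a))
      has_integral (\<Sum>b\<in>Basis. ((y - a) \<bullet> b) *\<^sub>R ?g b y)) {0..1}"
    unfolding cbox_interval
    by (rule has_integral_eq[rotated])
      (use linear_basis_expansion[OF Cinf_linear_frechet[OF assms in_ball], of _ "y - a"] in simp)
  from has_integral_unique[OF I1 I2] show "f y = f a + (\<Sum>b\<in>Basis. ((y - a) \<bullet> b) * ?g b y)" by simp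
qed

text \<open>The directional derivatives of the inverse solve a linear system whose matrix is the
  derivative of \<open>\<Theta>\<close> at the inverse, so each order of smoothness of the inverse gives the next one.\<close>

lemma smooth_inverse_function:
  fixes \<Theta> :: "'e::euclidean_space \<Rightarrow> 'e"
  assumes O: "open U" and z: "z \<in> U" and \<Theta>: "Cinf U \<Theta>"
    and id: "\<And>v. frechet_derivative \<Theta> (at z) v = v"
  obtains U' V \<Omega> where "open U'" "U' \<subseteq> U" "z \<in> U'" "open V" "\<Theta> z \<in> V" "homeomorphism U' V \<Theta> \<Omega>"
    "Cinf V \<Omega>"
proof -
  define f' where "f' x = Blinfun (frechet_derivative \<Theta> (at x))" for x
  have f': "blinfun_apply (f' x) = frechet_derivative \<Theta> (at x)" if "x \<in> U" for x
    unfolding f'_def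
    by (rule bounded_linear_Blinfun_apply[OF has_derivative_bounded_linear[OF Cinf_has_derivative[OF \<Theta> that]]])
  have der: "(\<Theta> has_derivative blinfun_apply (f' x)) (at x)" if "x \<in> U" for x
    using Cinf_has_derivative[OF \<Theta> that] f'[OF that] by simp
  have cont: "continuous_on U f'"
  proof (rule continuous_on_blinfun_componentwise)
    fix b :: 'e
    show "continuous_on U (\<lambda>x. blinfun_apply (f' x) b)"
      by (rule continuous_on_eq[OF Cinf_continuous_on[OF Cinf_frechet[OF \<Theta>, of b]]]) (simp add: f')
  qed
  have inv: "id_blinfun o\<^sub>L f' z = id_blinfun"
    by (rule blinfun_eqI) (simp add: f'[OF z] id)
  obtain U' V \<Omega> g' where U': "open U'" "U' \<subseteq> U" "z \<in> U'" and V: "open V" "\<Theta> z \<in> V"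
    and hom: "homeomorphism U' V \<Theta> \<Omega>"
    and g': "\<And>y. y \<in> V \<Longrightarrow> (\<Omega> has_derivative (g' y)) (at y)"
      "\<And>y. y \<in> V \<Longrightarrow> g' y = inv (blinfun_apply (f' (\<Omega> y)))"
      "\<And>y. y \<in> V \<Longrightarrow> bij (blinfun_apply (f' (\<Omega> y)))"
    by (rule inverse_function_theorem[OF O der cont z inv], assumption, (rule that; assumption))
  have \<Omega>U: "\<Omega> y \<in> U" if "y \<in> V" for y
    using hom that U'(2) by (auto simp: homeomorphism_def)
  have "Ck_on k V \<Omega>" for k
  proof (induction k)
    case 0
    then show ?case using hom by (simp add: homeomorphism_def)
  next
    case (Suc k)
    show ?case
    proof (rule Ck_on_SucI[OF V(1) g'(1)])
      fix v
      show "Ck_on k V (\<lambda>y. g' y v)"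
      proof (rule Ck_on_linear_solve[OF V(1), where B="\<lambda>y. frechet_derivative \<Theta> (at (\<Omega> y))" and r="\<lambda>y. v"])
        fix y assume y: "y \<in> V"
        show "linear (frechet_derivative \<Theta> (at (\<Omega> y)))" by (rule Cinf_linear_frechet[OF \<Theta> \<Omega>U[OF y]])
        show "inj (frechet_derivative \<Theta> (at (\<Omega> y)))"
          using g'(3)[OF y] f'[OF \<Omega>U[OF y]] by (simp add: bij_is_inj)
        show "frechet_derivative \<Theta> (at (\<Omega> y)) (g' y v) = v"
          using g'(2,3)[OF y] f'[OF \<Omega>U[OF y]] by (simp add: bij_is_surj surj_f_inv_f)
      next
        fix w
        show "Ck_on k V (\<lambda>y. frechet_derivative \<Theta> (at (\<Omega> y)) w)"
        proof (rule Ck_on_compose[OF V(1) O _ Suc])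
          show "\<Omega> ` V \<subseteq> U" using \<Omega>U by blast
          show "Ck_on k U (\<lambda>x. frechet_derivative \<Theta> (at x) w)"
            using Cinf_frechet[OF \<Theta>, of w] unfolding Cinf_def by blast
        qed
      qed (rule Ck_on_const[OF V(1)])
    qed
  qed
  then have "Cinf V \<Omega>" by (simp add: Cinf_def)
  from that[OF U' V hom this] show thesis .
qed

section \<open>Smoothness on arbitrary sets and orthogonal projections\<close>

lemma smooth_onD:
  assumes "smooth_on S f" "x \<in> S"
  obtains U F where "open U" "x \<in> U" "Cinf U F" "\<And>y. y \<in> S \<Longrightarrow> y \<in> U \<Longrightarrow> F y = f y"
proof -
  from assms obtain U F where "open U" "x \<in> U" "\<forall>k. Ck_on k U F" "\<forall>y\<in>S \<inter> U. F y = f y"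
    unfolding smooth_on_def by blast
  then show thesis by (intro that[of U F]) (simp_all add: Cinf_def)
qed

lemma smooth_onI:
  assumes "\<And>x. x \<in> S \<Longrightarrow> \<exists>U F. open U \<and> x \<in> U \<and> Cinf U F \<and> (\<forall>y\<in>S \<inter> U. F y = f y)"
  shows "smooth_on S f"
  unfolding smooth_on_def
proof (intro ballI)
  fix x assume "x \<in> S"
  from assms[OF this] show "\<exists>U F. open U \<and> x \<in> U \<and> (\<forall>k. Ck_on k U F) \<and> (\<forall>y\<in>S \<inter> U. F y = f y)"
    by (simp only: Cinf_def)
qed

lemma smooth_on_subset_cong:
  assumes f: "smooth_on S f" and T: "T \<subseteq> S" and eq: "\<And>x. x \<in> T \<Longrightarrow> f x = g x"
  shows "smooth_on T g"
proof (rule smooth_onI)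
  fix x assume "x \<in> T"
  then have "x \<in> S" using T by blast
  then obtain U F where "open U" "x \<in> U" "Cinf U F" "\<And>y. y \<in> S \<Longrightarrow> y \<in> U \<Longrightarrow> F y = f y"
    using smooth_onD[OF f] by metis
  then show "\<exists>U F. open U \<and> x \<in> U \<and> Cinf U F \<and> (\<forall>y\<in>T \<inter> U. F y = g y)"
    using T eq by (intro exI[of _ U] exI[of _ F]) auto
qed

lemma smooth_on_cong: "(\<And>x. x \<in> S \<Longrightarrow> f x = g x) \<Longrightarrow> smooth_on S f \<Longrightarrow> smooth_on S g"
  by (rule smooth_on_subset_cong[of S f]) auto

lemma smooth_on_subset: "smooth_on S f \<Longrightarrow> T \<subseteq> S \<Longrightarrow> smooth_on T f"
  by (rule smooth_on_subset_cong[of S f]) auto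

lemma smooth_on_Cinf: "open S \<Longrightarrow> smooth_on S f \<longleftrightarrow> Cinf S f"
proof
  assume S: "open S" and f: "smooth_on S f"
  show "Cinf S f"
  proof (rule Cinf_local)
    fix x assume "x \<in> S"
    then obtain U F where U: "open U" "x \<in> U" "Cinf U F" "\<And>y. y \<in> S \<Longrightarrow> y \<in> U \<Longrightarrow> F y = f y"
      using f smooth_onD by metis
    have "Cinf (U \<inter> S) f"
      by (rule Cinf_cong[OF _ _ Cinf_subset[OF U(3)]]) (use U S in auto)
    then show "\<exists>V. open V \<and> x \<in> V \<and> Cinf V f" using U S \<open>x \<in> S\<close> by blast
  qed
qed (auto intro!: smooth_onI)

lemma smooth_on_local:
  assumes "\<And>x. x \<in> S \<Longrightarrow> \<exists>U. open U \<and> x \<in> U \<and> smooth_on (S \<inter> U) f"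
  shows "smooth_on S f"
proof (rule smooth_onI)
  fix x assume x: "x \<in> S"
  then obtain U where U: "open U" "x \<in> U" "smooth_on (S \<inter> U) f" using assms by blast
  then obtain V F where V: "open V" "x \<in> V" "Cinf V F" "\<And>y. y \<in> S \<inter> U \<Longrightarrow> y \<in> V \<Longrightarrow> F y = f y"
    using x smooth_onD[of "S \<inter> U" f x] by (metis IntI)
  show "\<exists>U F. open U \<and> x \<in> U \<and> Cinf U F \<and> (\<forall>y\<in>S \<inter> U. F y = f y)"
    by (rule exI[of _ "U \<inter> V"], rule exI[of _ F]) (use U V Cinf_subset[OF V(3)] in auto)
qed

lemma smooth_on_compose:
  assumes "smooth_on S g" "smooth_on T f" "g ` S \<subseteq> T"
  shows "smooth_on S (\<lambda>x. f (g x))"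
proof (rule smooth_onI)
  fix x assume x: "x \<in> S"
  obtain U G where U: "open U" "x \<in> U" "Cinf U G" "\<And>y. y \<in> S \<Longrightarrow> y \<in> U \<Longrightarrow> G y = g y"
    using smooth_onD[OF assms(1) x] by metis
  have "g x \<in> T" using assms(3) x by auto
  then obtain V F where V: "open V" "g x \<in> V" "Cinf V F" "\<And>y. y \<in> T \<Longrightarrow> y \<in> V \<Longrightarrow> F y = f y"
    using smooth_onD[OF assms(2)] by metis
  let ?W = "U \<inter> G -` V"
  have W: "open ?W" by (rule continuous_open_preimage[OF Cinf_continuous_on[OF U(3)] U(1) V(1)])
  have "Cinf ?W (\<lambda>x. F (G x))"
    by (rule Cinf_compose[OF W V(1) _ Cinf_subset[OF U(3)] V(3)]) auto
  then show "\<exists>U F. open U \<and> x \<in> U \<and> Cinf U F \<and> (\<forall>y\<in>S \<inter> U. F y = f (g y))"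
    using W U V x assms(3) by (intro exI[of _ ?W] exI[of _ "\<lambda>x. F (G x)"]) auto
qed

lemma smooth_on_componentwise:
  assumes "\<And>b. b \<in> Basis \<Longrightarrow> smooth_on S (\<lambda>x. f x \<bullet> b)"
  shows "smooth_on S (f::'e::euclidean_space \<Rightarrow> 'f::euclidean_space)"
proof (rule smooth_onI)
  fix x assume x: "x \<in> S"
  have "\<forall>b\<in>Basis. \<exists>U F. open U \<and> x \<in> U \<and> Cinf U F \<and> (\<forall>y\<in>S \<inter> U. F y = f y \<bullet> b)"
    using smooth_onD[OF assms x] by (metis IntE)
  then obtain U F where UF: "\<And>b. b \<in> Basis \<Longrightarrow> open (U b) \<and> x \<in> U b \<and> Cinf (U b) (F b)
      \<and> (\<forall>y\<in>S \<inter> U b. F b y = f y \<bullet> b)" by metis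
  let ?U = "\<Inter>b\<in>Basis. U b"
  let ?F = "\<lambda>y. \<Sum>b\<in>Basis. F b y *\<^sub>R b"
  have o: "open ?U" using UF by (intro open_INT) auto
  have "Cinf ?U ?F"
  proof (intro Cinf_sum Cinf_scaleR Cinf_const o)
    fix b :: 'f assume "b \<in> Basis"
    then show "Cinf ?U (F b)" using UF Cinf_subset[of "U b" "F b" ?U] by blast
  qed
  moreover have "?F y = f y" if "y \<in> S \<inter> ?U" for y
  proof -
    have "?F y = (\<Sum>b\<in>Basis. (f y \<bullet> b) *\<^sub>R b)" by (rule sum.cong) (use UF that in auto)
    then show ?thesis by (simp only: euclidean_representation)
  qed
  ultimately show "\<exists>U F. open U \<and> x \<in> U \<and> Cinf U F \<and> (\<forall>y\<in>S \<inter> U. F y = f y)"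
    using o UF by blast
qed

definition orth_proj :: "('e::euclidean_space \<Rightarrow> 'e) \<Rightarrow> bool" where
  "orth_proj P \<longleftrightarrow> linear P \<and> (\<forall>y. P (P y) = P y) \<and> (\<forall>x y. P x \<bullet> y = x \<bullet> P y)"

lemma orth_proj_exists:
  assumes "subspace E"
  obtains P where "orth_proj P" "range P = E"
proof -
  obtain B where B: "B \<subseteq> E" "pairwise orthogonal B" "\<And>x. x \<in> B \<Longrightarrow> norm x = 1"
    "independent B" "span B = E"
    using orthonormal_basis_subspace[OF assms] by metis
  have fin: "finite B" using B(4) independent_imp_finite by blast
  define P where "P y = (\<Sum>b\<in>B. (y \<bullet> b) *\<^sub>R b)" for y
  have lin: "linear P"
    unfolding P_def linear_iff by (simp add: inner_add_left scaleR_add_left sum.distrib scaleR_sum_right)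
  have Pb: "P b = b" if b: "b \<in> B" for b
  proof -
    have "(b \<bullet> c) *\<^sub>R c = (if c = b then b else 0)" if "c \<in> B" for c
      using B(2,3) b that by (auto simp: pairwise_def orthogonal_def norm_eq_1)
    then have "P b = (\<Sum>c\<in>B. if c = b then b else 0)" unfolding P_def by (intro sum.cong) auto
    then show ?thesis using b fin by (simp add: sum.delta')
  qed
  have "P y = y" if "y \<in> E" for y
    using linear_eq_on[OF lin linear_ident, of y B] Pb that B(5) by auto
  moreover have "P y \<in> E" for y
    unfolding P_def using B(1) assms by (intro subspace_sum subspace_scale) auto
  ultimately have PP: "P (P y) = P y" and "range P = E" for y
  proof -
    assume a: "\<And>y. y \<in> E \<Longrightarrow> P y = y" "\<And>y. P y \<in> E"
    show "P (P y) = P y" by (rule a(1)[OF a(2)])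
    show "range P = E" using a(2) a(1)[symmetric] by blast
  qed
  moreover have sym: "P x \<bullet> y = x \<bullet> P y" for x y
    unfolding P_def inner_sum_left inner_sum_right
    by (rule sum.cong) (simp_all add: inner_commute)
  have "orth_proj P" unfolding orth_proj_def using lin PP sym by blast
  then show thesis using \<open>range P = E\<close> by (rule that)
qed

lemma open_proj_preimage:
  assumes "orth_proj P" "openin (top_of_set (range P)) S"
  shows "open {y. P y \<in> S}"
proof -
  obtain T where T: "open T" "S = range P \<inter> T" using assms(2) by (auto simp: openin_open)
  have "linear P" using assms(1) unfolding orth_proj_def by blast
  then have "continuous_on UNIV P" unfolding linear_conv_bounded_linear by (rule linear_continuous_on)
  then have "open (P -` T)" by (rule open_vimage[OF T(1)])
  moreover have "P -` T = {y. P y \<in> S}" using T(2) by auto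
  ultimately show ?thesis by simp
qed

text \<open>Charts take values in relatively open subsets of a model subspace. Composing with the
  projection onto this subspace reduces smoothness on such a set to smoothness on an open set.\<close>

lemma smooth_on_proj:
  assumes P: "orth_proj P" and S: "openin (top_of_set (range P)) S"
  shows "smooth_on S f \<longleftrightarrow> Cinf {y. P y \<in> S} (\<lambda>y. f (P y))"
proof -
  have o: "open {y. P y \<in> S}" by (rule open_proj_preimage[OF P S])
  have lin: "linear P" and PP: "\<And>y. P (P y) = P y" using P unfolding orth_proj_def by blast+
  have PS: "P y = y" if yS: "y \<in> S" for y
  proof -
    obtain z where "y = P z" using subsetD[OF openin_imp_subset[OF S] yS] by (rule imageE)
    then show ?thesis using PP by simp
  qed
  show ?thesis
  proof
    assume f: "smooth_on S f"
    have "smooth_on {y. P y \<in> S} (\<lambda>y. f (P y))"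
    proof (rule smooth_on_compose[OF _ f])
      show "smooth_on {y. P y \<in> S} P" unfolding smooth_on_Cinf[OF o] by (rule Cinf_linear[OF lin o])
    qed blast
    then show "Cinf {y. P y \<in> S} (\<lambda>y. f (P y))" unfolding smooth_on_Cinf[OF o] .
  next
    assume f: "Cinf {y. P y \<in> S} (\<lambda>y. f (P y))"
    show "smooth_on S f"
    proof (rule smooth_onI)
      fix x assume "x \<in> S"
      then show "\<exists>U F. open U \<and> x \<in> U \<and> Cinf U F \<and> (\<forall>y\<in>S \<inter> U. F y = f y)"
        by (intro exI[of _ "{y. P y \<in> S}"] exI[of _ "\<lambda>y. f (P y)"]) (simp add: f o PS)
    qed
  qed
qed

section \<open>Local parametrisations, bump functions and tangent vectors\<close>

lemma orth_projD:
  assumes "orth_proj P"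
  shows "linear P" "\<And>y. P (P y) = P y" "\<And>x y. P x \<bullet> y = x \<bullet> P y"
  using assms unfolding orth_proj_def by blast+

lemma orth_proj_norm_le:
  assumes "orth_proj P"
  shows "norm (P y) \<le> norm y"
proof (cases "P y = 0")
  case False
  have "norm (P y) * norm (P y) = P y \<bullet> P y" by (simp add: power2_norm_eq_inner[symmetric] power2_eq_square)
  also have "\<dots> = P (P y) \<bullet> y" by (simp only: orth_projD(3)[OF assms, of "P y" y])
  also have "\<dots> = P y \<bullet> y" by (simp only: orth_projD(2)[OF assms])
  also have "\<dots> \<le> norm (P y) * norm y" by (rule norm_cauchy_schwarz)
  finally show ?thesis using False by simp
qed simp

lemma orth_proj_ball:
  assumes "orth_proj P" "P a = a" "y \<in> ball a r"
  shows "P y \<in> ball a r"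
proof -
  have "norm (P (y - a)) \<le> norm (y - a)" by (rule orth_proj_norm_le[OF assms(1)])
  then show ?thesis
    using assms(2,3) orth_projD(1)[OF assms(1)]
    by (simp add: linear_diff dist_norm norm_minus_commute)
qed

lemma orth_proj_continuous: "orth_proj P \<Longrightarrow> continuous_on S P"
  using orth_projD(1) unfolding linear_conv_bounded_linear by (rule linear_continuous_on)

text \<open>A parametrisation \<open>\<psi>\<close> is defined on an open set of the Euclidean space and factors through
  the projection \<open>P\<close> onto the model subspace, so that ordinary derivatives can be used. The
  compatibility with the atlas is expressed by smooth functions only; therefore it is preserved
  by every smooth change of coordinates.\<close>

definition local_param ::
  "('a::{second_countable_topology,t2_space}, 'e::euclidean_space) atlas \<Rightarrow> ('e \<Rightarrow> 'e) \<Rightarrow> 'e set \<Rightarrow>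
     ('e \<Rightarrow> 'a) \<Rightarrow> ('a \<Rightarrow> 'e) \<Rightarrow> bool" where
  "local_param A P S \<psi> \<phi> \<longleftrightarrow> orth_proj P \<and> open S \<and>
     (\<forall>y\<in>S. P y \<in> S \<and> \<psi> (P y) = \<psi> y \<and> \<phi> (\<psi> y) = P y) \<and>
     open (\<psi> ` S) \<and> continuous_on S \<psi> \<and> continuous_on (\<psi> ` S) \<phi> \<and>
     (\<forall>W f. open W \<and> smooth_fun_on A W f \<longrightarrow> Cinf (S \<inter> \<psi> -` W) (\<lambda>y. f (\<psi> y))) \<and>
     (\<forall>V f. open V \<and> V \<subseteq> S \<and> P ` V \<subseteq> V \<and> Cinf V (\<lambda>y. f (\<psi> y)) \<longrightarrow> smooth_fun_on A (\<psi> ` V) f)"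

lemma local_paramD:
  assumes "local_param A P S \<psi> \<phi>"
  shows "orth_proj P" "open S" "\<And>y. y \<in> S \<Longrightarrow> P y \<in> S" "\<And>y. y \<in> S \<Longrightarrow> \<psi> (P y) = \<psi> y"
    "\<And>y. y \<in> S \<Longrightarrow> \<phi> (\<psi> y) = P y" "open (\<psi> ` S)" "continuous_on S \<psi>" "continuous_on (\<psi> ` S) \<phi>"
    "\<And>W f. open W \<Longrightarrow> smooth_fun_on A W f \<Longrightarrow> Cinf (S \<inter> \<psi> -` W) (\<lambda>y. f (\<psi> y))"
    "\<And>V f. open V \<Longrightarrow> V \<subseteq> S \<Longrightarrow> P ` V \<subseteq> V \<Longrightarrow> Cinf V (\<lambda>y. f (\<psi> y)) \<Longrightarrow>
       smooth_fun_on A (\<psi> ` V) f"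
  using assms unfolding local_param_def by blast+

definition chart_domain :: "('e \<Rightarrow> 'e) \<Rightarrow> 'a set \<Rightarrow> ('a \<Rightarrow> 'e) \<Rightarrow> 'e set" where
  "chart_domain P U \<phi> = {y. P y \<in> \<phi> ` U}"

definition chart_param :: "('e \<Rightarrow> 'e) \<Rightarrow> 'a set \<Rightarrow> ('a \<Rightarrow> 'e) \<Rightarrow> 'e \<Rightarrow> 'a" where
  "chart_param P U \<phi> y = inv_into U \<phi> (P y)"

text \<open>The model subspace of an atlas is represented by the orthogonal projection onto it.\<close>

definition model_proj ::
  "('a::{second_countable_topology,t2_space}, 'e::euclidean_space) atlas \<Rightarrow> 'e \<Rightarrow> 'e" where
  "model_proj A = (SOME P. orth_proj P \<and> (\<forall>(U, \<phi>)\<in>A. open U \<and>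
      openin (top_of_set (range P)) (\<phi> ` U) \<and> homeomorphism U (\<phi> ` U) \<phi> (inv_into U \<phi>)))"

locale smooth_mfd =
  fixes A :: "('a::{second_countable_topology,t2_space}, 'e::euclidean_space) atlas"
  assumes manifold: "smooth_manifold A"
begin

lemma model_proj:
  "orth_proj (model_proj A)"
  "(U, \<phi>) \<in> A \<Longrightarrow> open U"
  "(U, \<phi>) \<in> A \<Longrightarrow> openin (top_of_set (range (model_proj A))) (\<phi> ` U)"
  "(U, \<phi>) \<in> A \<Longrightarrow> homeomorphism U (\<phi> ` U) \<phi> (inv_into U \<phi>)"
proof -
  obtain E where E: "subspace E" "\<forall>(U, \<phi>)\<in>A. open U \<and> openin (top_of_set E) (\<phi> ` U) \<and>
          homeomorphism U (\<phi> ` U) \<phi> (inv_into U \<phi>)"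
    using manifold unfolding smooth_manifold_def by blast
  obtain P where P: "orth_proj P" "range P = E" using orth_proj_exists[OF E(1)] .
  have "orth_proj (model_proj A) \<and> (\<forall>(U, \<phi>)\<in>A. open U \<and>
      openin (top_of_set (range (model_proj A))) (\<phi> ` U) \<and> homeomorphism U (\<phi> ` U) \<phi> (inv_into U \<phi>))"
    unfolding model_proj_def by (rule someI[of _ P]) (use P E(2) in auto)
  then show "orth_proj (model_proj A)"
    "(U, \<phi>) \<in> A \<Longrightarrow> open U"
    "(U, \<phi>) \<in> A \<Longrightarrow> openin (top_of_set (range (model_proj A))) (\<phi> ` U)"
    "(U, \<phi>) \<in> A \<Longrightarrow> homeomorphism U (\<phi> ` U) \<phi> (inv_into U \<phi>)"
    by auto
qed

lemma chart_inv: "(U, \<phi>) \<in> A \<Longrightarrow> x \<in> U \<Longrightarrow> inv_into U \<phi> (\<phi> x) = x"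
  using model_proj(4) unfolding homeomorphism_def by blast

lemma chart_proj: "(U, \<phi>) \<in> A \<Longrightarrow> x \<in> U \<Longrightarrow> model_proj A (\<phi> x) = \<phi> x"
proof -
  assume c: "(U, \<phi>) \<in> A" "x \<in> U"
  then have "\<phi> x \<in> range (model_proj A)" using openin_imp_subset[OF model_proj(3)[OF c(1)]] by blast
  then obtain z where "\<phi> x = model_proj A z" by (rule imageE)
  then show ?thesis using orth_projD(2)[OF model_proj(1)] by simp
qed

lemma chart_image_openin:
  assumes c: "(U, \<phi>) \<in> A" and W: "open W"
  shows "openin (top_of_set (range (model_proj A))) (\<phi> ` (U \<inter> W))"
proof -
  have "openin (top_of_set (\<phi> ` U)) (\<phi> ` (U \<inter> W))"
    by (rule homeomorphism_imp_open_map[OF model_proj(4)[OF c]]) (use W in \<open>auto simp: openin_open_Int\<close>)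
  then show ?thesis using model_proj(3)[OF c] openin_trans by blast
qed

lemma smooth_fun_on_charts:
  assumes W: "open W"
  shows "smooth_fun_on A W f \<longleftrightarrow> (\<forall>(U, \<phi>)\<in>A.
     Cinf (chart_domain (model_proj A) U \<phi> \<inter> chart_param (model_proj A) U \<phi> -` W)
       (\<lambda>y. f (chart_param (model_proj A) U \<phi> y)))"
proof -
  have "smooth_on (\<phi> ` (U \<inter> W)) (f \<circ> inv_into U \<phi>) \<longleftrightarrow>
     Cinf (chart_domain (model_proj A) U \<phi> \<inter> chart_param (model_proj A) U \<phi> -` W)
       (\<lambda>y. f (chart_param (model_proj A) U \<phi> y))" if c: "(U, \<phi>) \<in> A" for U \<phi>
  proof -
    have "{y. model_proj A y \<in> \<phi> ` (U \<inter> W)}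
        = chart_domain (model_proj A) U \<phi> \<inter> chart_param (model_proj A) U \<phi> -` W"
      unfolding chart_domain_def chart_param_def using chart_inv[OF c] by (auto simp: image_iff)
    then show ?thesis
      using smooth_on_proj[OF model_proj(1) chart_image_openin[OF c W], of "f \<circ> inv_into U \<phi>"]
      unfolding chart_param_def by simp
  qed
  then show ?thesis unfolding smooth_fun_on_def by fast
qed

text \<open>The inverse of a chart, composed with the projection onto the model subspace, is a
  parametrisation; smoothness of functions can be tested in this one chart because the transition
  maps are smooth.\<close>

lemma local_param_chart:
  assumes c: "(U, \<phi>) \<in> A"
  shows "local_param A (model_proj A) (chart_domain (model_proj A) U \<phi>) (chart_param (model_proj A) U \<phi>) \<phi>"
    and "chart_param (model_proj A) U \<phi> ` chart_domain (model_proj A) U \<phi> = U"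
proof -
  let ?P = "model_proj A"
  let ?S = "chart_domain ?P U \<phi>" and ?\<psi> = "chart_param ?P U \<phi>"
  note P = orth_projD[OF model_proj(1)]
  have hom: "homeomorphism U (\<phi> ` U) \<phi> (inv_into U \<phi>)" by (rule model_proj(4)[OF c])
  have S: "open ?S"
    unfolding chart_domain_def by (rule open_proj_preimage[OF model_proj(1) model_proj(3)[OF c]])
  have in_U: "?\<psi> y \<in> U" "\<phi> (?\<psi> y) = ?P y" if "y \<in> ?S" for y
    using that hom unfolding chart_domain_def chart_param_def by (auto simp: homeomorphism_def)
  have im: "?\<psi> ` ?S = U"
  proof
    show "U \<subseteq> ?\<psi> ` ?S"
    proof
      fix x assume x: "x \<in> U"
      have "?\<psi> (\<phi> x) = x" "\<phi> x \<in> ?S"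
        using chart_inv[OF c x] chart_proj[OF c x] x by (simp_all add: chart_param_def chart_domain_def)
      then show "x \<in> ?\<psi> ` ?S" by (metis imageI)
    qed
  qed (use in_U in blast)
  have cont: "continuous_on ?S ?\<psi>"
    unfolding chart_param_def
    by (rule continuous_on_compose2[OF _ orth_proj_continuous[OF model_proj(1)]])
      (use hom in \<open>auto simp: homeomorphism_def chart_domain_def\<close>)
  have smooth_back: "smooth_fun_on A (?\<psi> ` V) f"
    if V: "open V" "V \<subseteq> ?S" "?P ` V \<subseteq> V" and f: "Cinf V (\<lambda>y. f (?\<psi> y))" for V f
    unfolding smooth_fun_on_def
  proof (clarify)
    fix U' \<kappa> assume c': "(U', \<kappa>) \<in> A"
    let ?T = "\<kappa> ` (U' \<inter> ?\<psi> ` V)"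
    have TU: "?\<psi> ` V \<subseteq> U" using V(2) im by blast
    have "smooth_on (\<kappa> ` (U' \<inter> U)) (\<phi> \<circ> inv_into U' \<kappa>)"
      using manifold c c' unfolding smooth_manifold_def by blast
    then have tr: "smooth_on ?T (\<phi> \<circ> inv_into U' \<kappa>)"
      by (rule smooth_on_subset) (use TU in blast)
    have fV: "smooth_on V (\<lambda>y. f (?\<psi> y))" using smooth_on_Cinf[OF V(1)] f by blast
    have mem: "\<phi> (inv_into U' \<kappa> z) \<in> V \<and> ?\<psi> (\<phi> (inv_into U' \<kappa> z)) = inv_into U' \<kappa> z" if zT: "z \<in> ?T" for z
    proof -
      obtain x where x: "z = \<kappa> x" "x \<in> U'" "x \<in> ?\<psi> ` V" using zT by blast
      obtain y where y: "y \<in> V" "x = ?\<psi> y" using x(3) by blast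
      have "\<phi> x = ?P y" using in_U(2) y V(2) by blast
      moreover have "?\<psi> (?P y) = ?\<psi> y" unfolding chart_param_def P(2) ..
      ultimately show ?thesis using x y V(3) chart_inv[OF c' x(2)] by auto
    qed
    have "smooth_on ?T (\<lambda>z. f (?\<psi> ((\<phi> \<circ> inv_into U' \<kappa>) z)))"
      by (rule smooth_on_compose[OF tr fV]) (use mem in auto)
    then show "smooth_on ?T (f \<circ> inv_into U' \<kappa>)"
      by (rule smooth_on_cong[rotated]) (use mem in auto)
  qed
  have smooth_forth: "Cinf (?S \<inter> ?\<psi> -` W) (\<lambda>y. f (?\<psi> y))" if "open W" "smooth_fun_on A W f" for W f
    using smooth_fun_on_charts[OF that(1), of f] that(2) c by blast
  have sat: "?P y \<in> ?S \<and> ?\<psi> (?P y) = ?\<psi> y \<and> \<phi> (?\<psi> y) = ?P y" if "y \<in> ?S" for y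
    using in_U[OF that] that by (simp add: chart_domain_def chart_param_def P(2))
  show "local_param A ?P ?S ?\<psi> \<phi>"
    unfolding local_param_def im
    using model_proj(1) S sat model_proj(2)[OF c] cont smooth_forth smooth_back hom
    by (auto simp: homeomorphism_def)
  show "?\<psi> ` ?S = U" by (rule im)
qed

lemma chart_at: obtains U \<phi> where "(U, \<phi>) \<in> A" "x \<in> U"
proof -
  have "x \<in> (\<Union>(U, \<phi>)\<in>A. U)" using manifold unfolding smooth_manifold_def by blast
  then show thesis using that by blast
qed

lemma smooth_fun_on_cong:
  assumes W: "open W" and eq: "\<And>x. x \<in> W \<Longrightarrow> f x = g x" and f: "smooth_fun_on A W f"
  shows "smooth_fun_on A W g"
  unfolding smooth_fun_on_def
proof (clarify)
  fix U \<phi> assume c: "(U, \<phi>) \<in> A"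
  then have "smooth_on (\<phi> ` (U \<inter> W)) (f \<circ> inv_into U \<phi>)"
    using f unfolding smooth_fun_on_def by blast
  then show "smooth_on (\<phi> ` (U \<inter> W)) (g \<circ> inv_into U \<phi>)"
    by (rule smooth_on_cong[rotated]) (use chart_inv[OF c] eq in auto)
qed

lemma smooth_fun_on_subset:
  assumes "smooth_fun_on A W f" "W' \<subseteq> W"
  shows "smooth_fun_on A W' f"
  unfolding smooth_fun_on_def
proof (clarify)
  fix U \<phi> assume c: "(U, \<phi>) \<in> A"
  then have "smooth_on (\<phi> ` (U \<inter> W)) (f \<circ> inv_into U \<phi>)"
    using assms(1) unfolding smooth_fun_on_def by blast
  then show "smooth_on (\<phi> ` (U \<inter> W')) (f \<circ> inv_into U \<phi>)"
    by (rule smooth_on_subset) (use assms(2) in blast)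
qed

lemma smooth_fun_on_local:
  assumes "\<And>x. x \<in> W \<Longrightarrow> \<exists>W'. open W' \<and> x \<in> W' \<and> smooth_fun_on A W' f"
  shows "smooth_fun_on A W f"
  unfolding smooth_fun_on_def
proof (clarify)
  fix U \<phi> assume c: "(U, \<phi>) \<in> A"
  show "smooth_on (\<phi> ` (U \<inter> W)) (f \<circ> inv_into U \<phi>)"
  proof (rule smooth_on_local)
    fix z assume "z \<in> \<phi> ` (U \<inter> W)"
    then obtain x where x: "x \<in> U" "x \<in> W" "z = \<phi> x" by blast
    obtain W' where W': "open W'" "x \<in> W'" "smooth_fun_on A W' f" using assms[OF x(2)] by blast
    obtain T where T: "open T" "\<phi> ` (U \<inter> W') = range (model_proj A) \<inter> T"
      using chart_image_openin[OF c W'(1)] by (auto simp: openin_open)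
    have "smooth_on (\<phi> ` (U \<inter> W')) (f \<circ> inv_into U \<phi>)"
      using W'(3) c unfolding smooth_fun_on_def by blast
    moreover have "\<phi> ` (U \<inter> W) \<inter> T \<subseteq> \<phi> ` (U \<inter> W')"
      unfolding T(2) using openin_imp_subset[OF model_proj(3)[OF c]] by blast
    ultimately have "smooth_on (\<phi> ` (U \<inter> W) \<inter> T) (f \<circ> inv_into U \<phi>)" by (rule smooth_on_subset)
    moreover have "z \<in> T" using T(2) x W'(2) by blast
    ultimately show "\<exists>T. open T \<and> z \<in> T \<and> smooth_on (\<phi> ` (U \<inter> W) \<inter> T) (f \<circ> inv_into U \<phi>)"
      using T(1) by blast
  qed
qed

lemma chart_set_open:
  assumes "(U, \<phi>) \<in> A" "open W"
  shows "open (chart_domain (model_proj A) U \<phi> \<inter> chart_param (model_proj A) U \<phi> -` W)"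
  using local_param_chart(1)[OF assms(1)] assms(2) unfolding local_param_def
  by (auto intro: continuous_open_preimage)

lemma smooth_fun_on_const: "open W \<Longrightarrow> smooth_fun_on A W (\<lambda>x. c)"
  by (auto simp: smooth_fun_on_charts intro!: Cinf_const chart_set_open)

lemma smooth_fun_on_add:
  "open W \<Longrightarrow> smooth_fun_on A W f \<Longrightarrow> smooth_fun_on A W g \<Longrightarrow> smooth_fun_on A W (\<lambda>x. f x + g x)"
  by (auto simp: smooth_fun_on_charts intro!: Cinf_add chart_set_open)

lemma smooth_fun_on_mult:
  "open W \<Longrightarrow> smooth_fun_on A W f \<Longrightarrow> smooth_fun_on A W g \<Longrightarrow> smooth_fun_on A W (\<lambda>x. f x * g x)"
  by (auto simp: smooth_fun_on_charts intro!: Cinf_mult chart_set_open)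

lemma smooth_fun_on_diff:
  "open W \<Longrightarrow> smooth_fun_on A W f \<Longrightarrow> smooth_fun_on A W g \<Longrightarrow> smooth_fun_on A W (\<lambda>x. f x - g x)"
  by (auto simp: smooth_fun_on_charts intro!: Cinf_diff chart_set_open)

lemma smooth_fun_on_sum:
  "open W \<Longrightarrow> (\<And>i. i \<in> I \<Longrightarrow> smooth_fun_on A W (f i)) \<Longrightarrow> smooth_fun_on A W (\<lambda>x. \<Sum>i\<in>I. f i x)"
  by (induction I rule: infinite_finite_induct) (auto intro: smooth_fun_on_const smooth_fun_on_add)

lemma smooth_fun_on_continuous:
  assumes W: "open W" and f: "smooth_fun_on A W f"
  shows "continuous_on W f"
proof (rule continuous_at_imp_continuous_on, rule ballI)
  fix x assume x: "x \<in> W"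
  obtain U \<phi> where c: "(U, \<phi>) \<in> A" "x \<in> U" by (rule chart_at)
  let ?S = "chart_domain (model_proj A) U \<phi>" and ?\<psi> = "chart_param (model_proj A) U \<phi>"
  note lp = local_paramD[OF local_param_chart(1)[OF c(1)]]
  have "continuous_on (?S \<inter> ?\<psi> -` W) (\<lambda>y. f (?\<psi> y))"
    by (rule Cinf_continuous_on[OF lp(9)[OF W f]])
  moreover have "continuous_on (U \<inter> W) \<phi>"
    using lp(8) unfolding local_param_chart(2)[OF c(1)] by (rule continuous_on_subset) blast
  moreover have inv: "?\<psi> (\<phi> u) = u" "\<phi> u \<in> ?S" if "u \<in> U" for u
    using chart_inv[OF c(1) that] chart_proj[OF c(1) that] that by (simp_all add: chart_param_def chart_domain_def)
  have "\<phi> ` (U \<inter> W) \<subseteq> ?S \<inter> ?\<psi> -` W"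
  proof (rule image_subsetI)
    fix u assume "u \<in> U \<inter> W"
    then show "\<phi> u \<in> ?S \<inter> ?\<psi> -` W" using inv[of u] by simp
  qed
  ultimately have "continuous_on (U \<inter> W) (\<lambda>u. f (?\<psi> (\<phi> u)))"
    by (rule continuous_on_compose2)
  then have "continuous_on (U \<inter> W) f"
    by (rule continuous_on_eq) (use inv in auto)
  then show "isCont f x"
    using model_proj(2)[OF c(1)] W c(2) x by (simp add: continuous_on_eq_continuous_at open_Int)
qed

lemma smooth_funsD: "f \<in> smooth_funs A \<Longrightarrow> smooth_fun_on A W f"
  unfolding smooth_funs_def using smooth_fun_on_subset[of UNIV f W] by simp

lemma smooth_funs_const: "(\<lambda>x. c) \<in> smooth_funs A"
  by (simp add: smooth_funs_def smooth_fun_on_const)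

lemma smooth_funs_add: "f \<in> smooth_funs A \<Longrightarrow> g \<in> smooth_funs A \<Longrightarrow> (\<lambda>x. f x + g x) \<in> smooth_funs A"
  by (simp add: smooth_funs_def smooth_fun_on_add)

lemma smooth_funs_mult: "f \<in> smooth_funs A \<Longrightarrow> g \<in> smooth_funs A \<Longrightarrow> (\<lambda>x. f x * g x) \<in> smooth_funs A"
  by (simp add: smooth_funs_def smooth_fun_on_mult)

lemma smooth_funs_diff: "f \<in> smooth_funs A \<Longrightarrow> g \<in> smooth_funs A \<Longrightarrow> (\<lambda>x. f x - g x) \<in> smooth_funs A"
  by (simp add: smooth_funs_def smooth_fun_on_diff)

lemma smooth_funs_sum: "(\<And>i. i \<in> I \<Longrightarrow> f i \<in> smooth_funs A) \<Longrightarrow> (\<lambda>x. \<Sum>i\<in>I. f i x) \<in> smooth_funs A"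
  by (simp add: smooth_funs_def smooth_fun_on_sum)

lemma smooth_funs_glue:
  assumes "open W" "smooth_fun_on A W f" "closed C" "C \<subseteq> W" "\<And>x. x \<notin> C \<Longrightarrow> f x = 0"
  shows "f \<in> smooth_funs A"
proof -
  have "smooth_fun_on A (- C) f"
    by (rule smooth_fun_on_cong[OF _ _ smooth_fun_on_const[of _ 0]]) (use assms(3,5) in auto)
  then have "smooth_fun_on A UNIV f"
    using assms(1-4) by (intro smooth_fun_on_local) blast
  then show ?thesis by (simp add: smooth_funs_def)
qed

lemma smooth_funs_bump_mult:
  assumes W: "open W" and f: "smooth_fun_on A W f"
    and \<kappa>: "\<kappa> \<in> smooth_funs A" and C: "compact C" "C \<subseteq> W" "\<And>x. x \<notin> C \<Longrightarrow> \<kappa> x = 0"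
  shows "(\<lambda>x. \<kappa> x * f x) \<in> smooth_funs A"
  by (rule smooth_funs_glue[OF W _ compact_imp_closed[OF C(1)] C(2)])
    (use smooth_fun_on_mult[OF W smooth_funsD[OF \<kappa>] f] C(3) in auto)

lemma smooth_funs_c_I:
  assumes \<kappa>: "\<kappa> \<in> smooth_funs A" and C: "compact C" "C \<subseteq> W" "\<And>x. x \<notin> C \<Longrightarrow> \<kappa> x = 0"
  shows "\<kappa> \<in> smooth_funs_c A W"
proof -
  have "closure {p. \<kappa> p \<noteq> 0} \<subseteq> C"
    by (rule closure_minimal) (use C compact_imp_closed in auto)
  moreover from this have "closure {p. \<kappa> p \<noteq> 0} = C \<inter> closure {p. \<kappa> p \<noteq> 0}" by blast
  then have "compact (closure {p. \<kappa> p \<noteq> 0})"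
    using compact_Int_closed[OF C(1) closed_closure] by metis
  ultimately show ?thesis using \<kappa> C(2) unfolding smooth_funs_c_def by blast
qed

text \<open>A bump function in a chart is extended by zero. The extension is smooth because its support in
  the chart is compact and therefore closed in the manifold.\<close>

lemma bump_function:
  assumes W: "open W" and p: "p \<in> W"
  obtains \<kappa> N C where "\<kappa> \<in> smooth_funs A" "open N" "p \<in> N" "\<And>x. x \<in> N \<Longrightarrow> \<kappa> x = 1" "N \<subseteq> C"
    "compact C" "C \<subseteq> W" "\<And>x. x \<notin> C \<Longrightarrow> \<kappa> x = 0"
proof -
  obtain U \<phi> where c: "(U, \<phi>) \<in> A" "p \<in> U" by (rule chart_at)
  let ?P = "model_proj A"
  let ?S = "chart_domain ?P U \<phi>" and ?\<psi> = "chart_param ?P U \<phi>"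
  have lp: "local_param A ?P ?S ?\<psi> \<phi>" and im: "?\<psi> ` ?S = U"
    using local_param_chart[OF c(1)] by auto
  note lpu = local_paramD[OF lp]
  define a where "a = \<phi> p"
  have a: "?P a = a" "?\<psi> a = p" "a \<in> ?S"
    using chart_inv[OF c] chart_proj[OF c] c(2) by (simp_all add: a_def chart_param_def chart_domain_def)
  have "open (?S \<inter> ?\<psi> -` W)" by (rule chart_set_open[OF c(1) W])
  then obtain R where R: "R > 0" "ball a R \<subseteq> ?S \<inter> ?\<psi> -` W"
    using a p by (metis IntI open_contains_ball vimageI)
  obtain \<beta> where \<beta>: "Cinf UNIV \<beta>" "\<And>y. norm (y - a) \<le> R/3 \<Longrightarrow> \<beta> y = (1::real)"
    "\<And>y. R/2 \<le> norm (y - a) \<Longrightarrow> \<beta> y = 0"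
    using smooth_bump_exists[of "R/3" "R/2" a] R(1) by auto
  have RS: "ball a R \<subseteq> ?S" using R(2) by blast
  have Pball: "?P ` ball a r \<subseteq> ball a r" for r
    using orth_proj_ball[OF model_proj(1) a(1)] by blast
  have open_im: "open (?\<psi> ` ball a r)" if "r \<le> R" for r
  proof -
    have sub: "ball a r \<subseteq> ?S" using RS that by auto
    have "?\<psi> ` ball a r = (?\<psi> ` ?S) \<inter> \<phi> -` ball a r"
    proof (intro equalityI subsetI)
      fix x assume "x \<in> ?\<psi> ` ball a r"
      then obtain y where y: "y \<in> ball a r" "x = ?\<psi> y" by blast
      then have "y \<in> ?S" using sub by blast
      then have "\<phi> x = ?P y" using lpu(5) y(2) by simp
      moreover have "?P y \<in> ball a r" using Pball[of r] y(1) by blast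
      ultimately show "x \<in> (?\<psi> ` ?S) \<inter> \<phi> -` ball a r" using y(2) \<open>y \<in> ?S\<close> by simp
    next
      fix x assume x: "x \<in> (?\<psi> ` ?S) \<inter> \<phi> -` ball a r"
      then obtain y where y: "y \<in> ?S" "x = ?\<psi> y" by blast
      then have "x = ?\<psi> (\<phi> x)" using lpu(4,5) by simp
      then show "x \<in> ?\<psi> ` ball a r" using x by blast
    qed
    then show ?thesis using continuous_open_preimage[OF lpu(8,6) open_ball] by simp
  qed
  define C where "C = ?\<psi> ` cball a (R/2)"
  have cb: "cball a (R/2) \<subseteq> ball a R" using R(1) by auto
  have C: "compact C" "C \<subseteq> W"
  proof -
    show "compact C" unfolding C_def
      by (rule compact_continuous_image[OF continuous_on_subset[OF lpu(7)]]) (use cb RS in auto)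
    show "C \<subseteq> W" unfolding C_def using cb R(2) by blast
  qed
  define \<kappa> where "\<kappa> q = (if q \<in> ?\<psi> ` ball a R then \<beta> (\<phi> q) else 0)" for q
  have \<kappa>\<psi>: "\<kappa> (?\<psi> y) = \<beta> (?P y)" if "y \<in> ball a R" for y
    using that subsetD[OF RS that] lpu(5) unfolding \<kappa>_def by simp
  have out: "\<kappa> q = 0" if "q \<notin> C" for q
  proof (cases "q \<in> ?\<psi> ` ball a R")
    case True
    then obtain y where y: "y \<in> ball a R" "q = ?\<psi> y" by blast
    have "q = ?\<psi> (?P y)" using lpu(4)[OF subsetD[OF RS y(1)]] y(2) by simp
    then have "?P y \<notin> cball a (R/2)" using that C_def by blast
    then have "R/2 \<le> norm (?P y - a)" by (simp add: dist_norm norm_minus_commute)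
    then show ?thesis using \<kappa>\<psi>[OF y(1)] \<beta>(3) y(2) by simp
  qed (simp add: \<kappa>_def)
  have "smooth_fun_on A (?\<psi> ` ball a R) \<kappa>"
  proof -
    have "Cinf (ball a R) (\<lambda>y. \<beta> (?P y))"
      by (rule Cinf_compose[OF open_ball open_UNIV _ Cinf_linear[OF orth_projD(1)[OF model_proj(1)] open_ball] \<beta>(1)]) simp
    then have "Cinf (ball a R) (\<lambda>y. \<kappa> (?\<psi> y))"
      by (rule Cinf_cong[OF open_ball, rotated]) (simp add: \<kappa>\<psi>)
    from lpu(10)[OF open_ball RS Pball this] show ?thesis .
  qed
  then have sm: "\<kappa> \<in> smooth_funs A"
    by (rule smooth_funs_glue[OF open_im[OF order_refl] _ compact_imp_closed[OF C(1)] _ out])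
      (use C_def cb in blast)
  have one: "\<kappa> x = 1" if xb: "x \<in> ?\<psi> ` ball a (R/3)" for x
  proof -
    obtain y where y: "y \<in> ball a (R/3)" "x = ?\<psi> y" using xb by blast
    have "?P y \<in> ball a (R/3)" using Pball[of "R/3"] y(1) by blast
    then have "norm (?P y - a) \<le> R/3" by (simp add: dist_norm norm_minus_commute)
    moreover have "y \<in> ball a R" using y(1) R(1) by auto
    ultimately show ?thesis using \<kappa>\<psi> \<beta>(2) y(2) by simp
  qed
  have "p \<in> ?\<psi> ` ball a (R/3)" using a(2) R(1) by (metis centre_in_ball imageI zero_less_divide_iff zero_less_numeral)
  moreover have "?\<psi> ` ball a (R/3) \<subseteq> C" unfolding C_def using R(1) by (intro image_mono) auto
  ultimately show thesis
    using that[OF sm open_im[of "R/3"] _ one _ C out] R(1) by auto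
qed

subsection \<open>Tangent vectors\<close>

lemma tangent_spaceD:
  assumes "v \<in> tangent_space A p"
  shows "f \<in> smooth_funs A \<Longrightarrow> g \<in> smooth_funs A \<Longrightarrow> v (\<lambda>x. f x + g x) = v f + v g"
    and "f \<in> smooth_funs A \<Longrightarrow> v (\<lambda>x. c * f x) = c * v f"
    and "f \<in> smooth_funs A \<Longrightarrow> g \<in> smooth_funs A \<Longrightarrow> v (\<lambda>x. f x * g x) = v f * g p + f p * v g"
    and "f \<notin> smooth_funs A \<Longrightarrow> v f = 0"
  using assms unfolding tangent_space_def by auto

lemma tangent_zero: "(\<lambda>f. 0) \<in> tangent_space A p"
  by (simp add: tangent_space_def)

lemma tangent_lincomb:
  assumes "u \<in> tangent_space A p" "v \<in> tangent_space A p"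
  shows "(\<lambda>f. c * u f + d * v f) \<in> tangent_space A p"
  using tangent_spaceD[OF assms(1)] tangent_spaceD[OF assms(2)]
  unfolding tangent_space_def by (simp add: algebra_simps)

lemma tangent_scale: "u \<in> tangent_space A p \<Longrightarrow> (\<lambda>f. c * u f) \<in> tangent_space A p"
  using tangent_lincomb[of u p u c 0] by simp

lemma tangent_add:
  "u \<in> tangent_space A p \<Longrightarrow> v \<in> tangent_space A p \<Longrightarrow> (\<lambda>f. u f + v f) \<in> tangent_space A p"
  using tangent_lincomb[of u p v 1 1] by simp

lemma tangent_sum:
  "(\<And>i. i \<in> I \<Longrightarrow> u i \<in> tangent_space A p) \<Longrightarrow> (\<lambda>f. \<Sum>i\<in>I. u i f) \<in> tangent_space A p"
  by (induction I rule: infinite_finite_induct) (auto intro: tangent_zero tangent_add)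

lemma derivation_const:
  assumes "v \<in> tangent_space A p"
  shows "v (\<lambda>x. c) = 0"
proof -
  have "v (\<lambda>x. 1 * 1) = v (\<lambda>x. 1) * 1 + 1 * v (\<lambda>x. 1)"
    by (rule tangent_spaceD(3)[OF assms]) (rule smooth_funs_const)+
  then have "v (\<lambda>x. 1) = 0" by simp
  then show ?thesis using tangent_spaceD(2)[OF assms smooth_funs_const[of 1], of c] by simp
qed

lemma derivation_diff:
  assumes "v \<in> tangent_space A p" "f \<in> smooth_funs A" "g \<in> smooth_funs A"
  shows "v (\<lambda>x. f x - g x) = v f - v g"
proof -
  have "v (\<lambda>x. f x + (-1) * g x) = v f + v (\<lambda>x. (-1) * g x)"
    by (rule tangent_spaceD(1)[OF assms(1,2)]) (rule smooth_funs_mult[OF smooth_funs_const assms(3)])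
  then show ?thesis using tangent_spaceD(2)[OF assms(1,3), of "-1"] by simp
qed

lemma derivation_sum:
  assumes "v \<in> tangent_space A p" "\<And>i. i \<in> I \<Longrightarrow> f i \<in> smooth_funs A"
  shows "v (\<lambda>x. \<Sum>i\<in>I. f i x) = (\<Sum>i\<in>I. v (f i))"
  using assms(2)
proof (induction I rule: infinite_finite_induct)
  case (insert i I)
  then show ?case using tangent_spaceD(1)[OF assms(1), of "f i" "\<lambda>x. \<Sum>i\<in>I. f i x"]
    by (simp add: smooth_funs_sum)
qed (auto simp: derivation_const[OF assms(1)])

text \<open>The difference of \<open>f\<close> and \<open>g\<close> times a bump function vanishes identically; the product rule
  then compares the derivatives.\<close>

lemma derivation_local:
  assumes v: "v \<in> tangent_space A p" and f: "f \<in> smooth_funs A" and g: "g \<in> smooth_funs A"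
    and N: "open N" "p \<in> N" and eq: "\<And>x. x \<in> N \<Longrightarrow> f x = g x"
  shows "v f = v g"
proof -
  obtain \<kappa> N' C where \<kappa>: "\<kappa> \<in> smooth_funs A" "p \<in> N'" "\<And>x. x \<in> N' \<Longrightarrow> \<kappa> x = 1"
    "C \<subseteq> N" "\<And>x. x \<notin> C \<Longrightarrow> \<kappa> x = 0"
    by (rule bump_function[OF N]) (rule that; assumption)
  have "\<kappa> x * (f x - g x) = 0" for x using eq \<kappa>(4,5) by (cases "x \<in> C") auto
  then have "v (\<lambda>x. \<kappa> x * (f x - g x)) = 0" by (simp only: derivation_const[OF v])
  moreover have "v (\<lambda>x. \<kappa> x * (f x - g x)) = v \<kappa> * (f p - g p) + \<kappa> p * v (\<lambda>x. f x - g x)"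
    by (rule tangent_spaceD(3)[OF v \<kappa>(1) smooth_funs_diff[OF f g]])
  ultimately show ?thesis using derivation_diff[OF v f g] eq[OF N(2)] \<kappa>(3)[OF \<kappa>(2)] by simp
qed

end

locale mfd_param = smooth_mfd A
  for A :: "('a::{second_countable_topology,t2_space}, 'e::euclidean_space) atlas" +
  fixes P :: "'e \<Rightarrow> 'e" and S :: "'e set" and \<psi> :: "'e \<Rightarrow> 'a" and \<phi> :: "'a \<Rightarrow> 'e"
  assumes param: "local_param A P S \<psi> \<phi>"
begin

lemma P_proj: "orth_proj P" and S_open: "open S" and im_open: "open (\<psi> ` S)"
  and \<psi>_cont: "continuous_on S \<psi>" and \<phi>_cont: "continuous_on (\<psi> ` S) \<phi>"
  using param unfolding local_param_def by blast+

lemma P_lin: "linear P" and PP[simp]: "P (P y) = P y" and P_sym: "P x \<bullet> y = x \<bullet> P y"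
  using orth_projD[OF P_proj] by blast+

lemma P_in: "y \<in> S \<Longrightarrow> P y \<in> S" and \<psi>P: "y \<in> S \<Longrightarrow> \<psi> (P y) = \<psi> y" and \<phi>\<psi>: "y \<in> S \<Longrightarrow> \<phi> (\<psi> y) = P y"
  using param unfolding local_param_def by blast+

lemma smooth_pull: "open W \<Longrightarrow> smooth_fun_on A W f \<Longrightarrow> Cinf (S \<inter> \<psi> -` W) (\<lambda>y. f (\<psi> y))"
  using param unfolding local_param_def by blast

lemma smooth_push:
  "open V \<Longrightarrow> V \<subseteq> S \<Longrightarrow> (\<And>y. y \<in> V \<Longrightarrow> P y \<in> V) \<Longrightarrow> Cinf V (\<lambda>y. f (\<psi> y)) \<Longrightarrow> smooth_fun_on A (\<psi> ` V) f"
  using param unfolding local_param_def by blast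

lemma preimage_open: "open W \<Longrightarrow> open (S \<inter> \<psi> -` W)"
  by (rule continuous_open_preimage[OF \<psi>_cont S_open])

lemma \<phi>_mem: "q \<in> \<psi> ` S \<Longrightarrow> \<phi> q \<in> S" and \<psi>\<phi>: "q \<in> \<psi> ` S \<Longrightarrow> \<psi> (\<phi> q) = q"
  and P\<phi>: "q \<in> \<psi> ` S \<Longrightarrow> P (\<phi> q) = \<phi> q"
  using P_in \<psi>P \<phi>\<psi> by auto

lemma image_open:
  assumes V: "open V" "V \<subseteq> S" "\<And>y. y \<in> V \<Longrightarrow> P y \<in> V"
  shows "open (\<psi> ` V)"
proof -
  have "\<psi> ` V = (\<psi> ` S) \<inter> \<phi> -` V"
  proof (intro equalityI subsetI)
    fix x assume "x \<in> \<psi> ` V"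
    then obtain y where "y \<in> V" "x = \<psi> y" by blast
    then show "x \<in> (\<psi> ` S) \<inter> \<phi> -` V" using V \<phi>\<psi> by auto
  next
    fix x assume "x \<in> (\<psi> ` S) \<inter> \<phi> -` V"
    then show "x \<in> \<psi> ` V" using \<psi>\<phi>[of x] by (metis Int_iff imageI vimageE)
  qed
  then show ?thesis using continuous_open_preimage[OF \<phi>_cont im_open V(1)] by simp
qed

lemma smooth_funs_pull: "f \<in> smooth_funs A \<Longrightarrow> Cinf S (\<lambda>y. f (\<psi> y))"
  using smooth_pull[OF open_UNIV smooth_funsD[of f UNIV]] by simp

lemma smooth_push_compose:
  assumes "Cinf S (f::'e \<Rightarrow> real)"
  shows "smooth_fun_on A (\<psi> ` S) (\<lambda>q. f (\<phi> q))"
proof (rule smooth_push[OF S_open order_refl P_in])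
  have "Cinf S (\<lambda>y. f (P y))"
    by (rule Cinf_compose[OF S_open S_open _ Cinf_linear[OF P_lin S_open] assms]) (use P_in in auto)
  then show "Cinf S (\<lambda>y. f (\<phi> (\<psi> y)))"
    by (rule Cinf_cong[OF S_open, rotated]) (simp add: \<phi>\<psi>)
qed

text \<open>The tangent vector with coordinates \<open>v\<close> at the point with coordinates \<open>y\<close>.\<close>

definition tv :: "'e \<Rightarrow> 'e \<Rightarrow> 'a tangent_vec" where
  "tv y v = (\<lambda>f. if f \<in> smooth_funs A then frechet_derivative (\<lambda>z. f (\<psi> z)) (at y) v else 0)"

lemma tv_apply: "f \<in> smooth_funs A \<Longrightarrow> tv y v f = frechet_derivative (\<lambda>z. f (\<psi> z)) (at y) v"
  by (simp add: tv_def)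

lemma pull_derivative:
  "f \<in> smooth_funs A \<Longrightarrow> y \<in> S \<Longrightarrow> ((\<lambda>z. f (\<psi> z)) has_derivative frechet_derivative (\<lambda>z. f (\<psi> z)) (at y)) (at y)"
  by (rule Cinf_has_derivative[OF smooth_funs_pull])

lemma tv_lincomb:
  assumes "y \<in> S"
  shows "tv y (c *\<^sub>R v + d *\<^sub>R w) = (\<lambda>f. c * tv y v f + d * tv y w f)"
  using Cinf_linear_frechet[OF smooth_funs_pull assms]
  by (auto simp: tv_def fun_eq_iff linear_add linear_cmul)

lemma tv_linear: "y \<in> S \<Longrightarrow> linear (\<lambda>v. tv y v f)"
  using Cinf_linear_frechet[OF smooth_funs_pull, of f y]
  by (cases "f \<in> smooth_funs A") (simp_all add: tv_def linear_zero)

lemma tv_tangent: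
  assumes y: "y \<in> S"
  shows "tv y v \<in> tangent_space A (\<psi> y)"
  unfolding tangent_space_def
proof (intro CollectI conjI ballI allI impI)
  fix f g assume f: "f \<in> smooth_funs A" and g: "g \<in> smooth_funs A"
  note df = pull_derivative[OF f y] and dg = pull_derivative[OF g y]
  show "tv y v (\<lambda>x. f x + g x) = tv y v f + tv y v g"
    unfolding tv_apply[OF f] tv_apply[OF g] tv_apply[OF smooth_funs_add[OF f g]]
    using frechet_derivative_at[OF has_derivative_add[OF df dg]] by metis
  show "tv y v (\<lambda>x. f x * g x) = tv y v f * g (\<psi> y) + f (\<psi> y) * tv y v g"
    unfolding tv_apply[OF f] tv_apply[OF g] tv_apply[OF smooth_funs_mult[OF f g]]
    by (subst frechet_derivative_at[OF has_derivative_mult[OF df dg], symmetric]) (simp add: algebra_simps)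
next
  fix f c assume f: "f \<in> smooth_funs A"
  note df = pull_derivative[OF f y]
  show "tv y v (\<lambda>x. c * f x) = c * tv y v f"
    unfolding tv_apply[OF f] tv_apply[OF smooth_funs_mult[OF smooth_funs_const f]]
    by (subst frechet_derivative_at[OF has_derivative_mult_right[OF df], symmetric]) simp
qed (simp add: tv_def)

text \<open>The parametrisation is constant along the fibres of \<open>P\<close>, so a coordinate vector and its
  projection represent the same tangent vector.\<close>

lemma tv_proj:
  assumes y: "y \<in> S"
  shows "tv (P y) (P v) = tv y v"
proof (rule ext)
  fix f
  show "tv (P y) (P v) f = tv y v f"
  proof (cases "f \<in> smooth_funs A")
    case f: True
    have "((\<lambda>z. f (\<psi> (P z))) has_derivative
       (\<lambda>h. frechet_derivative (\<lambda>z. f (\<psi> z)) (at (P y)) (P h))) (at y)"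
      by (rule has_derivative_compose[OF linear_imp_has_derivative[OF P_lin] pull_derivative[OF f P_in[OF y]]])
    then have "((\<lambda>z. f (\<psi> z)) has_derivative
       (\<lambda>h. frechet_derivative (\<lambda>z. f (\<psi> z)) (at (P y)) (P h))) (at y)"
      by (rule has_derivative_transform_within_open[OF _ S_open y]) (simp add: \<psi>P)
    from frechet_derivative_at[OF this, symmetric] show ?thesis by (simp add: tv_apply[OF f])
  qed (simp add: tv_def)
qed

lemma tv_P: "y \<in> S \<Longrightarrow> tv y (P v) = tv y v"
  using tv_proj[of y v] tv_proj[of y "P v"] by simp

text \<open>Derivations act on globally defined functions, so the coordinates are cut off by a bump
  function.\<close>

lemma coordinate_functions:
  assumes y: "y \<in> S"
  obtains x N where "\<And>b. x b \<in> smooth_funs A" "open N" "\<psi> y \<in> N" "N \<subseteq> \<psi> ` S"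
    "\<And>b q. q \<in> N \<Longrightarrow> x b q = \<phi> q \<bullet> b"
proof -
  obtain \<kappa> N C where \<kappa>: "\<kappa> \<in> smooth_funs A" "open N" "\<psi> y \<in> N" "\<And>x. x \<in> N \<Longrightarrow> \<kappa> x = 1" "N \<subseteq> C"
    "compact C" "C \<subseteq> \<psi> ` S" "\<And>x. x \<notin> C \<Longrightarrow> \<kappa> x = 0"
    by (rule bump_function[OF im_open imageI[OF y]]) (rule that; assumption)
  have "(\<lambda>q. \<kappa> q * (\<phi> q \<bullet> b)) \<in> smooth_funs A" for b
    by (rule smooth_funs_bump_mult[OF im_open smooth_push_compose[OF Cinf_linear[OF linear_inner_const S_open]] \<kappa>(1,6-8)])
  then show thesis
    by (rule that[of "\<lambda>b q. \<kappa> q * (\<phi> q \<bullet> b)" N]) (use \<kappa> in auto)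
qed

lemma tv_coordinate:
  assumes y: "y \<in> S" and x: "x \<in> smooth_funs A" and N: "open N" "\<psi> y \<in> N" "\<And>q. q \<in> N \<Longrightarrow> x q = \<phi> q \<bullet> b"
  shows "tv y v x = P v \<bullet> b"
proof -
  have "((\<lambda>z. P z \<bullet> b) has_derivative (\<lambda>v. P v \<bullet> b)) (at y)"
    by (rule has_derivative_inner_left[OF linear_imp_has_derivative[OF P_lin]])
  then have "((\<lambda>z. x (\<psi> z)) has_derivative (\<lambda>v. P v \<bullet> b)) (at y)"
    by (rule has_derivative_transform_within_open[OF _ preimage_open[OF N(1)]])
      (use y N in \<open>auto simp: \<phi>\<psi>\<close>)
  from frechet_derivative_at[OF this, symmetric] show ?thesis by (simp add: tv_apply[OF x])
qed

text \<open>Every derivation is a directional derivative. By Hadamard's lemma \<open>f\<close> is, near the point, a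
  constant plus a sum of products \<open>x\<^sub>b g\<^sub>b\<close>, where \<open>x\<^sub>b\<close> are coordinates that vanish at the point; by
  the product rule only the values of the derivation on the \<open>x\<^sub>b\<close> remain.\<close>

lemma tangent_coordinates:
  assumes y: "y \<in> S" "P y = y" and v: "v \<in> tangent_space A (\<psi> y)"
    and x: "\<And>b. x b \<in> smooth_funs A" and N: "open N" "\<psi> y \<in> N" "\<And>b q. q \<in> N \<Longrightarrow> x b q = \<phi> q \<bullet> b"
  shows "v = tv y (\<Sum>b\<in>Basis. v (x b) *\<^sub>R b)"
proof (rule ext)
  fix f
  show "v f = tv y (\<Sum>b\<in>Basis. v (x b) *\<^sub>R b) f"
  proof (cases "f \<in> smooth_funs A")
    case f: True
    obtain r where r: "r > 0" "ball y r \<subseteq> S" using S_open y(1) open_contains_ball by metis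
    let ?F = "\<lambda>z. f (\<psi> z)"
    have F: "Cinf (ball y r) ?F" by (rule Cinf_subset[OF smooth_funs_pull[OF f] r(2)])
    obtain g where g: "\<And>b. Cinf (ball y r) (g b)"
      "\<And>z. z \<in> ball y r \<Longrightarrow> ?F z = ?F y + (\<Sum>b\<in>Basis. ((z - y) \<bullet> b) * g b z)"
      "\<And>b. y \<in> ball y r \<Longrightarrow> g b y = frechet_derivative ?F (at y) b"
      by (rule Hadamard[OF F]) (rule that; assumption)
    let ?W = "\<psi> ` ball y r"
    have Pb: "P z \<in> ball y r" if "z \<in> ball y r" for z by (rule orth_proj_ball[OF P_proj y(2) that])
    have W: "open ?W" by (rule image_open[OF open_ball r(2) Pb])
    have pW: "\<psi> y \<in> ?W" using r(1) by simp
    obtain \<kappa> M C where \<kappa>: "\<kappa> \<in> smooth_funs A" "open M" "\<psi> y \<in> M" "\<And>x. x \<in> M \<Longrightarrow> \<kappa> x = 1" "M \<subseteq> C"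
      "compact C" "C \<subseteq> ?W" "\<And>x. x \<notin> C \<Longrightarrow> \<kappa> x = 0"
      by (rule bump_function[OF W pW]) (rule that; assumption)
    have "smooth_fun_on A ?W (\<lambda>q. g b (\<phi> q))" for b
    proof (rule smooth_push[OF open_ball r(2) Pb])
      have "Cinf (ball y r) (\<lambda>z. g b (P z))"
        by (rule Cinf_compose[OF open_ball open_ball _ Cinf_linear[OF P_lin open_ball] g(1)]) (use Pb in auto)
      then show "Cinf (ball y r) (\<lambda>z. g b (\<phi> (\<psi> z)))"
        by (rule Cinf_cong[OF open_ball, rotated]) (use r(2) \<phi>\<psi> in auto)
    qed
    then have G: "(\<lambda>q. \<kappa> q * g b (\<phi> q)) \<in> smooth_funs A" for b
      by (rule smooth_funs_bump_mult[OF W _ \<kappa>(1,6-8)])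
    let ?x = "\<lambda>b q. x b q - y \<bullet> b" and ?G = "\<lambda>b q. \<kappa> q * g b (\<phi> q)"
    have xs: "?x b \<in> smooth_funs A" for b by (rule smooth_funs_diff[OF x smooth_funs_const])
    have sm: "(\<lambda>q. ?x b q * ?G b q) \<in> smooth_funs A" for b by (rule smooth_funs_mult[OF xs G])
    have sms: "(\<lambda>q. \<Sum>b\<in>Basis. ?x b q * ?G b q) \<in> smooth_funs A" by (rule smooth_funs_sum[OF sm])
    have "v f = v (\<lambda>q. f (\<psi> y) + (\<Sum>b\<in>Basis. ?x b q * ?G b q))"
    proof (rule derivation_local[OF v f _ open_Int[OF N(1) \<kappa>(2)]])
      show "(\<lambda>q. f (\<psi> y) + (\<Sum>b\<in>Basis. ?x b q * ?G b q)) \<in> smooth_funs A"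
        by (rule smooth_funs_add[OF smooth_funs_const sms])
      fix q assume q: "q \<in> N \<inter> M"
      then obtain z where z: "z \<in> ball y r" "q = \<psi> z" using \<kappa>(5,7) by blast
      have "q = \<psi> (P z)" "\<phi> q = P z" using z r(2) \<psi>P[of z] \<phi>\<psi>[of z] by auto
      then show "f q = f (\<psi> y) + (\<Sum>b\<in>Basis. ?x b q * ?G b q)"
        using g(2)[OF Pb[OF z(1)]] q N(3) \<kappa>(4) by (simp add: inner_diff_left)
    qed (use N(2) \<kappa>(3) in blast)
    also have "\<dots> = v (\<lambda>q. f (\<psi> y)) + v (\<lambda>q. \<Sum>b\<in>Basis. ?x b q * ?G b q)"
      by (rule tangent_spaceD(1)[OF v smooth_funs_const sms])
    also have "\<dots> = (\<Sum>b\<in>Basis. v (\<lambda>q. ?x b q * ?G b q))"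
      by (simp only: derivation_const[OF v] derivation_sum[OF v sm] add_0)
    also have "\<dots> = (\<Sum>b\<in>Basis. v (x b) * frechet_derivative ?F (at y) b)"
    proof (rule sum.cong[OF refl])
      fix b :: 'e assume "b \<in> Basis"
      have "v (\<lambda>q. ?x b q * ?G b q) = v (?x b) * ?G b (\<psi> y) + ?x b (\<psi> y) * v (?G b)"
        by (rule tangent_spaceD(3)[OF v xs G])
      moreover have "?x b (\<psi> y) = 0" using N(3)[OF N(2)] \<phi>\<psi>[OF y(1)] y(2) by simp
      moreover have "v (?x b) = v (x b)"
        by (simp only: derivation_diff[OF v x smooth_funs_const] derivation_const[OF v] diff_0_right)
      moreover have "?G b (\<psi> y) = frechet_derivative ?F (at y) b"
        using g(3) r(1) \<kappa>(4)[OF \<kappa>(3)] \<phi>\<psi>[OF y(1)] y(2) by simp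
      ultimately show "v (\<lambda>q. ?x b q * ?G b q) = v (x b) * frechet_derivative ?F (at y) b" by simp
    qed
    also have "\<dots> = frechet_derivative ?F (at y) (\<Sum>b\<in>Basis. v (x b) *\<^sub>R b)"
      using Cinf_linear_frechet[OF smooth_funs_pull[OF f] y(1)] by (simp add: linear_sum linear_cmul)
    finally show ?thesis by (simp add: tv_apply[OF f])
  qed (simp add: tv_def tangent_spaceD(4)[OF v])
qed

text \<open>The coordinates, in the model subspace, of a tangent vector at the point with coordinates
  \<open>y\<close>.\<close>

definition coords :: "'e \<Rightarrow> 'a tangent_vec \<Rightarrow> 'e" where
  "coords y v = (SOME \<xi>. P \<xi> = \<xi> \<and> v = tv y \<xi>)"

lemma tv_inj: "y \<in> S \<Longrightarrow> tv y v = tv y w \<Longrightarrow> P v = P w"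
proof -
  assume y: "y \<in> S" and eq: "tv y v = tv y w"
  obtain x N where x: "\<And>b. x b \<in> smooth_funs A" "open N" "\<psi> y \<in> N"
    "\<And>b q. q \<in> N \<Longrightarrow> x b q = \<phi> q \<bullet> b"
    by (rule coordinate_functions[OF y]) (rule that; assumption)
  have "P v \<bullet> b = P w \<bullet> b" for b
    using tv_coordinate[OF y x(1-4), of v b] tv_coordinate[OF y x(1-4), of w b] eq by simp
  then show ?thesis by (simp add: euclidean_eq_iff[of "P v"])
qed

lemma coords:
  assumes y: "y \<in> S" and v: "v \<in> tangent_space A (\<psi> y)"
  shows "P (coords y v) = coords y v" "tv y (coords y v) = v"
proof -
  obtain x N where x: "\<And>b. x b \<in> smooth_funs A" "open N" "\<psi> y \<in> N"
    "\<And>b q. q \<in> N \<Longrightarrow> x b q = \<phi> q \<bullet> b"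
    by (rule coordinate_functions[OF y]) (rule that; assumption)
  let ?\<xi> = "\<Sum>b\<in>Basis. v (x b) *\<^sub>R b"
  have "v = tv (P y) ?\<xi>"
    by (rule tangent_coordinates[OF P_in[OF y] PP]) (use y v x in \<open>simp_all add: \<psi>P\<close>)
  also have "\<dots> = tv y (P ?\<xi>)"
    using tv_proj[OF y, of ?\<xi>] tv_P[OF P_in[OF y], of ?\<xi>] tv_P[OF y, of ?\<xi>] by simp
  finally have "\<exists>\<xi>. P \<xi> = \<xi> \<and> v = tv y \<xi>" by (intro exI[of _ "P ?\<xi>"]) simp
  from someI_ex[OF this] show "P (coords y v) = coords y v" "tv y (coords y v) = v"
    unfolding coords_def by auto
qed

lemma coords_tv: "y \<in> S \<Longrightarrow> coords y (tv y w) = P w"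
  using tv_inj[of y "coords y (tv y w)" w] coords[of y "tv y w"] tv_tangent[of y w] by simp

lemma coords_lincomb:
  assumes "y \<in> S" "u \<in> tangent_space A (\<psi> y)" "v \<in> tangent_space A (\<psi> y)"
  shows "coords y (\<lambda>f. c * u f + d * v f) = c *\<^sub>R coords y u + d *\<^sub>R coords y v"
proof -
  have "(\<lambda>f. c * u f + d * v f) = tv y (c *\<^sub>R coords y u + d *\<^sub>R coords y v)"
    using tv_lincomb[OF assms(1)] coords[OF assms(1,2)] coords[OF assms(1,3)] by simp
  then show ?thesis
    using coords_tv[OF assms(1)] coords(1)[OF assms(1,2)] coords(1)[OF assms(1,3)] P_lin
    by (simp add: linear_add linear_cmul)
qed

lemma coords_P:
  assumes y: "y \<in> S" and v: "v \<in> tangent_space A (\<psi> y)"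
  shows "coords (P y) v = coords y v"
proof -
  have "v = tv (P y) (coords y v)"
    using coords[OF y v] tv_proj[OF y, of "coords y v"] by simp
  then show ?thesis using coords_tv[OF P_in[OF y]] coords(1)[OF y v] by metis
qed

lemma coords_coordinate:
  assumes y: "y \<in> S" and v: "v \<in> tangent_space A (\<psi> y)"
    and x: "\<And>b. x b \<in> smooth_funs A" and N: "open N" "\<psi> y \<in> N" "\<And>b q. q \<in> N \<Longrightarrow> x b q = \<phi> q \<bullet> b"
  shows "coords y v = (\<Sum>b\<in>Basis. v (x b) *\<^sub>R b)"
proof -
  have "v (x b) = coords y v \<bullet> b" for b
    using tv_coordinate[OF y x N, of "coords y v" b] coords[OF y v] by simp
  then show ?thesis by (simp add: euclidean_representation)
qed

lemma coords_smooth: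
  assumes W: "open W" and T: "\<And>p. p \<in> W \<Longrightarrow> X p \<in> tangent_space A p"
    and X: "\<And>f. f \<in> smooth_funs A \<Longrightarrow> smooth_fun_on A W (\<lambda>p. X p f)"
  shows "Cinf (S \<inter> \<psi> -` W) (\<lambda>y. coords y (X (\<psi> y)))"
proof (rule Cinf_local)
  fix y assume y: "y \<in> S \<inter> \<psi> -` W"
  then have yS: "y \<in> S" by blast
  obtain x N where x: "\<And>b. x b \<in> smooth_funs A" "open N" "\<psi> y \<in> N"
    "\<And>b q. q \<in> N \<Longrightarrow> x b q = \<phi> q \<bullet> b"
    by (rule coordinate_functions[OF yS]) (rule that; assumption)
  let ?V = "S \<inter> \<psi> -` (W \<inter> N)"
  have V: "open ?V" by (rule preimage_open[OF open_Int[OF W x(2)]])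
  have "Cinf ?V (\<lambda>y. \<Sum>b\<in>Basis. X (\<psi> y) (x b) *\<^sub>R b)"
  proof (intro Cinf_sum Cinf_scaleR Cinf_const V)
    fix b :: 'e
    show "Cinf ?V (\<lambda>y. X (\<psi> y) (x b))"
      by (rule Cinf_subset[OF smooth_pull[OF W X[OF x(1)]]]) blast
  qed
  moreover have "(\<Sum>b\<in>Basis. X (\<psi> z) (x b) *\<^sub>R b) = coords z (X (\<psi> z))" if "z \<in> ?V" for z
    by (rule coords_coordinate[OF _ _ x(1,2) _ x(4), symmetric]) (use that T in auto)
  ultimately have "Cinf ?V (\<lambda>y. coords y (X (\<psi> y)))" by (rule Cinf_cong[OF V, rotated])
  then show "\<exists>V. open V \<and> y \<in> V \<and> Cinf V (\<lambda>y. coords y (X (\<psi> y)))"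
    using V y x(3) by blast
qed

lemma vec_field_coords_smooth: "X \<in> vec_fields A UNIV \<Longrightarrow> Cinf S (\<lambda>y. coords y (X (\<psi> y)))"
  using coords_smooth[of UNIV X] unfolding vec_fields_def by simp

lemma smooth_field_of_coords:
  assumes V: "open V" "V \<subseteq> S" "\<And>y. y \<in> V \<Longrightarrow> P y \<in> V" and \<eta>: "Cinf V \<eta>" and f: "f \<in> smooth_funs A"
  shows "smooth_fun_on A (\<psi> ` V) (\<lambda>q. tv (\<phi> q) (\<eta> (\<phi> q)) f)"
proof (rule smooth_push[OF V])
  have "Cinf V (\<lambda>y. frechet_derivative (\<lambda>z. f (\<psi> z)) (at y) (\<eta> y))"
    by (rule Cinf_frechet_apply[OF V(1) Cinf_subset[OF smooth_funs_pull[OF f] V(2)] \<eta>])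
  then have "Cinf V (\<lambda>y. frechet_derivative (\<lambda>z. f (\<psi> z)) (at (P y)) (\<eta> (P y)))"
    by (intro Cinf_compose[OF V(1) V(1) _ Cinf_linear[OF P_lin V(1)], of "\<lambda>y. frechet_derivative (\<lambda>z. f (\<psi> z)) (at y) (\<eta> y)"])
      (use V(3) in auto)
  then show "Cinf V (\<lambda>y. tv (\<phi> (\<psi> y)) (\<eta> (\<phi> (\<psi> y))) f)"
    by (rule Cinf_cong[OF V(1), rotated]) (use V(2) in \<open>auto simp: \<phi>\<psi> tv_apply[OF f]\<close>)
qed

lemma bump_field:
  assumes \<eta>: "Cinf S \<eta>" and \<kappa>: "\<kappa> \<in> smooth_funs A"
    and C: "compact C" "C \<subseteq> \<psi> ` S" "\<And>x. x \<notin> C \<Longrightarrow> \<kappa> x = 0"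
  shows "(\<lambda>q f. \<kappa> q * tv (\<phi> q) (\<eta> (\<phi> q)) f) \<in> vec_fields A UNIV"
proof -
  have "(\<lambda>q. \<kappa> q * tv (\<phi> q) (\<eta> (\<phi> q)) f) \<in> smooth_funs A" if "f \<in> smooth_funs A" for f
    by (rule smooth_funs_bump_mult[OF im_open smooth_field_of_coords[OF S_open order_refl P_in \<eta> that] \<kappa> C])
  moreover have "(\<lambda>f. \<kappa> q * tv (\<phi> q) (\<eta> (\<phi> q)) f) \<in> tangent_space A q" for q
  proof (cases "q \<in> C")
    case True
    then have q: "q \<in> \<psi> ` S" using C(2) by blast
    show ?thesis using tangent_scale[OF tv_tangent[OF \<phi>_mem[OF q]]] unfolding \<psi>\<phi>[OF q] .
  qed (simp add: C(3) tangent_zero)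
  ultimately show ?thesis unfolding vec_fields_def smooth_funs_def by simp
qed

end

section \<open>Estimates for ordinary differential equations\<close>

lemma has_vector_derivative_bound:
  fixes f :: "real \<Rightarrow> 'e::euclidean_space"
  assumes "\<And>t. t \<in> {a..b} \<Longrightarrow> (f has_vector_derivative f' t) (at t within {a..b})"
    and "\<And>t. t \<in> {a..b} \<Longrightarrow> norm (f' t) \<le> B" and "s \<in> {a..b}" "t \<in> {a..b}"
  shows "norm (f t - f s) \<le> B * \<bar>t - s\<bar>"
proof -
  have "norm (f t - f s) \<le> B * norm (t - s)"
  proof (rule differentiable_bound[where S="{a..b}" and f'="\<lambda>x h. h *\<^sub>R f' x"])
    show "onorm (\<lambda>h. h *\<^sub>R f' x) \<le> B" if "x \<in> {a..b}" for x
      by (rule onorm_le) (use mult_left_mono[OF assms(2)[OF that] abs_ge_zero] in \<open>simp add: mult.commute\<close>)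
  qed (use assms in \<open>auto simp: has_vector_derivative_def\<close>)
  then show ?thesis by simp
qed

text \<open>Gronwall's inequality on a short interval, where comparing with the maximum of the sum
  already suffices.\<close>

lemma gronwall_short:
  fixes f :: "'g \<Rightarrow> real \<Rightarrow> 'e::euclidean_space"
  assumes fin: "finite G" and t0: "t0 \<in> {a..b}"
    and der: "\<And>g t. g \<in> G \<Longrightarrow> t \<in> {a..b} \<Longrightarrow> (f g has_vector_derivative f' g t) (at t within {a..b})"
    and bnd: "\<And>g t. g \<in> G \<Longrightarrow> t \<in> {a..b} \<Longrightarrow> norm (f' g t) \<le> C * (\<Sum>h\<in>G. norm (f h t)) + e"
    and zero: "\<And>g. g \<in> G \<Longrightarrow> f g t0 = 0"
    and C: "0 \<le> C" "0 \<le> e" and short: "real (card G) * (C * (b - a)) \<le> 1 / 2"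
    and t: "t \<in> {a..b}"
  shows "(\<Sum>h\<in>G. norm (f h t)) \<le> 2 * real (card G) * e * (b - a)"
proof -
  define s where "s t = (\<Sum>h\<in>G. norm (f h t))" for t
  have ab: "0 \<le> b - a" using t by simp
  have "continuous_on {a..b} (f g)" if "g \<in> G" for g
    unfolding continuous_on_eq_continuous_within
    using has_vector_derivative_continuous[OF der[OF that]] by blast
  then have "continuous_on {a..b} s" unfolding s_def by (intro continuous_intros) auto
  then obtain m where m: "m \<in> {a..b}" "\<And>t. t \<in> {a..b} \<Longrightarrow> s t \<le> s m"
    using continuous_attains_sup[of "{a..b}" s] t by auto
  have sm: "0 \<le> s m" unfolding s_def by (rule sum_nonneg) simp
  have "norm (f g m) \<le> (C * s m + e) * (b - a)" if g: "g \<in> G" for g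
  proof -
    have "norm (f g m - f g t0) \<le> (C * s m + e) * \<bar>m - t0\<bar>"
    proof (rule has_vector_derivative_bound[OF der[OF g] _ t0 m(1)])
      fix t assume t: "t \<in> {a..b}"
      have "C * s t \<le> C * s m" using m(2)[OF t] C(1) by (rule mult_left_mono)
      then show "norm (f' g t) \<le> C * s m + e" using bnd[OF g t] unfolding s_def by linarith
    qed
    also have "\<dots> \<le> (C * s m + e) * (b - a)"
      by (rule mult_left_mono) (use m(1) t0 C sm in auto)
    finally show ?thesis using zero[OF g] by simp
  qed
  then have "s m \<le> (\<Sum>g\<in>G. (C * s m + e) * (b - a))"
    unfolding s_def[of m] by (rule sum_mono)
  also have "\<dots> = (real (card G) * (C * (b - a))) * s m + real (card G) * e * (b - a)"
    by (simp add: algebra_simps)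
  also have "\<dots> \<le> (1 / 2) * s m + real (card G) * e * (b - a)"
    using short sm by (intro add_right_mono mult_right_mono) auto
  finally have "s m \<le> 2 * real (card G) * e * (b - a)" by simp
  then show ?thesis using m(2)[OF t] unfolding s_def by linarith
qed

lemma gronwall_short_single:
  fixes f :: "real \<Rightarrow> 'e::euclidean_space"
  assumes "t0 \<in> {a..b}" "\<And>t. t \<in> {a..b} \<Longrightarrow> (f has_vector_derivative f' t) (at t within {a..b})"
    and "\<And>t. t \<in> {a..b} \<Longrightarrow> norm (f' t) \<le> C * norm (f t) + e" "f t0 = 0"
    and "0 \<le> C" "0 \<le> e" "C * (b - a) \<le> 1 / 2" "t \<in> {a..b}"
  shows "norm (f t) \<le> 2 * e * (b - a)"
  using gronwall_short[of "{()}" t0 a b "\<lambda>_. f" "\<lambda>_. f'" C e t] assms by simp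

text \<open>Picard's theorem for a field whose Lipschitz constant is small compared with the length of
  the time interval, so that a single application of the contraction principle is enough.\<close>

lemma picard_unit_interval:
  fixes F :: "'e::euclidean_space \<Rightarrow> 'e"
  assumes r: "0 \<le> r" and F: "\<And>y. y \<in> cball a r \<Longrightarrow> norm (F y) \<le> r"
    and lip: "\<And>y z. y \<in> cball a r \<Longrightarrow> z \<in> cball a r \<Longrightarrow> norm (F y - F z) \<le> 1 / 2 * norm (y - z)"
  obtains E where "E 0 = a" "\<And>s. s \<in> {0..1} \<Longrightarrow> E s \<in> cball a r"
    "\<And>s. s \<in> {0..1} \<Longrightarrow> (E has_vector_derivative F (E s)) (at s within {0..1::real})"
proof -
  let ?K = "cball a r"
  let ?c = "\<lambda>y. closest_point ?K y"
  have cp: "?c y \<in> ?K" for y by (rule closest_point_in_set) (use r in auto)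
  \<comment> \<open>Retracting onto the ball makes the field globally bounded and Lipschitz.\<close>
  define F1 where "F1 y = F (?c y)" for y
  have F1: "norm (F1 y) \<le> r" for y unfolding F1_def by (rule F[OF cp])
  have lip1: "norm (F1 y - F1 z) \<le> 1 / 2 * norm (y - z)" for y z
  proof -
    have "norm (F1 y - F1 z) \<le> 1 / 2 * norm (?c y - ?c z)" unfolding F1_def by (rule lip[OF cp cp])
    also have "norm (?c y - ?c z) \<le> norm (y - z)"
      using closest_point_lipschitz[of ?K y z] r by (simp add: dist_norm)
    finally show ?thesis by simp
  qed
  have F1c: "continuous_on T F1" for T
  proof (rule continuous_onI)
    fix x e assume "x \<in> T" "0 < (e::real)"
    then show "\<exists>d>0. \<forall>x'\<in>T. dist x' x < d \<longrightarrow> dist (F1 x') (F1 x) \<le> e"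
    proof (intro exI[of _ e] conjI ballI impI)
      fix y assume "dist y x < e"
      then show "dist (F1 y) (F1 x) \<le> e"
        using lip1[of y x] norm_ge_zero[of "y - x"] unfolding dist_norm by linarith
    qed auto
  qed
  define cl where "cl s = max 0 (min 1 (s::real))" for s
  have cl: "cl s \<in> {0..1}" for s by (simp add: cl_def)
  have clc: "continuous_on UNIV cl" unfolding cl_def by (intro continuous_intros)
  define Tf where "Tf f s = a + integral {0..cl s} (\<lambda>\<tau>. F1 (f \<tau>))" for f :: "real \<Rightarrow> 'e" and s
  have cF: "continuous_on T (\<lambda>\<tau>. F1 (apply_bcontfun f \<tau>))" for T and f :: "real \<Rightarrow>\<^sub>C 'e"
    by (rule continuous_on_compose2[OF F1c[of UNIV]]) auto
  have iF: "(\<lambda>\<tau>. F1 (apply_bcontfun f \<tau>)) integrable_on {c..d}" for f :: "real \<Rightarrow>\<^sub>C 'e" and c d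
    by (rule integrable_continuous_real[OF cF])
  have bF: "norm (integral {0..s} (\<lambda>\<tau>. F1 (apply_bcontfun f \<tau>))) \<le> r" if "s \<in> {0..1}" for f :: "real \<Rightarrow>\<^sub>C 'e" and s
  proof -
    have "norm (integral {0..s} (\<lambda>\<tau>. F1 (apply_bcontfun f \<tau>))) \<le> r * (s - 0)"
      by (rule integral_bound) (use that cF F1 in auto)
    also have "\<dots> \<le> r" using that r by (simp add: mult_left_le)
    finally show ?thesis .
  qed
  have mem: "Tf (apply_bcontfun f) \<in> bcontfun" for f :: "real \<Rightarrow>\<^sub>C 'e"
    unfolding bcontfun_def
  proof (intro CollectI conjI)
    have "continuous_on {0..1} (\<lambda>s. integral {0..s} (\<lambda>\<tau>. F1 (apply_bcontfun f \<tau>)))"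
      by (rule indefinite_integral_continuous_1[OF iF])
    then have "continuous_on UNIV (\<lambda>s. integral {0..cl s} (\<lambda>\<tau>. F1 (apply_bcontfun f \<tau>)))"
      by (rule continuous_on_compose2[OF _ clc]) (use cl in auto)
    then show "continuous_on UNIV (Tf (apply_bcontfun f))"
      unfolding Tf_def by (intro continuous_intros)
    show "bounded (range (Tf (apply_bcontfun f)))"
    proof (rule boundedI)
      fix x assume "x \<in> range (Tf (apply_bcontfun f))"
      then obtain s where "x = Tf (apply_bcontfun f) s" by blast
      then show "norm x \<le> norm a + r"
        unfolding Tf_def using norm_triangle_le[of a] bF[OF cl, of s f] by (simp add: norm_triangle_le)
    qed
  qed
  define T where "T f = Bcontfun (Tf (apply_bcontfun f))" for f :: "real \<Rightarrow>\<^sub>C 'e"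
  have T: "apply_bcontfun (T f) = Tf (apply_bcontfun f)" for f
    unfolding T_def by (rule Bcontfun_inverse[OF mem])
  have "dist (T f) (T g) \<le> 1 / 2 * dist f g" for f g
  proof (rule dist_bound)
    fix s
    have "dist (T f s) (T g s) = norm (integral {0..cl s} (\<lambda>\<tau>. F1 (f \<tau>)) - integral {0..cl s} (\<lambda>\<tau>. F1 (g \<tau>)))"
      by (simp add: T Tf_def dist_norm)
    also have "\<dots> = norm (integral {0..cl s} (\<lambda>\<tau>. F1 (f \<tau>) - F1 (g \<tau>)))"
      by (simp add: integral_diff[OF iF iF])
    also have "\<dots> \<le> (1 / 2 * dist f g) * (cl s - 0)"
    proof (rule integral_bound)
      show "continuous_on {0..cl s} (\<lambda>\<tau>. F1 (f \<tau>) - F1 (g \<tau>))" by (intro continuous_on_diff cF)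
      fix \<tau>
      have "norm (F1 (f \<tau>) - F1 (g \<tau>)) \<le> 1 / 2 * dist (f \<tau>) (g \<tau>)" using lip1 by (simp add: dist_norm)
      also have "\<dots> \<le> 1 / 2 * dist f g" using dist_bounded[of f \<tau> g] by simp
      finally show "norm (F1 (f \<tau>) - F1 (g \<tau>)) \<le> 1 / 2 * dist f g" .
    qed (use cl in auto)
    also have "\<dots> \<le> 1 / 2 * dist f g" using cl[of s] by (simp add: mult_left_le)
    finally show "dist (T f s) (T g s) \<le> 1 / 2 * dist f g" .
  qed
  then have "\<exists>!f. T f = f" by (intro banach_fix_type[of "1 / 2"]) auto
  then obtain f where f: "T f = f" by blast
  define E where "E = apply_bcontfun f"
  have E: "E s = a + integral {0..s} (\<lambda>\<tau>. F1 (E \<tau>))" if "s \<in> {0..1}" for s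
  proof -
    have "E s = apply_bcontfun (T f) s" using f E_def by simp
    then show ?thesis using that unfolding T Tf_def E_def cl_def by simp
  qed
  have in_K: "E s \<in> ?K" if "s \<in> {0..1}" for s
    using E[OF that] bF[OF that, of f] unfolding E_def by (simp add: dist_norm)
  show thesis
  proof (rule that)
    show "E 0 = a" using E[of 0] by simp
    fix s :: real assume s: "s \<in> {0..1}"
    show "E s \<in> ?K" by (rule in_K[OF s])
    have "((\<lambda>s. integral {0..s} (\<lambda>\<tau>. F1 (E \<tau>))) has_vector_derivative F1 (E s)) (at s within {0..1})"
      by (rule integral_has_vector_derivative[OF _ s]) (use cF E_def in auto)
    then have "((\<lambda>s. a + integral {0..s} (\<lambda>\<tau>. F1 (E \<tau>))) has_vector_derivative F1 (E s)) (at s within {0..1})"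
      by (auto intro!: derivative_eq_intros)
    then have "(E has_vector_derivative F1 (E s)) (at s within {0..1})"
      by (rule has_vector_derivative_transform[OF s, rotated]) (use E in auto)
    moreover have "F1 (E s) = F (E s)"
      unfolding F1_def using closest_point_self[OF in_K[OF s]] by simp
    ultimately show "(E has_vector_derivative F (E s)) (at s within {0..1})" by simp
  qed
qed

lemma Cinf_bounds:
  fixes f :: "'e::euclidean_space \<Rightarrow> 'f::euclidean_space"
  assumes f: "Cinf U f" and K: "cball a r \<subseteq> U"
  obtains C where "0 \<le> C" "\<And>y. y \<in> cball a r \<Longrightarrow> norm (f y) \<le> C"
    "\<And>y h. y \<in> cball a r \<Longrightarrow> norm (frechet_derivative f (at y) h) \<le> C * norm h"
    "\<And>y z. y \<in> cball a r \<Longrightarrow> z \<in> cball a r \<Longrightarrow> norm (f z - f y) \<le> C * norm (z - y)"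
proof -
  have bdd: "\<exists>B\<ge>0. \<forall>y\<in>cball a r. norm (g y) \<le> B" if "Cinf U g" for g :: "'e \<Rightarrow> 'f"
  proof -
    have "compact (g ` cball a r)"
      by (rule compact_continuous_image[OF continuous_on_subset[OF Cinf_continuous_on[OF that] K]]) simp
    then obtain B where "\<And>x. x \<in> g ` cball a r \<Longrightarrow> norm x \<le> B"
      using compact_imp_bounded bounded_iff by metis
    then have "norm (g y) \<le> B" if "y \<in> cball a r" for y using that by blast
    then show ?thesis by (intro exI[of _ "max B 0"]) (auto intro: max.coboundedI1)
  qed
  obtain B where B: "B \<ge> 0" "\<And>y. y \<in> cball a r \<Longrightarrow> norm (f y) \<le> B" using bdd[OF f] by blast
  have "\<exists>D. \<forall>b. D b \<ge> 0 \<and> (\<forall>y\<in>cball a r. norm (frechet_derivative f (at y) b) \<le> D b)"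
    using bdd[OF Cinf_frechet[OF f]] by (intro choice) blast
  then obtain D where D: "\<And>b. D b \<ge> 0" "\<And>b y. y \<in> cball a r \<Longrightarrow> norm (frechet_derivative f (at y) b) \<le> D b"
    by blast
  define C where "C = B + (\<Sum>b\<in>Basis. D b)"
  have sD: "0 \<le> (\<Sum>b\<in>(Basis::'e set). D b)" by (rule sum_nonneg) (rule D(1))
  have dC: "norm (frechet_derivative f (at y) h) \<le> C * norm h" if y: "y \<in> cball a r" for y h
  proof -
    have "frechet_derivative f (at y) h = (\<Sum>b\<in>Basis. (h \<bullet> b) *\<^sub>R frechet_derivative f (at y) b)"
      by (rule linear_basis_expansion[OF Cinf_linear_frechet[OF f subsetD[OF K y]]])
    also have "norm \<dots> \<le> (\<Sum>b\<in>Basis. norm h * D b)"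
      by (rule sum_norm_le) (use D[of _] y Basis_le_norm in \<open>auto intro!: mult_mono\<close>)
    also have "\<dots> \<le> norm h * C" unfolding C_def sum_distrib_left[symmetric] using B(1) by (intro mult_left_mono) auto
    finally show ?thesis by (simp add: mult.commute)
  qed
  show thesis
  proof (rule that[of C])
    show "0 \<le> C" unfolding C_def using B(1) sD by simp
    show "norm (f y) \<le> C" if "y \<in> cball a r" for y using B(2)[OF that] sD unfolding C_def by linarith
    show "norm (f z - f y) \<le> C * norm (z - y)" if yz: "y \<in> cball a r" "z \<in> cball a r" for y z
    proof (rule differentiable_bound[OF convex_cball _ _ yz(2,1)])
      fix x assume x: "x \<in> cball a r"
      show "(f has_derivative frechet_derivative f (at x)) (at x within cball a r)"
        by (rule has_derivative_at_withinI[OF Cinf_has_derivative[OF f subsetD[OF K x]]])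
      show "onorm (frechet_derivative f (at x)) \<le> C" by (rule onorm_le) (rule dC[OF x])
    qed
  qed (rule dC)
qed

lemma Cinf_taylor_bound:
  fixes f :: "'e::euclidean_space \<Rightarrow> 'f::euclidean_space"
  assumes f: "Cinf U f" and K: "cball a r \<subseteq> U"
  obtains C where "0 \<le> C" "\<And>y z. y \<in> cball a r \<Longrightarrow> z \<in> cball a r \<Longrightarrow>
    norm (f z - f y - frechet_derivative f (at y) (z - y)) \<le> C * (norm (z - y))\<^sup>2"
proof -
  have "\<forall>b. \<exists>C\<ge>0. \<forall>y\<in>cball a r. \<forall>z\<in>cball a r.
     norm (frechet_derivative f (at z) b - frechet_derivative f (at y) b) \<le> C * norm (z - y)"
    using Cinf_bounds[OF Cinf_frechet[OF f] K] by metis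
  then obtain D where D: "\<And>b. D b \<ge> 0" "\<And>b y z. y \<in> cball a r \<Longrightarrow> z \<in> cball a r \<Longrightarrow>
     norm (frechet_derivative f (at z) b - frechet_derivative f (at y) b) \<le> D b * norm (z - y)"
    by metis
  define C where "C = (\<Sum>b\<in>(Basis::'e set). D b)"
  have C: "0 \<le> C" unfolding C_def by (rule sum_nonneg) (rule D(1))
  note lin = Cinf_linear_frechet[OF f]
  show thesis
  proof (rule that[OF C])
    fix y z assume y: "y \<in> cball a r" and z: "z \<in> cball a r"
    let ?L = "frechet_derivative f (at y)"
    have seg: "closed_segment y z \<subseteq> cball a r" by (rule closed_segment_subset[OF y z convex_cball])
    have ly: "linear ?L" by (rule lin) (use K y in blast)
    have "norm ((f z - ?L z) - (f y - ?L y)) \<le> (C * norm (z - y)) * norm (z - y)"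
    proof (rule differentiable_bound[OF convex_closed_segment])
      fix x assume x: "x \<in> closed_segment y z"
      have xK: "x \<in> cball a r" using seg x by blast
      have "((\<lambda>x. f x - ?L x) has_derivative (\<lambda>h. frechet_derivative f (at x) h - ?L h)) (at x)"
        by (intro has_derivative_diff Cinf_has_derivative[OF f subsetD[OF K xK]] linear_imp_has_derivative ly)
      then show "((\<lambda>x. f x - ?L x) has_derivative (\<lambda>h. frechet_derivative f (at x) h - ?L h))
          (at x within closed_segment y z)" by (rule has_derivative_at_withinI)
      show "onorm (\<lambda>h. frechet_derivative f (at x) h - ?L h) \<le> C * norm (z - y)"
      proof (rule onorm_le)
        fix h
        have lx: "linear (frechet_derivative f (at x))" by (rule lin) (use K xK in blast)
        have "frechet_derivative f (at x) h - ?L h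
            = (\<Sum>b\<in>Basis. (h \<bullet> b) *\<^sub>R (frechet_derivative f (at x) b - ?L b))"
          unfolding linear_basis_expansion[OF lx, of h] linear_basis_expansion[OF ly, of h]
          by (simp add: sum_subtractf scaleR_diff_right)
        also have "norm \<dots> \<le> (\<Sum>b\<in>Basis. norm h * (D b * norm (z - y)))"
        proof (rule sum_norm_le)
          fix b :: 'e assume b: "b \<in> Basis"
          have "norm (frechet_derivative f (at x) b - ?L b) \<le> D b * norm (x - y)" by (rule D(2)[OF y xK])
          also have "\<dots> \<le> D b * norm (z - y)"
            using segment_bound1[OF x] D(1)[of b] by (intro mult_left_mono) auto
          finally show "norm ((h \<bullet> b) *\<^sub>R (frechet_derivative f (at x) b - ?L b)) \<le> norm h * (D b * norm (z - y))"
            unfolding norm_scaleR using Basis_le_norm[OF b, of h] by (intro mult_mono) auto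
        qed
        also have "\<dots> = C * norm (z - y) * norm h"
          unfolding C_def by (simp add: sum_distrib_left sum_distrib_right mult.commute mult.left_commute)
        finally show "norm (frechet_derivative f (at x) h - ?L h) \<le> C * norm (z - y) * norm h" .
      qed
    qed auto
    then show "norm (f z - f y - ?L (z - y)) \<le> C * (norm (z - y))\<^sup>2"
      using ly by (simp add: linear_diff power2_eq_square algebra_simps)
  qed
qed

text \<open>This criterion gives the derivative of the solutions of an equation with respect to a parameter
  from a single estimate, without a theory of smooth dependence.\<close>

lemma has_derivative_of_quadratic_bound:
  fixes f :: "'e::euclidean_space \<Rightarrow> 'f::euclidean_space"
  assumes D: "bounded_linear D" and d: "0 < d"
    and b: "\<And>k. norm k < d \<Longrightarrow> norm (f (v + k) - f v - D k) \<le> K * (norm k)\<^sup>2"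
  shows "(f has_derivative D) (at v)"
  unfolding has_derivative_at
proof
  have lim: "(\<lambda>k::'e. \<bar>K\<bar> * norm k) \<midarrow>0\<rightarrow> 0" by (auto intro!: tendsto_eq_intros)
  have ev: "\<forall>\<^sub>F k in at 0. norm (f (v + k) - f v - D k) / norm k \<le> \<bar>K\<bar> * norm k"
    unfolding eventually_at
  proof (intro exI[of _ d] conjI ballI impI d)
    fix k :: 'e assume k: "k \<noteq> 0 \<and> dist k 0 < d"
    have "norm (f (v + k) - f v - D k) \<le> K * (norm k)\<^sup>2" by (rule b) (use k in simp)
    also have "\<dots> \<le> \<bar>K\<bar> * (norm k)\<^sup>2" by (intro mult_right_mono) auto
    finally show "norm (f (v + k) - f v - D k) / norm k \<le> \<bar>K\<bar> * norm k"
      using k by (simp add: field_simps power2_eq_square)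
  qed
  show "(\<lambda>h. norm (f (v + h) - f v - D h) / norm h) \<midarrow>0\<rightarrow> 0"
    by (rule real_tendsto_sandwich[OF _ ev tendsto_const lim]) simp
qed (rule D)

section \<open>Curves tangent to an involutive family of vector fields\<close>

text \<open>The fields \<open>X v\<close>, depending linearly on \<open>v\<close>, are to be thought of as lifts of constant
  fields, and the \<open>\<eta> g\<close> as the fields that measure by how much the rank exceeds its value at the
  base point \<open>y0\<close>. The assumptions on derivatives say that the whole system is involutive: they
  force a curve through \<open>y0\<close> that is tangent to it to stay in the locus where the \<open>\<eta> g\<close> vanish,
  and along this locus the fields \<open>X v\<close> commute.\<close>

locale parallel_family =
  fixes U :: "'e::euclidean_space set" and X :: "'e \<Rightarrow> 'e \<Rightarrow> 'e" and Q :: "'e \<Rightarrow> 'e"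
    and y0 :: 'e and r :: real and G :: "'g set" and \<eta> :: "'g \<Rightarrow> 'e \<Rightarrow> 'e" and C :: real
  assumes U: "open U" "cball y0 r \<subseteq> U" and r: "0 < r"
    and X_lin: "\<And>y. y \<in> U \<Longrightarrow> linear (X y)" and X_smooth: "\<And>v. Cinf U (\<lambda>y. X y v)"
    and Q_lin: "linear Q" and X_Q: "\<And>y v. y \<in> U \<Longrightarrow> X y (Q v) = X y v"
    and G: "finite G" and \<eta>_smooth: "\<And>g. g \<in> G \<Longrightarrow> Cinf U (\<eta> g)" and \<eta>_y0: "\<And>g. g \<in> G \<Longrightarrow> \<eta> g y0 = 0"
    and C: "0 \<le> C"
    and \<eta>_deriv: "\<And>g y v. g \<in> G \<Longrightarrow> y \<in> cball y0 r \<Longrightarrow>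
      norm (frechet_derivative (\<eta> g) (at y) (X y v)) \<le> C * norm v * (\<Sum>h\<in>G. norm (\<eta> h y))"
    and bracket: "\<And>y v w. y \<in> cball y0 r \<Longrightarrow> (\<Sum>h\<in>G. norm (\<eta> h y)) = 0 \<Longrightarrow>
      frechet_derivative (\<lambda>y. X y v) (at y) (X y w) = frechet_derivative (\<lambda>y. X y w) (at y) (X y v)"
begin

abbreviation DX :: "'e \<Rightarrow> 'e \<Rightarrow> 'e \<Rightarrow> 'e" where
  "DX v y h \<equiv> frechet_derivative (\<lambda>y. X y v) (at y) h"

lemma DX_expand:
  assumes y: "y \<in> U"
  shows "DX v y h = (\<Sum>b\<in>Basis. (v \<bullet> b) *\<^sub>R DX b y h)"
proof -
  have "((\<lambda>y. \<Sum>b\<in>Basis. (v \<bullet> b) *\<^sub>R X y b) has_derivative (\<lambda>h. \<Sum>b\<in>Basis. (v \<bullet> b) *\<^sub>R DX b y h)) (at y)"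
    by (intro has_derivative_sum has_derivative_scaleR_right Cinf_has_derivative[OF X_smooth y])
  then have "((\<lambda>y. X y v) has_derivative (\<lambda>h. \<Sum>b\<in>Basis. (v \<bullet> b) *\<^sub>R DX b y h)) (at y)"
    by (rule has_derivative_transform_within_open[OF _ U(1) y])
      (rule linear_basis_expansion[OF X_lin, symmetric])
  from fun_cong[OF frechet_derivative_at[OF this], of h] show ?thesis by (rule sym)
qed

lemma DX_linear: "y \<in> U \<Longrightarrow> linear (\<lambda>v. DX v y h)"
  unfolding linear_iff
  by (subst (1 2 3 4 5) DX_expand, assumption+)
    (simp add: inner_add_left scaleR_add_left sum.distrib scaleR_sum_right)

lemma DX_linear2: "y \<in> U \<Longrightarrow> linear (DX v y)"
  by (rule Cinf_linear_frechet[OF X_smooth])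

lemma bounds:
  obtains L where "0 < L" "\<And>y v. y \<in> cball y0 r \<Longrightarrow> norm (X y v) \<le> L * norm v"
    "\<And>y v h. y \<in> cball y0 r \<Longrightarrow> norm (DX v y h) \<le> L * norm v * norm h"
    "\<And>y z v. y \<in> cball y0 r \<Longrightarrow> z \<in> cball y0 r \<Longrightarrow> norm (X z v - X y v) \<le> L * norm v * norm (z - y)"
    "\<And>y z v. y \<in> cball y0 r \<Longrightarrow> z \<in> cball y0 r \<Longrightarrow>
       norm (X z v - X y v - DX v y (z - y)) \<le> L * norm v * (norm (z - y))\<^sup>2"
proof -
  let ?K = "cball y0 r"
  have "\<forall>b. \<exists>c\<ge>0. (\<forall>y\<in>?K. norm (X y b) \<le> c) \<and> (\<forall>y\<in>?K. \<forall>h. norm (DX b y h) \<le> c * norm h) \<and>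
      (\<forall>y\<in>?K. \<forall>z\<in>?K. norm (X z b - X y b) \<le> c * norm (z - y))"
  proof
    fix b
    obtain c where "0 \<le> c" "\<And>y. y \<in> ?K \<Longrightarrow> norm (X y b) \<le> c"
      "\<And>y h. y \<in> ?K \<Longrightarrow> norm (DX b y h) \<le> c * norm h"
      "\<And>y z. y \<in> ?K \<Longrightarrow> z \<in> ?K \<Longrightarrow> norm (X z b - X y b) \<le> c * norm (z - y)"
      by (rule Cinf_bounds[OF X_smooth U(2)]) (rule that; assumption)
    then show "\<exists>c\<ge>0. (\<forall>y\<in>?K. norm (X y b) \<le> c) \<and> (\<forall>y\<in>?K. \<forall>h. norm (DX b y h) \<le> c * norm h) \<and>
      (\<forall>y\<in>?K. \<forall>z\<in>?K. norm (X z b - X y b) \<le> c * norm (z - y))" by blast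
  qed
  then obtain c where c: "\<And>b. 0 \<le> c b" "\<And>b y. y \<in> ?K \<Longrightarrow> norm (X y b) \<le> c b"
    "\<And>b y h. y \<in> ?K \<Longrightarrow> norm (DX b y h) \<le> c b * norm h"
    "\<And>b y z. y \<in> ?K \<Longrightarrow> z \<in> ?K \<Longrightarrow> norm (X z b - X y b) \<le> c b * norm (z - y)"
    by metis
  have "\<forall>b. \<exists>d\<ge>0. \<forall>y\<in>?K. \<forall>z\<in>?K. norm (X z b - X y b - DX b y (z - y)) \<le> d * (norm (z - y))\<^sup>2"
  proof
    fix b
    obtain d where "0 \<le> d" "\<And>y z. y \<in> ?K \<Longrightarrow> z \<in> ?K \<Longrightarrow>
        norm (X z b - X y b - DX b y (z - y)) \<le> d * (norm (z - y))\<^sup>2"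
      by (rule Cinf_taylor_bound[OF X_smooth U(2)]) (rule that; assumption)
    then show "\<exists>d\<ge>0. \<forall>y\<in>?K. \<forall>z\<in>?K. norm (X z b - X y b - DX b y (z - y)) \<le> d * (norm (z - y))\<^sup>2"
      by blast
  qed
  then obtain d where d: "\<And>b. 0 \<le> d b" "\<And>b y z. y \<in> ?K \<Longrightarrow> z \<in> ?K \<Longrightarrow>
      norm (X z b - X y b - DX b y (z - y)) \<le> d b * (norm (z - y))\<^sup>2"
    by metis
  define L where "L = 1 + (\<Sum>b\<in>Basis. c b + d b)"
  have nn: "0 \<le> (\<Sum>b\<in>(Basis::'e set). c b + d b)" by (rule sum_nonneg) (simp add: c(1) d(1))
  \<comment> \<open>Estimates for the basis vectors are combined linearly.\<close>
  have comb: "norm (\<Sum>b\<in>Basis. (v \<bullet> b) *\<^sub>R Z b) \<le> L * norm v * t"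
    if "\<And>b. b \<in> Basis \<Longrightarrow> norm (Z b) \<le> (c b + d b) * t" "0 \<le> t" for Z :: "'e \<Rightarrow> 'e" and v :: 'e and t
  proof -
    have "norm (\<Sum>b\<in>Basis. (v \<bullet> b) *\<^sub>R Z b) \<le> (\<Sum>b\<in>Basis. norm v * ((c b + d b) * t))"
      by (rule sum_norm_le) (use that Basis_le_norm in \<open>auto intro!: mult_mono\<close>)
    also have "\<dots> = (\<Sum>b\<in>(Basis::'e set). c b + d b) * norm v * t"
      by (simp add: sum_distrib_left sum_distrib_right mult.commute mult.left_commute)
    also have "\<dots> \<le> L * norm v * t" unfolding L_def using that(2) by (intro mult_right_mono) auto
    finally show ?thesis .
  qed
  show thesis
  proof (rule that[of L])
    show "0 < L" unfolding L_def using nn by simp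
    fix y v assume y: "y \<in> ?K"
    have yU: "y \<in> U" using y U(2) by blast
    note Xy = linear_basis_expansion[OF X_lin[OF yU], of v]
    have "norm (X y v) \<le> L * norm v * 1" unfolding Xy
      by (rule comb) (use c(2)[OF y] d(1) in \<open>auto intro: add_increasing2\<close>)
    then show "norm (X y v) \<le> L * norm v" by simp
    show "norm (DX v y h) \<le> L * norm v * norm h" for h
      unfolding DX_expand[OF yU, of v]
    proof (rule comb)
      fix b :: 'e
      have "c b * norm h \<le> (c b + d b) * norm h" using d(1)[of b] by (intro mult_right_mono) auto
      then show "norm (DX b y h) \<le> (c b + d b) * norm h" using c(3)[OF y, of b h] by linarith
    qed simp
    fix z assume z: "z \<in> ?K"
    have zU: "z \<in> U" using z U(2) by blast
    note Xz = linear_basis_expansion[OF X_lin[OF zU], of v]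
    have e: "X z v - X y v = (\<Sum>b\<in>Basis. (v \<bullet> b) *\<^sub>R (X z b - X y b))"
      unfolding Xy Xz by (simp add: sum_subtractf scaleR_diff_right)
    show "norm (X z v - X y v) \<le> L * norm v * norm (z - y)" unfolding e
    proof (rule comb)
      fix b :: 'e
      have "c b * norm (z - y) \<le> (c b + d b) * norm (z - y)" using d(1)[of b] by (intro mult_right_mono) auto
      then show "norm (X z b - X y b) \<le> (c b + d b) * norm (z - y)" using c(4)[OF y z, of b] by linarith
    qed simp
    have e2: "X z v - X y v - DX v y (z - y) = (\<Sum>b\<in>Basis. (v \<bullet> b) *\<^sub>R (X z b - X y b - DX b y (z - y)))"
      unfolding e DX_expand[OF yU, of v] by (simp add: sum_subtractf scaleR_diff_right)
    show "norm (X z v - X y v - DX v y (z - y)) \<le> L * norm v * (norm (z - y))\<^sup>2" unfolding e2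
    proof (rule comb)
      fix b :: 'e
      have "d b * (norm (z - y))\<^sup>2 \<le> (c b + d b) * (norm (z - y))\<^sup>2" using c(1)[of b] by (intro mult_right_mono) auto
      then show "norm (X z b - X y b - DX b y (z - y)) \<le> (c b + d b) * (norm (z - y))\<^sup>2"
        using d(2)[OF y z, of b] by linarith
    qed simp
  qed
qed

text \<open>Along the curve the sum of the norms satisfies a linear differential inequality, and it vanishes
  at \<open>y0\<close>.\<close>

lemma \<eta>_vanishes_along:
  assumes t0: "t0 \<in> {a..b}" "w t0 = y0"
    and w: "\<And>t. t \<in> {a..b} \<Longrightarrow> (w has_vector_derivative w' t) (at t within {a..b})"
    and K: "\<And>t. t \<in> {a..b} \<Longrightarrow> w t \<in> cball y0 r"
    and bnd: "\<And>g t. g \<in> G \<Longrightarrow> t \<in> {a..b} \<Longrightarrow>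
       norm (frechet_derivative (\<eta> g) (at (w t)) (w' t)) \<le> c * (\<Sum>h\<in>G. norm (\<eta> h (w t)))"
    and c: "0 \<le> c" "real (card G) * (c * (b - a)) \<le> 1 / 2" and t: "t \<in> {a..b}"
  shows "(\<Sum>h\<in>G. norm (\<eta> h (w t))) = 0"
proof -
  have "(\<Sum>h\<in>G. norm (\<eta> h (w t))) \<le> 2 * real (card G) * 0 * (b - a)"
  proof (rule gronwall_short[OF G t0(1), where f="\<lambda>g t. \<eta> g (w t)"])
    fix g t assume g: "g \<in> G" and t: "t \<in> {a..b}"
    have "w t \<in> U" using K[OF t] U(2) by blast
    from has_derivative_compose[OF w[OF t, unfolded has_vector_derivative_def] Cinf_has_derivative[OF \<eta>_smooth[OF g] this]]
    show "((\<lambda>t. \<eta> g (w t)) has_vector_derivative frechet_derivative (\<eta> g) (at (w t)) (w' t)) (at t within {a..b})"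
      unfolding has_vector_derivative_def
      using Cinf_linear_frechet[OF \<eta>_smooth[OF g] \<open>w t \<in> U\<close>] by (simp add: linear_cmul)
  qed (use bnd \<eta>_y0 t0(2) c t in auto)
  moreover have "0 \<le> (\<Sum>h\<in>G. norm (\<eta> h (w t)))" by (rule sum_nonneg) simp
  ultimately show ?thesis by simp
qed

text \<open>The curves \<open>E v\<close> replace the flow of \<open>X v\<close>. Their end points form the leaf through \<open>y0\<close>,
  parametrised by \<open>v\<close>. To differentiate the end points, \<open>E (v + k)\<close> is compared with the curve
  \<open>E v s + s *\<^sub>R X (E v s) k\<close>: as the fields commute along \<open>E v\<close>, the latter solves the equation of
  \<open>E (v + k)\<close> up to an error that is quadratic in \<open>k\<close>.\<close>

lemma radial_curves:
  obtains \<rho> E where "0 < \<rho>" "\<And>v. norm v < \<rho> \<Longrightarrow> E v 0 = y0"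
    "\<And>v s. norm v < \<rho> \<Longrightarrow> s \<in> {0..1} \<Longrightarrow> E v s \<in> cball y0 r"
    "\<And>v s. norm v < \<rho> \<Longrightarrow> s \<in> {0..1} \<Longrightarrow> (E v has_vector_derivative X (E v s) v) (at s within {0..1::real})"
    "\<And>v. norm v < \<rho> \<Longrightarrow> ((\<lambda>v. E v 1) has_derivative X (E v 1)) (at v)"
proof -
  obtain L where L: "0 < L" "\<And>y v. y \<in> cball y0 r \<Longrightarrow> norm (X y v) \<le> L * norm v"
    "\<And>y v h. y \<in> cball y0 r \<Longrightarrow> norm (DX v y h) \<le> L * norm v * norm h"
    "\<And>y z v. y \<in> cball y0 r \<Longrightarrow> z \<in> cball y0 r \<Longrightarrow> norm (X z v - X y v) \<le> L * norm v * norm (z - y)"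
    "\<And>y z v. y \<in> cball y0 r \<Longrightarrow> z \<in> cball y0 r \<Longrightarrow>
       norm (X z v - X y v - DX v y (z - y)) \<le> L * norm v * (norm (z - y))\<^sup>2"
    by (rule bounds) (rule that; assumption)
  define c where "c = real (card G) * C"
  have c: "0 \<le> c" unfolding c_def using C by simp
  define \<rho> where "\<rho> = min (1 / (2 * L)) (min (r / (2 * L)) (1 / (2 * (c + 1))))"
  have \<rho>: "0 < \<rho>" unfolding \<rho>_def using L(1) r c by simp
  have \<rho>L: "L * t \<le> 1 / 2" "L * t \<le> r / 2" "c * t \<le> 1 / 2" if "t < \<rho>" "0 \<le> t" for t
  proof -
    have t: "t \<le> 1 / (2 * L)" "t \<le> r / (2 * L)" "t \<le> 1 / (2 * (c + 1))" using that(1) unfolding \<rho>_def by auto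
    show "L * t \<le> 1 / 2" "L * t \<le> r / 2" using t(1,2) L(1) by (simp_all add: field_simps)
    have "(c + 1) * t \<le> 1 / 2" using t(3) c by (simp add: field_simps)
    then show "c * t \<le> 1 / 2" using that(2) by (simp add: algebra_simps)
  qed
  have half: "y \<in> cball y0 r" if "y \<in> cball y0 (r / 2)" for y using that r by simp
  have "\<exists>E. E 0 = y0 \<and> (\<forall>s\<in>{0..1}. E s \<in> cball y0 (r / 2)) \<and>
      (\<forall>s\<in>{0..1}. (E has_vector_derivative X (E s) v) (at s within {0..1::real}))" if v: "norm v < \<rho>" for v
  proof -
    have 1: "norm (X y v) \<le> r / 2" if "y \<in> cball y0 (r / 2)" for y
      using L(2)[OF half[OF that], of v] \<rho>L(2)[OF v] by simp
    have 2: "norm (X y v - X z v) \<le> 1 / 2 * norm (y - z)" if "y \<in> cball y0 (r / 2)" "z \<in> cball y0 (r / 2)" for y z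
    proof -
      have "norm (X y v - X z v) \<le> L * norm v * norm (y - z)" by (rule L(4)[OF half[OF that(2)] half[OF that(1)]])
      also have "\<dots> \<le> 1 / 2 * norm (y - z)" using \<rho>L(1)[OF v] by (intro mult_right_mono) auto
      finally show ?thesis .
    qed
    obtain E where "E 0 = y0" "\<And>s. s \<in> {0..1} \<Longrightarrow> E s \<in> cball y0 (r / 2)"
      "\<And>s. s \<in> {0..1} \<Longrightarrow> (E has_vector_derivative X (E s) v) (at s within {0..1::real})"
      by (rule picard_unit_interval[of "r / 2" y0 "\<lambda>y. X y v"]) (use r 1 2 in auto)
    then show ?thesis by blast
  qed
  then obtain E where E0: "\<And>v. norm v < \<rho> \<Longrightarrow> E v 0 = y0"
    and EK: "\<And>v s. norm v < \<rho> \<Longrightarrow> s \<in> {0..1} \<Longrightarrow> E v s \<in> cball y0 (r / 2)"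
    and Ed: "\<And>v s. norm v < \<rho> \<Longrightarrow> s \<in> {0..1} \<Longrightarrow> (E v has_vector_derivative X (E v s) v) (at s within {0..1::real})"
    by metis
  have E\<eta>: "(\<Sum>h\<in>G. norm (\<eta> h (E v s))) = 0" if v: "norm v < \<rho>" and s: "s \<in> {0..1}" for v s
  proof (rule \<eta>_vanishes_along[where w'="\<lambda>s. X (E v s) v" and c="C * norm v" and a=0 and b=1 and ?t0.0=0])
    show "real (card G) * (C * norm v * (1 - 0)) \<le> 1 / 2"
      using \<rho>L(3)[OF v] unfolding c_def by (simp add: mult.assoc)
    fix t :: real assume "t \<in> {0..1}"
    then show "E v t \<in> cball y0 r" by (rule half[OF EK[OF v]])
    then show "norm (frechet_derivative (\<eta> g) (at (E v t)) (X (E v t) v)) \<le> C * norm v * (\<Sum>h\<in>G. norm (\<eta> h (E v t)))"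
      if "g \<in> G" for g by (rule \<eta>_deriv[OF that])
  qed (use E0[OF v] Ed[OF v] s C in auto)
  have "((\<lambda>v. E v 1) has_derivative X (E v 1)) (at v)" if v: "norm v < \<rho>" for v
  proof (rule has_derivative_of_quadratic_bound[where d="min \<rho> (\<rho> - norm v)" and K="2 * (L * \<rho> * L\<^sup>2 + L * L)"])
    have one: "(1::real) \<in> {0..1}" by simp
    have "E v 1 \<in> U" using half[OF EK[OF v one]] U(2) by blast
    then show "bounded_linear (X (E v 1))" using X_lin linear_conv_bounded_linear by blast
    show "0 < min \<rho> (\<rho> - norm v)" using \<rho> v by simp
    fix k :: 'e assume k: "norm k < min \<rho> (\<rho> - norm v)"
    have vk: "norm (v + k) < \<rho>" using norm_triangle_ineq[of v k] k by linarith
    have k\<rho>: "norm k < \<rho>" using order_less_le_trans[OF k min.cobounded1] .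
    let ?z = "\<lambda>s. E v s + s *\<^sub>R X (E v s) k"
    let ?z' = "\<lambda>s. X (E v s) v + (X (E v s) k + s *\<^sub>R DX k (E v s) (X (E v s) v))"
    let ?d = "\<lambda>s. E (v + k) s - ?z s"
    have "norm (?d 1) \<le> 2 * ((L * \<rho> * L\<^sup>2 + L * L) * (norm k)\<^sup>2) * (1 - 0)"
    proof (rule gronwall_short_single[where ?t0.0=0 and C="1 / 2" and f'="\<lambda>s. X (E (v + k) s) (v + k) - ?z' s"])
      fix s :: real assume s: "s \<in> {0..1}"
      have EU: "E v s \<in> U" using half[OF EK[OF v s]] U(2) by blast
      note EsK = half[OF EK[OF v s]]
      have dXk: "((\<lambda>s. X (E v s) k) has_vector_derivative DX k (E v s) (X (E v s) v)) (at s within {0..1})"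
        using has_derivative_compose[OF Ed[OF v s, unfolded has_vector_derivative_def] Cinf_has_derivative[OF X_smooth EU]]
          DX_linear2[OF EU]
        unfolding has_vector_derivative_def by (simp add: linear_cmul)
      have "(?z has_vector_derivative X (E v s) v + (s *\<^sub>R DX k (E v s) (X (E v s) v) + 1 *\<^sub>R X (E v s) k)) (at s within {0..1})"
        by (intro has_vector_derivative_add Ed[OF v s] has_vector_derivative_scaleR[OF DERIV_ident dXk])
      then have "(?z has_vector_derivative ?z' s) (at s within {0..1})" by (simp add: add.commute)
      then show "(?d has_vector_derivative X (E (v + k) s) (v + k) - ?z' s) (at s within {0..1})"
        by (rule has_vector_derivative_diff[OF Ed[OF vk s]])
      have Xk: "norm (X (E v s) k) \<le> L * norm k" by (rule L(2)[OF EsK])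
      have sXk: "norm (s *\<^sub>R X (E v s) k) \<le> L * norm k"
        using mult_mono[of "\<bar>s\<bar>" 1 "norm (X (E v s) k)" "L * norm k"] s Xk by simp
      have zK: "?z s \<in> cball y0 r"
      proof -
        have "norm (s *\<^sub>R X (E v s) k) \<le> r / 2" using sXk \<rho>L(2)[OF k\<rho>] by simp
        moreover have "norm (E v s - y0) \<le> r / 2" using EK[OF v s] by (simp add: dist_norm norm_minus_commute)
        moreover have "norm (?z s - y0) \<le> norm (E v s - y0) + norm (s *\<^sub>R X (E v s) k)"
          using norm_triangle_ineq[of "E v s - y0" "s *\<^sub>R X (E v s) k"] by (simp add: algebra_simps)
        ultimately show ?thesis by (simp add: dist_norm norm_minus_commute)
      qed
      have zE: "?z s - E v s = s *\<^sub>R X (E v s) k" by simp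
      have br: "DX v (E v s) (X (E v s) k) = DX k (E v s) (X (E v s) v)"
        by (rule bracket[OF EsK E\<eta>[OF v s]])
      have dl: "DX (v + k) (E v s) h = DX v (E v s) h + DX k (E v s) h"
        "DX (k + v) (E v s) h = DX v (E v s) h + DX k (E v s) h" for h
        using linear_add[OF DX_linear[OF EU], of v k h] by (simp_all add: add.commute[of k v])
      \<comment> \<open>The first order terms cancel because the fields commute along the curve.\<close>
      have e1: "X (E (v + k) s) (v + k) - ?z' s = (X (E (v + k) s) (v + k) - X (?z s) (v + k))
         + (X (?z s) (v + k) - X (E v s) (v + k) - DX (v + k) (E v s) (?z s - E v s))
         + s *\<^sub>R DX k (E v s) (X (E v s) k)"
        unfolding zE using X_lin[OF EU] DX_linear2[OF EU] br
        by (simp add: linear_add linear_cmul dl scaleR_add_right algebra_simps)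
      have "norm (X (E (v + k) s) (v + k) - ?z' s) \<le> norm (X (E (v + k) s) (v + k) - X (?z s) (v + k))
         + norm (X (?z s) (v + k) - X (E v s) (v + k) - DX (v + k) (E v s) (?z s - E v s))
         + norm (s *\<^sub>R DX k (E v s) (X (E v s) k))"
        unfolding e1 by (rule norm_triangle_le[OF add_right_mono[OF norm_triangle_ineq]])
      also have "\<dots> \<le> 1 / 2 * norm (?d s) + L * \<rho> * L\<^sup>2 * (norm k)\<^sup>2 + L * L * (norm k)\<^sup>2"
      proof (intro add_mono)
        have "norm (X (E (v + k) s) (v + k) - X (?z s) (v + k)) \<le> L * norm (v + k) * norm (?d s)"
          by (rule L(4)[OF zK half[OF EK[OF vk s]]])
        also have "\<dots> \<le> 1 / 2 * norm (?d s)" using \<rho>L(1)[OF vk] by (intro mult_right_mono) auto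
        finally show "norm (X (E (v + k) s) (v + k) - X (?z s) (v + k)) \<le> 1 / 2 * norm (?d s)" .
        have "norm (X (?z s) (v + k) - X (E v s) (v + k) - DX (v + k) (E v s) (?z s - E v s))
            \<le> L * norm (v + k) * (norm (?z s - E v s))\<^sup>2"
          by (rule L(5)[OF EsK zK])
        also have "\<dots> \<le> L * \<rho> * (L * norm k)\<^sup>2"
          unfolding zE using sXk vk L(1) \<rho> by (intro mult_mono power_mono) auto
        finally show "norm (X (?z s) (v + k) - X (E v s) (v + k) - DX (v + k) (E v s) (?z s - E v s))
            \<le> L * \<rho> * L\<^sup>2 * (norm k)\<^sup>2" by (simp add: power_mult_distrib mult.assoc)
        have "norm (DX k (E v s) (X (E v s) k)) \<le> L * norm k * norm (X (E v s) k)" by (rule L(3)[OF EsK])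
        also have "\<dots> \<le> L * norm k * (L * norm k)" using Xk L(1) by (intro mult_left_mono) auto
        finally have "norm (DX k (E v s) (X (E v s) k)) \<le> L * L * (norm k)\<^sup>2"
          by (simp add: power2_eq_square algebra_simps)
        then show "norm (s *\<^sub>R DX k (E v s) (X (E v s) k)) \<le> L * L * (norm k)\<^sup>2"
          using mult_mono[of "\<bar>s\<bar>" 1 "norm (DX k (E v s) (X (E v s) k))"] s by simp
      qed
      finally show "norm (X (E (v + k) s) (v + k) - ?z' s) \<le> 1 / 2 * norm (?d s) + (L * \<rho> * L\<^sup>2 + L * L) * (norm k)\<^sup>2"
        by (simp add: algebra_simps)
    qed (use E0[OF v] E0[OF vk] L(1) \<rho> in auto)
    then show "norm (E (v + k) 1 - E v 1 - X (E v 1) k) \<le> 2 * (L * \<rho> * L\<^sup>2 + L * L) * (norm k)\<^sup>2"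
      by (simp only: diff_diff_eq scaleR_one diff_zero mult_1_right mult.assoc)
  qed
  from that[OF \<rho> E0 half[OF EK] Ed this] show thesis .
qed

text \<open>The curve \<open>w\<close> and the curve of the end points of the radial curves in direction \<open>Q (w t - y0)\<close>
  both solve \<open>y' = X y (w' t)\<close>, and both are at \<open>y0\<close> at time \<open>t0\<close>. The rate \<open>S\<close> in the proof is so
  large that on an interval of radius \<open>1 / S\<close> all smallness conditions hold at once.\<close>

lemma tangent_curve_radial:
  assumes t0: "t0 \<in> {a..b}" "w t0 = y0"
    and w: "\<And>t. t \<in> {a..b} \<Longrightarrow> (w has_vector_derivative w' t) (at t within {a..b})"
    and M: "\<And>t. t \<in> {a..b} \<Longrightarrow> norm (w' t) \<le> M"
    and c: "0 \<le> c" "\<And>g t. g \<in> G \<Longrightarrow> t \<in> {a..b} \<Longrightarrow> w t \<in> cball y0 r \<Longrightarrow>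
       norm (frechet_derivative (\<eta> g) (at (w t)) (w' t)) \<le> c * (\<Sum>h\<in>G. norm (\<eta> h (w t)))"
    and wX: "\<And>t. t \<in> {a..b} \<Longrightarrow> w t \<in> cball y0 r \<Longrightarrow> (\<Sum>h\<in>G. norm (\<eta> h (w t))) = 0 \<Longrightarrow>
       w' t = X (w t) (w' t)"
  shows "\<exists>d>0. \<forall>t\<in>{a..b}. \<bar>t - t0\<bar> < d \<longrightarrow> (\<exists>v E. E 0 = y0 \<and> E 1 = w t \<and> (\<forall>s\<in>{0..1}.
     E s \<in> cball y0 r \<and> (E has_vector_derivative X (E s) v) (at s within {0..1::real})))"
proof -
  obtain \<rho> E where \<rho>: "0 < \<rho>" and E: "\<And>v. norm v < \<rho> \<Longrightarrow> E v 0 = y0"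
    "\<And>v s. norm v < \<rho> \<Longrightarrow> s \<in> {0..1} \<Longrightarrow> E v s \<in> cball y0 r"
    "\<And>v s. norm v < \<rho> \<Longrightarrow> s \<in> {0..1} \<Longrightarrow> (E v has_vector_derivative X (E v s) v) (at s within {0..1::real})"
    "\<And>v. norm v < \<rho> \<Longrightarrow> ((\<lambda>v. E v 1) has_derivative X (E v 1)) (at v)"
    by (rule radial_curves) (rule that; assumption)
  obtain L where L: "0 < L"
    "\<And>y z v. y \<in> cball y0 r \<Longrightarrow> z \<in> cball y0 r \<Longrightarrow> norm (X z v - X y v) \<le> L * norm v * norm (z - y)"
    by (rule bounds) (rule that; assumption)
  obtain B where B: "0 < B" "\<And>h. norm (Q h) \<le> B * norm h"
    using linear_bounded_pos[OF Q_lin] by blast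
  have M0: "0 \<le> M" using M[OF t0(1)] norm_ge_zero order_trans by blast
  let ?N = "real (card G)"
  define S where "S = M / r + B * M / \<rho> + 4 * ?N * c + 4 * L * M + 1"
  have parts: "0 \<le> M / r" "0 \<le> B * M / \<rho>" "0 \<le> 4 * ?N * c" "0 \<le> 4 * L * M"
    using M0 r B(1) \<rho> c(1) L(1) by auto
  have S: "0 < S" unfolding S_def using parts by linarith
  define d where "d = 1 / S"
  have d: "0 < d" unfolding d_def using S by simp
  have Sd: "S * d = 1" unfolding d_def using S by simp
  have small: "x * d \<le> 1" if "0 \<le> x" "x \<le> S" for x
    using mult_right_mono[OF that(2), of d] d Sd by simp
  have strict: "x * d < 1" if "0 \<le> x" "x < S" for x
    using mult_strict_right_mono[OF that(2) d] Sd by simp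
  have dM: "M * d \<le> r" "B * M * d < \<rho>" "?N * c * (2 * d) \<le> 1 / 2" "L * M * (2 * d) \<le> 1 / 2"
  proof -
    have "M / r * d \<le> 1" by (rule small) (use parts in \<open>auto simp: S_def\<close>)
    then show "M * d \<le> r" using r by (simp add: field_simps)
    have "B * M / \<rho> < S" unfolding S_def using parts by linarith
    then have "B * M / \<rho> * d < 1" by (rule strict[OF parts(2)])
    then show "B * M * d < \<rho>" using \<rho> by (simp add: field_simps)
    have "4 * ?N * c * d \<le> 1" by (rule small) (use parts in \<open>auto simp: S_def\<close>)
    then show "?N * c * (2 * d) \<le> 1 / 2" by simp
    have "4 * L * M * d \<le> 1" by (rule small) (use parts in \<open>auto simp: S_def\<close>)
    then show "L * M * (2 * d) \<le> 1 / 2" by simp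
  qed
  define a' b' where "a' = max a (t0 - d)" and "b' = min b (t0 + d)"
  have J: "{a'..b'} \<subseteq> {a..b}" "\<And>t. t \<in> {a'..b'} \<Longrightarrow> \<bar>t - t0\<bar> \<le> d" "t0 \<in> {a'..b'}"
    using t0(1) d unfolding a'_def b'_def by auto
  have len: "b' - a' \<le> 2 * d" "0 \<le> b' - a'" using J(3) unfolding a'_def b'_def by auto
  have wJ: "(w has_vector_derivative w' t) (at t within {a'..b'})" if "t \<in> {a'..b'}" for t
    using has_vector_derivative_within_subset[OF w J(1)] J(1) that by blast
  have near: "norm (w t - y0) \<le> M * d" if t: "t \<in> {a'..b'}" for t
  proof -
    have "norm (w t - w t0) \<le> M * \<bar>t - t0\<bar>"
      by (rule has_vector_derivative_bound[OF wJ _ J(3) t]) (use M J(1) in auto)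
    also have "\<dots> \<le> M * d" using J(2)[OF t] M0 by (rule mult_left_mono)
    finally show ?thesis using t0(2) by simp
  qed
  have wK: "w t \<in> cball y0 r" if "t \<in> {a'..b'}" for t
    using near[OF that] dM(1) by (simp add: dist_norm norm_minus_commute)
  have w\<eta>: "(\<Sum>h\<in>G. norm (\<eta> h (w t))) = 0" if t: "t \<in> {a'..b'}" for t
  proof (rule \<eta>_vanishes_along[OF J(3) t0(2) wJ wK _ c(1) _ t])
    have "?N * c * (b' - a') \<le> ?N * c * (2 * d)" using len c(1) by (intro mult_left_mono) auto
    then show "?N * (c * (b' - a')) \<le> 1 / 2" unfolding mult.assoc[symmetric] using dM(3) by linarith
  qed (use c(2) J(1) wK in auto)
  let ?v = "\<lambda>t. Q (w t - y0)"
  have v: "norm (?v t) < \<rho>" if t: "t \<in> {a'..b'}" for t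
  proof -
    have "norm (?v t) \<le> B * (M * d)"
      by (rule order_trans[OF B(2) mult_left_mono[OF near[OF t]]]) (use B(1) in simp)
    then show ?thesis using dM(2) by (simp add: mult.assoc)
  qed
  have fin: "E (?v t) 1 = w t" if t: "t \<in> {a'..b'}" for t
  proof -
    have one: "(1::real) \<in> {0..1}" by simp
    have "norm (E (?v t) 1 - w t) \<le> 2 * 0 * (b' - a')"
    proof (rule gronwall_short_single[OF J(3), where C="L * M" and f'="\<lambda>t. X (E (?v t) 1) (w' t) - X (w t) (w' t)"])
      fix t assume t: "t \<in> {a'..b'}"
      have "((\<lambda>t. w t - y0) has_derivative (\<lambda>h. h *\<^sub>R w' t)) (at t within {a'..b'})"
        using has_derivative_diff[OF wJ[OF t, unfolded has_vector_derivative_def] has_derivative_const, of y0] by simp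
      from has_derivative_compose[OF has_derivative_compose[OF this linear_imp_has_derivative[OF Q_lin]] E(4)[OF v[OF t]]]
      have "((\<lambda>t. E (?v t) 1) has_derivative (\<lambda>h. X (E (?v t) 1) (Q (h *\<^sub>R w' t)))) (at t within {a'..b'})" .
      moreover have EU: "E (?v t) 1 \<in> U" using E(2)[OF v[OF t] one] U(2) by blast
      ultimately have "((\<lambda>t. E (?v t) 1) has_vector_derivative X (E (?v t) 1) (w' t)) (at t within {a'..b'})"
        unfolding has_vector_derivative_def using X_lin[OF EU] X_Q[OF EU] by (simp add: linear_cmul)
      moreover have "(w has_vector_derivative X (w t) (w' t)) (at t within {a'..b'})"
        using wJ[OF t] wX[OF subsetD[OF J(1) t] wK[OF t] w\<eta>[OF t]] by simp
      ultimately show "((\<lambda>t. E (?v t) 1 - w t) has_vector_derivative X (E (?v t) 1) (w' t) - X (w t) (w' t))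
          (at t within {a'..b'})" by (rule has_vector_derivative_diff)
      have "norm (X (E (?v t) 1) (w' t) - X (w t) (w' t)) \<le> L * norm (w' t) * norm (E (?v t) 1 - w t)"
        by (rule L(2)[OF wK[OF t] E(2)[OF v[OF t] one]])
      also have "\<dots> \<le> L * M * norm (E (?v t) 1 - w t)"
        using M[OF subsetD[OF J(1) t]] L(1) by (intro mult_right_mono mult_left_mono) auto
      finally show "norm (X (E (?v t) 1) (w' t) - X (w t) (w' t)) \<le> L * M * norm (E (?v t) 1 - w t) + 0" by simp
    next
      have Q0: "?v t0 = 0" using t0(2) linear_0[OF Q_lin] by simp
      have z: "norm (0::'e) < \<rho>" using \<rho> by simp
      have "norm (E 0 1 - E 0 0) \<le> 0 * \<bar>1 - 0\<bar>"
      proof (rule has_vector_derivative_bound[OF E(3)[OF z]])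
        fix s :: real assume s: "s \<in> {0..1}"
        have "E 0 s \<in> U" using E(2)[OF z s] U(2) by blast
        then show "norm (X (E 0 s) 0) \<le> 0" using linear_0[OF X_lin] by simp
      qed auto
      then show "E (?v t0) 1 - w t0 = 0" unfolding Q0 using E(1)[OF z] t0(2) by simp
      have "L * M * (b' - a') \<le> L * M * (2 * d)" using len L(1) M0 by (intro mult_left_mono) auto
      then show "L * M * (b' - a') \<le> 1 / 2" using dM(4) by linarith
    qed (use L(1) M0 t in auto)
    then show ?thesis by simp
  qed
  show ?thesis
  proof (intro exI[of _ d] conjI d ballI impI)
    fix t assume t: "t \<in> {a..b}" "\<bar>t - t0\<bar> < d"
    have tJ: "t \<in> {a'..b'}" using t unfolding a'_def b'_def by auto
    show "\<exists>v E. E 0 = y0 \<and> E 1 = w t \<and> (\<forall>s\<in>{0..1}.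
     E s \<in> cball y0 r \<and> (E has_vector_derivative X (E s) v) (at s within {0..1::real}))"
      by (intro exI[of _ "?v t"] exI[of _ "E (?v t)"])
        (use fin[OF tJ] E(1-3)[OF v[OF tJ]] in auto)
  qed
qed

end

section \<open>Leaves of a singular foliation\<close>

lemma Cinf_linear_field:
  assumes "open U" "\<And>b. Cinf U (\<lambda>y. L y b)" "Cinf U a" "\<And>y. y \<in> U \<Longrightarrow> linear (L y)"
  shows "Cinf U (\<lambda>y. L y (a y :: 'e::euclidean_space) :: 'f::euclidean_space)"
proof -
  have "Cinf U (\<lambda>y. \<Sum>b\<in>Basis. (a y \<bullet> b) *\<^sub>R L y b)"
    by (intro Cinf_sum Cinf_scaleR Cinf_inner_const assms)
  then show ?thesis
    by (rule Cinf_cong[OF assms(1), rotated]) (rule linear_basis_expansion[OF assms(4), symmetric])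
qed

lemma frechet_linear_compose:
  assumes "linear L" "Cinf U f" "y \<in> U"
  shows "frechet_derivative (\<lambda>y. L (f y)) (at y) h = L (frechet_derivative f (at y) h)"
proof -
  have "((\<lambda>y. L (f y)) has_derivative (\<lambda>h. L (frechet_derivative f (at y) h))) (at y)"
    by (rule has_derivative_compose[OF Cinf_has_derivative[OF assms(2,3)] linear_imp_has_derivative[OF assms(1)]])
  from fun_cong[OF frechet_derivative_at[OF this], of h] show ?thesis by (rule sym)
qed

lemma frechet_const_on:
  assumes "open U" "y \<in> U" "\<And>z. z \<in> U \<Longrightarrow> f z = c"
  shows "frechet_derivative f (at y) h = 0"
proof -
  have "(f has_derivative (\<lambda>h. 0)) (at y)"
    by (rule has_derivative_transform_within_open[OF has_derivative_const[of c] assms(1,2)]) (simp add: assms(3))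
  from fun_cong[OF frechet_derivative_at[OF this], of h] show ?thesis by (rule sym)
qed

context smooth_mfd
begin

lemma vec_fieldD:
  assumes "X \<in> vec_fields A UNIV"
  shows "X p \<in> tangent_space A p" "f \<in> smooth_funs A \<Longrightarrow> (\<lambda>p. X p f) \<in> smooth_funs A"
  using assms unfolding vec_fields_def smooth_funs_def by auto

text \<open>Only the composition of the curve with smooth functions is known to be differentiable; bump
  functions turn this into continuity.\<close>

lemma integral_curve_continuous:
  assumes ic: "\<And>f. f \<in> smooth_funs A \<Longrightarrow> continuous (at t within T) (\<lambda>s. f (\<gamma> s))"
  shows "continuous (at t within T) \<gamma>"
  unfolding continuous_within
proof (rule topological_tendstoI)
  fix W assume W: "open W" "\<gamma> t \<in> W"
  obtain \<kappa> N C where k: "\<kappa> \<in> smooth_funs A" "\<gamma> t \<in> N" "\<And>x. x \<in> N \<Longrightarrow> \<kappa> x = 1"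
    "C \<subseteq> W" "\<And>x. x \<notin> C \<Longrightarrow> \<kappa> x = 0"
    by (rule bump_function[OF W]) (rule that; assumption)
  have "((\<lambda>s. \<kappa> (\<gamma> s)) \<longlongrightarrow> 1) (at t within T)"
    using ic[OF k(1)] k(3)[OF k(2)] unfolding continuous_within by simp
  then have "\<forall>\<^sub>F s in at t within T. \<kappa> (\<gamma> s) > 0" by (rule order_tendstoD) simp
  then show "\<forall>\<^sub>F s in at t within T. \<gamma> s \<in> W"
    by eventually_elim (use k(4,5) in force)
qed

end

context mfd_param
begin

lemma curve_tv:
  assumes w: "(w has_vector_derivative w') (at t within T)" and y: "w t \<in> S" and f: "f \<in> smooth_funs A"
  shows "((\<lambda>s. f (\<psi> (w s))) has_real_derivative tv (w t) w' f) (at t within T)"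
proof -
  have "((\<lambda>s. f (\<psi> (w s))) has_derivative
      (\<lambda>h. frechet_derivative (\<lambda>z. f (\<psi> z)) (at (w t)) (h *\<^sub>R w'))) (at t within T)"
    by (rule has_derivative_compose[OF w[unfolded has_vector_derivative_def] pull_derivative[OF f y]])
  then show ?thesis
    unfolding has_field_derivative_def tv_apply[OF f]
    using Cinf_linear_frechet[OF smooth_funs_pull[OF f] y] by (simp add: linear_cmul mult_commute_abs)
qed

lemma coords_curve:
  assumes t: "t \<in> T" and v: "v \<in> tangent_space A (\<gamma> t)" and S: "\<gamma> t \<in> \<psi> ` S"
    and der: "\<And>f. f \<in> smooth_funs A \<Longrightarrow> ((\<lambda>s. f (\<gamma> s)) has_real_derivative v f) (at t within T)"
  shows "((\<lambda>s. \<phi> (\<gamma> s)) has_vector_derivative coords (\<phi> (\<gamma> t)) v) (at t within T)"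
proof -
  have y: "\<phi> (\<gamma> t) \<in> S" and py: "\<psi> (\<phi> (\<gamma> t)) = \<gamma> t" using S \<phi>_mem \<psi>\<phi> by auto
  obtain x N where x: "\<And>b. x b \<in> smooth_funs A" and N: "open N" "\<gamma> t \<in> N" "N \<subseteq> \<psi> ` S"
    "\<And>b q. q \<in> N \<Longrightarrow> x b q = \<phi> q \<bullet> b"
    using coordinate_functions[OF y] unfolding py by blast
  have cont: "continuous (at t within T) \<gamma>"
    by (rule integral_curve_continuous) (rule DERIV_continuous[OF der])
  then have "\<forall>\<^sub>F s in at t within T. \<gamma> s \<in> N" using N(1,2) unfolding continuous_within by (rule topological_tendstoD)
  then obtain d where d: "d > 0" "\<And>s. s \<in> T \<Longrightarrow> s \<noteq> t \<Longrightarrow> dist s t < d \<Longrightarrow> \<gamma> s \<in> N"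
    unfolding eventually_at by auto
  have cv: "coords (\<phi> (\<gamma> t)) v = (\<Sum>b\<in>Basis. v (x b) *\<^sub>R b)"
    by (rule coords_coordinate[OF y _ x N(1)]) (use v N py in auto)
  have "((\<lambda>s. \<Sum>b\<in>Basis. x b (\<gamma> s) *\<^sub>R b) has_derivative (\<lambda>h. \<Sum>b\<in>Basis. (h *\<^sub>R v (x b)) *\<^sub>R b)) (at t within T)"
    by (intro has_derivative_sum has_derivative_scaleR_left)
      (use der[OF x] in \<open>simp add: has_field_derivative_def mult_commute_abs\<close>)
  moreover have "(\<Sum>b\<in>Basis. (h *\<^sub>R v (x b)) *\<^sub>R b) = h *\<^sub>R (\<Sum>b\<in>Basis. v (x b) *\<^sub>R b)" for h
    by (simp add: scaleR_sum_right)
  ultimately have 1: "((\<lambda>s. \<Sum>b\<in>Basis. x b (\<gamma> s) *\<^sub>R b) has_derivative (\<lambda>h. h *\<^sub>R coords (\<phi> (\<gamma> t)) v)) (at t within T)"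
    unfolding cv by simp
  have 2: "(\<Sum>b\<in>Basis. x b (\<gamma> s) *\<^sub>R b) = \<phi> (\<gamma> s)" if "s \<in> T" "dist s t < d" for s
  proof -
    have "\<gamma> s \<in> N" using d(2)[OF that(1) _ that(2)] N(2) by (cases "s = t") auto
    then show ?thesis using N(4) by (simp add: euclidean_representation)
  qed
  show ?thesis unfolding has_vector_derivative_def
    by (rule has_derivative_transform_within[OF 1 d(1) t 2])
qed

definition vf_coords :: "'a vec_field \<Rightarrow> 'e \<Rightarrow> 'e" where
  "vf_coords X y = coords y (X (\<psi> y))"

lemma vf_coords_smooth: "X \<in> vec_fields A UNIV \<Longrightarrow> Cinf S (vf_coords X)"
  unfolding vf_coords_def[abs_def] by (rule vec_field_coords_smooth)

lemma vf_coords_tv: "X \<in> vec_fields A UNIV \<Longrightarrow> y \<in> S \<Longrightarrow> tv y (vf_coords X y) = X (\<psi> y)"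
  unfolding vf_coords_def by (rule coords(2)[OF _ vec_fieldD(1)])

lemma P_cf: "X \<in> vec_fields A UNIV \<Longrightarrow> y \<in> S \<Longrightarrow> P (vf_coords X y) = vf_coords X y"
  unfolding vf_coords_def by (rule coords(1)[OF _ vec_fieldD(1)])

lemma vf_coords_P: "X \<in> vec_fields A UNIV \<Longrightarrow> y \<in> S \<Longrightarrow> vf_coords X (P y) = vf_coords X y"
  unfolding vf_coords_def using coords_P[of y "X (\<psi> y)"] vec_fieldD(1)[of X "\<psi> y"] \<psi>P by simp

lemma vf_coords_sum:
  assumes X: "\<And>i. i \<in> I \<Longrightarrow> X i \<in> vec_fields A UNIV" and y: "y \<in> S"
  shows "vf_coords (\<lambda>p f. \<Sum>i\<in>I. c i p * X i p f) y = (\<Sum>i\<in>I. c i (\<psi> y) *\<^sub>R vf_coords (X i) y)"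
proof -
  have "(\<Sum>i\<in>I. c i (\<psi> y) * X i (\<psi> y) f) = tv y (\<Sum>i\<in>I. c i (\<psi> y) *\<^sub>R vf_coords (X i) y) f" for f
  proof -
    have "tv y (\<Sum>i\<in>I. c i (\<psi> y) *\<^sub>R vf_coords (X i) y) f = (\<Sum>i\<in>I. tv y (c i (\<psi> y) *\<^sub>R vf_coords (X i) y) f)"
      using linear_sum[OF tv_linear[OF y, of f], of "\<lambda>i. c i (\<psi> y) *\<^sub>R vf_coords (X i) y" I] by simp
    also have "\<dots> = (\<Sum>i\<in>I. c i (\<psi> y) * X i (\<psi> y) f)"
    proof (rule sum.cong[OF refl])
      fix i assume "i \<in> I"
      then show "tv y (c i (\<psi> y) *\<^sub>R vf_coords (X i) y) f = c i (\<psi> y) * X i (\<psi> y) f"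
        using linear_cmul[OF tv_linear[OF y, of f], of "c i (\<psi> y)" "vf_coords (X i) y"] vf_coords_tv[OF X y] by simp
    qed
    finally show ?thesis ..
  qed
  then have "(\<lambda>f. \<Sum>i\<in>I. c i (\<psi> y) * X i (\<psi> y) f) = tv y (\<Sum>i\<in>I. c i (\<psi> y) *\<^sub>R vf_coords (X i) y)" by blast
  then have "vf_coords (\<lambda>p f. \<Sum>i\<in>I. c i p * X i p f) y = P (\<Sum>i\<in>I. c i (\<psi> y) *\<^sub>R vf_coords (X i) y)"
    unfolding vf_coords_def[of "\<lambda>p f. \<Sum>i\<in>I. c i p * X i p f"] using coords_tv[OF y] by simp
  also have "\<dots> = (\<Sum>i\<in>I. c i (\<psi> y) *\<^sub>R vf_coords (X i) y)"
    using P_lin P_cf[OF X y] by (simp add: linear_sum linear_cmul)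
  finally show ?thesis .
qed

text \<open>Both sides are compared by applying the bracket to coordinate functions.\<close>

lemma vf_coords_bracket:
  assumes X: "X \<in> vec_fields A UNIV" and Y: "Y \<in> vec_fields A UNIV"
    and XY: "lie_bracket X Y \<in> vec_fields A UNIV" and y: "y \<in> S"
  shows "vf_coords (lie_bracket X Y) y
    = frechet_derivative (vf_coords Y) (at y) (vf_coords X y) - frechet_derivative (vf_coords X) (at y) (vf_coords Y y)"
proof -
  obtain x N where x: "\<And>b. x b \<in> smooth_funs A" and N: "open N" "\<psi> y \<in> N" "N \<subseteq> \<psi> ` S"
    "\<And>b q. q \<in> N \<Longrightarrow> x b q = \<phi> q \<bullet> b"
    by (rule coordinate_functions[OF y]) (rule that; assumption)
  have c: "Z (\<psi> z) (x b) = vf_coords Z z \<bullet> b" if Z: "Z \<in> vec_fields A UNIV" and z: "z \<in> S \<inter> \<psi> -` N" and b: "b \<in> Basis" for Z z b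
  proof -
    have "vf_coords Z z = (\<Sum>b\<in>Basis. Z (\<psi> z) (x b) *\<^sub>R b)" unfolding vf_coords_def
      by (rule coords_coordinate[OF _ vec_fieldD(1)[OF Z] x N(1)]) (use z N in auto)
    then show ?thesis using b by simp
  qed
  have part: "X (\<psi> y) (\<lambda>q. Y q (x b)) = frechet_derivative (vf_coords Y) (at y) (vf_coords X y) \<bullet> b"
    if X: "X \<in> vec_fields A UNIV" and Y: "Y \<in> vec_fields A UNIV" and b: "b \<in> Basis" for X Y b
  proof -
    have "X (\<psi> y) (\<lambda>q. Y q (x b)) = frechet_derivative (\<lambda>z. Y (\<psi> z) (x b)) (at y) (vf_coords X y)"
      unfolding vf_coords_tv[OF X y, symmetric] tv_apply[OF vec_fieldD(2)[OF Y x]] ..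
    also have "((\<lambda>z. vf_coords Y z \<bullet> b) has_derivative (\<lambda>h. frechet_derivative (vf_coords Y) (at y) h \<bullet> b)) (at y)"
      by (rule has_derivative_inner_left[OF Cinf_has_derivative[OF vf_coords_smooth[OF Y] y]])
    then have "((\<lambda>z. Y (\<psi> z) (x b)) has_derivative (\<lambda>h. frechet_derivative (vf_coords Y) (at y) h \<bullet> b)) (at y)"
      by (rule has_derivative_transform_within_open[OF _ preimage_open[OF N(1)]])
        (use y N c[OF Y _ b] in auto)
    from fun_cong[OF frechet_derivative_at[OF this, symmetric]]
    have "frechet_derivative (\<lambda>z. Y (\<psi> z) (x b)) (at y) (vf_coords X y) = frechet_derivative (vf_coords Y) (at y) (vf_coords X y) \<bullet> b" .
    finally show ?thesis .
  qed
  show ?thesis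
  proof (rule euclidean_eqI)
    fix b :: 'e assume b: "b \<in> Basis"
    have "vf_coords (lie_bracket X Y) y \<bullet> b = lie_bracket X Y (\<psi> y) (x b)"
      using c[OF XY _ b, of y] y N(2) by simp
    also have "\<dots> = frechet_derivative (vf_coords Y) (at y) (vf_coords X y) \<bullet> b - frechet_derivative (vf_coords X) (at y) (vf_coords Y y) \<bullet> b"
      unfolding lie_bracket_def part[OF X Y b] part[OF Y X b] ..
    finally show "vf_coords (lie_bracket X Y) y \<bullet> b
      = (frechet_derivative (vf_coords Y) (at y) (vf_coords X y) - frechet_derivative (vf_coords X) (at y) (vf_coords Y y)) \<bullet> b"
      by (simp add: inner_diff_left)
  qed
qed

end

locale foliated_mfd = smooth_mfd A
  for A :: "('a::{second_countable_topology,t2_space}, 'e::euclidean_space) atlas" +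
  fixes F :: "'a vec_field set"
  assumes foliation: "singular_foliation A F"
begin

lemma F_field: "X \<in> F \<Longrightarrow> X \<in> vec_fields A UNIV"
  using foliation unfolding singular_foliation_def vec_fields_c_def by blast

lemma F_zero: "(\<lambda>p f. 0) \<in> F"
  and F_add: "X \<in> F \<Longrightarrow> Y \<in> F \<Longrightarrow> (\<lambda>p f. X p f + Y p f) \<in> F"
  and F_scale: "c \<in> smooth_funs A \<Longrightarrow> X \<in> F \<Longrightarrow> (\<lambda>p f. c p * X p f) \<in> F"
  and F_bracket: "X \<in> F \<Longrightarrow> Y \<in> F \<Longrightarrow> lie_bracket X Y \<in> F"
  and F_finite: "\<exists>U G. open U \<and> q \<in> U \<and> finite G \<and> G \<subseteq> vec_fields A U \<and>
        restrict_foliation U F = vf_span (smooth_funs_c A U) G"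
proof -
  note f = foliation[unfolded singular_foliation_def]
  show "(\<lambda>p f. 0) \<in> F" using f by (elim conjE)
  have f2: "\<forall>X\<in>F. \<forall>Y\<in>F. (\<lambda>p f. X p f + Y p f) \<in> F" using f by (elim conjE)
  have f3: "\<forall>c\<in>smooth_funs A. \<forall>X\<in>F. (\<lambda>p f. c p * X p f) \<in> F" using f by (elim conjE)
  have f4: "\<forall>X\<in>F. \<forall>Y\<in>F. lie_bracket X Y \<in> F" using f by (elim conjE)
  show "(\<lambda>p f. X p f + Y p f) \<in> F" if "X \<in> F" "Y \<in> F" by (rule bspec[OF bspec[OF f2 that(1)] that(2)])
  show "(\<lambda>p f. c p * X p f) \<in> F" if "c \<in> smooth_funs A" "X \<in> F"
    by (rule bspec[OF bspec[OF f3 that(1)] that(2)])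
  show "lie_bracket X Y \<in> F" if "X \<in> F" "Y \<in> F" by (rule bspec[OF bspec[OF f4 that(1)] that(2)])
  show "\<exists>U G. open U \<and> q \<in> U \<and> finite G \<and> G \<subseteq> vec_fields A U \<and>
        restrict_foliation U F = vf_span (smooth_funs_c A U) G" using f by (elim conjE) (rule spec)
qed

lemma F_sum:
  "(\<And>i. i \<in> I \<Longrightarrow> c i \<in> smooth_funs A) \<Longrightarrow> (\<And>i. i \<in> I \<Longrightarrow> X i \<in> F) \<Longrightarrow>
    (\<lambda>p f. \<Sum>i\<in>I. c i p * X i p f) \<in> F"
proof (induction I rule: infinite_finite_induct)
  case (insert i I)
  then show ?case using F_add[OF F_scale[of "c i" "X i"], of "\<lambda>p f. \<Sum>i\<in>I. c i p * X i p f"] by simp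
qed (simp_all add: F_zero)

lemma F_minus: "X \<in> F \<Longrightarrow> (\<lambda>p f. - X p f) \<in> F"
  using F_scale[OF smooth_funs_const[of "-1"]] by simp

lemma same_leaf_refl: "(p, p) \<in> same_leaf A F"
  by (simp add: same_leaf_def)

lemma same_leaf_trans: "(p, q) \<in> same_leaf A F \<Longrightarrow> (q, r) \<in> same_leaf A F \<Longrightarrow> (p, r) \<in> same_leaf A F"
  unfolding same_leaf_def by (rule rtrancl_trans)

lemma same_leaf_curve:
  "X \<in> F \<Longrightarrow> a \<le> b \<Longrightarrow> integral_curve A X a b \<gamma> \<Longrightarrow> (\<gamma> a, \<gamma> b) \<in> same_leaf A F"
  unfolding same_leaf_def by blast

text \<open>A reversed integral curve is an integral curve of the negative field.\<close>

lemma same_leaf_curve_reverse: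
  assumes X: "X \<in> F" and ab: "a \<le> b" and ic: "integral_curve A X a b \<gamma>"
  shows "(\<gamma> b, \<gamma> a) \<in> same_leaf A F"
proof -
  have "integral_curve A (\<lambda>p f. - X p f) a b (\<lambda>t. \<gamma> (a + b - t))"
    unfolding integral_curve_def
  proof (intro ballI)
    fix t f assume t: "t \<in> {a..b}" and f: "f \<in> smooth_funs A"
    have im: "(\<lambda>t. a + b - t) ` {a..b} = {a..b}"
    proof (intro equalityI subsetI)
      fix x assume "x \<in> {a..b}"
      then show "x \<in> (\<lambda>t. a + b - t) ` {a..b}" by (intro image_eqI[of _ _ "a + b - x"]) auto
    qed auto
    have "((\<lambda>s. f (\<gamma> s)) has_real_derivative X (\<gamma> (a + b - t)) f) (at (a + b - t) within (\<lambda>t. a + b - t) ` {a..b})"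
      unfolding im using ic t f unfolding integral_curve_def by simp
    moreover have "((\<lambda>t. a + b - t) has_real_derivative -1) (at t within {a..b})"
      by (auto intro!: derivative_eq_intros)
    ultimately have "((\<lambda>s. f (\<gamma> s)) \<circ> (\<lambda>t. a + b - t) has_real_derivative X (\<gamma> (a + b - t)) f * (-1)) (at t within {a..b})"
      by (rule DERIV_image_chain)
    then show "((\<lambda>s. f (\<gamma> (a + b - s))) has_real_derivative - X (\<gamma> (a + b - t)) f) (at t within {a..b})"
      by (simp add: o_def)
  qed
  from same_leaf_curve[OF F_minus[OF X] ab this] show ?thesis by simp
qed

lemma same_leaf_sym: "(p, q) \<in> same_leaf A F \<Longrightarrow> (q, p) \<in> same_leaf A F"
proof -
  assume "(p, q) \<in> same_leaf A F"
  then show "(q, p) \<in> same_leaf A F"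
    unfolding same_leaf_def[of A F]
  proof (induction rule: rtrancl_induct)
    case (step y z)
    then obtain X a b \<gamma> where "X \<in> F" "a \<le> b" "integral_curve A X a b \<gamma>" "\<gamma> a = y" "\<gamma> b = z"
      by blast
    then have "(z, y) \<in> same_leaf A F" using same_leaf_curve_reverse[of X a b \<gamma>] by simp
    then show ?case using step.IH unfolding same_leaf_def by (rule rtrancl_trans)
  qed simp
qed

lemma same_leaf_equiv: "equiv UNIV (same_leaf A F)"
proof (rule equivI)
  show "sym (same_leaf A F)" by (rule symI) (rule same_leaf_sym)
  show "trans (same_leaf A F)" by (rule transI) (rule same_leaf_trans)
  show "refl_on UNIV (same_leaf A F)" by (rule refl_onI) (rule same_leaf_refl)
qed simp

end

lemma continuous_on_compact_bound:
  fixes f :: "'x::topological_space \<Rightarrow> 'y::real_normed_vector"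
  assumes "compact S" "continuous_on S f"
  obtains M where "0 \<le> M" "\<And>x. x \<in> S \<Longrightarrow> norm (f x) \<le> M"
proof -
  have "bounded (f ` S)" by (rule compact_imp_bounded[OF compact_continuous_image[OF assms(2,1)]])
  then obtain M where "\<And>y. y \<in> f ` S \<Longrightarrow> norm y \<le> M" unfolding bounded_iff by blast
  then have "norm (f x) \<le> max M 0" if "x \<in> S" for x using that by (simp add: max.coboundedI1)
  then show thesis by (rule that[rotated]) simp_all
qed

text \<open>In the following \<open>range Q\<close> is the tangent space of the leaf at the base point, in
  coordinates, and \<open>XB v\<close> is some field of the foliation that takes the value \<open>Q v\<close> there. The
  fields \<open>Xh v\<close> are combinations of these that project to \<open>Q v\<close> at all nearby points: the
  coefficients \<open>s y v\<close> solve \<open>Q (M y (s y v)) = Q v\<close>. This system is made uniquely solvable by adding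
  the complementary projection; its matrix \<open>B y\<close> is the identity at the base point and hence
  injective on the neighbourhood \<open>U1\<close>.\<close>

locale leaf_frame = mfd_param A P S \<psi> \<phi> + foliated_mfd A F
  for A :: "('a::{second_countable_topology,t2_space}, 'e::euclidean_space) atlas"
    and P S \<psi> \<phi> F +
  fixes y0 :: 'e and Q :: "'e \<Rightarrow> 'e" and XB :: "'e \<Rightarrow> 'a vec_field"
  assumes y0: "y0 \<in> S" and Q: "orth_proj Q" and range_Q: "range Q = (\<lambda>X. vf_coords X y0) ` F"
    and XB: "\<And>v. XB v \<in> F" "\<And>v. vf_coords (XB v) y0 = Q v"
begin

lemma Q_lin: "linear Q" and QQ: "Q (Q v) = Q v"
  using orth_projD[OF Q] by blast+

definition M :: "'e \<Rightarrow> 'e \<Rightarrow> 'e" where "M y v = (\<Sum>b\<in>Basis. (v \<bullet> b) *\<^sub>R vf_coords (XB b) y)"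
definition B :: "'e \<Rightarrow> 'e \<Rightarrow> 'e" where "B y v = Q (M y v) + (v - Q v)"
definition U1 :: "'e set" where "U1 = {y \<in> S. (\<Sum>b\<in>Basis. norm (B y b - b)) < 1}"
definition s :: "'e \<Rightarrow> 'e \<Rightarrow> 'e" where "s y v = inv (B y) (Q v)"
definition Xh :: "'e \<Rightarrow> 'e \<Rightarrow> 'e" where "Xh y v = M y (s y v)"

lemma M_lin: "linear (M y)"
  unfolding M_def linear_iff by (simp add: inner_add_left scaleR_add_left sum.distrib scaleR_sum_right)

lemma B_lin: "linear (B y)"
  unfolding B_def using M_lin[of y] Q_lin
  by (simp add: linear_iff scaleR_diff_right scaleR_add_right)

lemma M_smooth: "Cinf S (\<lambda>y. M y v)"
  unfolding M_def by (intro Cinf_sum Cinf_scaleR Cinf_const vf_coords_smooth F_field XB S_open)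

lemma B_smooth: "Cinf S (\<lambda>y. B y v)"
  unfolding B_def by (intro Cinf_add Cinf_const Cinf_compose_linear[OF _ Q_lin] M_smooth S_open)

lemma B_y0: "B y0 v = v"
proof -
  have "M y0 v = Q v" unfolding M_def XB(2) by (rule linear_basis_expansion[OF Q_lin, symmetric])
  then show ?thesis by (simp add: B_def QQ)
qed

lemma B_P: "y \<in> S \<Longrightarrow> B (P y) = B y"
  by (simp add: M_def B_def[abs_def] vf_coords_P[OF F_field[OF XB(1)]])

lemma s_P: "y \<in> S \<Longrightarrow> s (P y) = s y"
  by (simp add: s_def[abs_def] B_P)

lemma U1_open: "open U1"
proof -
  have "continuous_on S (\<lambda>y. \<Sum>b\<in>Basis. norm (B y b - b))"
    by (intro continuous_intros Cinf_continuous_on[OF B_smooth])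
  from continuous_open_preimage[OF this S_open open_lessThan[of 1]] show ?thesis
    unfolding U1_def by (simp add: vimage_def Int_def)
qed

lemma U1_S: "U1 \<subseteq> S" and y0_U1: "y0 \<in> U1" and U1_P: "y \<in> U1 \<Longrightarrow> P y \<in> U1"
  using y0 P_in B_P by (auto simp: U1_def B_y0)

lemma B_inj:
  assumes y: "y \<in> U1"
  shows "inj (B y)"
  unfolding linear_injective_0[OF B_lin]
proof (intro allI impI)
  fix v assume v: "B y v = 0"
  have "- v = (\<Sum>b\<in>Basis. (v \<bullet> b) *\<^sub>R (B y b - b))"
    using v linear_basis_expansion[OF B_lin, of y v] linear_basis_expansion[OF linear_ident, of v]
    by (simp add: scaleR_diff_right sum_subtractf)
  also have "norm \<dots> \<le> (\<Sum>b\<in>Basis. norm v * norm (B y b - b))"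
    by (rule sum_norm_le) (use Basis_le_norm in \<open>auto intro!: mult_right_mono\<close>)
  finally have le: "norm v \<le> norm v * (\<Sum>b\<in>Basis. norm (B y b - b))" by (simp add: sum_distrib_left)
  show "v = 0"
  proof (rule ccontr)
    assume "v \<noteq> 0"
    then have "norm v * (\<Sum>b\<in>Basis. norm (B y b - b)) < norm v * 1"
      using y unfolding U1_def by (intro mult_strict_left_mono) auto
    then show False using le by simp
  qed
qed

lemma B_s: "y \<in> U1 \<Longrightarrow> B y (s y v) = Q v"
  unfolding s_def
  by (rule surj_f_inv_f[OF linear_inj_imp_surj[OF B_lin B_inj]])

lemma s_lin:
  assumes y: "y \<in> U1"
  shows "linear (s y)"
  unfolding linear_iff
proof (intro conjI allI)
  fix v w c
  have "B y (s y (v + w)) = B y (s y v + s y w)"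
    using Q_lin by (simp add: B_s[OF y] linear_add[OF B_lin] linear_add)
  then show "s y (v + w) = s y v + s y w" using B_inj[OF y] by (simp add: inj_eq)
  have "B y (s y (c *\<^sub>R v)) = B y (c *\<^sub>R s y v)"
    using Q_lin by (simp add: B_s[OF y] linear_cmul[OF B_lin] linear_cmul)
  then show "s y (c *\<^sub>R v) = c *\<^sub>R s y v" using B_inj[OF y] by (simp add: inj_eq)
qed

lemma s_smooth: "Cinf U1 (\<lambda>y. s y v)"
  by (rule Cinf_linear_solve[OF U1_open B_lin B_inj Cinf_subset[OF B_smooth U1_S] Cinf_const[OF U1_open] B_s])

lemma s_Q: "s y (Q v) = s y v"
  by (simp add: s_def QQ)

lemma Xh_lin: "y \<in> U1 \<Longrightarrow> linear (Xh y)"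
  unfolding Xh_def[abs_def] using linear_compose[OF s_lin M_lin] by (simp add: o_def)

lemma Xh_Q: "Xh y (Q v) = Xh y v"
  by (simp add: Xh_def s_Q)

lemma Xh_smooth: "Cinf U1 (\<lambda>y. Xh y v)"
  unfolding Xh_def
  by (rule Cinf_linear_field[OF U1_open Cinf_subset[OF M_smooth U1_S] s_smooth M_lin])

lemma Q_Xh:
  assumes y: "y \<in> U1"
  shows "Q (Xh y v) = Q v"
proof -
  have "Q (B y (s y v)) = Q v" by (simp add: B_s[OF y] QQ)
  then show ?thesis
    using Q_lin by (simp add: B_def Xh_def linear_add linear_diff QQ)
qed

text \<open>The global field of the foliation that equals \<open>Xh y (a y)\<close>, in coordinates, wherever the
  cut-off \<open>\<kappa>\<close> is \<open>1\<close>.\<close>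

definition XF :: "('a \<Rightarrow> real) \<Rightarrow> ('e \<Rightarrow> 'e) \<Rightarrow> 'a vec_field" where
  "XF \<kappa> a = (\<lambda>p f. \<Sum>b\<in>Basis. (\<kappa> p * (s (\<phi> p) (a (\<phi> p)) \<bullet> b)) * XB b p f)"

lemma lift_field:
  assumes \<kappa>: "\<kappa> \<in> smooth_funs A" and C: "compact C" "C \<subseteq> \<psi> ` U1" "\<And>x. x \<notin> C \<Longrightarrow> \<kappa> x = 0"
    and a: "Cinf U1 a" "\<And>y. y \<in> U1 \<Longrightarrow> a (P y) = a y"
  shows "XF \<kappa> a \<in> F" and "y \<in> U1 \<Longrightarrow> vf_coords (XF \<kappa> a) y = \<kappa> (\<psi> y) *\<^sub>R Xh y (a y)"
proof -
  have eq: "s (\<phi> (\<psi> y)) (a (\<phi> (\<psi> y))) = s y (a y)" if "y \<in> U1" for y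
    using that U1_S \<phi>\<psi>[of y] s_P[of y] a(2)[of y] by auto
  have "(\<lambda>p. \<kappa> p * (s (\<phi> p) (a (\<phi> p)) \<bullet> b)) \<in> smooth_funs A" for b
  proof (rule smooth_funs_bump_mult[OF image_open[OF U1_open U1_S U1_P] _ \<kappa> C])
    show "smooth_fun_on A (\<psi> ` U1) (\<lambda>p. s (\<phi> p) (a (\<phi> p)) \<bullet> b)"
    proof (rule smooth_push[OF U1_open U1_S U1_P])
      have "Cinf U1 (\<lambda>y. s y (a y) \<bullet> b)"
        by (rule Cinf_inner_const[OF U1_open Cinf_linear_field[OF U1_open s_smooth a(1) s_lin]])
      then show "Cinf U1 (\<lambda>y. s (\<phi> (\<psi> y)) (a (\<phi> (\<psi> y))) \<bullet> b)"
        by (rule Cinf_cong[OF U1_open, rotated]) (simp add: eq)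
    qed
  qed
  then show "XF \<kappa> a \<in> F" unfolding XF_def by (intro F_sum XB(1))
  assume y: "y \<in> U1"
  then have yS: "y \<in> S" using U1_S by blast
  have "vf_coords (XF \<kappa> a) y = (\<Sum>b\<in>Basis. (\<kappa> (\<psi> y) * (s (\<phi> (\<psi> y)) (a (\<phi> (\<psi> y))) \<bullet> b)) *\<^sub>R vf_coords (XB b) y)"
    unfolding XF_def by (rule vf_coords_sum[OF F_field[OF XB(1)] yS])
  also have "\<dots> = \<kappa> (\<psi> y) *\<^sub>R Xh y (a y)"
    unfolding eq[OF y] Xh_def M_def by (simp add: scaleR_sum_right)
  finally show "vf_coords (XF \<kappa> a) y = \<kappa> (\<psi> y) *\<^sub>R Xh y (a y)" .
qed

end

text \<open>The cut-off \<open>\<kappa>\<close> is \<open>1\<close> near the base point and supported where both the frame and finitely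
  many generators \<open>G\<close> of the foliation are available.\<close>

locale leaf_chart = leaf_frame A P S \<psi> \<phi> F y0 Q XB
  for A :: "('a::{second_countable_topology,t2_space}, 'e::euclidean_space) atlas"
    and P S \<psi> \<phi> F y0 Q XB +
  fixes U' :: "'a set" and G :: "'a vec_field set" and \<kappa> :: "'a \<Rightarrow> real" and N C :: "'a set" and R :: real
  assumes U'_open: "open U'" and G: "finite G" "G \<subseteq> vec_fields A U'"
    and span: "restrict_foliation U' F = vf_span (smooth_funs_c A U') G"
    and \<kappa>: "\<kappa> \<in> smooth_funs A" and N: "open N" "N \<subseteq> C" and \<kappa>_1: "\<And>x. x \<in> N \<Longrightarrow> \<kappa> x = 1"
    and C: "compact C" "C \<subseteq> U' \<inter> \<psi> ` U1" and \<kappa>_0: "\<And>x. x \<notin> C \<Longrightarrow> \<kappa> x = 0"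
    and R: "0 < R" "cball y0 R \<subseteq> S \<inter> \<psi> -` N"
begin

definition Uo :: "'e set" where "Uo = S \<inter> \<psi> -` N"

lemma Uo_open: "open Uo"
  unfolding Uo_def by (rule preimage_open[OF N(1)])

lemma Uo_\<kappa>: "y \<in> Uo \<Longrightarrow> \<kappa> (\<psi> y) = 1" and Uo_S: "Uo \<subseteq> S"
  using \<kappa>_1 by (auto simp: Uo_def)

lemma Uo_U1: "Uo \<subseteq> U1"
proof
  fix y assume y: "y \<in> Uo"
  then have yS: "y \<in> S" and "\<psi> y \<in> \<psi> ` U1" using N(2) C(2) by (auto simp: Uo_def)
  then obtain z where z: "z \<in> U1" "\<psi> y = \<psi> z" by blast
  have zS: "z \<in> S" using z(1) U1_S by blast
  have "P y = P z" using \<phi>\<psi>[OF yS] \<phi>\<psi>[OF zS] z(2) by simp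
  then have "B y = B z" using B_P[OF yS] B_P[OF zS] by simp
  then show "y \<in> U1" using z(1) yS by (simp add: U1_def)
qed

lemma ball_Uo: "cball y0 R \<subseteq> Uo"
  using R unfolding Uo_def by blast

lemma y0_Uo: "y0 \<in> Uo"
  by (rule subsetD[OF ball_Uo]) (use R in simp)

lemma C_im: "C \<subseteq> \<psi> ` U1" and C_U': "C \<subseteq> U'"
  using C(2) by auto

definition XC :: "'e \<Rightarrow> 'a vec_field" where "XC v = XF \<kappa> (\<lambda>y. v)"

lemma XC: "XC v \<in> F" "y \<in> Uo \<Longrightarrow> vf_coords (XC v) y = Xh y v"
proof -
  note l = lift_field[OF \<kappa> C(1) C_im \<kappa>_0 Cinf_const[OF U1_open, of v] refl]
  show "XC v \<in> F" unfolding XC_def by (rule l(1))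
  assume y: "y \<in> Uo"
  then show "vf_coords (XC v) y = Xh y v" unfolding XC_def using l(2) Uo_U1 Uo_\<kappa>[OF y] by auto
qed

lemma restrict_bump: "Z \<in> F \<Longrightarrow> (\<lambda>p f. \<kappa> p * Z p f) \<in> restrict_foliation U' F"
proof -
  assume Z: "Z \<in> F"
  have "{p. (\<lambda>f. \<kappa> p * Z p f) \<noteq> (\<lambda>f. 0)} \<subseteq> C" using \<kappa>_0 by auto
  then have "closure {p. (\<lambda>f. \<kappa> p * Z p f) \<noteq> (\<lambda>f. 0)} \<subseteq> C"
    by (rule closure_minimal) (rule compact_imp_closed[OF C(1)])
  then show ?thesis
    unfolding restrict_foliation_def vf_support_def using F_scale[OF \<kappa> Z] C_U' by blast
qed

definition GF :: "'a vec_field \<Rightarrow> 'a vec_field" where "GF g = (\<lambda>p f. \<kappa> p * g p f)"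

lemma GF: "g \<in> G \<Longrightarrow> GF g \<in> F"
proof -
  assume g: "g \<in> G"
  have "\<kappa> \<in> smooth_funs_c A U'" by (rule smooth_funs_c_I[OF \<kappa> C(1) C_U' \<kappa>_0])
  then have "GF g \<in> vf_span (smooth_funs_c A U') G"
    unfolding vf_span_def GF_def using g
    by (intro CollectI exI[of _ 1] exI[of _ "\<lambda>_. \<kappa>"] exI[of _ "\<lambda>_. g"]) auto
  then show ?thesis unfolding span[symmetric] restrict_foliation_def by blast
qed

text \<open>The generator \<open>g\<close> minus its part in the span of the fields \<open>Xh v\<close>.\<close>

definition ZF :: "'a vec_field \<Rightarrow> 'a vec_field" where
  "ZF g = (\<lambda>p f. 1 * GF g p f + (-1) * XF \<kappa> (\<lambda>y. Q (vf_coords (GF g) y)) p f)"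

lemma ZF:
  assumes g: "g \<in> G"
  shows "ZF g \<in> F" "y \<in> Uo \<Longrightarrow> vf_coords (ZF g) y = vf_coords (GF g) y - Xh y (Q (vf_coords (GF g) y))"
proof -
  note gF = F_field[OF GF[OF g]]
  have a: "Cinf U1 (\<lambda>y. Q (vf_coords (GF g) y))"
    by (rule Cinf_compose_linear[OF U1_open Q_lin Cinf_subset[OF vf_coords_smooth[OF gF] U1_S]])
  have aP: "Q (vf_coords (GF g) (P y)) = Q (vf_coords (GF g) y)" if "y \<in> U1" for y
    using vf_coords_P[OF gF] that U1_S by auto
  note l = lift_field[OF \<kappa> C(1) C_im \<kappa>_0 a aP]
  show "ZF g \<in> F" unfolding ZF_def by (intro F_add F_scale smooth_funs_const GF[OF g] l(1))
  assume y: "y \<in> Uo"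
  have yS: "y \<in> S" using y Uo_S by blast
  have "vf_coords (ZF g) y = 1 *\<^sub>R vf_coords (GF g) y + (-1) *\<^sub>R vf_coords (XF \<kappa> (\<lambda>y. Q (vf_coords (GF g) y))) y"
    unfolding vf_coords_def ZF_def
    by (rule coords_lincomb[OF yS vec_fieldD(1)[OF gF] vec_fieldD(1)[OF F_field[OF l(1)], unfolded vf_coords_def]])
  then show "vf_coords (ZF g) y = vf_coords (GF g) y - Xh y (Q (vf_coords (GF g) y))"
    using l(2)[of y] y Uo_U1 Uo_\<kappa>[OF y] by auto
qed

lemma Q_ZF:
  assumes g: "g \<in> G" and y: "y \<in> Uo"
  shows "Q (vf_coords (ZF g) y) = 0"
  using ZF(2)[OF g y] Q_Xh[of y] Uo_U1 y Q_lin by (auto simp: linear_diff QQ)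

lemma ZF_y0:
  assumes g: "g \<in> G"
  shows "vf_coords (ZF g) y0 = 0"
proof -
  have "vf_coords (ZF g) y0 \<in> range Q" unfolding range_Q using ZF(1)[OF g] by blast
  then obtain z where "vf_coords (ZF g) y0 = Q z" by (rule imageE)
  then show ?thesis using Q_ZF[OF g y0_Uo] QQ[of z] by simp
qed

text \<open>At points where this vanishes, the fields \<open>Xh v\<close> already span the foliation.\<close>

abbreviation rank_excess :: "'e \<Rightarrow> real" where "rank_excess y \<equiv> (\<Sum>g\<in>G. norm (vf_coords (ZF g) y))"

lemma rank_excess_ge: "g \<in> G \<Longrightarrow> norm (vf_coords (ZF g) y) \<le> rank_excess y"
  by (rule member_le_sum) (use G(1) in auto)

lemma rank_excess_nonneg: "0 \<le> rank_excess y"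
  by (rule sum_nonneg) simp

text \<open>The field is a combination of the local generators, with continuous coefficients. Subtracting
  the part in the span of the \<open>Xh v\<close> on both sides leaves a combination of the fields \<open>ZF g\<close>.\<close>

lemma vertical_part:
  assumes Z: "Z \<in> F"
  obtains c where "0 \<le> c" "\<And>y. y \<in> cball y0 R \<Longrightarrow> norm (vf_coords Z y - Xh y (Q (vf_coords Z y))) \<le> c * rank_excess y"
proof -
  obtain n c V where cV: "\<And>i. i < n \<Longrightarrow> c i \<in> smooth_funs_c A U'" "\<And>i. i < n \<Longrightarrow> V i \<in> G"
    and eq: "(\<lambda>p f. \<kappa> p * Z p f) = (\<lambda>p f. \<Sum>i<(n::nat). c i p * V i p f)"
    using restrict_bump[OF Z] unfolding span vf_span_def by blast
  have split: "vf_coords Z y - Xh y (Q (vf_coords Z y)) = (\<Sum>i<n. c i (\<psi> y) *\<^sub>R vf_coords (ZF (V i)) y)" if y: "y \<in> Uo" for y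
  proof -
    have yS: "y \<in> S" and y1: "y \<in> U1" using y Uo_S Uo_U1 by auto
    have "Z (\<psi> y) = (\<lambda>f. \<Sum>i<n. c i (\<psi> y) * GF (V i) (\<psi> y) f)"
      using fun_cong[OF eq, of "\<psi> y"] Uo_\<kappa>[OF y] by (simp add: GF_def)
    then have "vf_coords Z y = vf_coords (\<lambda>p f. \<Sum>i<n. c i p * GF (V i) p f) y" by (simp add: vf_coords_def)
    also have "\<dots> = (\<Sum>i<n. c i (\<psi> y) *\<^sub>R vf_coords (GF (V i)) y)"
      by (rule vf_coords_sum[OF _ yS]) (use cV GF F_field in auto)
    finally have e: "vf_coords Z y = (\<Sum>i<n. c i (\<psi> y) *\<^sub>R vf_coords (GF (V i)) y)" .
    have "Xh y (Q (vf_coords Z y)) = (\<Sum>i<n. c i (\<psi> y) *\<^sub>R Xh y (Q (vf_coords (GF (V i)) y)))"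
      unfolding e using Q_lin Xh_lin[OF y1] by (simp add: linear_sum linear_cmul)
    then show ?thesis
      unfolding e using ZF(2)[OF cV(2) y] by (simp add: scaleR_diff_right sum_subtractf)
  qed
  have "\<exists>K\<ge>0. \<forall>y\<in>cball y0 R. \<bar>c i (\<psi> y)\<bar> \<le> K" if i: "i < n" for i
  proof -
    have "c i \<in> smooth_funs A" using cV(1)[OF i] unfolding smooth_funs_c_def by blast
    then have "continuous_on (cball y0 R) (\<lambda>y. c i (\<psi> y))"
      by (intro continuous_on_subset[OF Cinf_continuous_on[OF smooth_funs_pull]]) (use ball_Uo Uo_S in auto)
    from continuous_on_compact_bound[OF compact_cball this] show ?thesis by (metis real_norm_def)
  qed
  then obtain K where K: "\<And>i. i < n \<Longrightarrow> 0 \<le> K i" "\<And>i y. i < n \<Longrightarrow> y \<in> cball y0 R \<Longrightarrow> \<bar>c i (\<psi> y)\<bar> \<le> K i"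
    by metis
  show thesis
  proof (rule that[of "\<Sum>i<n. K i"])
    show "0 \<le> (\<Sum>i<n. K i)" by (rule sum_nonneg) (use K(1) in auto)
    fix y assume y: "y \<in> cball y0 R"
    have "y \<in> Uo" using y ball_Uo by blast
    from split[OF this] have "norm (vf_coords Z y - Xh y (Q (vf_coords Z y))) \<le> (\<Sum>i<n. K i * rank_excess y)"
    proof (simp only:, intro sum_norm_le)
      fix i assume "i \<in> {..<n}"
      then show "norm (c i (\<psi> y) *\<^sub>R vf_coords (ZF (V i)) y) \<le> K i * rank_excess y"
        unfolding norm_scaleR using K y rank_excess_ge[OF cV(2)] by (intro mult_mono) auto
    qed
    then show "norm (vf_coords Z y - Xh y (Q (vf_coords Z y))) \<le> (\<Sum>i<n. K i) * rank_excess y" by (simp add: sum_distrib_right)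
  qed
qed

text \<open>The bracket of two fields with constant projection has projection zero, because a derivative of a
  constant vanishes. It also belongs to the foliation, so \<open>vertical_part\<close> applies to it.\<close>

lemma bracket_vertical:
  assumes X: "X \<in> F" "\<And>y. y \<in> Uo \<Longrightarrow> Q (vf_coords X y) = v" and Y: "Y \<in> F" "\<And>y. y \<in> Uo \<Longrightarrow> Q (vf_coords Y y) = w"
  obtains c where "0 \<le> c" "\<And>y. y \<in> cball y0 R \<Longrightarrow>
    norm (frechet_derivative (vf_coords Y) (at y) (vf_coords X y) - frechet_derivative (vf_coords X) (at y) (vf_coords Y y)) \<le> c * rank_excess y"
proof -
  have Q0: "Q (frechet_derivative (vf_coords Z) (at y) h) = 0"
    if Z: "Z \<in> F" "\<And>y. y \<in> Uo \<Longrightarrow> Q (vf_coords Z y) = u" and y: "y \<in> Uo" for Z u y h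
  proof -
    have "y \<in> S" using y Uo_S by blast
    from frechet_linear_compose[OF Q_lin vf_coords_smooth[OF F_field[OF Z(1)]] this, of h, symmetric]
    show ?thesis using frechet_const_on[OF Uo_open y Z(2)] by simp
  qed
  obtain c where c: "0 \<le> c" "\<And>y. y \<in> cball y0 R \<Longrightarrow>
      norm (vf_coords (lie_bracket X Y) y - Xh y (Q (vf_coords (lie_bracket X Y) y))) \<le> c * rank_excess y"
    by (rule vertical_part[OF F_bracket[OF X(1) Y(1)]]) (rule that; assumption)
  show thesis
  proof (rule that[OF c(1)])
    fix y assume y: "y \<in> cball y0 R"
    then have yo: "y \<in> Uo" and yS: "y \<in> S" and y1: "y \<in> U1" using ball_Uo Uo_S Uo_U1 by auto
    have br: "vf_coords (lie_bracket X Y) y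
        = frechet_derivative (vf_coords Y) (at y) (vf_coords X y) - frechet_derivative (vf_coords X) (at y) (vf_coords Y y)"
      by (rule vf_coords_bracket[OF F_field[OF X(1)] F_field[OF Y(1)] F_field[OF F_bracket[OF X(1) Y(1)]] yS])
    have "Q (frechet_derivative (vf_coords Y) (at y) (vf_coords X y)) = 0" by (rule Q0[OF Y(1) _ yo]) (rule Y(2))
    moreover have "Q (frechet_derivative (vf_coords X) (at y) (vf_coords Y y)) = 0" by (rule Q0[OF X(1) _ yo]) (rule X(2))
    ultimately have "Q (vf_coords (lie_bracket X Y) y) = 0" by (simp add: br linear_diff[OF Q_lin])
    then show "norm (frechet_derivative (vf_coords Y) (at y) (vf_coords X y) - frechet_derivative (vf_coords X) (at y) (vf_coords Y y)) \<le> c * rank_excess y"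
      using c(2)[OF y] linear_0[OF Xh_lin[OF y1]] br by simp
  qed
qed

lemma frechet_Xh: "y \<in> Uo \<Longrightarrow> frechet_derivative (\<lambda>y. Xh y v) (at y) = frechet_derivative (vf_coords (XC v)) (at y)"
proof -
  assume y: "y \<in> Uo"
  have "(vf_coords (XC v) has_derivative frechet_derivative (vf_coords (XC v)) (at y)) (at y)"
    by (rule Cinf_has_derivative[OF vf_coords_smooth[OF F_field[OF XC(1)]]]) (use y Uo_S in auto)
  then have "((\<lambda>y. Xh y v) has_derivative frechet_derivative (vf_coords (XC v)) (at y)) (at y)"
    by (rule has_derivative_transform_within_open[OF _ Uo_open y]) (rule XC(2))
  from frechet_derivative_at[OF this] show ?thesis by (rule sym)
qed

lemma Q_XC: "y \<in> Uo \<Longrightarrow> Q (vf_coords (XC v) y) = Q v"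
  using XC(2) Q_Xh Uo_U1 by auto

text \<open>The derivative of \<open>ZF g\<close> along \<open>Xh v\<close> is their bracket plus a derivative in the direction
  \<open>ZF g\<close>, and both are bounded by the rank excess.\<close>

lemma ZF_deriv_Xh:
  assumes g: "g \<in> G"
  obtains c where "0 \<le> c" "\<And>y v. y \<in> cball y0 R \<Longrightarrow>
    norm (frechet_derivative (vf_coords (ZF g)) (at y) (Xh y v)) \<le> c * norm v * rank_excess y"
proof -
  have ball_S: "cball y0 R \<subseteq> S" using ball_Uo Uo_S by blast
  have "\<exists>c\<ge>0. \<forall>y\<in>cball y0 R. norm (frechet_derivative (vf_coords (ZF g)) (at y) (Xh y b)) \<le> c * rank_excess y" for b
  proof -
    obtain c where c: "0 \<le> c" "\<And>y. y \<in> cball y0 R \<Longrightarrow> norm (frechet_derivative (vf_coords (ZF g)) (at y) (vf_coords (XC b) y)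
        - frechet_derivative (vf_coords (XC b)) (at y) (vf_coords (ZF g) y)) \<le> c * rank_excess y"
      by (rule bracket_vertical[OF XC(1) Q_XC ZF(1)[OF g] Q_ZF[OF g]]) (assumption | rule that)+
    obtain L where L: "0 \<le> L" "\<And>y h. y \<in> cball y0 R \<Longrightarrow> norm (frechet_derivative (vf_coords (XC b)) (at y) h) \<le> L * norm h"
      by (rule Cinf_bounds[OF vf_coords_smooth[OF F_field[OF XC(1)]] ball_S]) (rule that; assumption)
    show ?thesis
    proof (intro exI[of _ "c + L"] conjI ballI)
      fix y assume y: "y \<in> cball y0 R"
      have "norm (frechet_derivative (vf_coords (XC b)) (at y) (vf_coords (ZF g) y)) \<le> L * rank_excess y"
        by (rule order_trans[OF L(2)[OF y] mult_left_mono[OF rank_excess_ge[OF g] L(1)]])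
      moreover have "vf_coords (XC b) y = Xh y b" using XC(2) y ball_Uo by blast
      ultimately show "norm (frechet_derivative (vf_coords (ZF g)) (at y) (Xh y b)) \<le> (c + L) * rank_excess y"
        using c(2)[OF y] norm_triangle_sub[of "frechet_derivative (vf_coords (ZF g)) (at y) (Xh y b)"
            "frechet_derivative (vf_coords (XC b)) (at y) (vf_coords (ZF g) y)"]
        by (simp add: distrib_right)
    qed (use c(1) L(1) in simp)
  qed
  then obtain c where c: "\<And>b. 0 \<le> c b" "\<And>b y. y \<in> cball y0 R \<Longrightarrow>
      norm (frechet_derivative (vf_coords (ZF g)) (at y) (Xh y b)) \<le> c b * rank_excess y" by metis
  show thesis
  proof (rule that[of "\<Sum>b\<in>Basis. c b"])
    show "0 \<le> (\<Sum>b\<in>Basis. c b)" by (rule sum_nonneg) (rule c(1))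
    fix y v assume y: "y \<in> cball y0 R"
    have y1: "y \<in> U1" and yS: "y \<in> S" using y ball_Uo Uo_U1 Uo_S by auto
    have "linear (\<lambda>v. frechet_derivative (vf_coords (ZF g)) (at y) (Xh y v))"
      using linear_compose[OF Xh_lin[OF y1] Cinf_linear_frechet[OF vf_coords_smooth[OF F_field[OF ZF(1)[OF g]]] yS]]
      by (simp add: o_def)
    from linear_basis_expansion[OF this, of v]
    have "norm (frechet_derivative (vf_coords (ZF g)) (at y) (Xh y v))
        = norm (\<Sum>b\<in>Basis. (v \<bullet> b) *\<^sub>R frechet_derivative (vf_coords (ZF g)) (at y) (Xh y b))" by simp
    also have "\<dots> \<le> (\<Sum>b\<in>Basis. norm v * (c b * rank_excess y))"
      by (rule sum_norm_le) (use c(2)[OF y] Basis_le_norm in \<open>auto intro!: mult_mono\<close>)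
    also have "\<dots> = (\<Sum>b\<in>Basis. c b) * norm v * rank_excess y"
    proof -
      have "(\<Sum>b\<in>Basis. norm v * (c b * t)) = (\<Sum>b\<in>Basis. c b) * norm v * t" for t
        by (simp add: sum_distrib_left sum_distrib_right mult.commute mult.left_commute)
      then show ?thesis .
    qed
    finally show "norm (frechet_derivative (vf_coords (ZF g)) (at y) (Xh y v)) \<le> (\<Sum>b\<in>Basis. c b) * norm v * rank_excess y" .
  qed
qed

text \<open>At each point a field of the foliation is some \<open>Xh y v\<close> up to a vertical part, which is itself
  bounded by the rank excess.\<close>

lemma ZF_deriv_F:
  assumes g: "g \<in> G" and Y: "Y \<in> F"
  obtains c where "0 \<le> c" "\<And>y. y \<in> cball y0 R \<Longrightarrow>
    norm (frechet_derivative (vf_coords (ZF g)) (at y) (vf_coords Y y)) \<le> c * rank_excess y"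
proof -
  have ball_S: "cball y0 R \<subseteq> S" using ball_Uo Uo_S by blast
  obtain c where c: "0 \<le> c" "\<And>y v. y \<in> cball y0 R \<Longrightarrow>
    norm (frechet_derivative (vf_coords (ZF g)) (at y) (Xh y v)) \<le> c * norm v * rank_excess y"
    by (rule ZF_deriv_Xh[OF g]) (rule that; assumption)
  obtain k where k: "0 \<le> k" "\<And>y. y \<in> cball y0 R \<Longrightarrow> norm (vf_coords Y y) \<le> k"
    by (rule Cinf_bounds[OF vf_coords_smooth[OF F_field[OF Y]] ball_S]) (rule that; assumption)
  obtain L where L: "0 \<le> L" "\<And>y h. y \<in> cball y0 R \<Longrightarrow> norm (frechet_derivative (vf_coords (ZF g)) (at y) h) \<le> L * norm h"
    by (rule Cinf_bounds[OF vf_coords_smooth[OF F_field[OF ZF(1)[OF g]]] ball_S]) (rule that; assumption)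
  obtain e where e: "0 \<le> e" "\<And>y. y \<in> cball y0 R \<Longrightarrow> norm (vf_coords Y y - Xh y (Q (vf_coords Y y))) \<le> e * rank_excess y"
    by (rule vertical_part[OF Y]) (rule that; assumption)
  show thesis
  proof (rule that[of "c * k + L * e"])
    show "0 \<le> c * k + L * e" using c(1) k(1) L(1) e(1) by simp
    fix y assume y: "y \<in> cball y0 R"
    have yS: "y \<in> S" using y ball_S by blast
    let ?D = "frechet_derivative (vf_coords (ZF g)) (at y)"
    have lin: "linear ?D" by (rule Cinf_linear_frechet[OF vf_coords_smooth[OF F_field[OF ZF(1)[OF g]]] yS])
    have "?D (vf_coords Y y) = ?D (Xh y (vf_coords Y y)) + ?D (vf_coords Y y - Xh y (Q (vf_coords Y y)))"
      using lin by (simp add: linear_diff Xh_Q)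
    then have "norm (?D (vf_coords Y y)) \<le> norm (?D (Xh y (vf_coords Y y))) + norm (?D (vf_coords Y y - Xh y (Q (vf_coords Y y))))"
      by (simp only: norm_triangle_ineq)
    also have "\<dots> \<le> c * k * rank_excess y + L * (e * rank_excess y)"
    proof (rule add_mono)
      have "c * norm (vf_coords Y y) * rank_excess y \<le> c * k * rank_excess y"
        using k(2)[OF y] c(1) rank_excess_nonneg by (intro mult_right_mono mult_left_mono)
      then show "norm (?D (Xh y (vf_coords Y y))) \<le> c * k * rank_excess y" using c(2)[OF y, of "vf_coords Y y"] by linarith
      show "norm (?D (vf_coords Y y - Xh y (Q (vf_coords Y y)))) \<le> L * (e * rank_excess y)"
        by (rule order_trans[OF L(2)[OF y] mult_left_mono[OF e(2)[OF y] L(1)]])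
    qed
    finally show "norm (?D (vf_coords Y y)) \<le> (c * k + L * e) * rank_excess y" by (simp add: algebra_simps)
  qed
qed

lemma rank_excess_0_field:
  assumes Y: "Y \<in> F" and y: "y \<in> cball y0 R" "rank_excess y = 0"
  shows "vf_coords Y y = Xh y (vf_coords Y y)"
proof -
  obtain e where e: "0 \<le> e" "\<And>y. y \<in> cball y0 R \<Longrightarrow> norm (vf_coords Y y - Xh y (Q (vf_coords Y y))) \<le> e * rank_excess y"
    by (rule vertical_part[OF Y]) (rule that; assumption)
  have "norm (vf_coords Y y - Xh y (Q (vf_coords Y y))) \<le> 0" using e(2)[OF y(1)] unfolding y(2) by simp
  then show ?thesis by (simp add: Xh_Q)
qed

lemma parallel: "\<exists>c. parallel_family Uo Xh Q y0 R G (\<lambda>g. vf_coords (ZF g)) c"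
proof -
  have "\<exists>c. \<forall>g\<in>G. 0 \<le> c g \<and> (\<forall>y\<in>cball y0 R. \<forall>v. norm (frechet_derivative (vf_coords (ZF g)) (at y) (Xh y v)) \<le> c g * norm v * rank_excess y)"
  proof (rule bchoice, rule ballI)
    fix g assume g: "g \<in> G"
    obtain c where "0 \<le> c" "\<And>y v. y \<in> cball y0 R \<Longrightarrow>
      norm (frechet_derivative (vf_coords (ZF g)) (at y) (Xh y v)) \<le> c * norm v * rank_excess y"
      by (rule ZF_deriv_Xh[OF g]) (rule that; assumption)
    then show "\<exists>c\<ge>0. \<forall>y\<in>cball y0 R. \<forall>v. norm (frechet_derivative (vf_coords (ZF g)) (at y) (Xh y v)) \<le> c * norm v * rank_excess y"
      by blast
  qed
  then obtain c where c: "\<And>g. g \<in> G \<Longrightarrow> 0 \<le> c g" "\<And>g y v. g \<in> G \<Longrightarrow> y \<in> cball y0 R \<Longrightarrow>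
     norm (frechet_derivative (vf_coords (ZF g)) (at y) (Xh y v)) \<le> c g * norm v * rank_excess y" by blast
  have "parallel_family Uo Xh Q y0 R G (\<lambda>g. vf_coords (ZF g)) (\<Sum>g\<in>G. c g)"
  proof (rule parallel_family.intro)
    show "open Uo" "cball y0 R \<subseteq> Uo" "0 < R" "linear Q" "finite G"
      using Uo_open ball_Uo R Q_lin G by blast+
    show "0 \<le> (\<Sum>g\<in>G. c g)" by (rule sum_nonneg) (rule c(1))
    show "linear (Xh y)" if "y \<in> Uo" for y using Xh_lin that Uo_U1 by blast
    show "Cinf Uo (\<lambda>y. Xh y v)" for v by (rule Cinf_subset[OF Xh_smooth Uo_U1])
    show "Xh y (Q v) = Xh y v" if "y \<in> Uo" for y v by (rule Xh_Q)
    show "Cinf Uo (vf_coords (ZF g))" if "g \<in> G" for g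
      by (rule Cinf_subset[OF vf_coords_smooth[OF F_field[OF ZF(1)[OF that]]] Uo_S])
    show "vf_coords (ZF g) y0 = 0" if "g \<in> G" for g by (rule ZF_y0[OF that])
    show "norm (frechet_derivative (vf_coords (ZF g)) (at y) (Xh y v)) \<le> (\<Sum>g\<in>G. c g) * norm v * rank_excess y"
      if g: "g \<in> G" and y: "y \<in> cball y0 R" for g y v
    proof -
      have "c g \<le> (\<Sum>g\<in>G. c g)" by (rule member_le_sum) (use g c(1) G(1) in auto)
      then have "c g * norm v * rank_excess y \<le> (\<Sum>g\<in>G. c g) * norm v * rank_excess y"
        using rank_excess_nonneg by (intro mult_right_mono) auto
      then show ?thesis using c(2)[OF g y, of v] by linarith
    qed
    show "frechet_derivative (\<lambda>y. Xh y v) (at y) (Xh y w) = frechet_derivative (\<lambda>y. Xh y w) (at y) (Xh y v)"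
      if y: "y \<in> cball y0 R" and rank_excess: "rank_excess y = 0" for y v w
    proof -
      obtain c where "\<And>y. y \<in> cball y0 R \<Longrightarrow> norm (frechet_derivative (vf_coords (XC v)) (at y) (vf_coords (XC w) y)
          - frechet_derivative (vf_coords (XC w)) (at y) (vf_coords (XC v) y)) \<le> c * rank_excess y"
        by (rule bracket_vertical[OF XC(1) Q_XC XC(1) Q_XC]) (assumption | rule that)+
      from this[OF y] have "norm (frechet_derivative (vf_coords (XC v)) (at y) (vf_coords (XC w) y)
          - frechet_derivative (vf_coords (XC w)) (at y) (vf_coords (XC v) y)) \<le> 0" unfolding rank_excess by simp
      moreover have yo: "y \<in> Uo" using y ball_Uo by blast
      ultimately show ?thesis by (simp add: frechet_Xh[OF yo] XC(2)[OF yo])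
    qed
  qed
  then show ?thesis ..
qed

lemma radial_same_leaf:
  assumes E: "\<And>s. s \<in> {0..1} \<Longrightarrow> E s \<in> cball y0 R"
    "\<And>s. s \<in> {0..1} \<Longrightarrow> (E has_vector_derivative Xh (E s) v) (at s within {0..1::real})"
  shows "(\<psi> (E 0), \<psi> (E 1)) \<in> same_leaf A F"
proof -
  have "integral_curve A (XC v) 0 1 (\<lambda>s. \<psi> (E s))"
    unfolding integral_curve_def
  proof (intro ballI)
    fix t :: real and f assume t: "t \<in> {0..1}" and f: "f \<in> smooth_funs A"
    have yo: "E t \<in> Uo" and yS: "E t \<in> S" using E(1)[OF t] ball_Uo Uo_S by auto
    have "((\<lambda>s. f (\<psi> (E s))) has_real_derivative tv (E t) (Xh (E t) v) f) (at t within {0..1})"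
      by (rule curve_tv[OF E(2)[OF t] yS f])
    moreover have "tv (E t) (Xh (E t) v) = XC v (\<psi> (E t))"
      unfolding XC(2)[OF yo, symmetric] by (rule vf_coords_tv[OF F_field[OF XC(1)] yS])
    ultimately show "((\<lambda>s. f (\<psi> (E s))) has_real_derivative XC v (\<psi> (E t)) f) (at t within {0..1})" by simp
  qed
  from same_leaf_curve[OF XC(1) _ this] show ?thesis by simp
qed

end

context foliated_mfd
begin

text \<open>The coefficients of the velocity depend on time, so the curve need not be an integral curve of a
  field. Near each time it is therefore compared with the radial integral curves through its current
  position.\<close>

lemma tangent_curve_local:
  fixes \<gamma> :: "real \<Rightarrow> 'a"
  assumes I: "finite I" and c: "\<And>i. i \<in> I \<Longrightarrow> continuous_on {a..b} (c i)" and Y: "\<And>i. i \<in> I \<Longrightarrow> Y i \<in> F"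
    and der: "\<And>t f. t \<in> {a..b} \<Longrightarrow> f \<in> smooth_funs A \<Longrightarrow>
      ((\<lambda>s. f (\<gamma> s)) has_real_derivative (\<Sum>i\<in>I. c i t * Y i (\<gamma> t) f)) (at t within {a..b})"
    and t0: "t0 \<in> {a..b}"
  shows "\<exists>d>0. \<forall>t\<in>{a..b}. \<bar>t - t0\<bar> < d \<longrightarrow> (\<gamma> t0, \<gamma> t) \<in> same_leaf A F"
proof -
  have tan: "(\<lambda>f. \<Sum>i\<in>I. c i t * Y i (\<gamma> t) f) \<in> tangent_space A (\<gamma> t)" for t
    by (intro tangent_sum tangent_scale vec_fieldD(1) F_field Y)
  have cont: "continuous_on {a..b} \<gamma>"
    unfolding continuous_on_eq_continuous_within
    using integral_curve_continuous DERIV_continuous[OF der] by blast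
  obtain U \<phi> where ch: "(U, \<phi>) \<in> A" "\<gamma> t0 \<in> U" by (rule chart_at)
  let ?P = "model_proj A"
  let ?S = "chart_domain ?P U \<phi>" and ?\<psi> = "chart_param ?P U \<phi>"
  interpret mp: mfd_param A ?P ?S ?\<psi> \<phi>
    by unfold_locales (rule local_param_chart(1)[OF ch(1)])
  have im: "?\<psi> ` ?S = U" by (rule local_param_chart(2)[OF ch(1)])
  define y0 where "y0 = \<phi> (\<gamma> t0)"
  have y0: "y0 \<in> ?S" "?\<psi> y0 = \<gamma> t0" using mp.\<phi>_mem mp.\<psi>\<phi> ch(2) unfolding im y0_def by auto
  have "subspace ((\<lambda>X. mp.vf_coords X y0) ` F)"
    unfolding subspace_def
  proof (intro conjI ballI allI)
    have zero: "0 = mp.vf_coords (\<lambda>p f. 0) y0"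
      using mp.vf_coords_sum[of "{}" "\<lambda>i. undefined" y0 "\<lambda>i. undefined"] y0(1) by simp
    show "0 \<in> (\<lambda>X. mp.vf_coords X y0) ` F" using zero F_zero by (rule image_eqI)
    fix u v assume "u \<in> (\<lambda>X. mp.vf_coords X y0) ` F" "v \<in> (\<lambda>X. mp.vf_coords X y0) ` F"
    then obtain X Z where XZ: "X \<in> F" "u = mp.vf_coords X y0" "Z \<in> F" "v = mp.vf_coords Z y0" by blast
    have lc: "mp.vf_coords (\<lambda>p f. k * X p f + l * Z p f) y0 = k *\<^sub>R u + l *\<^sub>R v" for k l
      unfolding XZ(2,4) mp.vf_coords_def
      by (rule mp.coords_lincomb[OF y0(1) vec_fieldD(1)[OF F_field[OF XZ(1)]] vec_fieldD(1)[OF F_field[OF XZ(3)]]])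
    have mem: "(\<lambda>p f. k * X p f + l * Z p f) \<in> F" for k l
      by (intro F_add F_scale smooth_funs_const XZ)
    show "u + v \<in> (\<lambda>X. mp.vf_coords X y0) ` F" using lc[of 1 1] by (intro image_eqI[OF _ mem[of 1 1]]) simp
    show "k *\<^sub>R u \<in> (\<lambda>X. mp.vf_coords X y0) ` F" for k using lc[of k 0] by (intro image_eqI[OF _ mem[of k 0]]) simp
  qed
  then obtain Q where Q: "orth_proj Q" "range Q = (\<lambda>X. mp.vf_coords X y0) ` F" by (rule orth_proj_exists)
  have "\<exists>X. X \<in> F \<and> mp.vf_coords X y0 = Q v" for v
  proof -
    have "Q v \<in> (\<lambda>X. mp.vf_coords X y0) ` F" unfolding Q(2)[symmetric] by blast
    then show ?thesis by (rule imageE) auto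
  qed
  then obtain XB where XB: "\<And>v. XB v \<in> F" "\<And>v. mp.vf_coords (XB v) y0 = Q v" by metis
  interpret lf: leaf_frame A ?P ?S ?\<psi> \<phi> F y0 Q XB
    by unfold_locales (rule y0(1) Q XB)+
  obtain U' G where UG: "open U'" "\<gamma> t0 \<in> U'" "finite G" "G \<subseteq> vec_fields A U'"
    "restrict_foliation U' F = vf_span (smooth_funs_c A U') G"
    using F_finite[of "\<gamma> t0"] by (elim exE conjE) (rule that)
  let ?W = "U' \<inter> ?\<psi> ` lf.U1"
  have W: "open ?W" by (rule open_Int[OF UG(1) mp.image_open[OF lf.U1_open lf.U1_S lf.U1_P]])
  have pW: "\<gamma> t0 \<in> ?W" using UG(2) y0(2) lf.y0_U1 by (metis IntI imageI)
  obtain \<kappa> N C where k: "\<kappa> \<in> smooth_funs A" "open N" "\<gamma> t0 \<in> N" "\<And>x. x \<in> N \<Longrightarrow> \<kappa> x = 1" "N \<subseteq> C"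
    "compact C" "C \<subseteq> ?W" "\<And>x. x \<notin> C \<Longrightarrow> \<kappa> x = 0"
    by (rule bump_function[OF W pW]) (rule that; assumption)
  have "y0 \<in> ?S \<inter> ?\<psi> -` N" using y0 k(3) by simp
  then obtain R where R: "0 < R" "cball y0 R \<subseteq> ?S \<inter> ?\<psi> -` N"
    using mp.preimage_open[OF k(2)] open_contains_cball by metis
  interpret lc: leaf_chart A ?P ?S ?\<psi> \<phi> F y0 Q XB U' G \<kappa> N C R
    by unfold_locales (rule UG k R; assumption?)+
  obtain K where "parallel_family lc.Uo lf.Xh Q y0 R G (\<lambda>g. mp.vf_coords (lc.ZF g)) K" using lc.parallel by blast
  then interpret pf: parallel_family lc.Uo lf.Xh Q y0 R G "\<lambda>g. mp.vf_coords (lc.ZF g)" K .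
  \<comment> \<open>Near \<open>t0\<close> the curve lies in the chart.\<close>
  have "continuous (at t0 within {a..b}) \<gamma>" using cont t0 continuous_on_eq_continuous_within by blast
  then have "\<forall>\<^sub>F s in at t0 within {a..b}. \<gamma> s \<in> U"
    using model_proj(2)[OF ch(1)] ch(2) unfolding continuous_within by (rule topological_tendstoD)
  then obtain d0 where d0: "d0 > 0" "\<And>s. s \<in> {a..b} \<Longrightarrow> s \<noteq> t0 \<Longrightarrow> dist s t0 < d0 \<Longrightarrow> \<gamma> s \<in> U"
    unfolding eventually_at by auto
  define a' b' where "a' = max a (t0 - d0 / 2)" and "b' = min b (t0 + d0 / 2)"
  have J: "{a'..b'} \<subseteq> {a..b}" "t0 \<in> {a'..b'}" using t0 d0(1) unfolding a'_def b'_def by auto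
  have U: "\<gamma> s \<in> U" if "s \<in> {a'..b'}" for s
  proof (cases "s = t0")
    case False
    have "dist s t0 < d0" using that d0(1) unfolding a'_def b'_def dist_real_def by auto
    then show ?thesis using d0(2)[OF subsetD[OF J(1) that] False] by simp
  qed (simp add: ch(2))
  let ?w = "\<lambda>t. \<phi> (\<gamma> t)"
  let ?w' = "\<lambda>t. \<Sum>i\<in>I. c i t *\<^sub>R mp.vf_coords (Y i) (?w t)"
  have wS: "?w t \<in> ?S" "?\<psi> (?w t) = \<gamma> t" if "t \<in> {a'..b'}" for t
    using mp.\<phi>_mem mp.\<psi>\<phi> U[OF that] unfolding im by auto
  have w: "(?w has_vector_derivative ?w' t) (at t within {a'..b'})" if t: "t \<in> {a'..b'}" for t
  proof -
    have "(?w has_vector_derivative mp.coords (?w t) (\<lambda>f. \<Sum>i\<in>I. c i t * Y i (\<gamma> t) f)) (at t within {a'..b'})"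
    proof (rule mp.coords_curve[OF t tan])
      show "\<gamma> t \<in> ?\<psi> ` ?S" unfolding im by (rule U[OF t])
      show "((\<lambda>s. f (\<gamma> s)) has_real_derivative (\<Sum>i\<in>I. c i t * Y i (\<gamma> t) f)) (at t within {a'..b'})"
        if "f \<in> smooth_funs A" for f
        by (rule DERIV_subset[OF der[OF subsetD[OF J(1) t] that] J(1)])
    qed
    moreover have "mp.coords (?w t) (\<lambda>f. \<Sum>i\<in>I. c i t * Y i (\<gamma> t) f) = ?w' t"
      using mp.vf_coords_sum[OF F_field[OF Y] wS(1)[OF t], of I "\<lambda>i. i" "\<lambda>i p. c i t"] 
      unfolding mp.vf_coords_def wS(2)[OF t] by simp
    ultimately show ?thesis by simp
  qed
  have wc: "continuous_on {a'..b'} ?w"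
    unfolding continuous_on_eq_continuous_within using has_vector_derivative_continuous[OF w] by blast
  have cY: "continuous_on {a'..b'} (\<lambda>t. mp.vf_coords (Y i) (?w t))" if "i \<in> I" for i
    by (rule continuous_on_compose2[OF Cinf_continuous_on[OF mp.vf_coords_smooth[OF F_field[OF Y[OF that]]]] wc])
      (use wS(1) in auto)
  have "continuous_on {a'..b'} ?w'"
    by (intro continuous_on_sum continuous_on_scaleR cY continuous_on_subset[OF c J(1)])
  then obtain M where M: "\<And>t. t \<in> {a'..b'} \<Longrightarrow> norm (?w' t) \<le> M"
    by (rule continuous_on_compact_bound[OF compact_Icc]) (rule that; assumption)
  have "\<exists>k\<ge>0. \<forall>t\<in>{a'..b'}. \<bar>c i t\<bar> \<le> k" if i: "i \<in> I" for i
  proof -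
    from continuous_on_compact_bound[OF compact_Icc continuous_on_subset[OF c[OF i] J(1)]]
    show ?thesis by (metis real_norm_def)
  qed
  then obtain m where m: "\<And>i. i \<in> I \<Longrightarrow> 0 \<le> m i" "\<And>i t. i \<in> I \<Longrightarrow> t \<in> {a'..b'} \<Longrightarrow> \<bar>c i t\<bar> \<le> m i"
    by metis
  have "\<exists>e\<ge>0. \<forall>y\<in>cball y0 R. norm (frechet_derivative (mp.vf_coords (lc.ZF g)) (at y) (mp.vf_coords (Y i) y)) \<le> e * lc.rank_excess y"
    if g: "g \<in> G" and i: "i \<in> I" for g i
  proof -
    obtain e where "0 \<le> e" "\<And>y. y \<in> cball y0 R \<Longrightarrow>
      norm (frechet_derivative (mp.vf_coords (lc.ZF g)) (at y) (mp.vf_coords (Y i) y)) \<le> e * lc.rank_excess y"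
      by (rule lc.ZF_deriv_F[OF g Y[OF i]]) (rule that; assumption)
    then show ?thesis by blast
  qed
  then obtain e where e: "\<And>g i. g \<in> G \<Longrightarrow> i \<in> I \<Longrightarrow> 0 \<le> e g i"
    "\<And>g i y. g \<in> G \<Longrightarrow> i \<in> I \<Longrightarrow> y \<in> cball y0 R \<Longrightarrow>
      norm (frechet_derivative (mp.vf_coords (lc.ZF g)) (at y) (mp.vf_coords (Y i) y)) \<le> e g i * lc.rank_excess y"
    by metis
  let ?c = "\<Sum>g\<in>G. \<Sum>i\<in>I. m i * e g i"
  have c0: "0 \<le> (\<Sum>i\<in>I. m i * e g i)" if "g \<in> G" for g
    by (rule sum_nonneg) (use m(1) e(1)[OF that] in auto)
  have "\<exists>d>0. \<forall>t\<in>{a'..b'}. \<bar>t - t0\<bar> < d \<longrightarrow> (\<exists>v E. E 0 = y0 \<and> E 1 = ?w t \<and> (\<forall>s\<in>{0..1}.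
     E s \<in> cball y0 R \<and> (E has_vector_derivative lf.Xh (E s) v) (at s within {0..1::real})))"
  proof (rule pf.tangent_curve_radial[OF J(2) _ w, where M=M and c="?c"])
    show "?w t0 = y0" by (simp add: y0_def)
    show "norm (?w' t) \<le> M" if "t \<in> {a'..b'}" for t by (rule M[OF that])
    show "0 \<le> ?c" by (rule sum_nonneg) (rule c0)
    fix t assume t: "t \<in> {a'..b'}" and wt: "?w t \<in> cball y0 R"
    show "norm (frechet_derivative (mp.vf_coords (lc.ZF g)) (at (?w t)) (?w' t)) \<le> ?c * lc.rank_excess (?w t)" if g: "g \<in> G" for g
    proof -
      let ?D = "frechet_derivative (mp.vf_coords (lc.ZF g)) (at (?w t))"
      have lin: "linear ?D" by (rule Cinf_linear_frechet[OF mp.vf_coords_smooth[OF F_field[OF lc.ZF(1)[OF g]]] wS(1)[OF t]])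
      have e1: "?D (?w' t) = (\<Sum>i\<in>I. c i t *\<^sub>R ?D (mp.vf_coords (Y i) (?w t)))"
        using lin by (simp add: linear_sum linear_cmul)
      have "norm (?D (?w' t)) \<le> (\<Sum>i\<in>I. m i * (e g i * lc.rank_excess (?w t)))"
        unfolding e1 by (rule sum_norm_le) (use m(2)[OF _ t] m(1) e(2)[OF g _ wt] in \<open>auto intro!: mult_mono\<close>)
      also have "\<dots> = (\<Sum>i\<in>I. m i * e g i) * lc.rank_excess (?w t)"
        unfolding sum_distrib_right[of "\<lambda>i. m i * e g i"] by (simp only: mult.assoc)
      also have "\<dots> \<le> ?c * lc.rank_excess (?w t)"
        by (rule mult_right_mono[OF _ lc.rank_excess_nonneg], rule member_le_sum) (use g c0 UG(3) in auto)
      finally show ?thesis .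
    qed
    show "?w' t = lf.Xh (?w t) (?w' t)" if rank_excess: "lc.rank_excess (?w t) = 0"
    proof -
      have "?w t \<in> lf.U1" using wt lc.ball_Uo lc.Uo_U1 by blast
      from lf.Xh_lin[OF this] have "lf.Xh (?w t) (?w' t) = (\<Sum>i\<in>I. c i t *\<^sub>R lf.Xh (?w t) (mp.vf_coords (Y i) (?w t)))"
        by (simp add: linear_sum linear_cmul)
      also have "\<dots> = ?w' t" by (rule sum.cong) (simp_all add: lc.rank_excess_0_field[OF Y wt rank_excess, symmetric])
      finally show ?thesis by (rule sym)
    qed
  qed
  then obtain d where d: "0 < d" "\<And>t. t \<in> {a'..b'} \<Longrightarrow> \<bar>t - t0\<bar> < d \<Longrightarrow> (\<exists>v E. E 0 = y0 \<and> E 1 = ?w t \<and>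
     (\<forall>s\<in>{0..1}. E s \<in> cball y0 R \<and> (E has_vector_derivative lf.Xh (E s) v) (at s within {0..1::real})))"
    by blast
  show ?thesis
  proof (intro exI[of _ "min d (d0 / 2)"] conjI ballI impI)
    show "0 < min d (d0 / 2)" using d(1) d0(1) by simp
    fix t assume t: "t \<in> {a..b}" "\<bar>t - t0\<bar> < min d (d0 / 2)"
    have "\<bar>t - t0\<bar> < d0 / 2" using t(2) by simp
    then have "t0 - d0 / 2 \<le> t" "t \<le> t0 + d0 / 2" by linarith+
    then have tJ: "t \<in> {a'..b'}" using t(1) unfolding a'_def b'_def by simp
    have td: "\<bar>t - t0\<bar> < d" using t(2) by simp
    obtain v E where E: "E 0 = y0" "E 1 = ?w t" and E': "\<forall>s\<in>{0..1}.
      E s \<in> cball y0 R \<and> (E has_vector_derivative lf.Xh (E s) v) (at s within {0..1::real})"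
      using d(2)[OF tJ td] by blast
    from lc.radial_same_leaf[OF conjunct1[OF bspec[OF E']] conjunct2[OF bspec[OF E']]] show "(\<gamma> t0, \<gamma> t) \<in> same_leaf A F"
      unfolding E(1,2) y0(2) wS(2)[OF tJ] .
  qed
qed

theorem tangent_curve_same_leaf:
  fixes \<gamma> :: "real \<Rightarrow> 'a"
  assumes ab: "a \<le> b" and I: "finite I" and c: "\<And>i. i \<in> I \<Longrightarrow> continuous_on {a..b} (c i)"
    and Y: "\<And>i. i \<in> I \<Longrightarrow> Y i \<in> F"
    and der: "\<And>t f. t \<in> {a..b} \<Longrightarrow> f \<in> smooth_funs A \<Longrightarrow>
      ((\<lambda>s. f (\<gamma> s)) has_real_derivative (\<Sum>i\<in>I. c i t * Y i (\<gamma> t) f)) (at t within {a..b})"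
  shows "(\<gamma> a, \<gamma> b) \<in> same_leaf A F"
proof -
  let ?P = "\<lambda>s t. s \<in> {a..b} \<longrightarrow> t \<in> {a..b} \<longrightarrow> (\<gamma> s, \<gamma> t) \<in> same_leaf A F"
  have "?P a b"
  proof (rule Bolzano[OF ab, where P="?P"])
    fix s t r assume "?P s t" "?P t r" "s \<le> t" "t \<le> r"
    then show "?P s r" using same_leaf_trans[of "\<gamma> s" "\<gamma> t" "\<gamma> r"] by auto
  next
    fix x assume "a \<le> x" "x \<le> b"
    then have x: "x \<in> {a..b}" by simp
    have "\<exists>d>0. \<forall>t\<in>{a..b}. \<bar>t - x\<bar> < d \<longrightarrow> (\<gamma> x, \<gamma> t) \<in> same_leaf A F"
      by (rule tangent_curve_local[OF I c Y der x])
    then obtain d where d: "d > 0" "\<And>t. t \<in> {a..b} \<Longrightarrow> \<bar>t - x\<bar> < d \<Longrightarrow> (\<gamma> x, \<gamma> t) \<in> same_leaf A F"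
      by blast
    show "\<exists>d>0. \<forall>s t. s \<le> x \<and> x \<le> t \<and> t - s < d \<longrightarrow> ?P s t"
    proof (intro exI[of _ d] conjI d(1) allI impI)
      fix s t assume st: "s \<le> x \<and> x \<le> t \<and> t - s < d" "s \<in> {a..b}" "t \<in> {a..b}"
      show "(\<gamma> s, \<gamma> t) \<in> same_leaf A F"
        by (rule same_leaf_trans[OF same_leaf_sym[OF d(2)] d(2)]) (use st in auto)
    qed
  qed
  then show ?thesis using ab by simp
qed

end

section \<open>Submersions\<close>

locale submersion_pair = N: smooth_mfd B + M: smooth_mfd A
  for B :: "('n::{second_countable_topology,t2_space}, 'k::euclidean_space) atlas"
    and A :: "('a::{second_countable_topology,t2_space}, 'e::euclidean_space) atlas" +
  fixes \<pi> :: "'n \<Rightarrow> 'a"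
  assumes submersion: "submersion B A \<pi>"
begin

lemma \<pi>_cont: "continuous_on UNIV \<pi>"
  using submersion unfolding submersion_def smooth_map_def by blast

lemma \<pi>_preimage_open: "open W \<Longrightarrow> open (\<pi> -` W)"
  by (rule open_vimage[OF _ \<pi>_cont])

lemma push_image: "pushforward A \<pi> ` tangent_space B q = tangent_space A (\<pi> q)"
  using submersion unfolding submersion_def by blast

lemma pull_smooth:
  assumes W: "open W" and f: "smooth_fun_on A W f"
  shows "smooth_fun_on B (\<pi> -` W) (\<lambda>q. f (\<pi> q))"
proof (rule N.smooth_fun_on_local)
  fix x assume x: "x \<in> \<pi> -` W"
  obtain V \<chi>' where c': "(V, \<chi>') \<in> A" "\<pi> x \<in> V" by (rule M.chart_at)
  have V: "open V" by (rule M.model_proj(2)[OF c'(1)])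
  let ?W = "\<pi> -` (V \<inter> W)"
  have "smooth_fun_on B ?W (\<lambda>q. f (\<pi> q))"
    unfolding smooth_fun_on_def
  proof (clarify)
    fix U \<phi> assume c: "(U, \<phi>) \<in> B"
    have "smooth_on (\<phi> ` (U \<inter> \<pi> -` V)) (\<chi>' \<circ> \<pi> \<circ> inv_into U \<phi>)"
      using submersion c c'(1) unfolding submersion_def smooth_map_def by blast
    then have 1: "smooth_on (\<phi> ` (U \<inter> ?W)) (\<chi>' \<circ> \<pi> \<circ> inv_into U \<phi>)"
      by (rule smooth_on_subset) blast
    have 2: "smooth_on (\<chi>' ` (V \<inter> W)) (f \<circ> inv_into V \<chi>')"
      using f c'(1) unfolding smooth_fun_on_def by blast
    have "smooth_on (\<phi> ` (U \<inter> ?W)) (\<lambda>z. (f \<circ> inv_into V \<chi>') ((\<chi>' \<circ> \<pi> \<circ> inv_into U \<phi>) z))"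
      by (rule smooth_on_compose[OF 1 2]) (use N.chart_inv[OF c] in auto)
    then show "smooth_on (\<phi> ` (U \<inter> ?W)) ((\<lambda>q. f (\<pi> q)) \<circ> inv_into U \<phi>)"
      by (rule smooth_on_cong[rotated]) (use N.chart_inv[OF c] M.chart_inv[OF c'(1)] in auto)
  qed
  then show "\<exists>W'. open W' \<and> x \<in> W' \<and> smooth_fun_on B W' (\<lambda>q. f (\<pi> q))"
    using x c'(2) \<pi>_preimage_open[OF open_Int[OF V W]] by (intro exI[of _ ?W]) auto
qed

lemma pull_funs: "f \<in> smooth_funs A \<Longrightarrow> (\<lambda>q. f (\<pi> q)) \<in> smooth_funs B"
  using pull_smooth[OF open_UNIV, of f] unfolding smooth_funs_def by simp

lemma push_apply: "f \<in> smooth_funs A \<Longrightarrow> pushforward A \<pi> v f = v (\<lambda>q. f (\<pi> q))"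
  by (simp add: pushforward_def o_def)

lemma push_tangent: "v \<in> tangent_space B q \<Longrightarrow> pushforward A \<pi> v \<in> tangent_space A (\<pi> q)"
  using push_image by blast

lemma push_lincomb:
  "pushforward A \<pi> (\<lambda>f. c * u f + d * v f) = (\<lambda>f. c * pushforward A \<pi> u f + d * pushforward A \<pi> v f)"
  by (auto simp: pushforward_def)

lemma push_scale: "pushforward A \<pi> (\<lambda>f. c * u f) = (\<lambda>f. c * pushforward A \<pi> u f)"
  by (auto simp: pushforward_def)

end

locale submersion_charts = submersion_pair B A \<pi> + NP: mfd_param B P S \<psi> \<phi> + MP: mfd_param A P' S' \<psi>' \<phi>'
  for B :: "('n::{second_countable_topology,t2_space}, 'k::euclidean_space) atlas"
    and A :: "('a::{second_countable_topology,t2_space}, 'e::euclidean_space) atlas"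
    and \<pi> P S \<psi> \<phi> P' S' \<psi>' \<phi>'
begin

definition T :: "'k set" where "T = S \<inter> \<psi> -` (\<pi> -` (\<psi>' ` S'))"
definition p :: "'k \<Rightarrow> 'e" where "p z = \<phi>' (\<pi> (\<psi> z))"

lemma T_open: "open T"
  unfolding T_def by (rule NP.preimage_open[OF \<pi>_preimage_open[OF MP.im_open]])

lemma T_S: "T \<subseteq> S"
  by (simp add: T_def)

lemma T_P: "z \<in> T \<Longrightarrow> P z \<in> T"
  using NP.P_in NP.\<psi>P by (auto simp: T_def)

lemma p_T: "z \<in> T \<Longrightarrow> p z \<in> S'" "z \<in> T \<Longrightarrow> \<psi>' (p z) = \<pi> (\<psi> z)" "z \<in> T \<Longrightarrow> P' (p z) = p z"
  using MP.\<phi>_mem MP.\<psi>\<phi> MP.P\<phi> unfolding p_def T_def by auto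

lemma p_P: "z \<in> T \<Longrightarrow> p (P z) = p z"
  using NP.\<psi>P T_S by (auto simp: p_def)

lemma p_smooth: "Cinf T p"
proof (rule Cinf_componentwise[OF T_open])
  fix b :: 'e
  have "smooth_fun_on A (\<psi>' ` S') (\<lambda>q. \<phi>' q \<bullet> b)"
    by (rule MP.smooth_push_compose[OF Cinf_linear[OF linear_inner_const MP.S_open]])
  from NP.smooth_pull[OF \<pi>_preimage_open[OF MP.im_open] pull_smooth[OF MP.im_open this]]
  show "Cinf T (\<lambda>z. p z \<bullet> b)" unfolding T_def p_def .
qed

lemma push_tv_coords:
  assumes z: "z \<in> T"
  shows "pushforward A \<pi> (NP.tv z v) = MP.tv (p z) (frechet_derivative p (at z) v)"
proof (rule ext)
  fix f
  show "pushforward A \<pi> (NP.tv z v) f = MP.tv (p z) (frechet_derivative p (at z) v) f"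
  proof (cases "f \<in> smooth_funs A")
    case f: True
    from has_derivative_compose[OF Cinf_has_derivative[OF p_smooth z] MP.pull_derivative[OF f p_T(1)[OF z]]]
    have "((\<lambda>z. f (\<pi> (\<psi> z))) has_derivative
        (\<lambda>v. frechet_derivative (\<lambda>w. f (\<psi>' w)) (at (p z)) (frechet_derivative p (at z) v))) (at z)"
      by (rule has_derivative_transform_within_open[OF _ T_open z]) (simp add: p_T(2))
    from frechet_derivative_at[OF this, symmetric] show ?thesis
      by (simp add: push_apply[OF f] NP.tv_apply[OF pull_funs[OF f]] MP.tv_apply[OF f])
  qed (simp add: pushforward_def MP.tv_def)
qed

end

text \<open>In coordinates \<open>y\<close> that are adapted to the submersion, it becomes an affine map with linear
  part \<open>D\<close>. The map \<open>R\<close> is a linear section of \<open>D\<close>.\<close>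

locale adapted_charts = submersion_pair B A \<pi> + NP: mfd_param B P S \<psi> \<phi> + MP: mfd_param A P' S' \<psi>' \<phi>'
  for B :: "('n::{second_countable_topology,t2_space}, 'k::euclidean_space) atlas"
    and A :: "('a::{second_countable_topology,t2_space}, 'e::euclidean_space) atlas"
    and \<pi> P S \<psi> \<phi> P' S' \<psi>' \<phi>' +
  fixes D :: "'k \<Rightarrow> 'e" and R :: "'e \<Rightarrow> 'k" and w0 :: 'e
  assumes D_lin: "linear D" and R_lin: "linear R"
    and D_P: "\<And>v. D (P v) = D v" and P'_D: "\<And>v. P' (D v) = D v"
    and P_R: "\<And>w. P (R w) = R w" and D_R: "\<And>w. D (R w) = P' w" and R_P': "\<And>w. R (P' w) = R w"
    and S_0: "0 \<in> S" and w0: "w0 \<in> S'" "P' w0 = w0"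
    and D_in: "\<And>y. y \<in> S \<Longrightarrow> w0 + D y \<in> S'" and \<pi>_\<psi>: "\<And>y. y \<in> S \<Longrightarrow> \<pi> (\<psi> y) = \<psi>' (w0 + D y)"

context submersion_pair
begin

text \<open>The coordinates come from the inverse of a map \<open>\<Theta>\<close> with \<open>D (\<Theta> z) = p z - w0\<close>, where \<open>p\<close> is the
  submersion in arbitrary charts and \<open>D\<close> its derivative at the base point. Since \<open>\<Theta>\<close> commutes with
  the projection onto the model subspace, the new coordinates form again a parametrisation.\<close>

lemma adapted_charts_exist:
  obtains P S \<psi> \<phi> U' \<phi>' D R w0 where
    "adapted_charts B A \<pi> P S \<psi> \<phi> (model_proj A) (chart_domain (model_proj A) U' \<phi>')
      (chart_param (model_proj A) U' \<phi>') \<phi>' D R w0"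
    "\<psi> 0 = x0" "(U', \<phi>') \<in> A" "\<pi> x0 \<in> U'" "w0 = \<phi>' (\<pi> x0)"
proof -
  obtain U \<phi>0 where ch: "(U, \<phi>0) \<in> B" "x0 \<in> U" by (rule N.chart_at)
  obtain U' \<phi>' where ch': "(U', \<phi>') \<in> A" "\<pi> x0 \<in> U'" by (rule M.chart_at)
  let ?P = "model_proj B" and ?P' = "model_proj A"
  let ?Sn = "chart_domain ?P U \<phi>0" and ?\<psi>n = "chart_param ?P U \<phi>0"
  let ?S' = "chart_domain ?P' U' \<phi>'" and ?\<psi>' = "chart_param ?P' U' \<phi>'"
  interpret np: mfd_param B ?P ?Sn ?\<psi>n \<phi>0 by unfold_locales (rule N.local_param_chart(1)[OF ch(1)])
  interpret mp: mfd_param A ?P' ?S' ?\<psi>' \<phi>' by unfold_locales (rule M.local_param_chart(1)[OF ch'(1)])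
  have im: "?\<psi>n ` ?Sn = U" by (rule N.local_param_chart(2)[OF ch(1)])
  have im': "?\<psi>' ` ?S' = U'" by (rule M.local_param_chart(2)[OF ch'(1)])
  have U': "open U'" by (rule M.model_proj(2)[OF ch'(1)])
  define z0 where "z0 = \<phi>0 x0"
  have z0: "z0 \<in> ?Sn" "?\<psi>n z0 = x0" "?P z0 = z0"
    using np.\<phi>_mem np.\<psi>\<phi> np.P\<phi> ch(2) unfolding im z0_def by auto
  define w0 where "w0 = \<phi>' (\<pi> x0)"
  have w0: "w0 \<in> ?S'" "?\<psi>' w0 = \<pi> x0" "?P' w0 = w0"
    using mp.\<phi>_mem mp.\<psi>\<phi> mp.P\<phi> ch'(2) unfolding im' w0_def by auto
  interpret sc: submersion_charts B A \<pi> ?P ?Sn ?\<psi>n \<phi>0 ?P' ?S' ?\<psi>' \<phi>' by unfold_locales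
  define T where "T = sc.T"
  define p where "p = sc.p"
  have T: "open T" and TS: "T \<subseteq> ?Sn" and TP: "\<And>z. z \<in> T \<Longrightarrow> ?P z \<in> T"
    and pT: "\<And>z. z \<in> T \<Longrightarrow> p z \<in> ?S'" "\<And>z. z \<in> T \<Longrightarrow> ?\<psi>' (p z) = \<pi> (?\<psi>n z)" "\<And>z. z \<in> T \<Longrightarrow> ?P' (p z) = p z"
    and p_P: "\<And>z. z \<in> T \<Longrightarrow> p (?P z) = p z" and p: "Cinf T p"
    unfolding T_def p_def by (fact sc.T_open sc.T_S sc.T_P sc.p_T sc.p_P sc.p_smooth)+
  have z0T: "z0 \<in> T" using z0 ch'(2) im' by (simp add: T_def sc.T_def)
  have p_z0: "p z0 = w0" by (simp add: p_def sc.p_def w0_def z0(2))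
  define D where "D = frechet_derivative p (at z0)"
  have D_lin: "linear D" unfolding D_def by (rule Cinf_linear_frechet[OF p z0T])
  have dp: "(p has_derivative D) (at z0)" unfolding D_def by (rule Cinf_has_derivative[OF p z0T])
  have D_P: "D (?P v) = D v" for v
  proof -
    have "(p has_derivative D) (at (?P z0))" using dp z0(3) by simp
    from has_derivative_compose[OF linear_imp_has_derivative[OF np.P_lin] this]
    have "((\<lambda>z. p (?P z)) has_derivative (\<lambda>v. D (?P v))) (at z0)" .
    then have "(p has_derivative (\<lambda>v. D (?P v))) (at z0)"
      by (rule has_derivative_transform_within_open[OF _ T z0T]) (rule p_P)
    from has_derivative_unique[OF this dp] show ?thesis by (rule fun_cong)
  qed
  have P'_D: "?P' (D v) = D v" for v
  proof -
    have "((\<lambda>z. ?P' (p z)) has_derivative (\<lambda>v. ?P' (D v))) (at z0)"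
      by (rule has_derivative_compose[OF dp linear_imp_has_derivative[OF mp.P_lin]])
    then have "(p has_derivative (\<lambda>v. ?P' (D v))) (at z0)"
      by (rule has_derivative_transform_within_open[OF _ T z0T]) (rule pT(3))
    from has_derivative_unique[OF this dp] show ?thesis by (rule fun_cong)
  qed
  have push: "pushforward A \<pi> (np.tv z0 v) = mp.tv w0 (D v)" for v
    using sc.push_tv_coords[OF z0T[unfolded T_def], of v] p_z0 unfolding D_def p_def by simp
  have "\<exists>v. ?P v = v \<and> D v = ?P' w" for w
  proof -
    have "mp.tv w0 w \<in> tangent_space A (\<pi> x0)" using mp.tv_tangent[OF w0(1), of w] w0(2) by simp
    then have "mp.tv w0 w \<in> pushforward A \<pi> ` tangent_space B (?\<psi>n z0)"
      unfolding push_image z0(2) .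
    then obtain u where u: "u \<in> tangent_space B (?\<psi>n z0)" "mp.tv w0 w = pushforward A \<pi> u" by (rule imageE)
    have "mp.tv w0 w = mp.tv w0 (D (np.coords z0 u))"
      unfolding push[symmetric] np.coords(2)[OF z0(1) u(1)] by (rule u(2))
    from mp.tv_inj[OF w0(1) this] show ?thesis
      using P'_D np.coords(1)[OF z0(1) u(1)] by (intro exI[of _ "np.coords z0 u"]) simp
  qed
  then obtain \<rho> where \<rho>: "\<And>w. ?P (\<rho> w) = \<rho> w" "\<And>w. D (\<rho> w) = ?P' w" by metis
  define R where "R w = (\<Sum>b\<in>Basis. (?P' w \<bullet> b) *\<^sub>R \<rho> b)" for w
  have R_lin: "linear R"
    unfolding R_def linear_iff using mp.P_lin
    by (simp add: linear_add linear_cmul inner_add_left scaleR_add_left sum.distrib scaleR_sum_right)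
  have P_R: "?P (R w) = R w" for w
    unfolding R_def using np.P_lin by (simp add: linear_sum linear_cmul \<rho>(1))
  have D_R: "D (R w) = ?P' w" for w
  proof -
    have "D (R w) = (\<Sum>b\<in>Basis. (?P' w \<bullet> b) *\<^sub>R ?P' b)"
      unfolding R_def using D_lin by (simp add: linear_sum linear_cmul \<rho>(2))
    also have "\<dots> = ?P' (?P' w)" by (rule linear_basis_expansion[OF mp.P_lin, symmetric])
    finally show ?thesis by simp
  qed
  have R_P': "R (?P' w) = R w" for w by (simp add: R_def)
  \<comment> \<open>The change of coordinates; its derivative at \<open>z0\<close> is the identity.\<close>
  define \<Theta> where "\<Theta> z = (z - z0) + R (p z - w0 - D (z - z0))" for z
  have \<Theta>: "Cinf T \<Theta>"
    unfolding \<Theta>_def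
    by (intro Cinf_add Cinf_diff Cinf_const Cinf_compose_linear[OF _ R_lin] Cinf_compose_linear[OF _ D_lin]
        Cinf_linear[OF linear_ident] p T)
  have d\<Theta>: "frechet_derivative \<Theta> (at z0) v = v" for v
  proof -
    have "(\<Theta> has_derivative (\<lambda>v. (v - 0) + R (D v - 0 - D (v - 0)))) (at z0)"
      unfolding \<Theta>_def
      by (intro has_derivative_add has_derivative_diff has_derivative_const has_derivative_ident dp
          bounded_linear.has_derivative[of R] bounded_linear.has_derivative[of D])
        (use R_lin D_lin linear_conv_bounded_linear in blast)+
    from fun_cong[OF frechet_derivative_at[OF this], of v] show ?thesis
      using linear_0[OF R_lin] by simp
  qed
  obtain W V \<Omega> where WV: "open W" "W \<subseteq> T" "z0 \<in> W" "open V" "\<Theta> z0 \<in> V" "homeomorphism W V \<Theta> \<Omega>" "Cinf V \<Omega>"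
    by (rule smooth_inverse_function[OF T z0T \<Theta> d\<Theta>]) (rule that; assumption)
  have \<Theta>_z0: "\<Theta> z0 = 0" using p_z0 linear_0[OF D_lin] linear_0[OF R_lin] by (simp add: \<Theta>_def)
  have \<Omega>: "\<Omega> y \<in> W" "\<Theta> (\<Omega> y) = y" if "y \<in> V" for y using WV(6) that unfolding homeomorphism_def by auto
  have \<Omega>\<Theta>: "\<Omega> (\<Theta> z) = z" "\<Theta> z \<in> V" if "z \<in> W" for z using WV(6) that unfolding homeomorphism_def by auto
  have WT: "z \<in> T" "z \<in> ?Sn" if "z \<in> W" for z using that WV(2) TS by auto
  have \<Theta>P: "\<Theta> (?P z) = ?P (\<Theta> z)" if z: "z \<in> T" for z
  proof -
    have "?P z - z0 = ?P (z - z0)" using np.P_lin z0(3) by (simp add: linear_diff)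
    then show ?thesis
      unfolding \<Theta>_def using np.P_lin by (simp add: linear_add P_R p_P[OF z] D_P)
  qed
  have D\<Theta>: "D (\<Theta> z) = p z - w0" if z: "z \<in> T" for z
    unfolding \<Theta>_def linear_add[OF D_lin] D_R using mp.P_lin pT(3)[OF z] w0(3)
    by (simp add: linear_diff P'_D)
  let ?S = "V \<inter> ?P -` V \<inter> (\<lambda>y. ?P (\<Omega> y)) -` W"
  have P_cont: "continuous_on X ?P" for X by (rule orth_proj_continuous[OF np.P_proj])
  have S_open: "open ?S"
  proof -
    have "open (V \<inter> ?P -` V)" by (rule continuous_open_preimage[OF P_cont WV(4,4)])
    moreover have "open (V \<inter> (\<lambda>y. ?P (\<Omega> y)) -` W)"
      by (rule continuous_open_preimage[OF _ WV(4,1)])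
        (rule continuous_on_compose2[OF P_cont[of UNIV] Cinf_continuous_on[OF WV(7)]], simp)
    ultimately have "open ((V \<inter> ?P -` V) \<inter> (V \<inter> (\<lambda>y. ?P (\<Omega> y)) -` W))" by (rule open_Int)
    moreover have "(V \<inter> ?P -` V) \<inter> (V \<inter> (\<lambda>y. ?P (\<Omega> y)) -` W) = ?S" by blast
    ultimately show ?thesis by simp
  qed
  have \<Omega>P: "\<Omega> (?P y) = ?P (\<Omega> y)" if y: "y \<in> ?S" for y
  proof -
    have yV: "y \<in> V" and PW: "?P (\<Omega> y) \<in> W" using y by auto
    have "\<Theta> (?P (\<Omega> y)) = ?P y" using \<Theta>P[OF WT(1)[OF \<Omega>(1)[OF yV]]] \<Omega>(2)[OF yV] by simp
    then show ?thesis using \<Omega>\<Theta>(1)[OF PW] by simp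
  qed
  have SP: "?P y \<in> ?S" if y: "y \<in> ?S" for y
  proof -
    have "?P (\<Omega> (?P y)) = ?P (\<Omega> y)" unfolding \<Omega>P[OF y] by simp
    then show ?thesis using y by simp
  qed
  let ?\<psi> = "\<lambda>y. ?\<psi>n (\<Omega> y)" and ?\<phi> = "\<lambda>q. ?P (\<Theta> (\<phi>0 q))"
  have \<psi>P: "?\<psi> (?P y) = ?\<psi> y" if y: "y \<in> ?S" for y
    unfolding \<Omega>P[OF y] by (rule np.\<psi>P[OF WT(2)[OF \<Omega>(1)]]) (use y in blast)
  have \<phi>\<psi>: "?\<phi> (?\<psi> y) = ?P y" if y: "y \<in> ?S" for y
  proof -
    have yV: "y \<in> V" using y by blast
    have "\<phi>0 (?\<psi>n (\<Omega> y)) = ?P (\<Omega> y)" by (rule np.\<phi>\<psi>[OF WT(2)[OF \<Omega>(1)[OF yV]]])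
    then show ?thesis using \<Theta>P[OF WT(1)[OF \<Omega>(1)[OF yV]]] \<Omega>(2)[OF yV] by simp
  qed
  have \<Omega>_im: "open (\<Omega> ` X)" "\<Omega> ` X \<subseteq> ?Sn" "\<And>z. z \<in> \<Omega> ` X \<Longrightarrow> ?P z \<in> \<Omega> ` X"
    if X: "open X" "X \<subseteq> ?S" "?P ` X \<subseteq> X" for X
  proof -
    have XV: "X \<subseteq> V" using X(2) by blast
    have "\<Omega> ` X = W \<inter> \<Theta> -` X"
    proof (intro equalityI subsetI)
      fix z assume "z \<in> \<Omega> ` X"
      then show "z \<in> W \<inter> \<Theta> -` X" using \<Omega> XV by auto
    next
      fix z assume "z \<in> W \<inter> \<Theta> -` X"
      then show "z \<in> \<Omega> ` X" using \<Omega>\<Theta>(1)[of z] by (metis IntD1 IntD2 imageI vimageD)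
    qed
    moreover have "open (W \<inter> \<Theta> -` X)"
      by (rule continuous_open_preimage[OF continuous_on_subset[OF Cinf_continuous_on[OF \<Theta>] WV(2)] WV(1) X(1)])
    ultimately show "open (\<Omega> ` X)" by simp
    show "\<Omega> ` X \<subseteq> ?Sn" using XV \<Omega>(1) WT(2) by blast
    fix z assume "z \<in> \<Omega> ` X"
    then obtain y where y: "y \<in> X" "z = \<Omega> y" by blast
    have "?P z = \<Omega> (?P y)" using \<Omega>P[OF subsetD[OF X(2) y(1)]] y(2) by simp
    moreover have "?P y \<in> X" using y(1) X(3) by blast
    ultimately show "?P z \<in> \<Omega> ` X" by blast
  qed
  have im_\<psi>: "?\<psi> ` X = ?\<psi>n ` (\<Omega> ` X)" for X by (simp add: image_image)
  have SP': "?P ` ?S \<subseteq> ?S" using SP by blast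
  note \<Omega>S = \<Omega>_im[OF S_open order_refl SP']
  have \<Omega>_cont: "continuous_on ?S \<Omega>" by (rule continuous_on_subset[OF Cinf_continuous_on[OF WV(7)]]) blast
  have lp: "local_param B ?P ?S ?\<psi> ?\<phi>"
    unfolding local_param_def
  proof (intro conjI ballI allI impI)
    show "orth_proj ?P" by (rule np.P_proj)
    show "open ?S" by (rule S_open)
    show "open (?\<psi> ` ?S)" unfolding im_\<psi> by (rule np.image_open[OF \<Omega>S])
    show "continuous_on ?S ?\<psi>" by (rule continuous_on_compose2[OF np.\<psi>_cont \<Omega>_cont \<Omega>S(2)])
    show "continuous_on (?\<psi> ` ?S) ?\<phi>"
    proof (rule continuous_on_compose2[OF P_cont[of UNIV] continuous_on_compose2[OF Cinf_continuous_on[OF \<Theta>]]])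
      show "continuous_on (?\<psi> ` ?S) \<phi>0"
        by (rule continuous_on_subset[OF np.\<phi>_cont]) (unfold im_\<psi>, rule image_mono[OF \<Omega>S(2)])
      show "\<phi>0 ` (?\<psi> ` ?S) \<subseteq> T"
      proof (clarify)
        fix y assume y: "y \<in> V" "?P y \<in> V" "?P (\<Omega> y) \<in> W"
        have "\<phi>0 (?\<psi>n (\<Omega> y)) = ?P (\<Omega> y)" by (rule np.\<phi>\<psi>[OF WT(2)[OF \<Omega>(1)[OF y(1)]]])
        then show "\<phi>0 (?\<psi>n (\<Omega> y)) \<in> T" using WT(1)[OF y(3)] by simp
      qed
    qed simp
    fix y assume y: "y \<in> ?S"
    show "?P y \<in> ?S" by (rule SP[OF y])
    show "?\<psi> (?P y) = ?\<psi> y" by (rule \<psi>P[OF y])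
    show "?\<phi> (?\<psi> y) = ?P y" by (rule \<phi>\<psi>[OF y])
  next
    fix X and f :: "'n \<Rightarrow> real" assume X: "open X \<and> smooth_fun_on B X f"
    have o: "open (?S \<inter> ?\<psi> -` X)"
      by (rule continuous_open_preimage[OF continuous_on_compose2[OF np.\<psi>_cont \<Omega>_cont \<Omega>S(2)] S_open]) (use X in blast)
    show "Cinf (?S \<inter> ?\<psi> -` X) (\<lambda>y. f (?\<psi> y))"
    proof (rule Cinf_compose[OF o np.preimage_open _ Cinf_subset[OF WV(7)] np.smooth_pull])
      show "\<Omega> ` (?S \<inter> ?\<psi> -` X) \<subseteq> ?Sn \<inter> ?\<psi>n -` X" using \<Omega>S(2) by blast
    qed (use X in auto)
  next
    fix X and f :: "'n \<Rightarrow> real"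
    assume X: "open X \<and> X \<subseteq> ?S \<and> ?P ` X \<subseteq> X \<and> Cinf X (\<lambda>y. f (?\<psi> y))"
    then have X': "open X" "X \<subseteq> ?S" "?P ` X \<subseteq> X" by blast+
    note o = \<Omega>_im[OF X']
    show "smooth_fun_on B (?\<psi> ` X) f"
      unfolding im_\<psi>
    proof (rule np.smooth_push[OF o])
      have OW: "\<Omega> ` X \<subseteq> W" using X'(2) \<Omega>(1) by blast
      have "Cinf (\<Omega> ` X) (\<lambda>z. f (?\<psi> (\<Theta> z)))"
      proof (rule Cinf_compose[OF o(1) X'(1), where g=\<Theta> and f="\<lambda>y. f (?\<psi> y)"])
        show "\<Theta> ` (\<Omega> ` X) \<subseteq> X" using \<Omega>(2) X'(2) by auto
        show "Cinf (\<Omega> ` X) \<Theta>" by (rule Cinf_subset[OF \<Theta>]) (use OW WV(2) in blast)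
        show "Cinf X (\<lambda>y. f (?\<psi> y))" using X by blast
      qed
      then show "Cinf (\<Omega> ` X) (\<lambda>z. f (?\<psi>n z))"
        by (rule Cinf_cong[OF o(1), rotated]) (use OW \<Omega>\<Theta>(1) in auto)
    qed
  qed
  have 0: "\<Omega> 0 = z0" "(0::'k) \<in> V" using \<Omega>\<Theta>[OF WV(3)] \<Theta>_z0 by auto
  have S0: "(0::'k) \<in> ?S" using 0 WV(3) z0(3) linear_0[OF np.P_lin] by simp
  have p\<Omega>: "p (\<Omega> y) = w0 + D y" if "y \<in> V" for y
    using D\<Theta>[OF WT(1)[OF \<Omega>(1)[OF that]]] \<Omega>(2)[OF that] by simp
  have "adapted_charts B A \<pi> ?P ?S ?\<psi> ?\<phi> ?P' ?S' ?\<psi>' \<phi>' D R w0"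
  proof (intro adapted_charts.intro submersion_pair_axioms mfd_param.intro N.smooth_mfd_axioms
      M.smooth_mfd_axioms mfd_param_axioms.intro lp mp.param adapted_charts_axioms.intro
      D_lin R_lin D_P P'_D P_R D_R R_P' S0 w0(1,3))
    fix y assume "y \<in> ?S"
    then have y: "y \<in> V" by blast
    show "w0 + D y \<in> ?S'" using pT(1)[OF WT(1)[OF \<Omega>(1)[OF y]]] p\<Omega>[OF y] by simp
    show "\<pi> (?\<psi>n (\<Omega> y)) = ?\<psi>' (w0 + D y)" using pT(2)[OF WT(1)[OF \<Omega>(1)[OF y]]] p\<Omega>[OF y] by simp
  qed
  then show thesis by (rule that[OF _ _ ch' w0_def]) (simp add: 0(1) z0(2))
qed

end

section \<open>Riemannian submersions\<close>

lemma riemannian_metricD: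
  assumes "riemannian_metric A g"
  shows "u \<in> tangent_space A p \<Longrightarrow> v \<in> tangent_space A p \<Longrightarrow> g p u v = g p v u"
    and "u \<in> tangent_space A p \<Longrightarrow> v \<in> tangent_space A p \<Longrightarrow> w \<in> tangent_space A p \<Longrightarrow>
      g p (\<lambda>f. c * u f + d * v f) w = c * g p u w + d * g p v w"
    and "v \<in> tangent_space A p \<Longrightarrow> v \<noteq> (\<lambda>f. 0) \<Longrightarrow> g p v v > 0"
    and "X \<in> vec_fields A UNIV \<Longrightarrow> Y \<in> vec_fields A UNIV \<Longrightarrow> (\<lambda>p. g p (X p) (Y p)) \<in> smooth_funs A"
  using assms unfolding riemannian_metric_def by blast+

context mfd_param
begin

definition metric_coords :: "'a metric_tensor \<Rightarrow> 'e \<Rightarrow> 'e \<Rightarrow> 'e \<Rightarrow> real" where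
  "metric_coords g y u v = g (\<psi> y) (tv y u) (tv y v)"

text \<open>The smoothness of a metric is given on global fields, so coordinate fields are cut off.\<close>

lemma metric_coords_smooth:
  assumes g: "riemannian_metric A g"
  shows "Cinf S (\<lambda>y. metric_coords g y u v)"
proof (rule Cinf_local)
  fix y assume y: "y \<in> S"
  obtain \<kappa> N C where k: "\<kappa> \<in> smooth_funs A" "open N" "\<psi> y \<in> N" "\<And>x. x \<in> N \<Longrightarrow> \<kappa> x = 1" "N \<subseteq> C"
    "compact C" "C \<subseteq> \<psi> ` S" "\<And>x. x \<notin> C \<Longrightarrow> \<kappa> x = 0"
    by (rule bump_function[OF im_open imageI[OF y]]) (rule that; assumption)
  let ?X = "\<lambda>u q f. \<kappa> q * tv (\<phi> q) u f"
  have X: "?X u \<in> vec_fields A UNIV" for u by (rule bump_field[OF Cinf_const[OF S_open] k(1,6-8)])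
  let ?V = "S \<inter> \<psi> -` N"
  have V: "open ?V" by (rule preimage_open[OF k(2)])
  have "Cinf S (\<lambda>y. g (\<psi> y) (?X u (\<psi> y)) (?X v (\<psi> y)))"
    by (rule smooth_funs_pull[OF riemannian_metricD(4)[OF g X X]])
  then have 1: "Cinf ?V (\<lambda>y. g (\<psi> y) (?X u (\<psi> y)) (?X v (\<psi> y)))" by (rule Cinf_subset) blast
  have 2: "?X u (\<psi> z) = tv z u" if "z \<in> ?V" for z u
  proof -
    have zS: "z \<in> S" and k1: "\<kappa> (\<psi> z) = 1" using that k(4) by auto
    have "tv (P z) u = tv z u" using tv_P[OF P_in[OF zS], of u] tv_proj[OF zS, of u] by simp
    then show ?thesis by (simp add: k1 \<phi>\<psi>[OF zS])
  qed
  have "Cinf ?V (\<lambda>y. metric_coords g y u v)"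
    by (rule Cinf_cong[OF V _ 1]) (simp only: metric_coords_def 2)
  moreover have "y \<in> ?V" using y k(3) by simp
  ultimately show "\<exists>V. open V \<and> y \<in> V \<and> Cinf V (\<lambda>y. metric_coords g y u v)" using V by (intro exI[of _ ?V] conjI)
qed

lemma metric_coords_sym: "riemannian_metric A g \<Longrightarrow> y \<in> S \<Longrightarrow> metric_coords g y u v = metric_coords g y v u"
  unfolding metric_coords_def by (rule riemannian_metricD(1)[OF _ tv_tangent tv_tangent])

lemma metric_coords_linear:
  assumes g: "riemannian_metric A g" and y: "y \<in> S"
  shows "linear (\<lambda>u. metric_coords g y u v)"
proof -
  have lc: "metric_coords g y (c *\<^sub>R u + d *\<^sub>R w) v = c * metric_coords g y u v + d * metric_coords g y w v" for c d u w
    unfolding metric_coords_def tv_lincomb[OF y] by (rule riemannian_metricD(2)[OF g]) (rule tv_tangent[OF y])+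
  show ?thesis unfolding linear_iff using lc[of 1 _ 1] lc[of _ _ 0 0] by simp
qed

lemma metric_coords_linear2: "riemannian_metric A g \<Longrightarrow> y \<in> S \<Longrightarrow> linear (\<lambda>v. metric_coords g y u v)"
  using metric_coords_linear[of g y u] by (simp only: metric_coords_sym[of g y u])

lemma metric_coords_pos:
  assumes g: "riemannian_metric A g" and y: "y \<in> S" and v: "P v \<noteq> 0"
  shows "0 < metric_coords g y v v"
  unfolding metric_coords_def
proof (rule riemannian_metricD(3)[OF g tv_tangent[OF y]])
  show "tv y v \<noteq> (\<lambda>f. 0)"
  proof
    assume "tv y v = (\<lambda>f. 0)"
    then have "tv y v = tv y 0" using linear_0[OF tv_linear[OF y]] by auto
    from tv_inj[OF y this] show False using v linear_0[OF P_lin] by simp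
  qed
qed

end

locale riem_submersion = submersion_pair B A \<pi>
  for B :: "('n::{second_countable_topology,t2_space}, 'k::euclidean_space) atlas"
    and A :: "('a::{second_countable_topology,t2_space}, 'e::euclidean_space) atlas" and \<pi> +
  fixes h :: "'n metric_tensor" and g :: "'a metric_tensor"
  assumes h: "riemannian_metric B h" and g: "riemannian_metric A g"
    and riem: "riemannian_submersion B h A g \<pi>"
begin

abbreviation Hor :: "'n \<Rightarrow> 'n tangent_vec set" where "Hor q \<equiv> horizontal_space B h A \<pi> q"

lemma Hor_tangent: "v \<in> Hor q \<Longrightarrow> v \<in> tangent_space B q"
  and Hor_orth: "v \<in> Hor q \<Longrightarrow> w \<in> tangent_space B q \<Longrightarrow> pushforward A \<pi> w = (\<lambda>f. 0) \<Longrightarrow> h q v w = 0"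
  unfolding horizontal_space_def by blast+

lemma push_bij: "bij_betw (pushforward A \<pi>) (Hor q) (tangent_space A (\<pi> q))"
  and push_isometry: "u \<in> Hor q \<Longrightarrow> v \<in> Hor q \<Longrightarrow> g (\<pi> q) (pushforward A \<pi> u) (pushforward A \<pi> v) = h q u v"
  using riem unfolding riemannian_submersion_def by blast+

definition hlift :: "'n \<Rightarrow> 'a tangent_vec \<Rightarrow> 'n tangent_vec" where
  "hlift q = the_inv_into (Hor q) (pushforward A \<pi>)"

lemma hlift:
  assumes "u \<in> tangent_space A (\<pi> q)"
  shows "hlift q u \<in> Hor q" "pushforward A \<pi> (hlift q u) = u"
proof -
  have i: "inj_on (pushforward A \<pi>) (Hor q)" "u \<in> pushforward A \<pi> ` Hor q"
    using push_bij[of q] assms unfolding bij_betw_def by auto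
  show "hlift q u \<in> Hor q" unfolding hlift_def by (rule the_inv_into_into[OF i order_refl])
  show "pushforward A \<pi> (hlift q u) = u" unfolding hlift_def by (rule f_the_inv_into_f[OF i])
qed

text \<open>The differential does not increase lengths, because a tangent vector is the orthogonal sum of
  a horizontal one with the same image and a vertical one.\<close>

lemma push_norm_le:
  assumes v: "v \<in> tangent_space B q"
  shows "g (\<pi> q) (pushforward A \<pi> v) (pushforward A \<pi> v) \<le> h q v v"
proof -
  define u where "u = hlift q (pushforward A \<pi> v)"
  have u: "u \<in> Hor q" "pushforward A \<pi> u = pushforward A \<pi> v" "u \<in> tangent_space B q"
    using hlift[OF push_tangent[OF v]] Hor_tangent unfolding u_def by auto
  define k where "k = (\<lambda>f. 1 * v f + (-1) * u f)"
  have k: "k \<in> tangent_space B q" unfolding k_def by (rule N.tangent_lincomb[OF v u(3)])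
  have pk: "pushforward A \<pi> k = (\<lambda>f. 0)" unfolding k_def push_lincomb u(2) by simp
  have vk: "v = (\<lambda>f. 1 * u f + 1 * k f)" by (simp add: k_def)
  have huk: "h q u k = 0" by (rule Hor_orth[OF u(1) k pk])
  have hku: "h q k u = 0" using huk riemannian_metricD(1)[OF h u(3) k] by simp
  have lin: "h q v w = h q u w + h q k w" if "w \<in> tangent_space B q" for w
    using riemannian_metricD(2)[OF h u(3) k that, of 1 1] unfolding vk[symmetric] by simp
  have kk: "0 \<le> h q k k"
  proof (cases "k = (\<lambda>f. 0)")
    case True
    have "h q (\<lambda>f. 0 * k f + 0 * k f) k = 0 * h q k k + 0 * h q k k" by (rule riemannian_metricD(2)[OF h k k k])
    then show ?thesis using True by simp
  qed (use riemannian_metricD(3)[OF h k] in auto)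
  have "h q v v = h q u v + h q k v" by (rule lin[OF v])
  also have "\<dots> = h q v u + h q v k" using riemannian_metricD(1)[OF h v u(3)] riemannian_metricD(1)[OF h v k] by simp
  also have "\<dots> = h q u u + h q k k" using lin[OF u(3)] lin[OF k] huk hku by simp
  finally have "h q u u \<le> h q v v" using kk by simp
  then show ?thesis using push_isometry[OF u(1,1)] unfolding u(2) by simp
qed

end

context adapted_charts
begin

lemma push_tv:
  assumes y: "y \<in> S"
  shows "pushforward A \<pi> (NP.tv y v) = MP.tv (w0 + D y) (D v)"
proof (rule ext)
  fix f
  show "pushforward A \<pi> (NP.tv y v) f = MP.tv (w0 + D y) (D v) f"
  proof (cases "f \<in> smooth_funs A")
    case f: True
    have "((\<lambda>y. w0 + D y) has_derivative (\<lambda>v. 0 + D v)) (at y)"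
      by (intro has_derivative_add has_derivative_const linear_imp_has_derivative D_lin)
    from has_derivative_compose[OF this MP.pull_derivative[OF f D_in[OF y]]]
    have "((\<lambda>y. f (\<psi>' (w0 + D y))) has_derivative
      (\<lambda>v. frechet_derivative (\<lambda>w. f (\<psi>' w)) (at (w0 + D y)) (0 + D v))) (at y)" .
    then have "((\<lambda>y. f (\<pi> (\<psi> y))) has_derivative
      (\<lambda>v. frechet_derivative (\<lambda>w. f (\<psi>' w)) (at (w0 + D y)) (0 + D v))) (at y)"
      by (rule has_derivative_transform_within_open[OF _ NP.S_open y]) (simp add: \<pi>_\<psi>)
    from frechet_derivative_at[OF this, symmetric] show ?thesis
      by (simp add: push_apply[OF f] NP.tv_apply[OF pull_funs[OF f]] MP.tv_apply[OF f])
  qed (simp add: pushforward_def MP.tv_def)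
qed

text \<open>The projection onto the vertical directions.\<close>

definition K :: "'k \<Rightarrow> 'k" where "K v = P v - R (D v)"

lemma K_lin: "linear K"
  unfolding K_def using NP.P_lin linear_compose[OF D_lin R_lin] by (intro linear_compose_sub) (auto simp: o_def)

lemma P_K: "P (K v) = K v" and D_K: "D (K v) = 0" and K_ker: "P k = k \<Longrightarrow> D k = 0 \<Longrightarrow> K k = k"
  using NP.P_lin D_lin linear_0[OF R_lin] by (simp_all add: K_def linear_diff P_R D_P D_R P'_D)

end

locale riem_adapted = riem_submersion B A \<pi> h g + adapted_charts B A \<pi> P S \<psi> \<phi> P' S' \<psi>' \<phi>' D R w0
  for B :: "('n::{second_countable_topology,t2_space}, 'k::euclidean_space) atlas"
    and A :: "('a::{second_countable_topology,t2_space}, 'e::euclidean_space) atlas"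
    and \<pi> h g P S \<psi> \<phi> P' S' \<psi>' \<phi>' D R w0
begin

lemma D_hlift:
  assumes X: "X \<in> vec_fields A UNIV" and y: "y \<in> S"
  shows "D (NP.coords y (hlift (\<psi> y) (X (\<pi> (\<psi> y))))) = MP.vf_coords X (w0 + D y)"
proof -
  let ?v = "NP.coords y (hlift (\<psi> y) (X (\<pi> (\<psi> y))))"
  have Xt: "X (\<pi> (\<psi> y)) \<in> tangent_space A (\<pi> (\<psi> y))" by (rule M.vec_fieldD(1)[OF X])
  note hl = hlift[OF Xt]
  note cv = NP.coords[OF y Hor_tangent[OF hl(1)]]
  have "MP.tv (w0 + D y) (D ?v) = X (\<psi>' (w0 + D y))"
    unfolding push_tv[OF y, symmetric] cv(2) hl(2) by (simp only: \<pi>_\<psi>[OF y])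
  then have "MP.tv (w0 + D y) (D ?v) = MP.tv (w0 + D y) (MP.vf_coords X (w0 + D y))"
    using MP.vf_coords_tv[OF X D_in[OF y]] by simp
  from MP.tv_inj[OF D_in[OF y] this] show ?thesis
    using P'_D MP.P_cf[OF X D_in[OF y]] by simp
qed

text \<open>Horizontal lifts are smooth, since in coordinates they solve a linear system: the
  first term of the matrix forces the solution into the model subspace, the second one prescribes its
  image, and the last one expresses that it is orthogonal to all vertical vectors.\<close>

lemma hlift_coords_smooth:
  assumes X: "X \<in> vec_fields A UNIV"
  shows "Cinf S (\<lambda>y. NP.coords y (hlift (\<psi> y) (X (\<pi> (\<psi> y)))))"
proof -
  let ?v = "\<lambda>y. NP.coords y (hlift (\<psi> y) (X (\<pi> (\<psi> y))))"
  let ?G = "NP.metric_coords h"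
  define C where "C y v = (\<Sum>b\<in>Basis. ?G y (K b) (P v) *\<^sub>R K b)" for y v
  define L where "L y v = (v - P v) + (R (D v) + C y v)" for y v
  have C_lin: "linear (C y)" if y: "y \<in> S" for y
    unfolding C_def using linear_compose[OF NP.P_lin NP.metric_coords_linear2[OF h y]]
    by (simp add: linear_iff o_def scaleR_add_left sum.distrib scaleR_sum_right)
  have L_lin: "linear (L y)" if y: "y \<in> S" for y
    unfolding L_def using C_lin[OF y] NP.P_lin linear_compose[OF D_lin R_lin] linear_ident
    by (intro linear_compose_add linear_compose_sub) (auto simp: o_def)
  have PC: "P (C y v) = C y v" "D (C y v) = 0" for y v
    unfolding C_def using NP.P_lin D_lin by (simp_all add: linear_sum linear_cmul P_K D_K)
  have inj: "inj (L y)" if y: "y \<in> S" for y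
    unfolding linear_injective_0[OF L_lin[OF y]]
  proof (intro allI impI)
    fix v assume v: "L y v = 0"
    have "P (L y v) = R (D v) + C y v"
      unfolding L_def using NP.P_lin by (simp add: linear_add linear_diff P_R PC)
    then have RC: "R (D v) + C y v = 0" using v linear_0[OF NP.P_lin] by simp
    have Pv: "P v = v" using v RC by (simp add: L_def)
    have "D (R (D v) + C y v) = D v" using D_lin by (simp add: linear_add D_R P'_D PC)
    then have Dv: "D v = 0" using RC linear_0[OF D_lin] by simp
    then have "C y v = 0" using RC linear_0[OF R_lin] by simp
    then have "0 = ?G y (C y v) v" using linear_0[OF NP.metric_coords_linear[OF h y]] by simp
    also have "\<dots> = (\<Sum>b\<in>Basis. ?G y (K b) v * ?G y (K b) v)"
      unfolding C_def Pv by (simp add: linear_sum[OF NP.metric_coords_linear[OF h y]] linear_cmul[OF NP.metric_coords_linear[OF h y]])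
    finally have "(\<Sum>b\<in>Basis. ?G y (K b) v * ?G y (K b) v) = 0" by simp
    then have z: "?G y (K b) v = 0" if "b \<in> Basis" for b
      using sum_nonneg_eq_0_iff[of Basis "\<lambda>b. ?G y (K b) v * ?G y (K b) v"] that by auto
    have "linear (\<lambda>u. ?G y (K u) v)" using linear_compose[OF K_lin NP.metric_coords_linear[OF h y]] by (simp add: o_def)
    from linear_basis_expansion[OF this, of v] have "?G y (K v) v = 0" using z by simp
    then have "?G y v v = 0" using K_ker[OF Pv Dv] by simp
    then show "v = 0" using NP.metric_coords_pos[OF h y, of v] Pv by force
  qed
  have smooth: "Cinf S (\<lambda>y. L y v)" for v
    unfolding L_def C_def
    by (intro Cinf_add Cinf_const Cinf_sum Cinf_scaleR NP.metric_coords_smooth[OF h] NP.S_open)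
  have rhs: "Cinf S (\<lambda>y. R (MP.vf_coords X (w0 + D y)))"
    by (intro Cinf_compose_linear[OF NP.S_open R_lin] Cinf_compose[OF NP.S_open MP.S_open _ _ MP.vf_coords_smooth[OF X]]
        Cinf_add[OF NP.S_open] Cinf_const NP.S_open Cinf_linear[OF D_lin]) (use D_in in auto)
  show ?thesis
  proof (rule Cinf_linear_solve[OF NP.S_open L_lin inj smooth rhs])
    fix y assume y: "y \<in> S"
    have Xt: "X (\<pi> (\<psi> y)) \<in> tangent_space A (\<pi> (\<psi> y))" by (rule M.vec_fieldD(1)[OF X])
    note hl = hlift[OF Xt]
    note hT = Hor_tangent[OF hl(1)]
    note cv = NP.coords[OF y hT]
    note Dv = D_hlift[OF X y]
    have "?G y (K b) (?v y) = 0" for b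
    proof -
      have "pushforward A \<pi> (NP.tv y (K b)) = (\<lambda>f. 0)"
        unfolding push_tv[OF y] D_K using linear_0[OF MP.tv_linear[OF D_in[OF y]]] by auto
      from Hor_orth[OF hl(1) NP.tv_tangent[OF y] this]
      have "?G y (?v y) (K b) = 0" unfolding NP.metric_coords_def cv(2) .
      then show ?thesis using NP.metric_coords_sym[OF h y] by simp
    qed
    then have "C y (?v y) = 0" unfolding C_def cv(1) by simp
    then show "L y (?v y) = R (MP.vf_coords X (w0 + D y))" unfolding L_def Dv cv(1) by simp
  qed
qed

end

context riem_submersion
begin

lemma hlift_field:
  assumes X: "X \<in> vec_fields A UNIV"
  shows "(\<lambda>q. hlift q (X (\<pi> q))) \<in> vec_fields B UNIV"
proof -
  have "smooth_fun_on B UNIV (\<lambda>q. hlift q (X (\<pi> q)) f)" if f: "f \<in> smooth_funs B" for f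
  proof (rule N.smooth_fun_on_local)
    fix x0
    obtain P S \<psi> \<phi> U' \<phi>' D R w0 where
      "adapted_charts B A \<pi> P S \<psi> \<phi> (model_proj A) (chart_domain (model_proj A) U' \<phi>')
      (chart_param (model_proj A) U' \<phi>') \<phi>' D R w0" and x0: "\<psi> 0 = x0"
      by (rule adapted_charts_exist) (rule that; assumption)
    then interpret ad: adapted_charts B A \<pi> P S \<psi> \<phi> "model_proj A" "chart_domain (model_proj A) U' \<phi>'"
      "chart_param (model_proj A) U' \<phi>'" \<phi>' D R w0 by blast
    interpret ra: riem_adapted B A \<pi> h g P S \<psi> \<phi> "model_proj A" "chart_domain (model_proj A) U' \<phi>'"
      "chart_param (model_proj A) U' \<phi>'" \<phi>' D R w0 by unfold_locales
    let ?v = "\<lambda>y. ad.NP.coords y (hlift (\<psi> y) (X (\<pi> (\<psi> y))))"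
    have "smooth_fun_on B (\<psi> ` S) (\<lambda>q. ad.NP.tv (\<phi> q) (?v (\<phi> q)) f)"
      by (rule ad.NP.smooth_field_of_coords[OF ad.NP.S_open order_refl ad.NP.P_in ra.hlift_coords_smooth[OF X] f])
    then have "smooth_fun_on B (\<psi> ` S) (\<lambda>q. hlift q (X (\<pi> q)) f)"
    proof (rule N.smooth_fun_on_cong[OF ad.NP.im_open, rotated])
      fix q assume q: "q \<in> \<psi> ` S"
      note ad.NP.coords(2)[OF ad.NP.\<phi>_mem[OF q], unfolded ad.NP.\<psi>\<phi>[OF q],
          OF Hor_tangent[OF hlift(1)[OF M.vec_fieldD(1)[OF X]]]]
      then show "ad.NP.tv (\<phi> q) (?v (\<phi> q)) f = hlift q (X (\<pi> q)) f" unfolding ad.NP.\<psi>\<phi>[OF q] by simp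
    qed
    then show "\<exists>W'. open W' \<and> x0 \<in> W' \<and> smooth_fun_on B W' (\<lambda>q. hlift q (X (\<pi> q)) f)"
      using ad.NP.im_open x0 ad.S_0 by blast
  qed
  moreover have "hlift q (X (\<pi> q)) \<in> tangent_space B q" for q
    by (rule Hor_tangent[OF hlift(1)[OF M.vec_fieldD(1)[OF X]]])
  ultimately show ?thesis unfolding vec_fields_def by simp
qed

end

section \<open>The correspondence of leaves\<close>

lemma integral_curveD:
  assumes "integral_curve A X a b \<gamma>" "t \<in> {a..b}" "f \<in> smooth_funs A"
  shows "((\<lambda>s. f (\<gamma> s)) has_real_derivative X (\<gamma> t) f) (at t within {a..b})"
  using assms unfolding integral_curve_def by blast

locale foliated_submersion = riem_submersion B A \<pi> h g + F: foliated_mfd A F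
  for B :: "('n::{second_countable_topology,t2_space}, 'k::euclidean_space) atlas"
    and A :: "('a::{second_countable_topology,t2_space}, 'e::euclidean_space) atlas" and \<pi> h g F
begin

abbreviation PB :: "'n vec_field set" where "PB \<equiv> pullback_foliation B A \<pi> F"

lemma pullback_mem:
  assumes "V \<in> projectable B A \<pi> F" "\<kappa> \<in> smooth_funs_c B UNIV"
  shows "(\<lambda>q f. \<kappa> q * V q f) \<in> PB"
  unfolding pullback_foliation_def vf_span_def
  using assms by (intro CollectI exI[of _ 1] exI[of _ "\<lambda>_. \<kappa>"] exI[of _ "\<lambda>_. V"]) auto

lemma projectableI:
  assumes "V \<in> vec_fields B UNIV" "X \<in> F" "\<And>q. pushforward A \<pi> (V q) = X (\<pi> q)"
  shows "V \<in> projectable B A \<pi> F"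
  using assms unfolding projectable_def by blast

text \<open>An integral curve upstairs is mapped to a curve whose velocity is a combination of fields of
  the foliation, with coefficients that depend on the position upstairs.\<close>

lemma image_same_leaf:
  assumes W: "W \<in> PB" and ab: "a \<le> b" and ic: "integral_curve B W a b \<eta>"
  shows "(\<pi> (\<eta> a), \<pi> (\<eta> b)) \<in> same_leaf A F"
proof -
  obtain n c V where cV: "\<And>i. i < n \<Longrightarrow> c i \<in> smooth_funs_c B UNIV"
    "\<And>i. i < n \<Longrightarrow> V i \<in> projectable B A \<pi> F"
    and Weq: "W = (\<lambda>q f. \<Sum>i<(n::nat). c i q * V i q f)"
    using W unfolding pullback_foliation_def vf_span_def by blast
  have "\<exists>Y\<in>F. \<forall>q. pushforward A \<pi> (V i q) = Y (\<pi> q)" if "i < n" for i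
    using cV(2)[OF that] unfolding projectable_def by blast
  then obtain Y where Y: "\<And>i. i < n \<Longrightarrow> Y i \<in> F" "\<And>i q. i < n \<Longrightarrow> pushforward A \<pi> (V i q) = Y i (\<pi> q)"
    by metis
  have \<eta>: "continuous_on {a..b} \<eta>"
    unfolding continuous_on_eq_continuous_within
  proof
    fix t assume t: "t \<in> {a..b}"
    show "continuous (at t within {a..b}) \<eta>"
    proof (rule N.integral_curve_continuous)
      fix f assume "f \<in> smooth_funs B"
      then have "((\<lambda>s. f (\<eta> s)) has_real_derivative W (\<eta> t) f) (at t within {a..b})"
        by (rule integral_curveD[OF ic t])
      then show "continuous (at t within {a..b}) (\<lambda>s. f (\<eta> s))" by (rule DERIV_continuous)
    qed
  qed
  show ?thesis
  proof (rule F.tangent_curve_same_leaf[OF ab, of "{..<n}" "\<lambda>i t. c i (\<eta> t)" Y "\<lambda>t. \<pi> (\<eta> t)"])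
    fix i assume "i \<in> {..<n}"
    then have "smooth_fun_on B UNIV (c i)" using cV(1) unfolding smooth_funs_c_def smooth_funs_def by auto
    then show "continuous_on {a..b} (\<lambda>t. c i (\<eta> t))"
      by (rule continuous_on_compose2[OF N.smooth_fun_on_continuous[OF open_UNIV] \<eta>]) simp
  next
    fix t f assume t: "t \<in> {a..b}" and f: "f \<in> smooth_funs A"
    have "((\<lambda>s. f (\<pi> (\<eta> s))) has_real_derivative W (\<eta> t) (\<lambda>q. f (\<pi> q))) (at t within {a..b})"
      by (rule integral_curveD[OF ic t pull_funs[OF f]])
    moreover have "W (\<eta> t) (\<lambda>q. f (\<pi> q)) = (\<Sum>i\<in>{..<n}. c i (\<eta> t) * Y i (\<pi> (\<eta> t)) f)"
      unfolding Weq
    proof (rule sum.cong[OF refl])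
      fix i assume i: "i \<in> {..<n}"
      have "V i (\<eta> t) (\<lambda>q. f (\<pi> q)) = Y i (\<pi> (\<eta> t)) f"
        using Y(2)[of i "\<eta> t"] i push_apply[OF f, of "V i (\<eta> t)"] by simp
      then show "c i (\<eta> t) * V i (\<eta> t) (\<lambda>q. f (\<pi> q)) = c i (\<eta> t) * Y i (\<pi> (\<eta> t)) f" by simp
    qed
    ultimately show "((\<lambda>s. f (\<pi> (\<eta> s))) has_real_derivative (\<Sum>i\<in>{..<n}. c i (\<eta> t) * Y i (\<pi> (\<eta> t)) f)) (at t within {a..b})"
      by simp
  qed (use Y(1) in auto)
qed

text \<open>Nearby points of a fibre are joined by straight lines in adapted coordinates, which are
  integral curves of vertical fields.\<close>

lemma fibre_curve:
  obtains N where "open N" "x0 \<in> N" "\<And>x. x \<in> N \<Longrightarrow> \<pi> x = \<pi> x0 \<Longrightarrow>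
    \<exists>W\<in>PB. \<exists>\<eta>. integral_curve B W 0 1 \<eta> \<and> \<eta> 0 = x0 \<and> \<eta> 1 = x"
proof -
  obtain P S \<psi> \<phi> U' \<phi>' D R w0 where
    "adapted_charts B A \<pi> P S \<psi> \<phi> (model_proj A) (chart_domain (model_proj A) U' \<phi>')
      (chart_param (model_proj A) U' \<phi>') \<phi>' D R w0" and \<psi>0: "\<psi> 0 = x0"
    by (rule adapted_charts_exist) (rule that; assumption)
  then interpret ad: adapted_charts B A \<pi> P S \<psi> \<phi> "model_proj A" "chart_domain (model_proj A) U' \<phi>'"
    "chart_param (model_proj A) U' \<phi>'" \<phi>' D R w0 by blast
  have x0: "x0 \<in> \<psi> ` S" using \<psi>0 ad.S_0 by blast
  obtain \<kappa> M C where k: "\<kappa> \<in> smooth_funs B" "open M" "x0 \<in> M" "\<And>x. x \<in> M \<Longrightarrow> \<kappa> x = 1" "M \<subseteq> C"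
    "compact C" "C \<subseteq> \<psi> ` S" "\<And>x. x \<notin> C \<Longrightarrow> \<kappa> x = 0"
    by (rule N.bump_function[OF ad.NP.im_open x0]) (rule that; assumption)
  have kc: "\<kappa> \<in> smooth_funs_c B UNIV" by (rule N.smooth_funs_c_I[OF k(1,6) subset_UNIV k(8)])
  have "0 \<in> S \<inter> \<psi> -` M" using \<psi>0 k(3) ad.S_0 by simp
  then obtain r where r: "0 < r" "ball 0 r \<subseteq> S \<inter> \<psi> -` M"
    using ad.NP.preimage_open[OF k(2)] open_contains_ball by metis
  have P0: "P 0 = 0" by (rule linear_0[OF ad.NP.P_lin])
  have rS: "ball 0 r \<subseteq> S" using r(2) by blast
  show thesis
  proof (rule that)
    show "open (\<psi> ` ball 0 r)"
      by (rule ad.NP.image_open[OF open_ball rS orth_proj_ball[OF ad.NP.P_proj P0]])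
    show "x0 \<in> \<psi> ` ball 0 r" using \<psi>0 r(1) by (metis centre_in_ball imageI)
    fix x assume x: "x \<in> \<psi> ` ball 0 r" and \<pi>x: "\<pi> x = \<pi> x0"
    obtain z where z: "z \<in> ball 0 r" "x = \<psi> z" using x by blast
    define v where "v = P z"
    have v: "v \<in> ball 0 r" "P v = v" "\<psi> v = x" "v \<in> S"
      using orth_proj_ball[OF ad.NP.P_proj P0 z(1)] z rS ad.NP.\<psi>P[of z] unfolding v_def by auto
    have "chart_param (model_proj A) U' \<phi>' (w0 + D v) = chart_param (model_proj A) U' \<phi>' (w0 + D 0)"
      using ad.\<pi>_\<psi>[OF v(4)] ad.\<pi>_\<psi>[OF ad.S_0] \<pi>x \<psi>0 v(3) by simp
    from arg_cong[OF this, of \<phi>'] have "model_proj A (w0 + D v) = model_proj A (w0 + D 0)"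
      unfolding ad.MP.\<phi>\<psi>[OF ad.D_in[OF v(4)]] ad.MP.\<phi>\<psi>[OF ad.D_in[OF ad.S_0]] .
    then have Dv: "D v = 0"
      using ad.MP.P_lin linear_0[OF ad.D_lin] by (simp add: linear_add ad.P'_D)
    let ?V = "\<lambda>q f. \<kappa> q * ad.NP.tv (\<phi> q) v f"
    let ?W = "\<lambda>q f. \<kappa> q * ?V q f"
    have V: "?V \<in> vec_fields B UNIV" by (rule ad.NP.bump_field[OF Cinf_const[OF ad.NP.S_open] k(1,6-8)])
    have "pushforward A \<pi> (?V q) = (\<lambda>f. 0)" for q
    proof (cases "q \<in> C")
      case True
      then have q: "\<phi> q \<in> S" using k(7) ad.NP.\<phi>_mem by blast
      show ?thesis
        unfolding push_scale ad.push_tv[OF q] Dv using linear_0[OF ad.MP.tv_linear[OF ad.D_in[OF q]]] by simp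
    qed (simp add: k(8) pushforward_def)
    then have "?V \<in> projectable B A \<pi> F" by (intro projectableI[OF V F.F_zero])
    then have W: "?W \<in> PB" by (rule pullback_mem[OF _ kc])
    have "integral_curve B ?W 0 1 (\<lambda>t. \<psi> (t *\<^sub>R v))"
      unfolding integral_curve_def
    proof (intro ballI)
      fix t :: real and f assume t: "t \<in> {0..1}" and f: "f \<in> smooth_funs B"
      have "norm (t *\<^sub>R v) \<le> 1 * norm v" using t by (simp add: mult_left_le_one_le)
      then have tv: "t *\<^sub>R v \<in> ball 0 r" using v(1) by simp
      then have tSM: "t *\<^sub>R v \<in> S \<inter> \<psi> -` M" by (rule subsetD[OF r(2)])
      then have tS: "t *\<^sub>R v \<in> S" and k1: "\<kappa> (\<psi> (t *\<^sub>R v)) = 1" using k(4) by simp_all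
      have "((\<lambda>s. f (\<psi> (s *\<^sub>R v))) has_real_derivative ad.NP.tv (t *\<^sub>R v) v f) (at t within {0..1})"
        by (rule ad.NP.curve_tv[where w="\<lambda>t. t *\<^sub>R v", OF _ tS f]) (auto intro!: derivative_eq_intros)
      moreover have "?W (\<psi> (t *\<^sub>R v)) f = ad.NP.tv (t *\<^sub>R v) v f"
        unfolding k1 ad.NP.\<phi>\<psi>[OF tS] using ad.NP.tv_proj[OF tS, of v] v(2) by simp
      ultimately show "((\<lambda>s. f (\<psi> (s *\<^sub>R v))) has_real_derivative ?W (\<psi> (t *\<^sub>R v)) f) (at t within {0..1})"
        by simp
    qed
    then show "\<exists>W\<in>PB. \<exists>\<eta>. integral_curve B W 0 1 \<eta> \<and> \<eta> 0 = x0 \<and> \<eta> 1 = x"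
      using W \<psi>0 v(3) by (intro bexI[of _ ?W] exI[of _ "\<lambda>t. \<psi> (t *\<^sub>R v)"]) auto
  qed
qed

text \<open>A field of the pullback foliation must be a combination of fields that project to the
  foliation on the whole manifold. The global horizontal lift is corrected near \<open>x0\<close> by a vertical
  field such that the given curve, lifted along a section, becomes an integral curve.\<close>

lemma lift_curve:
  assumes X: "X \<in> F" and ic: "integral_curve A X a b \<gamma>" and t0: "t0 \<in> {a..b}" "\<pi> x0 = \<gamma> t0"
  obtains d W \<eta> where "0 < d" "W \<in> PB" "\<eta> t0 = x0" "\<And>t. t \<in> {a..b} \<Longrightarrow> \<bar>t - t0\<bar> < d \<Longrightarrow> \<pi> (\<eta> t) = \<gamma> t"
    "\<And>s t. s \<in> {a..b} \<Longrightarrow> t \<in> {a..b} \<Longrightarrow> \<bar>s - t0\<bar> < d \<Longrightarrow> \<bar>t - t0\<bar> < d \<Longrightarrow> integral_curve B W s t \<eta>"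
proof -
  obtain P S \<psi> \<phi> U' \<phi>' D R w0 where
    ac: "adapted_charts B A \<pi> P S \<psi> \<phi> (model_proj A) (chart_domain (model_proj A) U' \<phi>')
      (chart_param (model_proj A) U' \<phi>') \<phi>' D R w0" and \<psi>0: "\<psi> 0 = x0"
    and ch: "(U', \<phi>') \<in> A" "\<pi> x0 \<in> U'" and w0: "w0 = \<phi>' (\<pi> x0)"
    by (rule adapted_charts_exist) (rule that; assumption)
  interpret ad: adapted_charts B A \<pi> P S \<psi> \<phi> "model_proj A" "chart_domain (model_proj A) U' \<phi>'"
    "chart_param (model_proj A) U' \<phi>'" \<phi>' D R w0 by (rule ac)
  interpret ra: riem_adapted B A \<pi> h g P S \<psi> \<phi> "model_proj A" "chart_domain (model_proj A) U' \<phi>'"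
    "chart_param (model_proj A) U' \<phi>'" \<phi>' D R w0 by unfold_locales
  let ?\<psi>' = "chart_param (model_proj A) U' \<phi>'" and ?S' = "chart_domain (model_proj A) U' \<phi>'"
  have im': "?\<psi>' ` ?S' = U'" by (rule M.local_param_chart(2)[OF ch(1)])
  have U': "open U'" by (rule M.model_proj(2)[OF ch(1)])
  have XU: "X \<in> vec_fields A UNIV" by (rule F.F_field[OF X])
  have x0: "x0 \<in> \<psi> ` S" using \<psi>0 ad.S_0 by blast
  obtain \<kappa> M C where k: "\<kappa> \<in> smooth_funs B" "open M" "x0 \<in> M" "\<And>x. x \<in> M \<Longrightarrow> \<kappa> x = 1" "M \<subseteq> C"
    "compact C" "C \<subseteq> \<psi> ` S" "\<And>x. x \<notin> C \<Longrightarrow> \<kappa> x = 0"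
    by (rule N.bump_function[OF ad.NP.im_open x0]) (rule that; assumption)
  have kc: "\<kappa> \<in> smooth_funs_c B UNIV" by (rule N.smooth_funs_c_I[OF k(1,6) subset_UNIV k(8)])
  have "0 \<in> S \<inter> \<psi> -` M" using \<psi>0 k(3) ad.S_0 by simp
  then obtain r where r: "0 < r" "ball 0 r \<subseteq> S \<inter> \<psi> -` M"
    using ad.NP.preimage_open[OF k(2)] open_contains_ball by metis
  \<comment> \<open>The corrected lift.\<close>
  define H where "H q = hlift q (X (\<pi> q))" for q
  define v where "v y = ad.NP.coords y (H (\<psi> y))" for y
  define e where "e y = v y - R (ad.MP.vf_coords X (w0 + D y))" for y
  have H: "H \<in> vec_fields B UNIV" unfolding H_def[abs_def] by (rule hlift_field[OF XU])
  have Dv: "D (v y) = ad.MP.vf_coords X (w0 + D y)" if "y \<in> S" for y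
    unfolding v_def H_def by (rule ra.D_hlift[OF XU that])
  have De: "D (e y) = 0" if y: "y \<in> S" for y
    unfolding e_def using ad.D_lin Dv[OF y] ad.MP.P_cf[OF XU ad.D_in[OF y]] by (simp add: linear_diff ad.D_R)
  have es: "Cinf S e"
  proof -
    have 1: "Cinf S v" unfolding v_def[abs_def] H_def by (rule ra.hlift_coords_smooth[OF XU])
    have 2: "Cinf S (\<lambda>y. ad.MP.vf_coords X (w0 + D y))"
      by (rule Cinf_compose[OF ad.NP.S_open ad.MP.S_open _
            Cinf_add[OF ad.NP.S_open Cinf_const[OF ad.NP.S_open] Cinf_linear[OF ad.D_lin ad.NP.S_open]]
            ad.MP.vf_coords_smooth[OF XU]]) (use ad.D_in in auto)
    show ?thesis unfolding e_def
      by (rule Cinf_diff[OF ad.NP.S_open 1 Cinf_compose_linear[OF ad.NP.S_open ad.R_lin 2]])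
  qed
  let ?E = "\<lambda>q f. \<kappa> q * ad.NP.tv (\<phi> q) (e (\<phi> q)) f"
  have E: "?E \<in> vec_fields B UNIV" by (rule ad.NP.bump_field[OF es k(1,6-8)])
  let ?V = "\<lambda>q f. 1 * H q f + (-1) * ?E q f"
  let ?W = "\<lambda>q f. \<kappa> q * ?V q f"
  have V: "?V \<in> vec_fields B UNIV"
    unfolding vec_fields_def
  proof (intro CollectI conjI ballI allI impI)
    show "?V q \<in> tangent_space B q" for q
      by (rule N.tangent_lincomb[OF N.vec_fieldD(1)[OF H] N.vec_fieldD(1)[OF E]])
    show "smooth_fun_on B UNIV (\<lambda>q. ?V q f)" if f: "f \<in> smooth_funs B" for f
      using N.smooth_funs_add[OF N.smooth_funs_mult[OF N.smooth_funs_const N.vec_fieldD(2)[OF H f]]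
          N.smooth_funs_mult[OF N.smooth_funs_const N.vec_fieldD(2)[OF E f]], of 1 "-1"]
      unfolding smooth_funs_def by simp
  qed simp
  have "pushforward A \<pi> (?V q) = X (\<pi> q)" for q
  proof -
    have "pushforward A \<pi> (?E q) = (\<lambda>f. 0)"
    proof (cases "q \<in> C")
      case True
      then have q: "\<phi> q \<in> S" using k(7) ad.NP.\<phi>_mem by blast
      show ?thesis
        unfolding push_scale ad.push_tv[OF q] De[OF q] using linear_0[OF ad.MP.tv_linear[OF ad.D_in[OF q]]] by simp
    qed (simp add: k(8) pushforward_def)
    moreover have "pushforward A \<pi> (H q) = X (\<pi> q)"
      unfolding H_def by (rule hlift(2)[OF M.vec_fieldD(1)[OF XU]])
    ultimately show ?thesis unfolding push_lincomb by simp
  qed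
  then have "?V \<in> projectable B A \<pi> F" by (rule projectableI[OF V X])
  then have W: "?W \<in> PB" by (rule pullback_mem[OF _ kc])
  \<comment> \<open>The lifted curve.\<close>
  define O' where "O' = U' \<inter> (\<lambda>p. R (\<phi>' p - w0)) -` ball 0 r"
  have "continuous_on U' (\<lambda>p. R (\<phi>' p - w0))"
  proof (rule continuous_on_compose2[of UNIV R])
    show "continuous_on UNIV R" by (rule linear_continuous_on) (use ad.R_lin linear_conv_bounded_linear in blast)
    show "continuous_on U' (\<lambda>p. \<phi>' p - w0)"
      using ad.MP.\<phi>_cont unfolding im' by (intro continuous_intros)
  qed simp
  then have O': "open O'" unfolding O'_def by (rule continuous_open_preimage[OF _ U' open_ball])
  have "\<gamma> t0 \<in> O'" unfolding O'_def using ch(2) t0(2) w0 r(1) linear_0[OF ad.R_lin] by simp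
  moreover have der\<gamma>: "((\<lambda>s. f (\<gamma> s)) has_real_derivative X (\<gamma> t) f) (at t within {a..b})"
    if "t \<in> {a..b}" "f \<in> smooth_funs A" for t f
    by (rule integral_curveD[OF ic that])
  have "continuous (at t0 within {a..b}) \<gamma>"
    by (rule M.integral_curve_continuous) (rule DERIV_continuous[OF der\<gamma>[OF t0(1)]])
  ultimately have "\<forall>\<^sub>F s in at t0 within {a..b}. \<gamma> s \<in> O'"
    using O' unfolding continuous_within by (intro topological_tendstoD)
  then obtain d where d: "d > 0" "\<And>s. s \<in> {a..b} \<Longrightarrow> s \<noteq> t0 \<Longrightarrow> dist s t0 < d \<Longrightarrow> \<gamma> s \<in> O'"
    unfolding eventually_at by auto
  have \<gamma>O: "\<gamma> s \<in> O'" if "s \<in> {a..b}" "\<bar>s - t0\<bar> < d" for s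
    using d(2)[OF that(1)] that(2) \<open>\<gamma> t0 \<in> O'\<close> by (cases "s = t0") (auto simp: dist_real_def)
  let ?y = "\<lambda>t. R (\<phi>' (\<gamma> t) - w0)"
  have y: "?y t \<in> ball 0 r" "?y t \<in> S" "\<psi> (?y t) \<in> M" "w0 + D (?y t) = \<phi>' (\<gamma> t)" "\<pi> (\<psi> (?y t)) = \<gamma> t"
    if "t \<in> {a..b}" "\<bar>t - t0\<bar> < d" for t
  proof -
    have gO: "\<gamma> t \<in> O'" by (rule \<gamma>O[OF that])
    then show yb: "?y t \<in> ball 0 r" by (simp add: O'_def)
    then show yS: "?y t \<in> S" and "\<psi> (?y t) \<in> M" using r(2) by auto
    have gU: "\<gamma> t \<in> ?\<psi>' ` ?S'" using gO unfolding im' O'_def by blast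
    have "D (?y t) = \<phi>' (\<gamma> t) - w0"
      unfolding ad.D_R using ad.MP.P_lin ad.MP.P\<phi>[OF gU] ad.w0(2) by (simp add: linear_diff)
    then show wD: "w0 + D (?y t) = \<phi>' (\<gamma> t)" by simp
    show "\<pi> (\<psi> (?y t)) = \<gamma> t" unfolding ad.\<pi>_\<psi>[OF yS] wD by (rule ad.MP.\<psi>\<phi>[OF gU])
  qed
  show thesis
  proof (rule that[OF d(1) W, of "\<lambda>t. \<psi> (?y t)"])
    show "\<psi> (?y t0) = x0" using t0(2) w0 \<psi>0 linear_0[OF ad.R_lin] by simp
    show "\<pi> (\<psi> (?y t)) = \<gamma> t" if "t \<in> {a..b}" "\<bar>t - t0\<bar> < d" for t by (rule y(5)[OF that])
    fix s t assume st: "s \<in> {a..b}" "t \<in> {a..b}" "\<bar>s - t0\<bar> < d" "\<bar>t - t0\<bar> < d"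
    show "integral_curve B ?W s t (\<lambda>t. \<psi> (?y t))"
      unfolding integral_curve_def
    proof (intro ballI)
      fix u f assume u: "u \<in> {s..t}" and f: "f \<in> smooth_funs B"
      have sub: "{s..t} \<subseteq> {a..b}" using st by auto
      have uab: "u \<in> {a..b}" and ud: "\<bar>u - t0\<bar> < d" using u st by auto
      note yu = y[OF uab ud]
      have gU: "\<gamma> u \<in> ?\<psi>' ` ?S'" using \<gamma>O[OF uab ud] unfolding im' O'_def by blast
      have "((\<lambda>t. \<phi>' (\<gamma> t)) has_vector_derivative ad.MP.coords (\<phi>' (\<gamma> u)) (X (\<gamma> u))) (at u within {s..t})"
        by (rule ad.MP.coords_curve[where \<gamma>=\<gamma> and v="X (\<gamma> u)", OF u M.vec_fieldD(1)[OF XU] gU]) (rule DERIV_subset[OF der\<gamma>[OF uab] sub])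
      moreover have "ad.MP.coords (\<phi>' (\<gamma> u)) (X (\<gamma> u)) = ad.MP.vf_coords X (\<phi>' (\<gamma> u))"
        unfolding ad.MP.vf_coords_def ad.MP.\<psi>\<phi>[OF gU] ..
      ultimately have "((\<lambda>t. \<phi>' (\<gamma> t) - w0) has_vector_derivative ad.MP.vf_coords X (\<phi>' (\<gamma> u)) - 0) (at u within {s..t})"
        by (intro has_vector_derivative_diff has_vector_derivative_const) simp
      then have "(?y has_vector_derivative R (ad.MP.vf_coords X (\<phi>' (\<gamma> u)) - 0)) (at u within {s..t})"
        by (rule bounded_linear.has_vector_derivative[rotated]) (use ad.R_lin linear_conv_bounded_linear in blast)
      then have yd: "(?y has_vector_derivative R (ad.MP.vf_coords X (\<phi>' (\<gamma> u)))) (at u within {s..t})" by simp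
      have Py: "P (?y u) = ?y u" by (rule ad.P_R)
      have k1: "\<kappa> (\<psi> (?y u)) = 1" by (rule k(4)[OF yu(3)])
      have Ht: "H (\<psi> (?y u)) = ad.NP.tv (?y u) (v (?y u))"
        unfolding v_def by (rule ad.NP.coords(2)[OF yu(2) N.vec_fieldD(1)[OF H], symmetric])
      have "?W (\<psi> (?y u)) f = 1 * ad.NP.tv (?y u) (v (?y u)) f + (-1) * ad.NP.tv (?y u) (e (?y u)) f"
        by (simp add: k1 Ht ad.NP.\<phi>\<psi>[OF yu(2)] Py)
      also have "\<dots> = ad.NP.tv (?y u) (1 *\<^sub>R v (?y u) + (-1) *\<^sub>R e (?y u)) f"
        unfolding ad.NP.tv_lincomb[OF yu(2)] ..
      also have "1 *\<^sub>R v (?y u) + (-1) *\<^sub>R e (?y u) = R (ad.MP.vf_coords X (\<phi>' (\<gamma> u)))"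
        unfolding e_def yu(4) by simp
      finally show "((\<lambda>t. f (\<psi> (?y t))) has_real_derivative ?W (\<psi> (?y u)) f) (at u within {s..t})"
        using ad.NP.curve_tv[OF yd yu(2) f] by simp
    qed
  qed
qed

end

locale leaf_transfer = L1: foliated_submersion B A1 \<pi>1 h g1 F1 + L2: foliated_submersion B A2 \<pi>2 h g2 F2
  for B :: "('n::{second_countable_topology,t2_space}, 'k::euclidean_space) atlas"
    and A1 :: "('a::{second_countable_topology,t2_space}, 'e::euclidean_space) atlas"
    and \<pi>1 and h and g1 and F1
    and A2 :: "('b::{second_countable_topology,t2_space}, 'f::euclidean_space) atlas" and \<pi>2 and g2 and F2 +
  assumes pullback_eq: "pullback_foliation B A1 \<pi>1 F1 = pullback_foliation B A2 \<pi>2 F2"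
    and surj1: "surj \<pi>1" and fibres1: "\<And>p. connected (\<pi>1 -` {p})"
begin

text \<open>Two points of a fibre of \<open>\<pi>1\<close> are joined by a chain of curves that are tangent to the pullback of
  \<open>F1\<close>, hence to the pullback of \<open>F2\<close>, and \<open>\<pi>2\<close> maps each of them into one leaf.\<close>

lemma fibre_transfer:
  assumes "\<pi>1 x = \<pi>1 y"
  shows "(\<pi>2 x, \<pi>2 y) \<in> same_leaf A2 F2"
proof (rule connected_equivalence_relation[OF fibres1[of "\<pi>1 x"], where R="\<lambda>x y. (\<pi>2 x, \<pi>2 y) \<in> same_leaf A2 F2"])
  show "x \<in> \<pi>1 -` {\<pi>1 x}" "y \<in> \<pi>1 -` {\<pi>1 x}" using assms by auto
  fix z assume z: "z \<in> \<pi>1 -` {\<pi>1 x}"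
  obtain N where N: "open N" "z \<in> N" "\<And>x. x \<in> N \<Longrightarrow> \<pi>1 x = \<pi>1 z \<Longrightarrow>
    \<exists>W\<in>L1.PB. \<exists>\<eta>. integral_curve B W 0 1 \<eta> \<and> \<eta> 0 = z \<and> \<eta> 1 = x"
    by (rule L1.fibre_curve[of z]) (rule that; assumption)
  show "\<exists>T. openin (top_of_set (\<pi>1 -` {\<pi>1 x})) T \<and> z \<in> T \<and> (\<forall>x\<in>T. (\<pi>2 z, \<pi>2 x) \<in> same_leaf A2 F2)"
  proof (intro exI[of _ "\<pi>1 -` {\<pi>1 x} \<inter> N"] conjI ballI)
    show "openin (top_of_set (\<pi>1 -` {\<pi>1 x})) (\<pi>1 -` {\<pi>1 x} \<inter> N)" by (rule openin_open_Int[OF N(1)])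
    show "z \<in> \<pi>1 -` {\<pi>1 x} \<inter> N" using z N(2) by blast
    fix u assume u: "u \<in> \<pi>1 -` {\<pi>1 x} \<inter> N"
    have "\<pi>1 u = \<pi>1 z" using u z by simp
    then obtain W \<eta> where W: "W \<in> L1.PB" "integral_curve B W 0 1 \<eta>" "\<eta> 0 = z" "\<eta> 1 = u"
      using N(3)[of u] u by blast
    from L2.image_same_leaf[of W 0 1 \<eta>] show "(\<pi>2 z, \<pi>2 u) \<in> same_leaf A2 F2"
      using W unfolding pullback_eq by simp
  qed
qed (rule L2.F.same_leaf_sym L2.F.same_leaf_trans; assumption)+

text \<open>By \<open>fibre_transfer\<close> the claim depends only on the points \<open>\<pi>1 x\<close> and \<open>\<pi>1 y\<close>. So it
  defines an equivalence relation on the base, and it suffices to check it on short pieces of integral curves,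
  which can be lifted.\<close>

theorem leaf_transfer:
  assumes "(\<pi>1 x, \<pi>1 y) \<in> same_leaf A1 F1"
  shows "(\<pi>2 x, \<pi>2 y) \<in> same_leaf A2 F2"
proof -
  define E where "E p q \<longleftrightarrow> (\<forall>x y. \<pi>1 x = p \<longrightarrow> \<pi>1 y = q \<longrightarrow> (\<pi>2 x, \<pi>2 y) \<in> same_leaf A2 F2)" for p q
  have E_refl: "E p p" for p unfolding E_def using fibre_transfer by metis
  have E_trans: "E p r" if "E p q" "E q r" for p q r
  proof -
    obtain z where z: "\<pi>1 z = q" using surj1 by (metis surjD)
    show ?thesis unfolding E_def
    proof (intro allI impI)
      fix x y assume "\<pi>1 x = p" "\<pi>1 y = r"
      then have "(\<pi>2 x, \<pi>2 z) \<in> same_leaf A2 F2" "(\<pi>2 z, \<pi>2 y) \<in> same_leaf A2 F2"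
        using that z unfolding E_def by blast+
      then show "(\<pi>2 x, \<pi>2 y) \<in> same_leaf A2 F2" by (rule L2.F.same_leaf_trans)
    qed
  qed
  have E_sym: "E q p" if "E p q" for p q
    using that L2.F.same_leaf_sym unfolding E_def by blast
  have E_point: "E (\<pi>1 x) (\<pi>1 y)" if "(\<pi>2 x, \<pi>2 y) \<in> same_leaf A2 F2" for x y
    unfolding E_def
  proof (intro allI impI)
    fix u v assume u: "\<pi>1 u = \<pi>1 x" "\<pi>1 v = \<pi>1 y"
    show "(\<pi>2 u, \<pi>2 v) \<in> same_leaf A2 F2"
      by (rule L2.F.same_leaf_trans[OF fibre_transfer[OF u(1)] L2.F.same_leaf_trans[OF that fibre_transfer[OF u(2)[symmetric]]]])
  qed
  have step: "E (\<gamma> a) (\<gamma> b)" if X: "X \<in> F1" and ab: "a \<le> b" and ic: "integral_curve A1 X a b \<gamma>" for X a b \<gamma>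
  proof -
    let ?P = "\<lambda>s t. s \<in> {a..b} \<longrightarrow> t \<in> {a..b} \<longrightarrow> E (\<gamma> s) (\<gamma> t)"
    have "?P a b"
    proof (rule Bolzano[OF ab, where P="?P"])
      fix s t r assume "?P s t" "?P t r" "s \<le> t" "t \<le> r"
      then show "?P s r" using E_trans[of "\<gamma> s" "\<gamma> t" "\<gamma> r"] by auto
    next
      fix t0 assume "a \<le> t0" "t0 \<le> b"
      then have t0: "t0 \<in> {a..b}" by simp
      obtain x0 where x0: "\<pi>1 x0 = \<gamma> t0" using surj1 by (metis surjD)
      obtain d W \<eta> where d: "0 < d" "W \<in> L1.PB" "\<And>t. t \<in> {a..b} \<Longrightarrow> \<bar>t - t0\<bar> < d \<Longrightarrow> \<pi>1 (\<eta> t) = \<gamma> t"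
        "\<And>s t. s \<in> {a..b} \<Longrightarrow> t \<in> {a..b} \<Longrightarrow> \<bar>s - t0\<bar> < d \<Longrightarrow> \<bar>t - t0\<bar> < d \<Longrightarrow> integral_curve B W s t \<eta>"
        by (rule L1.lift_curve[OF X ic t0 x0]) (rule that; assumption)
      show "\<exists>d>0. \<forall>s t. s \<le> t0 \<and> t0 \<le> t \<and> t - s < d \<longrightarrow> ?P s t"
      proof (intro exI[of _ d] conjI d(1) allI impI)
        fix s t assume st: "s \<le> t0 \<and> t0 \<le> t \<and> t - s < d" "s \<in> {a..b}" "t \<in> {a..b}"
        then have near: "\<bar>s - t0\<bar> < d" "\<bar>t - t0\<bar> < d" "s \<le> t" by auto
        have "(\<pi>2 (\<eta> s), \<pi>2 (\<eta> t)) \<in> same_leaf A2 F2"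
          by (rule L2.image_same_leaf[OF _ near(3) d(4)[OF st(2,3) near(1,2)]]) (use d(2) pullback_eq in simp)
        from E_point[OF this] show "E (\<gamma> s) (\<gamma> t)"
          unfolding d(3)[OF st(2) near(1)] d(3)[OF st(3) near(2)] .
      qed
    qed
    then show ?thesis using ab by simp
  qed
  have "E p q" if "(p, q) \<in> same_leaf A1 F1" for p q
    using that unfolding same_leaf_def
  proof (induction rule: rtrancl_induct)
    case base
    show ?case by (rule E_refl)
  next
    case (step q r)
    then obtain X a b \<gamma> where "X \<in> F1" "a \<le> b" "integral_curve A1 X a b \<gamma>" "\<gamma> a = q" "\<gamma> b = r" by blast
    then have "E q r" using \<open>\<And>X a b \<gamma>. X \<in> F1 \<Longrightarrow> a \<le> b \<Longrightarrow> integral_curve A1 X a b \<gamma> \<Longrightarrow> E (\<gamma> a) (\<gamma> b)\<close>[of X a b \<gamma>] by simp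
    then show ?case by (rule E_trans[OF step.IH])
  qed
  from this[OF assms] show ?thesis unfolding E_def by blast
qed

end

section \<open>Lengths of curves\<close>

text \<open>At an end point of the interval the local smooth extensions determine the one-sided derivative,
  so the derivatives of different extensions fit together.\<close>

lemma smooth_on_interval_derivative:
  fixes w :: "real \<Rightarrow> 'e::euclidean_space"
  assumes w: "smooth_on {s..t} w" and st: "s < t"
  obtains w' where "continuous_on {s..t} w'"
    "\<And>u. u \<in> {s..t} \<Longrightarrow> (w has_vector_derivative w' u) (at u within {s..t})"
proof -
  have loc: "\<exists>U F. open U \<and> u0 \<in> U \<and> Cinf U F \<and>
     (\<forall>u\<in>{s..t} \<inter> U. (w has_vector_derivative frechet_derivative F (at u) 1) (at u within {s..t}))"
    if u0: "u0 \<in> {s..t}" for u0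
  proof -
    obtain U F where U: "open U" "u0 \<in> U" "Cinf U F" "\<And>y. y \<in> {s..t} \<Longrightarrow> y \<in> U \<Longrightarrow> F y = w y"
      by (rule smooth_onD[OF w u0]) (rule that; assumption)
    have "(w has_vector_derivative frechet_derivative F (at u) 1) (at u within {s..t})" if u: "u \<in> {s..t} \<inter> U" for u
    proof -
      have uU: "u \<in> U" using u by blast
      have Fd: "(F has_derivative frechet_derivative F (at u)) (at u within {s..t})"
        by (rule has_derivative_at_withinI[OF Cinf_has_derivative[OF U(3) uU]])
      obtain d where d: "d > 0" "ball u d \<subseteq> U" using U(1) uU open_contains_ball by metis
      have "F z = w z" if "z \<in> {s..t}" "dist z u < d" for z
        using U(4)[OF that(1)] subsetD[OF d(2), of z] that(2) by (simp add: dist_commute)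
      from has_derivative_transform_within[OF Fd d(1) _ this] u
      have "(w has_derivative frechet_derivative F (at u)) (at u within {s..t})" by blast
      moreover have "frechet_derivative F (at u) = (\<lambda>h. h *\<^sub>R frechet_derivative F (at u) 1)"
      proof
        fix h :: real
        show "frechet_derivative F (at u) h = h *\<^sub>R frechet_derivative F (at u) 1"
          using linear_cmul[OF Cinf_linear_frechet[OF U(3) uU], of h 1] by simp
      qed
      ultimately show ?thesis unfolding has_vector_derivative_def by simp
    qed
    then show ?thesis using U(1-3) by (intro exI[of _ U] exI[of _ F]) simp
  qed
  define w' where "w' u = vector_derivative w (at u within {s..t})" for u
  have w'_eq: "w' u = v" if "(w has_vector_derivative v) (at u within {s..t})" "u \<in> {s..t}" for u v
    unfolding w'_def using vector_derivative_within_cbox[of s t u w v] that st by simp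
  show thesis
  proof (rule that[of w'])
    fix u assume u: "u \<in> {s..t}"
    then show "(w has_vector_derivative w' u) (at u within {s..t})" using loc[OF u] w'_eq by (metis IntI)
  next
    show "continuous_on {s..t} w'"
      unfolding continuous_on_eq_continuous_within
    proof
      fix u0 assume u0: "u0 \<in> {s..t}"
      obtain U F where U: "open U" "u0 \<in> U" "Cinf U F"
        "\<And>u. u \<in> {s..t} \<Longrightarrow> u \<in> U \<Longrightarrow> (w has_vector_derivative frechet_derivative F (at u) 1) (at u within {s..t})"
        using loc[OF u0] by blast
      have e: "frechet_derivative F (at u) 1 = w' u" if "u \<in> {s..t}" "u \<in> U" for u
        by (rule w'_eq[OF U(4)[OF that] that(1), symmetric])
      have Fc: "continuous (at u0 within {s..t}) (\<lambda>u. frechet_derivative F (at u) 1)"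
        using Cinf_continuous_on[OF Cinf_frechet[OF U(3)]] U(1,2)
        by (simp add: continuous_on_eq_continuous_at continuous_at_imp_continuous_at_within)
      obtain d where d: "d > 0" "ball u0 d \<subseteq> U" using U(1,2) open_contains_ball by metis
      have "frechet_derivative F (at u) 1 = w' u" if "u \<in> {s..t}" "dist u u0 < d" for u
        using e[OF that(1)] subsetD[OF d(2), of u] that(2) by (simp add: dist_commute)
      from continuous_transform_within[OF Fc d(1) u0 this]
      show "continuous (at u0 within {s..t}) w'" by blast
    qed
  qed
qed

lemma metric_coords_continuous_aux:
  fixes c d :: "'x::topological_space \<Rightarrow> 'e::euclidean_space" and a :: "'x \<Rightarrow> 'e \<Rightarrow> 'e \<Rightarrow> real"
  assumes lin1: "\<And>x v. x \<in> X \<Longrightarrow> linear (\<lambda>u. a x u v)" and lin2: "\<And>x u. x \<in> X \<Longrightarrow> linear (\<lambda>v. a x u v)"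
    and a: "\<And>u v. continuous_on X (\<lambda>x. a x u v)" and c: "continuous_on X c" and d: "continuous_on X d"
  shows "continuous_on X (\<lambda>x. a x (c x) (d x))"
proof -
  have "continuous_on X (\<lambda>x. \<Sum>i\<in>Basis. (c x \<bullet> i) *\<^sub>R (\<Sum>j\<in>Basis. (d x \<bullet> j) *\<^sub>R a x i j))"
    by (intro continuous_intros a c d)
  moreover have "(\<Sum>i\<in>Basis. (c x \<bullet> i) *\<^sub>R (\<Sum>j\<in>Basis. (d x \<bullet> j) *\<^sub>R a x i j)) = a x (c x) (d x)" if "x \<in> X" for x
    unfolding linear_basis_expansion[OF lin2[OF that], symmetric]
    by (rule linear_basis_expansion[OF lin1[OF that], symmetric])
  ultimately show ?thesis by (rule continuous_on_eq)
qed

definition speed ::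
  "('a::{second_countable_topology,t2_space}, 'e::euclidean_space) atlas \<Rightarrow> 'a metric_tensor \<Rightarrow>
     (real \<Rightarrow> 'a) \<Rightarrow> real \<Rightarrow> real" where
  "speed A g \<gamma> t = sqrt (g (\<gamma> t) (velocity A \<gamma> t) (velocity A \<gamma> t))"

lemma curve_length_speed: "curve_length A g \<gamma> = integral {0..1} (speed A g \<gamma>)"
  by (simp add: curve_length_def speed_def[abs_def])

context mfd_param
begin

lemma velocity_tv:
  assumes w: "(\<phi> \<circ> \<gamma> has_vector_derivative v) (at u)" and N: "open N" "u \<in> N" "\<And>s. s \<in> N \<Longrightarrow> \<gamma> s \<in> \<psi> ` S"
  shows "velocity A \<gamma> u = tv (\<phi> (\<gamma> u)) v"
proof (rule ext)
  fix f
  show "velocity A \<gamma> u f = tv (\<phi> (\<gamma> u)) v f"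
  proof (cases "f \<in> smooth_funs A")
    case f: True
    have S: "(\<phi> \<circ> \<gamma>) u \<in> S" using \<phi>_mem[OF N(3)[OF N(2)]] by simp
    have "((\<lambda>s. f (\<psi> ((\<phi> \<circ> \<gamma>) s))) has_real_derivative tv ((\<phi> \<circ> \<gamma>) u) v f) (at u)"
      by (rule curve_tv[OF w S f])
    then have "((\<lambda>s. f (\<gamma> s)) has_real_derivative tv ((\<phi> \<circ> \<gamma>) u) v f) (at u)"
      by (rule has_field_derivative_transform_within_open[OF _ N(1,2)]) (simp add: \<psi>\<phi>[OF N(3)])
    from DERIV_imp_deriv[OF this] show ?thesis using f by (simp add: velocity_def)
  qed (simp add: velocity_def tv_def)
qed

lemma metric_coords_continuous:
  assumes g: "riemannian_metric A g" and y: "continuous_on X y" "y ` X \<subseteq> S" and v: "continuous_on X v"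
  shows "continuous_on X (\<lambda>x. metric_coords g (y x) (v x) (v x))"
proof (rule metric_coords_continuous_aux[where a="\<lambda>x u v. metric_coords g (y x) u v", OF _ _ _ v v])
  show "linear (\<lambda>u. metric_coords g (y x) u z)" if "x \<in> X" for x z by (rule metric_coords_linear[OF g]) (use that y(2) in blast)
  show "linear (\<lambda>z. metric_coords g (y x) u z)" if "x \<in> X" for x u by (rule metric_coords_linear2[OF g]) (use that y(2) in blast)
  show "continuous_on X (\<lambda>x. metric_coords g (y x) u z)" for u z
    by (rule continuous_on_compose2[OF Cinf_continuous_on[OF metric_coords_smooth[OF g]] y])
qed

end

locale riem_mfd = smooth_mfd A
  for A :: "('a::{second_countable_topology,t2_space}, 'e::euclidean_space) atlas" +
  fixes g :: "'a metric_tensor"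
  assumes metric: "riemannian_metric A g"
begin

text \<open>The velocity is defined by a two-sided derivative, so nothing is said about it at the end points;
  they do not matter for the integral.\<close>

lemma speed_chart:
  assumes c: "smooth_curve_on A {s..t} \<gamma>" and ch: "(U, \<phi>) \<in> A" and U: "\<And>u. u \<in> {s..t} \<Longrightarrow> \<gamma> u \<in> U" and st: "s < t"
  obtains w' where "continuous_on {s..t} w'"
    "\<And>u. u \<in> {s<..<t} \<Longrightarrow> (\<phi> \<circ> \<gamma> has_vector_derivative w' u) (at u)"
    "\<And>u. u \<in> {s<..<t} \<Longrightarrow> velocity A \<gamma> u
       = mfd_param.tv A (chart_param (model_proj A) U \<phi>) (\<phi> (\<gamma> u)) (w' u)"
    "speed A g \<gamma> integrable_on {s..t}"
proof -
  let ?S = "chart_domain (model_proj A) U \<phi>" and ?\<psi> = "chart_param (model_proj A) U \<phi>"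
  interpret mp: mfd_param A "model_proj A" ?S ?\<psi> \<phi> by unfold_locales (rule local_param_chart(1)[OF ch])
  have im: "?\<psi> ` ?S = U" by (rule local_param_chart(2)[OF ch])
  have "smooth_on ({s..t} \<inter> \<gamma> -` U) (\<phi> \<circ> \<gamma>)" using c ch unfolding smooth_curve_on_def by blast
  then have w: "smooth_on {s..t} (\<phi> \<circ> \<gamma>)" by (rule smooth_on_subset) (use U in blast)
  obtain w' where w': "continuous_on {s..t} w'"
    "\<And>u. u \<in> {s..t} \<Longrightarrow> (\<phi> \<circ> \<gamma> has_vector_derivative w' u) (at u within {s..t})"
    by (rule smooth_on_interval_derivative[OF w st]) (rule that; assumption)
  have w'': "(\<phi> \<circ> \<gamma> has_vector_derivative w' u) (at u)" if u: "u \<in> {s<..<t}" for u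
    using w'(2)[of u] u at_within_Icc_at[of s u t] by simp
  have vel: "velocity A \<gamma> u = mp.tv (\<phi> (\<gamma> u)) (w' u)" if u: "u \<in> {s<..<t}" for u
    by (rule mp.velocity_tv[OF w''[OF u] open_greaterThanLessThan u]) (use U im in auto)
  have wc: "continuous_on {s..t} (\<lambda>u. \<phi> (\<gamma> u))"
    unfolding continuous_on_eq_continuous_within
    using has_vector_derivative_continuous[OF w'(2)] by (simp add: o_def)
  have wS: "\<phi> (\<gamma> u) \<in> ?S" "?\<psi> (\<phi> (\<gamma> u)) = \<gamma> u" if "u \<in> {s..t}" for u
    using mp.\<phi>_mem mp.\<psi>\<phi> U[OF that] unfolding im by auto
  have "continuous_on {s..t} (\<lambda>u. sqrt (mp.metric_coords g (\<phi> (\<gamma> u)) (w' u) (w' u)))"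
    by (intro continuous_on_real_sqrt mp.metric_coords_continuous[OF metric wc _ w'(1)]) (use wS in auto)
  then have "(\<lambda>u. sqrt (mp.metric_coords g (\<phi> (\<gamma> u)) (w' u) (w' u))) integrable_on {s..t}"
    by (rule integrable_continuous_real)
  then have "speed A g \<gamma> integrable_on {s..t}"
  proof (rule integrable_spike[of _ _ "{s, t}"])
    fix u assume u: "u \<in> {s..t} - {s, t}"
    have "g (\<gamma> u) (velocity A \<gamma> u) (velocity A \<gamma> u) = mp.metric_coords g (\<phi> (\<gamma> u)) (w' u) (w' u)"
      unfolding mp.metric_coords_def using vel[of u] wS(2)[of u] u by simp
    then show "speed A g \<gamma> u = sqrt (mp.metric_coords g (\<phi> (\<gamma> u)) (w' u) (w' u))" by (simp add: speed_def)
  qed simp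
  then show thesis using that[OF w'(1) w'' vel] by blast
qed

end

locale riem_foliated = riem_mfd A g + foliated_mfd A F
  for A :: "('a::{second_countable_topology,t2_space}, 'e::euclidean_space) atlas" and g F
begin

definition leaf :: "'a \<Rightarrow> 'a set" where "leaf p = same_leaf A F `` {p}"

lemma leaf_eq_iff: "leaf p = leaf q \<longleftrightarrow> (p, q) \<in> same_leaf A F"
  unfolding leaf_def using same_leaf_equiv by (simp add: eq_equiv_class_iff)

lemma mem_leaf: "q \<in> leaf p \<longleftrightarrow> (p, q) \<in> same_leaf A F"
  by (simp add: leaf_def)

text \<open>Leaves are addressed by points and discrete paths by their length, so that paths can be
  concatenated without reference to the curves.\<close>

definition joined :: "'a \<Rightarrow> 'a \<Rightarrow> real \<Rightarrow> bool" where
  "joined p q l \<longleftrightarrow> (\<exists>k \<gamma>. discrete_path A F (leaf p) (leaf q) k \<gamma> \<and> l = (\<Sum>i<k. curve_length A g (\<gamma> i)))"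

lemma leaf_dist_joined: "leaf_dist A g F (leaf p) (leaf q) = Inf (ereal ` {l. joined p q l})"
  unfolding leaf_dist_def joined_def by (rule arg_cong[where f=Inf]) auto

lemma joined_leaf:
  assumes "joined p q l" "(p, p') \<in> same_leaf A F" "(q, q') \<in> same_leaf A F"
  shows "joined p' q' l"
  using assms(1) unfolding joined_def leaf_eq_iff[THEN iffD2, OF assms(2)] leaf_eq_iff[THEN iffD2, OF assms(3)] .

lemma joined_curve:
  assumes "piecewise_smooth_curve A \<gamma>"
  shows "joined (\<gamma> 0) (\<gamma> 1) (curve_length A g \<gamma>)"
  unfolding joined_def discrete_path_def mem_leaf
  using assms same_leaf_refl by (intro exI[of _ 1] exI[of _ "\<lambda>_. \<gamma>"]) simp

lemma joined_trans:
  assumes "joined p q l" "joined q r l'"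
  shows "joined p r (l + l')"
proof -
  obtain k \<gamma> where 1: "discrete_path A F (leaf p) (leaf q) k \<gamma>" "l = (\<Sum>i<k. curve_length A g (\<gamma> i))"
    using assms(1) unfolding joined_def by blast
  obtain k' \<gamma>' where 2: "discrete_path A F (leaf q) (leaf r) k' \<gamma>'" "l' = (\<Sum>i<k'. curve_length A g (\<gamma>' i))"
    using assms(2) unfolding joined_def by blast
  note d1 = 1(1)[unfolded discrete_path_def mem_leaf] and d2 = 2(1)[unfolded discrete_path_def mem_leaf]
  define \<delta> where "\<delta> i = (if i < k then \<gamma> i else \<gamma>' (i - k))" for i
  have k: "k \<ge> 1" "k' \<ge> 1" using d1 d2 by blast+
  have "discrete_path A F (leaf p) (leaf r) (k + k') \<delta>"
    unfolding discrete_path_def mem_leaf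
  proof (intro conjI allI impI)
    show "piecewise_smooth_curve A (\<delta> i)" if "i < k + k'" for i
      using d1 d2 that unfolding \<delta>_def by auto
    show "(p, \<delta> 0 0) \<in> same_leaf A F" using d1 k unfolding \<delta>_def by simp
    have "\<not> k + k' - 1 < k" "k + k' - 1 - k = k' - 1" using k by auto
    then show "(r, \<delta> (k + k' - 1) 1) \<in> same_leaf A F" using d2 unfolding \<delta>_def by simp
    show "(\<delta> i 1, \<delta> (Suc i) 0) \<in> same_leaf A F" if i: "Suc i < k + k'" for i
    proof -
      consider "Suc i < k" | "Suc i = k" | "k \<le> i" by linarith
      then show ?thesis
      proof cases
        case 1
        then show ?thesis using d1 unfolding \<delta>_def by simp
      next
        case 2
        have "(q, \<gamma> (k - 1) 1) \<in> same_leaf A F" "(q, \<gamma>' 0 0) \<in> same_leaf A F" using d1 d2 by blast+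
        then have "(\<gamma> (k - 1) 1, \<gamma>' 0 0) \<in> same_leaf A F" by (rule same_leaf_trans[OF same_leaf_sym])
        then show ?thesis using 2 unfolding \<delta>_def by auto
      next
        case 3
        then have "Suc (i - k) < k'" using i by linarith
        then have "(\<gamma>' (i - k) 1, \<gamma>' (Suc (i - k)) 0) \<in> same_leaf A F" using d2 by blast
        then show ?thesis using 3 unfolding \<delta>_def by (simp add: Suc_diff_le)
      qed
    qed
  qed (use k in simp)
  moreover have "l + l' = (\<Sum>i<k + k'. curve_length A g (\<delta> i))"
  proof -
    have "(\<Sum>i<k + n. curve_length A g (\<delta> i)) = (\<Sum>i<k. curve_length A g (\<gamma> i)) + (\<Sum>i<n. curve_length A g (\<gamma>' i))" for n
      by (induction n) (simp_all add: \<delta>_def)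
    then show ?thesis using 1(2) 2(2) by simp
  qed
  ultimately show ?thesis unfolding joined_def by blast
qed

lemma joined_same_leaf:
  assumes "(p, q) \<in> same_leaf A F"
  shows "joined p q 0"
proof -
  have v: "velocity A (\<lambda>_. p) t = (\<lambda>f. 0)" for t by (auto simp: velocity_def)
  have "g p (\<lambda>f. 0 * 0 + 0 * 0) (\<lambda>f. 0) = 0 * g p (\<lambda>f. 0) (\<lambda>f. 0) + 0 * g p (\<lambda>f. 0) (\<lambda>f. 0)"
    by (rule riemannian_metricD(2)[OF metric tangent_zero tangent_zero tangent_zero])
  then have l: "curve_length A g (\<lambda>_. p) = 0" by (simp add: curve_length_def v)
  have "smooth_curve_on A {0..1} (\<lambda>_. p)"
    unfolding smooth_curve_on_def o_def
    by (auto intro!: smooth_onI exI[of _ UNIV] exI[of _ "\<lambda>_. _ p"] Cinf_const)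
  then have "piecewise_smooth_curve A (\<lambda>_. p)"
    unfolding piecewise_smooth_curve_def by (intro exI[of _ 1] exI[of _ real]) simp
  from joined_curve[OF this] have "joined p p 0" unfolding l .
  then show ?thesis by (rule joined_leaf[OF _ same_leaf_refl assms])
qed

end

text \<open>The smoothness of \<open>m\<close> is expressed by smooth functions only; the coordinates of a chart are such
  functions, and they determine the smoothness of the image curve.\<close>

lemma smooth_curve_on_compose:
  fixes A :: "('a::{second_countable_topology,t2_space}, 'e::euclidean_space) atlas"
  assumes A: "smooth_manifold A" and m: "continuous_on U (m :: 'd::euclidean_space \<Rightarrow> 'a)" "open U"
    and sm: "\<And>W f. open W \<Longrightarrow> smooth_fun_on A W f \<Longrightarrow> Cinf (U \<inter> m -` W) (\<lambda>w. f (m w))"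
    and w: "smooth_on I w" "continuous_on I w" "w ` I \<subseteq> U"
  shows "smooth_curve_on A I (\<lambda>t. m (w t))"
proof -
  interpret smooth_mfd A by unfold_locales (rule A)
  show ?thesis
    unfolding smooth_curve_on_def
  proof (intro conjI)
    show "continuous_on I (\<lambda>t. m (w t))" by (rule continuous_on_compose2[OF m(1) w(2,3)])
    show "\<forall>(V, \<phi>)\<in>A. smooth_on (I \<inter> (\<lambda>t. m (w t)) -` V) (\<phi> \<circ> (\<lambda>t. m (w t)))"
    proof (clarify)
      fix V \<phi> assume ch: "(V, \<phi>) \<in> A"
      let ?S = "chart_domain (model_proj A) V \<phi>" and ?\<psi> = "chart_param (model_proj A) V \<phi>"
      interpret mp: mfd_param A "model_proj A" ?S ?\<psi> \<phi> by unfold_locales (rule local_param_chart(1)[OF ch])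
      have V: "open V" by (rule model_proj(2)[OF ch])
      have o: "open (U \<inter> m -` V)" by (rule continuous_open_preimage[OF m V])
      show "smooth_on (I \<inter> (\<lambda>t. m (w t)) -` V) (\<phi> \<circ> (\<lambda>t. m (w t)))"
      proof (rule smooth_on_componentwise)
        fix b :: 'e
        have "smooth_fun_on A V (\<lambda>q. \<phi> q \<bullet> b)"
          using mp.smooth_push_compose[OF Cinf_linear[OF linear_inner_const mp.S_open], of b]
          unfolding local_param_chart(2)[OF ch] .
        from sm[OF V this] have "smooth_on (U \<inter> m -` V) (\<lambda>z. \<phi> (m z) \<bullet> b)" unfolding smooth_on_Cinf[OF o] .
        from smooth_on_compose[OF smooth_on_subset[OF w(1)] this, of "I \<inter> (\<lambda>t. m (w t)) -` V"]
        show "smooth_on (I \<inter> (\<lambda>t. m (w t)) -` V) (\<lambda>t. (\<phi> \<circ> (\<lambda>t. m (w t))) t \<bullet> b)"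
          using w(3) by (simp add: o_def) blast
      qed
    qed
  qed
qed

section \<open>Comparison of distances\<close>

text \<open>A tangent vector at \<open>m w\<close> is a derivation, so the differential of \<open>m\<close> is given by its action on
  functions.\<close>

definition differential ::
  "('a::{second_countable_topology,t2_space}, 'e::euclidean_space) atlas \<Rightarrow> ('d::euclidean_space \<Rightarrow> 'a) \<Rightarrow> 'd \<Rightarrow> 'd \<Rightarrow>
    'a tangent_vec" where
  "differential A m w z = (\<lambda>f. if f \<in> smooth_funs A then frechet_derivative (\<lambda>w. f (m w)) (at w) z else 0)"

text \<open>The form depends only on the projection of its argument. It is positive on the compact unit sphere
  of the range of \<open>P\<close> at \<open>w0\<close>, hence bounded below there, and remains nonnegative nearby.\<close>

lemma quadratic_form_nonneg_near:
  fixes a :: "'d::euclidean_space \<Rightarrow> 'd \<Rightarrow> 'd \<Rightarrow> real"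
  assumes P: "orth_proj P" and X: "open X" "w0 \<in> X"
    and lin1: "\<And>w v. w \<in> X \<Longrightarrow> linear (\<lambda>u. a w u v)" and lin2: "\<And>w u. w \<in> X \<Longrightarrow> linear (\<lambda>v. a w u v)"
    and a: "\<And>u v. continuous_on X (\<lambda>w. a w u v)" and aP: "\<And>w u. w \<in> X \<Longrightarrow> a w (P u) (P u) = a w u u"
    and pos: "\<And>u. P u = u \<Longrightarrow> u \<noteq> 0 \<Longrightarrow> 0 < a w0 u u"
  obtains N where "open N" "w0 \<in> N" "N \<subseteq> X" "\<And>w u. w \<in> N \<Longrightarrow> 0 \<le> a w u u"
proof -
  define C where "C = {u. P u = u} \<inter> sphere 0 1"
  have "closed {u. P u = u}" by (intro closed_Collect_eq orth_proj_continuous[OF P] continuous_on_id)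
  then have C: "compact C" unfolding C_def by (rule closed_Int_compact) simp
  have cont: "continuous_on (X \<times> C) (\<lambda>x. a (fst x) (snd x) (snd x))"
  proof (rule metric_coords_continuous_aux[where a="\<lambda>x u v. a (fst x) u v"])
    show "continuous_on (X \<times> C) (\<lambda>x. a (fst x) u v)" for u v
      by (rule continuous_on_compose2[OF a]) (auto intro: continuous_intros)
  qed (auto intro: lin1 lin2 continuous_intros)
  obtain N where N: "open N" "w0 \<in> N" "N \<subseteq> X" "\<And>w u. w \<in> N \<Longrightarrow> u \<in> C \<Longrightarrow> 0 \<le> a w u u"
  proof (cases "C = {}")
    case True
    then show ?thesis using that[OF X(1,2)] by blast
  next
    case False
    have "continuous_on C (\<lambda>u. a w0 u u)"
      by (rule continuous_on_slice[where G="\<lambda>w u. a w u u", OF _ X(2)]) (use cont in \<open>simp add: case_prod_unfold\<close>)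
    then obtain u0 where u0: "u0 \<in> C" "\<And>u. u \<in> C \<Longrightarrow> a w0 u0 u0 \<le> a w0 u u"
      using continuous_attains_inf[OF C False] by blast
    have e: "0 < a w0 u0 u0" by (rule pos) (use u0(1) in \<open>auto simp: C_def\<close>)
    obtain N where N: "w0 \<in> N" "open N"
      "\<forall>w\<in>N \<inter> X. \<forall>u\<in>C. dist (a (fst (w, u)) (snd (w, u)) (snd (w, u))) (a (fst (w0, u)) (snd (w0, u)) (snd (w0, u))) \<le> a w0 u0 u0"
      by (rule continuous_on_prod_compactE[OF cont C X(2) e])
    have "0 \<le> a w u u" if w: "w \<in> N \<inter> X" and u: "u \<in> C" for w u
    proof -
      have "dist (a w u u) (a w0 u u) \<le> a w0 u0 u0" using N(3) w u by simp
      then show ?thesis using u0(2)[OF u] unfolding dist_real_def by linarith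
    qed
    then show ?thesis using that[of "N \<inter> X"] N(1,2) X by blast
  qed
  show thesis
  proof (rule that[OF N(1-3)])
    fix w u assume w: "w \<in> N"
    then have wX: "w \<in> X" using N(3) by blast
    note l1 = lin1[OF wX] and l2 = lin2[OF wX]
    have "0 \<le> a w (P u) (P u)"
    proof (cases "P u = 0")
      case True
      then show ?thesis using linear_0[OF l1] by simp
    next
      case False
      let ?n = "norm (P u)"
      have "(1 / ?n) *\<^sub>R P u \<in> C"
        unfolding C_def using False orth_projD(1,2)[OF P] by (simp add: linear_cmul)
      from N(4)[OF w this] have "0 \<le> (1 / ?n) * ((1 / ?n) * a w (P u) (P u))"
        by (simp add: linear_cmul[OF l1] linear_cmul[OF l2])
      then have "0 \<le> (?n * ?n) * ((1 / ?n) * ((1 / ?n) * a w (P u) (P u)))" by (rule mult_nonneg_nonneg[rotated]) simp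
      then show ?thesis using False by (simp add: field_simps)
    qed
    then show "0 \<le> a w u u" using aP[OF wX] by simp
  qed
qed

context leaf_transfer
begin

sublocale R1: riem_foliated A1 g1 F1 by unfold_locales (rule L1.g)
sublocale R2: riem_foliated A2 g2 F2 by unfold_locales (rule L2.g)

text \<open>The map \<open>m\<close> is a section of \<open>\<pi>1\<close>, in coordinates, followed by \<open>\<pi>2\<close>. In adapted coordinates there
  is a linear section whose derivative at \<open>\<pi>1 x0\<close> consists of horizontal vectors and is therefore an
  isometric embedding. As \<open>\<pi>2\<close> does not increase lengths, the quadratic form that has to be
  nonnegative is positive at this point because \<open>K > 1\<close>, and so it is nonnegative nearby.\<close>

lemma short_section:
  assumes K: "1 < K"
  obtains U' \<phi>' V \<chi>' X m where "(U', \<phi>') \<in> A1" "\<pi>1 x0 \<in> U'" "(V, \<chi>') \<in> A2" "open X"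
    "X \<subseteq> chart_domain (model_proj A1) U' \<phi>'" "\<phi>' (\<pi>1 x0) \<in> X"
    "\<And>w. w \<in> X \<Longrightarrow> m w \<in> V" "\<And>w. w \<in> X \<Longrightarrow> model_proj A1 w = w \<Longrightarrow>
       \<exists>x. \<pi>1 x = chart_param (model_proj A1) U' \<phi>' w \<and> \<pi>2 x = m w"
    "continuous_on X m" "\<And>W f. open W \<Longrightarrow> smooth_fun_on A2 W f \<Longrightarrow> Cinf (X \<inter> m -` W) (\<lambda>w. f (m w))"
    "\<And>w z. w \<in> X \<Longrightarrow> g2 (m w) (differential A2 m w z) (differential A2 m w z)
       \<le> K\<^sup>2 * mfd_param.metric_coords A1 (chart_param (model_proj A1) U' \<phi>') g1 w z z"
proof -
  obtain P S \<psi> \<phi> U' \<phi>' D R w0 where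
    ac: "adapted_charts B A1 \<pi>1 P S \<psi> \<phi> (model_proj A1) (chart_domain (model_proj A1) U' \<phi>')
      (chart_param (model_proj A1) U' \<phi>') \<phi>' D R w0" and \<psi>0: "\<psi> 0 = x0"
    and ch: "(U', \<phi>') \<in> A1" "\<pi>1 x0 \<in> U'" and w0: "w0 = \<phi>' (\<pi>1 x0)"
    by (rule L1.adapted_charts_exist) (rule that; assumption)
  let ?P' = "model_proj A1" and ?\<psi>' = "chart_param (model_proj A1) U' \<phi>'" and ?S' = "chart_domain (model_proj A1) U' \<phi>'"
  interpret ad: adapted_charts B A1 \<pi>1 P S \<psi> \<phi> ?P' ?S' ?\<psi>' \<phi>' D R w0 by (rule ac)
  obtain V \<chi>' where ch2: "(V, \<chi>') \<in> A2" "\<pi>2 x0 \<in> V" by (rule L2.M.chart_at)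
  let ?P2 = "model_proj A2" and ?\<psi>2 = "chart_param (model_proj A2) V \<chi>'" and ?S2 = "chart_domain (model_proj A2) V \<chi>'"
  interpret mp2: mfd_param A2 ?P2 ?S2 ?\<psi>2 \<chi>' by unfold_locales (rule L2.M.local_param_chart(1)[OF ch2(1)])
  interpret sc: submersion_charts B A2 \<pi>2 P S \<psi> \<phi> ?P2 ?S2 ?\<psi>2 \<chi>' by unfold_locales
  have im2: "?\<psi>2 ` ?S2 = V" by (rule L2.M.local_param_chart(2)[OF ch2(1)])
  \<comment> \<open>The linear section with horizontal values at \<open>x0\<close>.\<close>
  define v where "v b = ad.NP.coords 0 (L1.hlift x0 (ad.MP.tv w0 b))" for b
  have w0D: "w0 + D 0 = w0" using linear_0[OF ad.D_lin] by simp
  have \<psi>w0: "?\<psi>' w0 = \<pi>1 x0" using ad.\<pi>_\<psi>[OF ad.S_0] \<psi>0 w0D by simp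
  have tvw0: "ad.MP.tv w0 b \<in> tangent_space A1 (\<pi>1 x0)" for b
    using ad.MP.tv_tangent[OF ad.w0(1), of b] unfolding \<psi>w0 .
  note hl = L1.hlift[OF tvw0]
  have hlT: "L1.hlift x0 (ad.MP.tv w0 b) \<in> tangent_space B (\<psi> 0)" for b
    unfolding \<psi>0 by (rule L1.Hor_tangent[OF hl(1)])
  have v: "P (v b) = v b" "ad.NP.tv 0 (v b) = L1.hlift x0 (ad.MP.tv w0 b)" for b
    unfolding v_def by (rule ad.NP.coords[OF ad.S_0 hlT])+
  have Dv: "D (v b) = ?P' b" for b
  proof -
    have "ad.MP.tv w0 (D (v b)) = ad.MP.tv w0 b"
      using ad.push_tv[OF ad.S_0, of "v b"] hl(2)[of b] unfolding v(2) w0D by simp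
    from ad.MP.tv_inj[OF ad.w0(1) this] show ?thesis by (simp add: ad.P'_D)
  qed
  define Rh where "Rh z = (\<Sum>b\<in>Basis. (?P' z \<bullet> b) *\<^sub>R v b)" for z
  have Rh_lin: "linear Rh"
    unfolding Rh_def linear_iff using ad.MP.P_lin
    by (simp add: linear_add linear_cmul inner_add_left scaleR_add_left sum.distrib scaleR_sum_right)
  have P_Rh: "P (Rh z) = Rh z" for z unfolding Rh_def using ad.NP.P_lin by (simp add: linear_sum linear_cmul v(1))
  have D_Rh: "D (Rh z) = ?P' z" for z
  proof -
    have "D (Rh z) = (\<Sum>b\<in>Basis. (?P' z \<bullet> b) *\<^sub>R ?P' b)"
      unfolding Rh_def using ad.D_lin by (simp add: linear_sum linear_cmul Dv)
    also have "\<dots> = ?P' (?P' z)" by (rule linear_basis_expansion[OF ad.MP.P_lin, symmetric])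
    finally show ?thesis by simp
  qed
  have Rh_P: "Rh (?P' z) = Rh z" for z by (simp add: Rh_def)
  have Rh_hor: "ad.NP.tv 0 (Rh z) \<in> L1.Hor x0" for z
    unfolding horizontal_space_def
  proof (intro CollectI conjI ballI impI)
    show "ad.NP.tv 0 (Rh z) \<in> tangent_space B x0" using ad.NP.tv_tangent[OF ad.S_0] unfolding \<psi>0 .
    fix k assume k: "k \<in> tangent_space B x0" "pushforward A1 \<pi>1 k = (\<lambda>f. 0)"
    have kt: "ad.NP.tv 0 (ad.NP.coords 0 k) = k" by (rule ad.NP.coords(2)[OF ad.S_0]) (use k(1) \<psi>0 in simp)
    have vk: "ad.NP.metric_coords h 0 (v b) (ad.NP.coords 0 k) = 0" for b
      unfolding ad.NP.metric_coords_def kt v(2) \<psi>0 by (rule L1.Hor_orth[OF hl(1) k])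
    note l = ad.NP.metric_coords_linear[OF L1.h ad.S_0]
    have "ad.NP.metric_coords h 0 (Rh z) (ad.NP.coords 0 k) = 0"
      unfolding Rh_def by (simp add: linear_sum[OF l] linear_cmul[OF l] vk)
    then show "h x0 (ad.NP.tv 0 (Rh z)) k = 0" unfolding ad.NP.metric_coords_def kt \<psi>0 .
  qed
  \<comment> \<open>The section followed by the second submersion.\<close>
  define y where "y w = Rh (w - w0)" for w
  define m where "m w = \<pi>2 (\<psi> (y w))" for w
  have y_smooth: "Cinf UNIV y"
    unfolding y_def[abs_def]
    by (intro Cinf_compose_linear[OF open_UNIV Rh_lin] Cinf_diff Cinf_const Cinf_linear[OF linear_ident] open_UNIV)
  have y_cont: "continuous_on Z y" for Z by (rule continuous_on_subset[OF Cinf_continuous_on[OF y_smooth]]) simp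
  have dy: "(y has_derivative Rh) (at w)" for w
  proof -
    have "((\<lambda>w. w - w0) has_derivative (\<lambda>h. h - 0)) (at w)"
      by (intro has_derivative_diff has_derivative_ident has_derivative_const)
    from has_derivative_compose[OF this linear_imp_has_derivative[OF Rh_lin]] show ?thesis unfolding y_def[abs_def] by simp
  qed
  have y0: "y w0 = 0" using linear_0[OF Rh_lin] by (simp add: y_def)
  define X0 where "X0 = ?S' \<inter> y -` sc.T"
  have X0: "open X0" unfolding X0_def by (rule continuous_open_preimage[OF y_cont ad.MP.S_open sc.T_open])
  have "0 \<in> sc.T" using ad.S_0 \<psi>0 ch2(2) im2 by (simp add: sc.T_def)
  then have w0X: "w0 \<in> X0" using y0 ad.w0(1) by (simp add: X0_def)
  have yT: "y w \<in> sc.T" "y w \<in> S" and X0S: "w \<in> ?S'" if "w \<in> X0" for w using that sc.T_S by (auto simp: X0_def)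
  have dm: "differential A2 m w z = pushforward A2 \<pi>2 (ad.NP.tv (y w) (Rh z))" if w: "w \<in> X0" for w z
  proof (rule ext)
    fix f
    show "differential A2 m w z f = pushforward A2 \<pi>2 (ad.NP.tv (y w) (Rh z)) f"
    proof (cases "f \<in> smooth_funs A2")
      case f: True
      from has_derivative_compose[OF dy ad.NP.pull_derivative[OF L2.pull_funs[OF f] yT(2)[OF w]]]
      have "((\<lambda>w. f (m w)) has_derivative (\<lambda>z. frechet_derivative (\<lambda>y. f (\<pi>2 (\<psi> y))) (at (y w)) (Rh z))) (at w)"
        unfolding m_def .
      from frechet_derivative_at[OF this, symmetric] show ?thesis
        by (simp add: differential_def f L2.push_apply[OF f] ad.NP.tv_apply[OF L2.pull_funs[OF f]])
    qed (simp add: differential_def pushforward_def)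
  qed
  let ?D2 = "\<lambda>w z. frechet_derivative sc.p (at (y w)) (Rh z)"
  have q2: "g2 (m w) (differential A2 m w z) (differential A2 m w z) = mp2.metric_coords g2 (sc.p (y w)) (?D2 w z) (?D2 w z)"
    if w: "w \<in> X0" for w z
    unfolding dm[OF w] sc.push_tv_coords[OF yT(1)[OF w]] mp2.metric_coords_def sc.p_T(2)[OF yT(1)[OF w]] m_def ..
  define a where "a w z u = K\<^sup>2 * ad.MP.metric_coords g1 w z u - mp2.metric_coords g2 (sc.p (y w)) (?D2 w z) (?D2 w u)" for w z u
  have D2_lin: "linear (?D2 w)" if w: "w \<in> X0" for w
    using linear_compose[OF Rh_lin Cinf_linear_frechet[OF sc.p_smooth yT(1)[OF w]]] by (simp add: o_def)
  have lin_scale: "linear (\<lambda>z. K\<^sup>2 * f z)" if "linear f" for f :: "'e \<Rightarrow> real"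
    using that by (simp add: linear_iff algebra_simps)
  have a_lin1: "linear (\<lambda>z. a w z u)" if w: "w \<in> X0" for w u
    unfolding a_def
    using linear_compose[OF D2_lin[OF w] mp2.metric_coords_linear[OF L2.g sc.p_T(1)[OF yT(1)[OF w]]]]
    by (intro linear_compose_sub lin_scale ad.MP.metric_coords_linear[OF L1.g X0S[OF w]]) (simp add: o_def)
  have a_lin2: "linear (\<lambda>u. a w z u)" if w: "w \<in> X0" for w z
    unfolding a_def
    using linear_compose[OF D2_lin[OF w] mp2.metric_coords_linear2[OF L2.g sc.p_T(1)[OF yT(1)[OF w]]]]
    by (intro linear_compose_sub lin_scale ad.MP.metric_coords_linear2[OF L1.g X0S[OF w]]) (simp add: o_def)
  have yX: "y ` X0 \<subseteq> sc.T" using yT by blast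
  have py_cont: "continuous_on X0 (\<lambda>w. sc.p (y w))"
    by (rule continuous_on_compose2[OF Cinf_continuous_on[OF sc.p_smooth] y_cont yX])
  have D2_cont: "continuous_on X0 (\<lambda>w. ?D2 w z)" for z
    by (rule continuous_on_compose2[OF Cinf_continuous_on[OF Cinf_frechet[OF sc.p_smooth]] y_cont yX])
  have a_cont: "continuous_on X0 (\<lambda>w. a w z u)" for z u
    unfolding a_def
  proof (intro continuous_on_diff continuous_on_mult continuous_on_const)
    show "continuous_on X0 (\<lambda>w. ad.MP.metric_coords g1 w z u)"
      by (rule continuous_on_subset[OF Cinf_continuous_on[OF ad.MP.metric_coords_smooth[OF L1.g]]]) (simp add: X0_def)
    show "continuous_on X0 (\<lambda>w. mp2.metric_coords g2 (sc.p (y w)) (?D2 w z) (?D2 w u))"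
    proof (rule metric_coords_continuous_aux[where a="\<lambda>w u v. mp2.metric_coords g2 (sc.p (y w)) u v", OF _ _ _ D2_cont D2_cont])
      show "linear (\<lambda>u. mp2.metric_coords g2 (sc.p (y w)) u v)" if "w \<in> X0" for w v
        by (rule mp2.metric_coords_linear[OF L2.g sc.p_T(1)[OF yT(1)[OF that]]])
      show "linear (\<lambda>v. mp2.metric_coords g2 (sc.p (y w)) u v)" if "w \<in> X0" for w u
        by (rule mp2.metric_coords_linear2[OF L2.g sc.p_T(1)[OF yT(1)[OF that]]])
      show "continuous_on X0 (\<lambda>w. mp2.metric_coords g2 (sc.p (y w)) u v)" for u v
        by (rule continuous_on_compose2[OF Cinf_continuous_on[OF mp2.metric_coords_smooth[OF L2.g]] py_cont])
          (use sc.p_T(1) yT(1) in auto)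
    qed
  qed
  have gm1_P: "ad.MP.metric_coords g1 w (?P' z) (?P' z) = ad.MP.metric_coords g1 w z z" if "w \<in> X0" for w z
    unfolding ad.MP.metric_coords_def ad.MP.tv_P[OF X0S[OF that]] ..
  have a_P: "a w (?P' z) (?P' z) = a w z z" if "w \<in> X0" for w z
    unfolding a_def Rh_P gm1_P[OF that] ..
  have a_pos: "0 < a w0 z z" if z: "?P' z = z" "z \<noteq> 0" for z
  proof -
    have push1: "pushforward A1 \<pi>1 (ad.NP.tv 0 (Rh z)) = ad.MP.tv w0 z"
      unfolding ad.push_tv[OF ad.S_0] w0D D_Rh z(1) ..
    have gz: "0 < ad.MP.metric_coords g1 w0 z z" by (rule ad.MP.metric_coords_pos[OF L1.g ad.w0(1)]) (use z in simp)
    have t0: "ad.NP.tv 0 (Rh z) \<in> tangent_space B x0" by (rule L1.Hor_tangent[OF Rh_hor])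
    have "mp2.metric_coords g2 (sc.p (y w0)) (?D2 w0 z) (?D2 w0 z) \<le> h x0 (ad.NP.tv 0 (Rh z)) (ad.NP.tv 0 (Rh z))"
      using L2.push_norm_le[OF t0] q2[OF w0X, of z] dm[OF w0X, of z] y0 \<psi>0 by (simp add: m_def)
    also have "\<dots> = ad.MP.metric_coords g1 w0 z z"
      unfolding ad.MP.metric_coords_def \<psi>w0 L1.push_isometry[OF Rh_hor Rh_hor, symmetric] push1 ..
    also have "\<dots> < K\<^sup>2 * ad.MP.metric_coords g1 w0 z z" using gz K by simp
    finally show ?thesis by (simp add: a_def)
  qed
  obtain X where X: "open X" "w0 \<in> X" "X \<subseteq> X0" "\<And>w z. w \<in> X \<Longrightarrow> 0 \<le> a w z z"
    by (rule quadratic_form_nonneg_near[OF ad.MP.P_proj X0 w0X a_lin1 a_lin2 a_cont a_P a_pos])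
      (assumption | rule that)+
  have m_cont: "continuous_on X m"
    unfolding m_def
    by (rule continuous_on_compose2[OF L2.\<pi>_cont continuous_on_compose2[OF ad.NP.\<psi>_cont y_cont]])
      (use X(3) yT(2) in auto)
  show thesis
  proof (rule that[OF ch ch2(1) X(1) _ _ _ _ m_cont])
    show "X \<subseteq> ?S'" using X(3) X0S by blast
    show "\<phi>' (\<pi>1 x0) \<in> X" using X(2) unfolding w0 .
    fix w assume w: "w \<in> X"
    then have wX: "w \<in> X0" using X(3) by blast
    show "m w \<in> V" using yT(1)[OF wX] im2 by (auto simp: m_def sc.T_def)
    show "\<exists>x. \<pi>1 x = ?\<psi>' w \<and> \<pi>2 x = m w" if Pw: "?P' w = w"
    proof (intro exI[of _ "\<psi> (y w)"] conjI)
      have "D (y w) = w - w0"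
        unfolding y_def D_Rh using ad.MP.P_lin Pw ad.w0(2) by (simp add: linear_diff)
      then show "\<pi>1 (\<psi> (y w)) = ?\<psi>' w" using ad.\<pi>_\<psi>[OF yT(2)[OF wX]] by simp
    qed (simp add: m_def)
    show "g2 (m w) (differential A2 m w z) (differential A2 m w z) \<le> K\<^sup>2 * ad.MP.metric_coords g1 w z z" for z
      using X(4)[OF w, of z] unfolding q2[OF wX] a_def by simp
  next
    fix W and f :: "'b \<Rightarrow> real" assume W: "open W" and f: "smooth_fun_on A2 W f"
    have "Cinf (S \<inter> \<psi> -` (\<pi>2 -` W)) (\<lambda>z. f (\<pi>2 (\<psi> z)))"
      by (rule ad.NP.smooth_pull[OF L2.\<pi>_preimage_open[OF W] L2.pull_smooth[OF W f]])
    moreover have "y ` (X \<inter> m -` W) \<subseteq> S \<inter> \<psi> -` (\<pi>2 -` W)"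
      using X(3) yT(2) by (auto simp: m_def)
    ultimately show "Cinf (X \<inter> m -` W) (\<lambda>w. f (m w))"
      unfolding m_def
      by (intro Cinf_compose[where f="\<lambda>z. f (\<pi>2 (\<psi> z))" and g=y and V="S \<inter> \<psi> -` (\<pi>2 -` W)"]
          continuous_open_preimage[OF m_cont[unfolded m_def] X(1) W] ad.NP.preimage_open L2.\<pi>_preimage_open W
          Cinf_subset[OF y_smooth])
        auto
  qed
qed

end

lemma has_integral_reparametrize:
  fixes f :: "real \<Rightarrow> real"
  assumes f: "f integrable_on {s..t}" and st: "s < t"
  shows "((\<lambda>\<tau>. (t - s) * f (s + \<tau> * (t - s))) has_integral integral {s..t} f) {0..1}"
proof -
  have i: "(f has_integral integral {s..t} f) (cbox s t)" using f by (simp add: integrable_integral)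
  have im: "(\<lambda>x. (1 / (t - s)) *\<^sub>R x + -((1 / (t - s)) *\<^sub>R s)) ` cbox s t = {0..1}"
  proof -
    have "(\<lambda>x. (1 / (t - s)) *\<^sub>R x + -((1 / (t - s)) *\<^sub>R s)) ` cbox s t
      = (\<lambda>x. (1 / (t - s)) * x + - (s / (t - s))) ` {s..t}" by simp
    also have "\<dots> = {0..1}"
      using st by (subst image_affinity_atLeastAtMost) (simp add: diff_divide_distrib[symmetric])
    finally show ?thesis .
  qed
  have "((\<lambda>\<tau>. f ((t - s) *\<^sub>R \<tau> + s)) has_integral (1 / \<bar>t - s\<bar> ^ DIM(real)) *\<^sub>R integral {s..t} f) {0..1}"
    using has_integral_affinity[OF i, of "t - s" s] st unfolding im by simp
  from has_integral_mult_right[OF this, of "t - s"] show ?thesis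
    using st by (simp add: add.commute mult.commute)
qed

text \<open>The chart values of the curve, reparametrised to the unit interval, are mapped by \<open>m\<close>. The bound
  on the differential of \<open>m\<close> holds at interior times and is integrated.\<close>

lemma mapped_curve_length:
  fixes A1 :: "('a::{second_countable_topology,t2_space}, 'e::euclidean_space) atlas"
    and A2 :: "('b::{second_countable_topology,t2_space}, 'f::euclidean_space) atlas"
  assumes "riem_mfd A1 g1" "riem_mfd A2 g2" and ch: "(U, \<phi>) \<in> A1" and ch2: "(V, \<chi>') \<in> A2"
    and X: "open X" "X \<subseteq> chart_domain (model_proj A1) U \<phi>" and mV: "\<And>w. w \<in> X \<Longrightarrow> m w \<in> V"
    and m: "continuous_on X m"
    and sm: "\<And>W f. open W \<Longrightarrow> smooth_fun_on A2 W f \<Longrightarrow> Cinf (X \<inter> m -` W) (\<lambda>w. f (m w))"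
    and K: "0 \<le> K" and metric_coords: "\<And>w z. w \<in> X \<Longrightarrow> g2 (m w) (differential A2 m w z) (differential A2 m w z)
       \<le> K\<^sup>2 * mfd_param.metric_coords A1 (chart_param (model_proj A1) U \<phi>) g1 w z z"
    and c: "smooth_curve_on A1 {s..t} c" and st: "s < t"
    and cU: "\<And>u. u \<in> {s..t} \<Longrightarrow> c u \<in> U" and cX: "\<And>u. u \<in> {s..t} \<Longrightarrow> \<phi> (c u) \<in> X"
  shows "speed A1 g1 c integrable_on {s..t}"
    and "piecewise_smooth_curve A2 (\<lambda>\<tau>. m (\<phi> (c (s + \<tau> * (t - s)))))"
    and "curve_length A2 g2 (\<lambda>\<tau>. m (\<phi> (c (s + \<tau> * (t - s))))) \<le> K * integral {s..t} (speed A1 g1 c)"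
proof -
  interpret R1: riem_mfd A1 g1 by fact
  interpret R2: riem_mfd A2 g2 by fact
  let ?\<psi> = "chart_param (model_proj A1) U \<phi>" and ?S = "chart_domain (model_proj A1) U \<phi>"
  interpret mp: mfd_param A1 "model_proj A1" ?S ?\<psi> \<phi> by unfold_locales (rule R1.local_param_chart(1)[OF ch])
  have im: "?\<psi> ` ?S = U" by (rule R1.local_param_chart(2)[OF ch])
  obtain w' where w': "\<And>u. u \<in> {s<..<t} \<Longrightarrow> (\<phi> \<circ> c has_vector_derivative w' u) (at u)"
    "\<And>u. u \<in> {s<..<t} \<Longrightarrow> velocity A1 c u = mp.tv (\<phi> (c u)) (w' u)"
    and int1: "speed A1 g1 c integrable_on {s..t}"
    by (rule R1.speed_chart[OF c ch cU st]) (assumption | (rule that; assumption))+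
  show "speed A1 g1 c integrable_on {s..t}" by (rule int1)
  define \<alpha> where "\<alpha> \<tau> = s + \<tau> * (t - s)" for \<tau>
  have mem: "s + r \<in> {s..t} \<longleftrightarrow> 0 \<le> r \<and> r \<le> 1 * (t - s)" "s + r \<in> {s<..<t} \<longleftrightarrow> 0 < r \<and> r < 1 * (t - s)" for r
    by auto
  have \<alpha>_in: "\<alpha> \<tau> \<in> {s..t}" if "\<tau> \<in> {0..1}" for \<tau>
    unfolding \<alpha>_def mem by (intro conjI mult_right_mono mult_nonneg_nonneg) (use that st in auto)
  have \<alpha>_int: "\<alpha> \<tau> \<in> {s<..<t}" if "\<tau> \<in> {0<..<1}" for \<tau>
    unfolding \<alpha>_def mem by (intro conjI mult_strict_right_mono mult_pos_pos) (use that st in auto)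
  define w where "w \<tau> = \<phi> (c (\<alpha> \<tau>))" for \<tau>
  have wX: "w \<tau> \<in> X" if "\<tau> \<in> {0..1}" for \<tau> unfolding w_def by (rule cX[OF \<alpha>_in[OF that]])
  have \<alpha>_smooth: "smooth_on {0..1} \<alpha>"
  proof (rule smooth_on_subset[of UNIV])
    have "linear (\<lambda>\<tau>. \<tau> * (t - s))" by (simp add: linear_iff algebra_simps)
    then have "Cinf UNIV \<alpha>" unfolding \<alpha>_def[abs_def] by (intro Cinf_add Cinf_const Cinf_linear open_UNIV)
    then show "smooth_on UNIV \<alpha>" unfolding smooth_on_Cinf[OF open_UNIV] .
  qed simp
  have \<alpha>_im: "\<alpha> ` {0..1} \<subseteq> {s..t}" using \<alpha>_in by blast
  have "smooth_on ({s..t} \<inter> c -` U) (\<phi> \<circ> c)" using c ch unfolding smooth_curve_on_def by blast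
  then have \<phi>c: "smooth_on {s..t} (\<lambda>u. \<phi> (c u))" unfolding o_def by (rule smooth_on_subset) (use cU in blast)
  have w_smooth: "smooth_on {0..1} w" unfolding w_def[abs_def] by (rule smooth_on_compose[OF \<alpha>_smooth \<phi>c \<alpha>_im])
  have c_cont: "continuous_on {s..t} c" using c unfolding smooth_curve_on_def by blast
  have "continuous_on {0..1} (\<lambda>\<tau>. c (\<alpha> \<tau>))"
    by (rule continuous_on_compose2[OF c_cont _ \<alpha>_im]) (unfold \<alpha>_def[abs_def], intro continuous_intros)
  then have w_cont: "continuous_on {0..1} w"
    unfolding w_def[abs_def] by (rule continuous_on_compose2[OF mp.\<phi>_cont]) (use cU \<alpha>_in im in auto)
  have c2: "smooth_curve_on A2 {0..1} (\<lambda>\<tau>. m (w \<tau>))"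
    by (rule smooth_curve_on_compose[OF R2.manifold m X(1) sm w_smooth w_cont]) (use wX in auto)
  have "piecewise_smooth_curve A2 (\<lambda>\<tau>. m (w \<tau>))"
    unfolding piecewise_smooth_curve_def using c2 by (intro exI[of _ 1] exI[of _ real]) simp
  then show "piecewise_smooth_curve A2 (\<lambda>\<tau>. m (\<phi> (c (s + \<tau> * (t - s)))))" unfolding w_def \<alpha>_def .
  have int2: "speed A2 g2 (\<lambda>\<tau>. m (w \<tau>)) integrable_on {0..1}"
    by (rule R2.speed_chart[OF c2 ch2]) (use mV wX in auto)
  have vel2: "velocity A2 (\<lambda>\<tau>. m (w \<tau>)) \<tau> = differential A2 m (w \<tau>) ((t - s) *\<^sub>R w' (\<alpha> \<tau>))" if \<tau>: "\<tau> \<in> {0<..<1}" for \<tau>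
  proof (rule ext)
    fix f
    show "velocity A2 (\<lambda>\<tau>. m (w \<tau>)) \<tau> f = differential A2 m (w \<tau>) ((t - s) *\<^sub>R w' (\<alpha> \<tau>)) f"
    proof (cases "f \<in> smooth_funs A2")
      case f: True
      have \<alpha>d: "(\<alpha> has_vector_derivative (t - s)) (at \<tau>)"
        unfolding \<alpha>_def[abs_def] has_real_derivative_iff_has_vector_derivative[symmetric]
        by (auto intro!: derivative_eq_intros)
      have "(w has_vector_derivative (t - s) *\<^sub>R w' (\<alpha> \<tau>)) (at \<tau>)"
        using vector_diff_chain_at[OF \<alpha>d w'(1)[OF \<alpha>_int[OF \<tau>]]] unfolding w_def[abs_def] o_def .
      then have wd: "(w has_derivative (\<lambda>x. x *\<^sub>R ((t - s) *\<^sub>R w' (\<alpha> \<tau>)))) (at \<tau>)"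
        unfolding has_vector_derivative_def .
      have mem: "w \<tau> \<in> X \<inter> m -` UNIV" using wX[of \<tau>] \<tau> by simp
      note C = sm[OF open_UNIV R2.smooth_funsD[OF f]]
      let ?D = "frechet_derivative (\<lambda>w. f (m w)) (at (w \<tau>))"
      have "((\<lambda>\<tau>. f (m (w \<tau>))) has_derivative (\<lambda>x. ?D (x *\<^sub>R ((t - s) *\<^sub>R w' (\<alpha> \<tau>))))) (at \<tau>)"
        by (rule has_derivative_compose[OF wd Cinf_has_derivative[OF C mem]])
      then have "((\<lambda>\<tau>. f (m (w \<tau>))) has_real_derivative ?D ((t - s) *\<^sub>R w' (\<alpha> \<tau>))) (at \<tau>)"
        unfolding has_real_derivative_iff_has_vector_derivative has_vector_derivative_def
          linear_cmul[OF Cinf_linear_frechet[OF C mem]] .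
      from DERIV_imp_deriv[OF this] show ?thesis using f by (simp add: velocity_def differential_def)
    qed (simp add: velocity_def differential_def)
  qed
  have le: "speed A2 g2 (\<lambda>\<tau>. m (w \<tau>)) \<tau> \<le> K * ((t - s) * speed A1 g1 c (\<alpha> \<tau>))" if \<tau>: "\<tau> \<in> {0<..<1}" for \<tau>
  proof -
    let ?u = "\<alpha> \<tau>"
    have u: "?u \<in> {s<..<t}" by (rule \<alpha>_int[OF \<tau>])
    have w: "w \<tau> \<in> X" using wX[of \<tau>] \<tau> by simp
    then have wS: "w \<tau> \<in> ?S" using X(2) by blast
    have \<psi>w: "?\<psi> (w \<tau>) = c ?u" unfolding w_def by (rule mp.\<psi>\<phi>) (use cU[of ?u] u im in simp)
    have e1: "g1 (c ?u) (velocity A1 c ?u) (velocity A1 c ?u) = mp.metric_coords g1 (w \<tau>) (w' ?u) (w' ?u)"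
      using \<psi>w unfolding mp.metric_coords_def w'(2)[OF u] by (simp add: w_def)
    have e2: "mp.metric_coords g1 (w \<tau>) ((t - s) *\<^sub>R w' ?u) ((t - s) *\<^sub>R w' ?u) = (t - s)\<^sup>2 * mp.metric_coords g1 (w \<tau>) (w' ?u) (w' ?u)"
      unfolding linear_cmul[OF mp.metric_coords_linear[OF R1.metric wS]] linear_cmul[OF mp.metric_coords_linear2[OF R1.metric wS]]
      by (simp add: power2_eq_square)
    have "speed A2 g2 (\<lambda>\<tau>. m (w \<tau>)) \<tau> \<le> sqrt (K\<^sup>2 * ((t - s)\<^sup>2 * mp.metric_coords g1 (w \<tau>) (w' ?u) (w' ?u)))"
      unfolding speed_def vel2[OF \<tau>] by (rule real_sqrt_le_mono) (use metric_coords[OF w] e2 in metis)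
    also have "\<dots> = K * ((t - s) * sqrt (mp.metric_coords g1 (w \<tau>) (w' ?u) (w' ?u)))"
      using K st by (simp add: real_sqrt_mult)
    also have "\<dots> = K * ((t - s) * speed A1 g1 c ?u)" unfolding speed_def e1 ..
    finally show ?thesis .
  qed
  have "((\<lambda>\<tau>. K * ((t - s) * speed A1 g1 c (\<alpha> \<tau>))) has_integral K * integral {s..t} (speed A1 g1 c)) {0..1}"
    unfolding \<alpha>_def by (rule has_integral_mult_right[OF has_integral_reparametrize[OF int1 st]])
  then have I2: "((\<lambda>\<tau>. if \<tau> \<in> {0, 1} then speed A2 g2 (\<lambda>\<tau>. m (w \<tau>)) \<tau> else K * ((t - s) * speed A1 g1 c (\<alpha> \<tau>)))
      has_integral K * integral {s..t} (speed A1 g1 c)) {0..1}"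
    by (rule has_integral_spike_finite[of "{0, 1}", rotated 2]) auto
  have "curve_length A2 g2 (\<lambda>\<tau>. m (w \<tau>)) \<le> K * integral {s..t} (speed A1 g1 c)"
    unfolding curve_length_speed
  proof (rule has_integral_le[OF integrable_integral[OF int2] I2])
    fix \<tau> :: real assume \<tau>: "\<tau> \<in> {0..1}"
    show "speed A2 g2 (\<lambda>\<tau>. m (w \<tau>)) \<tau>
       \<le> (if \<tau> \<in> {0, 1} then speed A2 g2 (\<lambda>\<tau>. m (w \<tau>)) \<tau> else K * ((t - s) * speed A1 g1 c (\<alpha> \<tau>)))"
    proof (cases "\<tau> \<in> {0, 1}")
      case False
      then have "\<tau> \<in> {0<..<1}" using \<tau> by auto
      from le[OF this] show ?thesis using False by simp
    qed simp
  qed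
  then show "curve_length A2 g2 (\<lambda>\<tau>. m (\<phi> (c (s + \<tau> * (t - s))))) \<le> K * integral {s..t} (speed A1 g1 c)"
    unfolding w_def \<alpha>_def .
qed

lemma smooth_curve_on_subset:
  assumes "smooth_curve_on A S c" "T \<subseteq> S"
  shows "smooth_curve_on A T c"
  unfolding smooth_curve_on_def
proof (intro conjI ballI)
  show "continuous_on T c" using assms continuous_on_subset unfolding smooth_curve_on_def by blast
  fix x assume "x \<in> A"
  then show "case x of (U, \<phi>) \<Rightarrow> smooth_on (T \<inter> c -` U) (\<phi> \<circ> c)"
    using assms unfolding smooth_curve_on_def by (auto intro!: smooth_on_subset[OF _ Int_mono[OF assms(2) order_refl]])
qed

context leaf_transfer
begin

text \<open>The endpoints are fixed only up to their fibres, and so the property is additive for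
  consecutive pieces of a curve although the discrete paths belonging to the pieces start and end at
  different points of the same leaf.\<close>

definition length_bound :: "real \<Rightarrow> (real \<Rightarrow> 'a) \<Rightarrow> real \<Rightarrow> real \<Rightarrow> bool" where
  "length_bound K c s t \<longleftrightarrow> speed A1 g1 c integrable_on {s..t} \<and>
     (\<forall>x y. \<pi>1 x = c s \<longrightarrow> \<pi>1 y = c t \<longrightarrow>
        (\<exists>l. R2.joined (\<pi>2 x) (\<pi>2 y) l \<and> l \<le> K * integral {s..t} (speed A1 g1 c)))"

lemma length_bound_refl: "length_bound K c s s"
  unfolding length_bound_def
proof (intro conjI allI impI)
  show "speed A1 g1 c integrable_on {s..s}" using integrable_on_refl[of "speed A1 g1 c" s] by simp
  fix x y assume "\<pi>1 x = c s" "\<pi>1 y = c s"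
  then have "R2.joined (\<pi>2 x) (\<pi>2 y) 0" by (intro R2.joined_same_leaf fibre_transfer) simp
  then show "\<exists>l. R2.joined (\<pi>2 x) (\<pi>2 y) l \<and> l \<le> K * integral {s..s} (speed A1 g1 c)" by auto
qed

lemma length_bound_trans:
  assumes Q: "length_bound K c s t" "length_bound K c t u" and stu: "s \<le> t" "t \<le> u"
  shows "length_bound K c s u"
  unfolding length_bound_def
proof (intro conjI allI impI)
  let ?f = "speed A1 g1 c"
  have i: "?f integrable_on {s..t}" "?f integrable_on {t..u}" using Q unfolding length_bound_def by blast+
  show i': "?f integrable_on {s..u}" by (rule Henstock_Kurzweil_Integration.integrable_combine[OF stu i])
  fix x y assume x: "\<pi>1 x = c s" and y: "\<pi>1 y = c u"
  obtain z where z: "\<pi>1 z = c t" using surj1 by (metis surjD)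
  obtain l where l: "R2.joined (\<pi>2 x) (\<pi>2 z) l" "l \<le> K * integral {s..t} ?f"
    using Q(1) x z unfolding length_bound_def by blast
  obtain l' where l': "R2.joined (\<pi>2 z) (\<pi>2 y) l'" "l' \<le> K * integral {t..u} ?f"
    using Q(2) y z unfolding length_bound_def by blast
  have "l + l' \<le> K * integral {s..u} ?f"
    using l(2) l'(2) unfolding Henstock_Kurzweil_Integration.integral_combine[OF stu i', symmetric] by (simp add: distrib_left)
  with R2.joined_trans[OF l(1) l'(1)]
  show "\<exists>l. R2.joined (\<pi>2 x) (\<pi>2 y) l \<and> l \<le> K * integral {s..u} ?f" by blast
qed

text \<open>The piece lies in the domain of a map as in \<open>short_section\<close>; its image is the required path. The
  endpoints of the image are the images under \<open>\<pi>2\<close> of points over the endpoints of the piece.\<close>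

lemma length_bound_local:
  assumes K: "1 < K" and c: "smooth_curve_on A1 {a..b} c" and t0: "t0 \<in> {a..b}"
  obtains d where "0 < d" "\<And>s t. s \<in> {a..b} \<Longrightarrow> t \<in> {a..b} \<Longrightarrow> s \<le> t0 \<Longrightarrow> t0 \<le> t \<Longrightarrow> t - s < d \<Longrightarrow> length_bound K c s t"
proof -
  obtain x0 where x0: "\<pi>1 x0 = c t0" using surj1 by (metis surjD)
  obtain U' \<phi>' V \<chi>' X m where ch: "(U', \<phi>') \<in> A1" "\<pi>1 x0 \<in> U'" and ch2: "(V, \<chi>') \<in> A2"
    and X: "open X" "X \<subseteq> chart_domain (model_proj A1) U' \<phi>'" "\<phi>' (\<pi>1 x0) \<in> X"
    and mV: "\<And>w. w \<in> X \<Longrightarrow> m w \<in> V" and lift: "\<And>w. w \<in> X \<Longrightarrow> model_proj A1 w = w \<Longrightarrow>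
       \<exists>x. \<pi>1 x = chart_param (model_proj A1) U' \<phi>' w \<and> \<pi>2 x = m w"
    and m: "continuous_on X m" and sm: "\<And>W f. open W \<Longrightarrow> smooth_fun_on A2 W f \<Longrightarrow> Cinf (X \<inter> m -` W) (\<lambda>w. f (m w))"
    and metric_coords: "\<And>w z. w \<in> X \<Longrightarrow> g2 (m w) (differential A2 m w z) (differential A2 m w z)
       \<le> K\<^sup>2 * mfd_param.metric_coords A1 (chart_param (model_proj A1) U' \<phi>') g1 w z z"
    by (rule short_section[OF K]) (rule that; assumption)
  let ?\<psi> = "chart_param (model_proj A1) U' \<phi>'" and ?S = "chart_domain (model_proj A1) U' \<phi>'"
  interpret mp: mfd_param A1 "model_proj A1" ?S ?\<psi> \<phi>' by unfold_locales (rule L1.M.local_param_chart(1)[OF ch(1)])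
  have im: "?\<psi> ` ?S = U'" by (rule L1.M.local_param_chart(2)[OF ch(1)])
  have U': "open U'" by (rule L1.M.model_proj(2)[OF ch(1)])
  have O: "open (U' \<inter> \<phi>' -` X)" by (rule continuous_open_preimage[OF mp.\<phi>_cont[unfolded im] U' X(1)])
  have c_cont: "continuous_on {a..b} c" using c unfolding smooth_curve_on_def by blast
  have "c t0 \<in> U' \<inter> \<phi>' -` X" using ch(2) X(3) x0 by simp
  then obtain T where T: "open T" "t0 \<in> T" "\<And>u. u \<in> {a..b} \<Longrightarrow> u \<in> T \<Longrightarrow> c u \<in> U' \<inter> \<phi>' -` X"
    using c_cont t0 O unfolding continuous_on_topological by meson
  obtain d where d: "0 < d" "ball t0 d \<subseteq> T" using T(1,2) open_contains_ball by metis
  show thesis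
  proof (rule that[OF d(1)])
    fix s t assume st: "s \<in> {a..b}" "t \<in> {a..b}" "s \<le> t0" "t0 \<le> t" "t - s < d"
    show "length_bound K c s t"
    proof (cases "s = t")
      case True
      then show ?thesis using length_bound_refl by simp
    next
      case False
      then have lt: "s < t" using st by simp
      have sub: "{s..t} \<subseteq> {a..b}" using st by auto
      have cO: "c u \<in> U'" "\<phi>' (c u) \<in> X" if u: "u \<in> {s..t}" for u
      proof -
        have "dist t0 u < d" using st u unfolding dist_real_def by auto
        then have "u \<in> T" using d(2) by auto
        from T(3)[OF _ this] show "c u \<in> U'" "\<phi>' (c u) \<in> X" using u sub by auto
      qed
      have K0: "0 \<le> K" using K by simp
      note mc = mapped_curve_length[OF R1.riem_mfd_axioms R2.riem_mfd_axioms ch(1) ch2 X(1,2) mV m sm K0 metric_coords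
          smooth_curve_on_subset[OF c sub] lt cO]
      define c2 where "c2 \<tau> = m (\<phi>' (c (s + \<tau> * (t - s))))" for \<tau>
      have int: "speed A1 g1 c integrable_on {s..t}" by (rule mc(1))
      have pw: "piecewise_smooth_curve A2 c2" unfolding c2_def[abs_def] by (rule mc(2))
      have len: "curve_length A2 g2 c2 \<le> K * integral {s..t} (speed A1 g1 c)"
        unfolding c2_def[abs_def] by (rule mc(3))
      have lifted: "\<exists>x. \<pi>1 x = c u \<and> \<pi>2 x = m (\<phi>' (c u))" if u: "u \<in> {s..t}" for u
      proof -
        have cu: "c u \<in> ?\<psi> ` ?S" using cO(1)[OF u] im by simp
        from lift[OF cO(2)[OF u] mp.P\<phi>[OF cu]] show ?thesis unfolding mp.\<psi>\<phi>[OF cu] .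
      qed
      obtain x' where x': "\<pi>1 x' = c s" "\<pi>2 x' = c2 0" using lifted[of s] lt by (auto simp: c2_def)
      obtain y' where y': "\<pi>1 y' = c t" "\<pi>2 y' = c2 1" using lifted[of t] lt by (auto simp: c2_def)
      show ?thesis
        unfolding length_bound_def
      proof (intro conjI allI impI int)
        fix x y assume x: "\<pi>1 x = c s" and y: "\<pi>1 y = c t"
        have "(c2 0, \<pi>2 x) \<in> same_leaf A2 F2" "(c2 1, \<pi>2 y) \<in> same_leaf A2 F2"
          using fibre_transfer[of x' x] fibre_transfer[of y' y] x y x' y' by simp_all
        from R2.joined_leaf[OF R2.joined_curve[OF pw] this]
        show "\<exists>l. R2.joined (\<pi>2 x) (\<pi>2 y) l \<and> l \<le> K * integral {s..t} (speed A1 g1 c)"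
          using len by blast
      qed
    qed
  qed
qed

text \<open>Bolzano's principle: an additive property of intervals that holds locally holds globally.\<close>

lemma length_bound_smooth:
  assumes K: "1 < K" and c: "smooth_curve_on A1 {a..b} c" and ab: "a \<le> b"
  shows "length_bound K c a b"
proof -
  let ?P = "\<lambda>s t. s \<in> {a..b} \<longrightarrow> t \<in> {a..b} \<longrightarrow> length_bound K c s t"
  have "?P a b"
  proof (rule Bolzano[OF ab, where P="?P"])
    fix s t r assume 1: "?P s t" "?P t r" "s \<le> t" "t \<le> r"
    show "?P s r"
    proof (intro impI)
      assume "s \<in> {a..b}" "r \<in> {a..b}"
      then show "length_bound K c s r" using 1 by (intro length_bound_trans[of K c s t r]) auto
    qed
  next
    fix t0 assume "a \<le> t0" "t0 \<le> b"
    then have t0: "t0 \<in> {a..b}" by simp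
    obtain d where d: "0 < d" "\<And>s t. s \<in> {a..b} \<Longrightarrow> t \<in> {a..b} \<Longrightarrow> s \<le> t0 \<Longrightarrow> t0 \<le> t \<Longrightarrow> t - s < d \<Longrightarrow> length_bound K c s t"
      by (rule length_bound_local[OF K c t0]) (rule that; assumption)
    show "\<exists>d>0. \<forall>s t. s \<le> t0 \<and> t0 \<le> t \<and> t - s < d \<longrightarrow> ?P s t"
      using d by (intro exI[of _ d]) simp
  qed
  then show ?thesis using ab by simp
qed

lemma length_bound_piecewise:
  assumes K: "1 < K" and c: "piecewise_smooth_curve A1 c"
  shows "length_bound K c 0 1"
proof -
  obtain n t where t: "t 0 = 0" "t n = 1" "\<And>i. i < n \<Longrightarrow> t i < t (Suc i)" "\<And>i. i < n \<Longrightarrow> smooth_curve_on A1 {t i..t (Suc i)} c"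
    using c unfolding piecewise_smooth_curve_def by blast
  have "t 0 \<le> t k \<and> length_bound K c (t 0) (t k)" if "k \<le> n" for k
    using that
  proof (induction k)
    case 0
    show ?case using length_bound_refl by simp
  next
    case (Suc k)
    then have k: "k < n" and IH: "t 0 \<le> t k" "length_bound K c (t 0) (t k)" by auto
    have le: "t k \<le> t (Suc k)" using t(3)[OF k] by simp
    have "length_bound K c (t 0) (t (Suc k))"
      by (rule length_bound_trans[OF IH(2) length_bound_smooth[OF K t(4)[OF k] le] IH(1) le])
    then show ?case using IH(1) le by simp
  qed
  from this[of n] show ?thesis using t(1,2) by simp
qed

text \<open>The curves of the path are transferred one after the other. The jumps between them stay in a leaf
  of \<open>F1\<close>, and \<open>leaf_transfer\<close> moves these to leaves of \<open>F2\<close>.\<close>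

lemma joined_transfer:
  assumes K: "1 < K" and j: "R1.joined (\<pi>1 x) (\<pi>1 y) l"
  obtains l' where "R2.joined (\<pi>2 x) (\<pi>2 y) l'" "l' \<le> K * l"
proof -
  obtain k \<gamma> where dp: "discrete_path A1 F1 (R1.leaf (\<pi>1 x)) (R1.leaf (\<pi>1 y)) k \<gamma>"
    and l: "l = (\<Sum>i<k. curve_length A1 g1 (\<gamma> i))"
    using j unfolding R1.joined_def by blast
  note dp = dp[unfolded discrete_path_def R1.mem_leaf]
  have piece: "\<exists>l'. R2.joined (\<pi>2 u) (\<pi>2 v) l' \<and> l' \<le> K * curve_length A1 g1 (\<gamma> i)"
    if "i < k" "\<pi>1 u = \<gamma> i 0" "\<pi>1 v = \<gamma> i 1" for i u v
    using length_bound_piecewise[OF K, of "\<gamma> i"] dp that unfolding length_bound_def curve_length_speed by blast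
  have "\<forall>v. \<pi>1 v = \<gamma> (n - 1) 1 \<longrightarrow> (\<exists>l'. R2.joined (\<pi>2 x) (\<pi>2 v) l' \<and> l' \<le> K * (\<Sum>i<n. curve_length A1 g1 (\<gamma> i)))"
    if "1 \<le> n" "n \<le> k" for n
    using that
  proof (induction n rule: nat_induct_at_least)
    case base
    obtain u where u: "\<pi>1 u = \<gamma> 0 0" using surj1 by (metis surjD)
    have s: "(\<pi>2 u, \<pi>2 x) \<in> same_leaf A2 F2"
      by (rule L2.F.same_leaf_sym[OF leaf_transfer]) (use dp u in simp)
    show ?case
    proof (intro allI impI)
      fix v assume "\<pi>1 v = \<gamma> (1 - 1) 1"
      then obtain l' where l': "R2.joined (\<pi>2 u) (\<pi>2 v) l'" "l' \<le> K * curve_length A1 g1 (\<gamma> 0)"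
        using piece[of 0 u v] u base by auto
      from R2.joined_leaf[OF l'(1) s L2.F.same_leaf_refl] l'(2)
      show "\<exists>l'. R2.joined (\<pi>2 x) (\<pi>2 v) l' \<and> l' \<le> K * (\<Sum>i<1. curve_length A1 g1 (\<gamma> i))" by auto
    qed
  next
    case (Suc n)
    obtain u where u: "\<pi>1 u = \<gamma> n 0" using surj1 by (metis surjD)
    obtain z where z: "\<pi>1 z = \<gamma> (n - 1) 1" using surj1 by (metis surjD)
    have "Suc (n - 1) = n" using Suc.hyps by simp
    then have "(\<gamma> (n - 1) 1, \<gamma> n 0) \<in> same_leaf A1 F1" using dp Suc.prems by (metis Suc_le_lessD)
    then have s: "(\<pi>2 z, \<pi>2 u) \<in> same_leaf A2 F2" by (intro leaf_transfer) (simp add: z u)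
    obtain l1 where l1: "R2.joined (\<pi>2 x) (\<pi>2 z) l1" "l1 \<le> K * (\<Sum>i<n. curve_length A1 g1 (\<gamma> i))"
      using Suc z by auto
    note l1' = R2.joined_leaf[OF l1(1) L2.F.same_leaf_refl s]
    show ?case
    proof (intro allI impI)
      fix v assume "\<pi>1 v = \<gamma> (Suc n - 1) 1"
      then obtain l2 where l2: "R2.joined (\<pi>2 u) (\<pi>2 v) l2" "l2 \<le> K * curve_length A1 g1 (\<gamma> n)"
        using piece[of n u v] u Suc.prems by auto
      have "l1 + l2 \<le> K * (\<Sum>i<Suc n. curve_length A1 g1 (\<gamma> i))" using l1(2) l2(2) by (simp add: distrib_left)
      with R2.joined_trans[OF l1' l2(1)]
      show "\<exists>l'. R2.joined (\<pi>2 x) (\<pi>2 v) l' \<and> l' \<le> K * (\<Sum>i<Suc n. curve_length A1 g1 (\<gamma> i))" by blast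
    qed
  qed
  from this[of k] obtain J: "\<And>v. \<pi>1 v = \<gamma> (k - 1) 1 \<Longrightarrow> \<exists>l'. R2.joined (\<pi>2 x) (\<pi>2 v) l' \<and> l' \<le> K * l"
    using dp l by blast
  obtain v where v: "\<pi>1 v = \<gamma> (k - 1) 1" using surj1 by (metis surjD)
  have s: "(\<pi>2 v, \<pi>2 y) \<in> same_leaf A2 F2"
    by (rule L2.F.same_leaf_sym[OF leaf_transfer]) (use dp v in simp)
  from J[OF v] obtain l' where "R2.joined (\<pi>2 x) (\<pi>2 v) l'" "l' \<le> K * l" by blast
  then show thesis using that R2.joined_leaf[OF _ L2.F.same_leaf_refl s] by blast
qed

theorem leaf_dist_transfer:
  "leaf_dist A2 g2 F2 (R2.leaf (\<pi>2 x)) (R2.leaf (\<pi>2 y)) \<le> leaf_dist A1 g1 F1 (R1.leaf (\<pi>1 x)) (R1.leaf (\<pi>1 y))"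
  unfolding R1.leaf_dist_joined R2.leaf_dist_joined
proof (rule Inf_greatest)
  fix e assume "e \<in> ereal ` {l. R1.joined (\<pi>1 x) (\<pi>1 y) l}"
  then obtain l where l: "e = ereal l" "R1.joined (\<pi>1 x) (\<pi>1 y) l" by blast
  let ?d = "Inf (ereal ` {l. R2.joined (\<pi>2 x) (\<pi>2 y) l})"
  have d: "?d \<le> ereal (K * l)" if K: "1 < K" for K
  proof -
    obtain l' where "R2.joined (\<pi>2 x) (\<pi>2 y) l'" "l' \<le> K * l" by (rule joined_transfer[OF K l(2)]) (rule that)
    then show ?thesis by (intro order_trans[OF Inf_lower[of "ereal l'"]]) auto
  qed
  \<comment> \<open>The factor \<open>K\<close> tends to \<open>1\<close>.\<close>
  have "((\<lambda>n. ereal ((1 + 1 / real (Suc n)) * l)) \<longlongrightarrow> ereal ((1 + 0) * l)) sequentially"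
    by (intro tendsto_intros lim_ereal[THEN iffD2]) (use LIMSEQ_Suc[OF lim_1_over_n] in simp)
  from tendsto_lowerbound[OF this] show "?d \<le> e" unfolding l(1) using d by simp
qed

end

section \<open>The isometry of leaf spaces\<close>

lemma leaf_transfer_of_foliations:
  assumes "singular_riemannian_foliation A1 g1 F1" "singular_riemannian_foliation A2 g2 F2"
    and "smooth_manifold B" "riemannian_metric B h"
    and "riemannian_submersion B h A1 g1 \<pi>1" "riemannian_submersion B h A2 g2 \<pi>2"
    and "surj \<pi>1" "\<And>p. connected (\<pi>1 -` {p})" "pullback_foliation B A1 \<pi>1 F1 = pullback_foliation B A2 \<pi>2 F2"
  shows "leaf_transfer B A1 \<pi>1 h g1 F1 A2 \<pi>2 g2 F2"
proof -
  have "submersion B A1 \<pi>1" "submersion B A2 \<pi>2"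
    using assms(5,6) unfolding riemannian_submersion_def by blast+
  then show ?thesis using assms unfolding singular_riemannian_foliation_def by unfold_locales auto
qed

theorem theorem1:
  fixes A1 :: "('a::{second_countable_topology,t2_space}, 'e::euclidean_space) atlas"
    and g1 :: "'a metric_tensor" and F1 :: "'a vec_field set"
    and A2 :: "('b::{second_countable_topology,t2_space}, 'f::euclidean_space) atlas"
    and g2 :: "'b metric_tensor" and F2 :: "'b vec_field set"
  assumes "singular_riemannian_foliation A1 g1 F1"
    and "singular_riemannian_foliation A2 g2 F2"
    and "morita_equivalent TYPE('n::{second_countable_topology,t2_space})
           TYPE('k::euclidean_space) A1 g1 F1 A2 g2 F2"
  shows "isometric_spaces (leaf_space A1 F1) (leaf_dist A1 g1 F1)
           (leaf_space A2 F2) (leaf_dist A2 g2 F2)"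
proof -
  obtain B :: "('n, 'k) atlas" and h \<pi>1 \<pi>2 where B: "smooth_manifold B" "riemannian_metric B h"
    and r1: "riemannian_submersion B h A1 g1 \<pi>1" and s1: "surj \<pi>1" and f1: "\<And>x. connected (\<pi>1 -` {x})"
    and r2: "riemannian_submersion B h A2 g2 \<pi>2" and s2: "surj \<pi>2" and f2: "\<And>y. connected (\<pi>2 -` {y})"
    and pb: "pullback_foliation B A1 \<pi>1 F1 = pullback_foliation B A2 \<pi>2 F2"
    using assms(3) unfolding morita_equivalent_def by blast
  interpret T12: leaf_transfer B A1 \<pi>1 h g1 F1 A2 \<pi>2 g2 F2
    by (rule leaf_transfer_of_foliations[OF assms(1,2) B r1 r2 s1 f1 pb])
  interpret T21: leaf_transfer B A2 \<pi>2 h g2 F2 A1 \<pi>1 g1 F1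
    by (rule leaf_transfer_of_foliations[OF assms(2,1) B r2 r1 s2 f2 pb[symmetric]])
  let ?l1 = "T12.R1.leaf" and ?l2 = "T12.R2.leaf"
  have eq: "?l1 (\<pi>1 x) = ?l1 (\<pi>1 y) \<longleftrightarrow> ?l2 (\<pi>2 x) = ?l2 (\<pi>2 y)" for x y
    unfolding T12.R1.leaf_eq_iff T12.R2.leaf_eq_iff using T12.leaf_transfer T21.leaf_transfer by blast
  have dist: "leaf_dist A2 g2 F2 (?l2 (\<pi>2 x)) (?l2 (\<pi>2 y)) = leaf_dist A1 g1 F1 (?l1 (\<pi>1 x)) (?l1 (\<pi>1 y))" for x y
    by (rule antisym[OF T12.leaf_dist_transfer T21.leaf_dist_transfer])
  have space: "leaf_space A1 F1 = range (\<lambda>x. ?l1 (\<pi>1 x))" "leaf_space A2 F2 = range (\<lambda>x. ?l2 (\<pi>2 x))"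
  proof -
    have "leaf_space A1 F1 = ?l1 ` range \<pi>1" "leaf_space A2 F2 = ?l2 ` range \<pi>2"
      unfolding s1 s2 by (auto simp: leaf_space_def quotient_def T12.R1.leaf_def T12.R2.leaf_def)
    then show "leaf_space A1 F1 = range (\<lambda>x. ?l1 (\<pi>1 x))" "leaf_space A2 F2 = range (\<lambda>x. ?l2 (\<pi>2 x))"
      by (simp_all add: image_image)
  qed
  define \<Phi> where "\<Phi> L = ?l2 (\<pi>2 (SOME x. ?l1 (\<pi>1 x) = L))" for L
  have \<Phi>: "\<Phi> (?l1 (\<pi>1 x)) = ?l2 (\<pi>2 x)" for x
  proof -
    have "?l1 (\<pi>1 (SOME z. ?l1 (\<pi>1 z) = ?l1 (\<pi>1 x))) = ?l1 (\<pi>1 x)" by (rule someI) (rule refl)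
    then show ?thesis unfolding \<Phi>_def eq .
  qed
  show ?thesis
    unfolding isometric_spaces_def
  proof (intro exI[of _ \<Phi>] conjI ballI)
    show "bij_betw \<Phi> (leaf_space A1 F1) (leaf_space A2 F2)"
      unfolding bij_betw_def space by (auto simp: inj_on_def \<Phi> eq image_image)
    show "leaf_dist A2 g2 F2 (\<Phi> L) (\<Phi> L') = leaf_dist A1 g1 F1 L L'"
      if L: "L \<in> leaf_space A1 F1" "L' \<in> leaf_space A1 F1" for L L'
      using L unfolding space by (auto simp: \<Phi> dist)
  qed
qed

end
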